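(* Let $\Omega_1\subset\mathbb{R}^{d_1}$ and $\Omega_2\subset\mathbb{R}^{d_2}$ be open sets and $\Gamma$ a closed cone in $\dot T^*\Omega_1$. For any smooth map $f:\Omega_1\to\Omega_2$ and any closed subset $C$ of $\Omega_1$ such that $f|_C:C\to\Omega_2$ is proper and $\underline{\pi}(\Gamma)\subset C$, the push-forward $f_*$ is continuous in the normal topology from $\{u\in\mathcal{D}'_\Gamma(\Omega_1) : \operatorname{supp}u\subset C\}$ to $\mathcal{D}'_{f_*\Gamma}(\Omega_2)$, where $$f_*\Gamma=\{(y;\eta)\in\dot T^*\Omega_2 : \exists x\in\Omega_1\text{ with }y=f(x)\text{ and }(x;\eta\circ df_x)\in\Gamma\cup(C\times\{0\})\}.$$
   Context: For an open set $\Omega\subset\mathbb{R}^n$ write $\mathcal{D}(\Omega)=C_c^\infty(\Omega)$, $T^*\Omega=\Omega\times\mathbb{R}^n$, $\dot T^*\Omega=\{(x;\xi)\in T^*\Omega : \xi\neq 0\}$, and $\underline{\pi}(x;\xi)=x$. A cone in $\dot T^*\Omega$ is a subset $\Gamma$ such that $(x;\xi)\in\Gamma$ and $\lambda>0$ imply $(x;\lambda\xi)\in\Gamma$; closed means closed in $\dot T^*\Omega$. For a closed cone $\Gamma$, $\mathcal{D}'_\Gamma(\Omega)=\{u\in\mathcal{D}'(\Omega) : \mathrm{WF}(u)\subset\Gamma\}$. The normal topology on $\mathcal{D}'_\Gamma(\Omega)$ is the locally convex topology defined by the seminorms $p_B(u)=\sup_{\phi\in B}|\langle u,\phi\rangle|$,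 $B$ running over the bounded subsets of $\mathcal{D}(\Omega)$, and $\|u\|_{N,V,\chi}=\sup_{k\in V}(1+|k|)^N|\widehat{u\chi}(k)|$, where $N\ge 0$, $\chi\in\mathcal{D}(\Omega)$ and $V\subset\mathbb{R}^n$ is a closed cone with $(\operatorname{supp}\chi\times V)\cap\Gamma=\emptyset$; here $\widehat{w}(k)=\langle w,e^{-ik\cdot x}\rangle$. The subspace of distributions supported in $C$ has the induced topology. Push-forward: $\langle f_*u,\varphi\rangle=\langle u,\varphi\circ f\rangle$ for $\varphi\in\mathcal{D}(\Omega_2)$, which makes sense since $\operatorname{supp}u\cap\operatorname{supp}(\varphi\circ f)$ is compact. Also $\eta\circ df_x=\sum_{i,j}\eta_j\,\partial_if^j(x)\,dx^i$. *)

theory Defs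
  imports "HOL-Analysis.Analysis"
begin

section \<open>Smooth functions and test functions\<close>

text \<open>Iterated directional derivatives; lists of basis vectors play the role of
  multi-indices.\<close>

primrec partials :: "'a list \<Rightarrow> ('a::euclidean_space \<Rightarrow> 'b::real_normed_vector) \<Rightarrow> 'a \<Rightarrow> 'b" where
  "partials [] f = f"
| "partials (v # vs) f = (\<lambda>x. frechet_derivative (partials vs f) (at x) v)"

text \<open>Intended for open \<open>\<Omega>\<close>. Differentiability of every partial derivative also gives
  its continuity.\<close>

definition smooth_on :: "'a::euclidean_space set \<Rightarrow> ('a \<Rightarrow> 'b::real_normed_vector) \<Rightarrow> bool" where
  "smooth_on \<Omega> f \<longleftrightarrow>
     (\<forall>vs. set vs \<subseteq> Basis \<longrightarrow> (\<forall>x\<in>\<Omega>. partials vs f differentiable (at x)))"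

definition fun_supp :: "('a::topological_space \<Rightarrow> complex) \<Rightarrow> 'a set" where
  "fun_supp \<phi> = closure {x. \<phi> x \<noteq> 0}"

text \<open>Elements of \<open>\<D>(\<Omega>)\<close> are represented by their extension by \<open>0\<close> to the whole space.\<close>

definition test_fun :: "'a::euclidean_space set \<Rightarrow> ('a \<Rightarrow> complex) set" where
  "test_fun \<Omega> = {\<phi>. smooth_on UNIV \<phi> \<and> compact (fun_supp \<phi>) \<and> fun_supp \<phi> \<subseteq> \<Omega>}"

definition Cm_norm :: "nat \<Rightarrow> ('a::euclidean_space \<Rightarrow> complex) \<Rightarrow> real" where
  "Cm_norm m \<phi> =
     (SUP (vs, x) \<in> {vs. set vs \<subseteq> Basis \<and> length vs \<le> m} \<times> UNIV. cmod (partials vs \<phi> x))"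

text \<open>\<open>\<D>(\<Omega>)\<close> carries the inductive limit topology of the Frechet spaces \<open>\<D>\<^sub>K\<close>, \<open>K \<subseteq> \<Omega>\<close> compact:
  a seminorm on \<open>\<D>(\<Omega>)\<close> is continuous iff its restriction to every \<open>\<D>\<^sub>K\<close> is dominated by
  a \<open>C\<^sup>m\<close> norm, and a set is bounded iff every continuous seminorm is bounded on it.\<close>

definition continuous_on_DK :: "'a::euclidean_space set \<Rightarrow> (('a \<Rightarrow> complex) \<Rightarrow> real) \<Rightarrow> bool" where
  "continuous_on_DK \<Omega> p \<longleftrightarrow>
     (\<forall>K. compact K \<and> K \<subseteq> \<Omega> \<longrightarrow>
        (\<exists>m c. \<forall>\<phi>\<in>test_fun \<Omega>. fun_supp \<phi> \<subseteq> K \<longrightarrow> p \<phi> \<le> c * Cm_norm m \<phi>))"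

definition test_seminorm :: "'a::euclidean_space set \<Rightarrow> (('a \<Rightarrow> complex) \<Rightarrow> real) \<Rightarrow> bool" where
  "test_seminorm \<Omega> p \<longleftrightarrow>
     (\<forall>\<phi>\<in>test_fun \<Omega>. \<forall>\<psi>\<in>test_fun \<Omega>. p (\<lambda>x. \<phi> x + \<psi> x) \<le> p \<phi> + p \<psi>) \<and>
     (\<forall>\<phi>\<in>test_fun \<Omega>. \<forall>a. p (\<lambda>x. a * \<phi> x) = cmod a * p \<phi>)"

definition bounded_test_set :: "'a::euclidean_space set \<Rightarrow> ('a \<Rightarrow> complex) set \<Rightarrow> bool" where
  "bounded_test_set \<Omega> B \<longleftrightarrow>
     B \<subseteq> test_fun \<Omega> \<and>
     (\<forall>p. test_seminorm \<Omega> p \<and> continuous_on_DK \<Omega> p \<longrightarrow> bdd_above (p ` B))"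


section \<open>Distributions\<close>

type_synonym 'a functional = "('a \<Rightarrow> complex) \<Rightarrow> complex"

text \<open>Functionals are normalised to \<open>0\<close> outside \<open>\<D>(\<Omega>)\<close>, so that equality of distributions is
  equality of functions.\<close>

definition distributions :: "'a::euclidean_space set \<Rightarrow> 'a functional set" where
  "distributions \<Omega> = {u.
     (\<forall>\<phi>. \<phi> \<notin> test_fun \<Omega> \<longrightarrow> u \<phi> = 0) \<and>
     (\<forall>\<phi>\<in>test_fun \<Omega>. \<forall>\<psi>\<in>test_fun \<Omega>. u (\<lambda>x. \<phi> x + \<psi> x) = u \<phi> + u \<psi>) \<and>
     (\<forall>\<phi>\<in>test_fun \<Omega>. \<forall>a. u (\<lambda>x. a * \<phi> x) = a * u \<phi>) \<and>
     continuous_on_DK \<Omega> (\<lambda>\<phi>. cmod (u \<phi>))}"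

definition dist_supp :: "'a::euclidean_space set \<Rightarrow> 'a functional \<Rightarrow> 'a set" where
  "dist_supp \<Omega> u =
     \<Omega> - \<Union>{W. open W \<and> W \<subseteq> \<Omega> \<and> (\<forall>\<phi>\<in>test_fun W. u \<phi> = 0)}"

text \<open>The Fourier transform of the compactly supported distribution \<open>u\<theta>\<close>, that is
  \<open>\<langle>u\<theta>, e\<^bsup>-ik\<cdot>x\<^esup>\<rangle> = \<langle>u, \<theta> e\<^bsup>-ik\<cdot>x\<^esup>\<rangle>\<close>.\<close>

definition fourier_loc :: "'a::euclidean_space functional \<Rightarrow> ('a \<Rightarrow> complex) \<Rightarrow> 'a \<Rightarrow> complex" where
  "fourier_loc u \<theta> k = u (\<lambda>x. \<theta> x * exp (- \<i> * complex_of_real (k \<bullet> x)))"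


section \<open>Cones and wave front sets\<close>

text \<open>Unlike \<^const>\<open>cone\<close>, only strictly positive factors are allowed.\<close>

definition conic :: "'a::real_vector set \<Rightarrow> bool" where
  "conic V \<longleftrightarrow> (\<forall>k\<in>V. \<forall>c>0. c *\<^sub>R k \<in> V)"

definition cotangent0 :: "'a::euclidean_space set \<Rightarrow> ('a \<times> 'a) set" where
  "cotangent0 \<Omega> = \<Omega> \<times> (UNIV - {0})"

definition closed_cone :: "'a::euclidean_space set \<Rightarrow> ('a \<times> 'a) set \<Rightarrow> bool" where
  "closed_cone \<Omega> \<Gamma> \<longleftrightarrow>
     closedin (top_of_set (cotangent0 \<Omega>)) \<Gamma> \<and>
     (\<forall>x \<xi>. \<forall>c>0. (x, \<xi>) \<in> \<Gamma> \<longrightarrow> (x, c *\<^sub>R \<xi>) \<in> \<Gamma>)"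

definition fourier_seminorm ::
  "nat \<Rightarrow> 'a set \<Rightarrow> ('a \<Rightarrow> complex) \<Rightarrow> 'a::euclidean_space functional \<Rightarrow> ennreal" where
  "fourier_seminorm N V \<theta> u =
     (SUP k\<in>V. ennreal ((1 + norm k) ^ N * cmod (fourier_loc u \<theta> k)))"

definition wave_front :: "'a::euclidean_space set \<Rightarrow> 'a functional \<Rightarrow> ('a \<times> 'a) set" where
  "wave_front \<Omega> u = {(x, \<xi>) \<in> cotangent0 \<Omega>.
     \<not> (\<exists>\<theta>\<in>test_fun \<Omega>. \<theta> x \<noteq> 0 \<and>
          (\<exists>V. open V \<and> conic V \<and> \<xi> \<in> V \<and> (\<forall>N. fourier_seminorm N V \<theta> u < \<infinity>)))}"


section \<open>The normal topology\<close>

definition dist_WF :: "'a::euclidean_space set \<Rightarrow> ('a \<times> 'a) set \<Rightarrow> 'a functional set" where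
  "dist_WF \<Omega> \<Gamma> = {u \<in> distributions \<Omega>. wave_front \<Omega> u \<subseteq> \<Gamma>}"

definition sup_seminorm :: "('a \<Rightarrow> complex) set \<Rightarrow> 'a functional \<Rightarrow> ennreal" where
  "sup_seminorm B u = (SUP \<phi>\<in>B. ennreal (cmod (u \<phi>)))"

definition normal_seminorms ::
  "'a::euclidean_space set \<Rightarrow> ('a \<times> 'a) set \<Rightarrow> ('a functional \<Rightarrow> ennreal) set" where
  "normal_seminorms \<Omega> \<Gamma> =
     {sup_seminorm B | B. bounded_test_set \<Omega> B} \<union>
     {fourier_seminorm N V \<theta> | N V \<theta>.
        \<theta> \<in> test_fun \<Omega> \<and> closed V \<and> conic V \<and> (fun_supp \<theta> \<times> V) \<inter> \<Gamma> = {}}"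

text \<open>The locally convex topology on \<open>E\<close> defined by a family \<open>P\<close> of seminorms. The values lie in
  \<^typ>\<open>ennreal\<close>, so that no supremum depends on a boundedness proof.\<close>

definition seminorm_topology ::
  "('b \<Rightarrow> complex) set \<Rightarrow> (('b \<Rightarrow> complex) \<Rightarrow> ennreal) set \<Rightarrow> ('b \<Rightarrow> complex) topology" where
  "seminorm_topology E P = topology_generated_by
     {{v \<in> E. p (\<lambda>\<phi>. v \<phi> - u \<phi>) < ennreal r} | p u r. p \<in> P \<and> u \<in> E \<and> r > 0}"

definition normal_topology ::
  "'a::euclidean_space set \<Rightarrow> ('a \<times> 'a) set \<Rightarrow> 'a functional topology" where
  "normal_topology \<Omega> \<Gamma> = seminorm_topology (dist_WF \<Omega> \<Gamma>) (normal_seminorms \<Omega> \<Gamma>)"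

lemma topspace_normal_topology: "topspace (normal_topology \<Omega> \<Gamma>) = dist_WF \<Omega> \<Gamma>"
proof
  have "bounded_test_set \<Omega> {}"
    by (simp add: bounded_test_set_def)
  then have P: "sup_seminorm {} \<in> normal_seminorms \<Omega> \<Gamma>"
    unfolding normal_seminorms_def by blast
  show "dist_WF \<Omega> \<Gamma> \<subseteq> topspace (normal_topology \<Omega> \<Gamma>)"
  proof
    fix u assume u: "u \<in> dist_WF \<Omega> \<Gamma>"
    let ?X = "{v \<in> dist_WF \<Omega> \<Gamma>. sup_seminorm {} (\<lambda>\<phi>. v \<phi> - u \<phi>) < ennreal 1}"
    have "u \<in> ?X"
      using u by (simp add: sup_seminorm_def bot_ennreal)
    moreover have "openin (normal_topology \<Omega> \<Gamma>) ?X"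
      unfolding normal_topology_def seminorm_topology_def
      by (rule topology_generated_by_Basis, rule CollectI,
          rule exI[of _ "sup_seminorm {}"], rule exI[of _ u], rule exI[of _ 1])
         (use u P in simp)
    ultimately show "u \<in> topspace (normal_topology \<Omega> \<Gamma>)"
      using openin_subset by blast
  qed
  show "topspace (normal_topology \<Omega> \<Gamma>) \<subseteq> dist_WF \<Omega> \<Gamma>"
    unfolding normal_topology_def seminorm_topology_def topology_generated_by_topspace
    by blast
qed


section \<open>Push-forward\<close>

text \<open>\<open>\<langle>u, g\<rangle>\<close> for \<open>g\<close> smooth on \<open>\<Omega>\<close> with \<open>supp u \<inter> supp g\<close> compact, namely \<open>\<langle>u, \<theta>g\<rangle>\<close> for any
  \<open>\<theta> \<in> \<D>(\<Omega>)\<close> that is \<open>1\<close> near \<open>supp u \<inter> supp g\<close>; the value does not depend on \<open>\<theta>\<close>.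
  The values of \<open>g\<close> outside \<open>\<Omega>\<close> are irrelevant.\<close>

definition dist_pair ::
  "'a::euclidean_space set \<Rightarrow> 'a functional \<Rightarrow> ('a \<Rightarrow> complex) \<Rightarrow> complex" where
  "dist_pair \<Omega> u g =
     (let \<theta> = (SOME \<theta>. \<theta> \<in> test_fun \<Omega> \<and>
                (\<exists>W. open W \<and> dist_supp \<Omega> u \<inter> closure {x\<in>\<Omega>. g x \<noteq> 0} \<subseteq> W \<and> (\<forall>x\<in>W. \<theta> x = 1)))
      in u (\<lambda>x. \<theta> x * g x))"

definition push_forward ::
  "'a::euclidean_space set \<Rightarrow> 'b::euclidean_space set \<Rightarrow> ('a \<Rightarrow> 'b) \<Rightarrow> 'a functional \<Rightarrow> 'b functional" where
  "push_forward \<Omega>1 \<Omega>2 f u =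
     (\<lambda>\<phi>. if \<phi> \<in> test_fun \<Omega>2 then dist_pair \<Omega>1 u (\<phi> \<circ> f) else 0)"

text \<open>The covector \<open>\<eta> \<circ> df\<^sub>x\<close>, identified with a vector through the standard basis.\<close>

definition covector_pullback ::
  "('a::euclidean_space \<Rightarrow> 'b::euclidean_space) \<Rightarrow> 'a \<Rightarrow> 'b \<Rightarrow> 'a" where
  "covector_pullback f x \<eta> =
     (\<Sum>i\<in>Basis. (\<Sum>j\<in>Basis. (\<eta> \<bullet> j) * (frechet_derivative f (at x) i \<bullet> j)) *\<^sub>R i)"

definition push_cone ::
  "'a::euclidean_space set \<Rightarrow> 'b::euclidean_space set \<Rightarrow> ('a \<Rightarrow> 'b) \<Rightarrow> 'a set
     \<Rightarrow> ('a \<times> 'a) set \<Rightarrow> ('b \<times> 'b) set" where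
  "push_cone \<Omega>1 \<Omega>2 f C \<Gamma> = {(y, \<eta>) \<in> cotangent0 \<Omega>2.
     \<exists>x\<in>\<Omega>1. y = f x \<and> (x, covector_pullback f x \<eta>) \<in> \<Gamma> \<union> (C \<times> {0})}"

text \<open>The target cone of the push-forward is again a closed cone.\<close>

lemma closedin_sequential_limits:
  fixes S T :: "'a::first_countable_topology set"
  shows "closedin (top_of_set S) T \<longleftrightarrow>
     T \<subseteq> S \<and> (\<forall>s l. (\<forall>n. s n \<in> T) \<and> l \<in> S \<and> s \<longlonglongrightarrow> l \<longrightarrow> l \<in> T)" (is "_ \<longleftrightarrow> ?R")
proof
  assume "closedin (top_of_set S) T"
  then obtain U where "closed U" "T = S \<inter> U" by (auto simp: closedin_closed)
  then show ?R unfolding closed_sequential_limits by blast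
next
  assume R: ?R
  have "T = S \<inter> closure T"
  proof
    show "T \<subseteq> S \<inter> closure T" using R closure_subset[of T] by blast
    show "S \<inter> closure T \<subseteq> T"
    proof
      fix l assume "l \<in> S \<inter> closure T"
      then obtain s where "\<forall>n. s n \<in> T" "s \<longlonglongrightarrow> l" "l \<in> S"
        by (auto simp: closure_sequential)
      with R show "l \<in> T" by blast
    qed
  qed
  then show "closedin (top_of_set S) T"
    unfolding closedin_closed by (intro exI[of _ "closure T"]) simp
qed

lemma closed_cone_push_cone:
  fixes f :: "'a::euclidean_space \<Rightarrow> 'b::euclidean_space"
  assumes cone: "closed_cone \<Omega>1 \<Gamma>" and smooth: "smooth_on \<Omega>1 f"
    and C: "closedin (top_of_set \<Omega>1) C"
    and proper: "proper_map (top_of_set C) (top_of_set \<Omega>2) f" and \<Gamma>C: "fst ` \<Gamma> \<subseteq> C"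
  shows "closed_cone \<Omega>2 (push_cone \<Omega>1 \<Omega>2 f C \<Gamma>)"
proof -
  let ?P = "push_cone \<Omega>1 \<Omega>2 f C \<Gamma>"
  have "closedin (top_of_set (cotangent0 \<Omega>1)) \<Gamma>"
    using cone by (simp add: closed_cone_def)
  then have \<Gamma>lim: "l \<in> \<Gamma>" if "\<forall>n. s n \<in> \<Gamma>" "l \<in> cotangent0 \<Omega>1" "s \<longlonglongrightarrow> l" for s l
    using that unfolding closedin_sequential_limits by blast
  have scale: "covector_pullback f x (c *\<^sub>R \<eta>) = c *\<^sub>R covector_pullback f x \<eta>" for x c \<eta>
    by (simp add: covector_pullback_def scaleR_sum_right sum_distrib_left mult.assoc)
  have conic: "(y, c *\<^sub>R \<eta>) \<in> ?P" if "(y, \<eta>) \<in> ?P" "c > 0" for y \<eta> c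
  proof -
    from that obtain x where x: "x \<in> \<Omega>1" "y = f x"
        "(x, covector_pullback f x \<eta>) \<in> \<Gamma> \<union> (C \<times> {0})" "(y, \<eta>) \<in> cotangent0 \<Omega>2"
      by (auto simp: push_cone_def)
    then have "(x, covector_pullback f x (c *\<^sub>R \<eta>)) \<in> \<Gamma> \<union> (C \<times> {0})"
      using cone that(2) by (auto simp: scale closed_cone_def)
    with x that(2) show ?thesis
      unfolding push_cone_def cotangent0_def by auto
  qed
  have "l \<in> ?P" if s: "\<forall>n. s n \<in> ?P" and l: "l \<in> cotangent0 \<Omega>2" and lim: "s \<longlonglongrightarrow> l" for s l
  proof -
    obtain y \<eta> where yl: "l = (y, \<eta>)" by (cases l)
    from s have "\<forall>n. \<exists>x. x \<in> \<Omega>1 \<and> fst (s n) = f x \<and> fst (s n) \<in> \<Omega>2 \<and>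
        (x, covector_pullback f x (snd (s n))) \<in> \<Gamma> \<union> (C \<times> {0})"
      by (auto simp: push_cone_def cotangent0_def case_prod_unfold)
    then obtain x where x: "\<And>n. x n \<in> \<Omega>1" "\<And>n. fst (s n) = f (x n)" "\<And>n. fst (s n) \<in> \<Omega>2"
        "\<And>n. (x n, covector_pullback f (x n) (snd (s n))) \<in> \<Gamma> \<union> (C \<times> {0})"
      by metis
    have xC: "x n \<in> C" for n using x(4)[of n] \<Gamma>C by force
    have fl: "(\<lambda>n. f (x n)) \<longlonglongrightarrow> y" and sl: "(\<lambda>n. snd (s n)) \<longlonglongrightarrow> \<eta>"
      using tendsto_fst[OF lim] tendsto_snd[OF lim] by (auto simp: yl x(2))
    define K where "K = insert y (range (\<lambda>n. f (x n)))"
    have "compact K" unfolding K_def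
      using fl by (rule compact_sequence_with_limit)
    moreover have "K \<subseteq> \<Omega>2"
      using l x(3) unfolding K_def x(2)[symmetric] by (auto simp: yl cotangent0_def)
    ultimately have "compactin (top_of_set C) {z \<in> topspace (top_of_set C). f z \<in> K}"
      by (intro compactin_proper_map_preimage[OF proper]) (simp add: compactin_subtopology)
    then have "compact {z \<in> C. f z \<in> K}"
      by (simp add: compactin_subtopology)
    then have sc: "seq_compact {z \<in> C. f z \<in> K}" by (rule compact_imp_seq_compact)
    have "\<forall>n. x n \<in> {z \<in> C. f z \<in> K}" using xC by (auto simp: K_def)
    with sc obtain z r where zr: "z \<in> {z \<in> C. f z \<in> K}" "strict_mono r" "(x \<circ> r) \<longlonglongrightarrow> z"
      by (rule seq_compactE)
    from zr(1) have z: "z \<in> C" by simp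
    note r = zr(2) and xz = zr(3)
    have z1: "z \<in> \<Omega>1" using C z closedin_imp_subset by blast
    have d: "partials vs f differentiable (at z)" if "set vs \<subseteq> Basis" for vs
      using smooth z1 that by (auto simp: smooth_on_def)
    have "isCont f z"
      using d[of "[]"] differentiable_imp_continuous_within[of f z UNIV] by simp
    then have "(\<lambda>n. f (x (r n))) \<longlonglongrightarrow> f z"
      using isCont_tendsto_compose xz unfolding comp_def by blast
    moreover have "(\<lambda>n. f (x (r n))) \<longlonglongrightarrow> y"
      using LIMSEQ_subseq_LIMSEQ[OF fl r] by (simp add: comp_def)
    ultimately have yz: "y = f z" using LIMSEQ_unique by blast
    have dl: "(\<lambda>n. frechet_derivative f (at (x (r n))) i) \<longlonglongrightarrow> frechet_derivative f (at z) i"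
      if "i \<in> Basis" for i
    proof -
      have "isCont (partials [i] f) z"
        using d[of "[i]"] that differentiable_imp_continuous_within[of _ z UNIV] by simp
      from isCont_tendsto_compose[OF this] xz show ?thesis by (auto simp: comp_def)
    qed
    have sr: "(\<lambda>n. snd (s (r n))) \<longlonglongrightarrow> \<eta>"
      using LIMSEQ_subseq_LIMSEQ[OF sl r] by (simp add: comp_def)
    have cl: "(\<lambda>n. covector_pullback f (x (r n)) (snd (s (r n)))) \<longlonglongrightarrow> covector_pullback f z \<eta>"
      unfolding covector_pullback_def by (intro tendsto_intros dl sr)
    have "(z, covector_pullback f z \<eta>) \<in> \<Gamma> \<union> (C \<times> {0})"
    proof (cases "covector_pullback f z \<eta> = 0")
      case True
      then show ?thesis using z by simp
    next
      case False
      let ?q = "\<lambda>n. (x (r n), covector_pullback f (x (r n)) (snd (s (r n))))"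
      have "eventually (\<lambda>n. snd (?q n) \<noteq> 0) sequentially"
        using tendsto_imp_eventually_ne[OF cl False] by simp
      then have "eventually (\<lambda>n. ?q n \<in> \<Gamma>) sequentially"
        by eventually_elim (use x(4) in fastforce)
      then obtain N where N: "\<And>n. n \<ge> N \<Longrightarrow> ?q n \<in> \<Gamma>"
        by (auto simp: eventually_sequentially)
      have "?q \<longlonglongrightarrow> (z, covector_pullback f z \<eta>)"
        using xz cl by (intro tendsto_Pair) (auto simp: comp_def)
      then have ql: "(\<lambda>n. ?q (n + N)) \<longlonglongrightarrow> (z, covector_pullback f z \<eta>)"
        by (rule LIMSEQ_ignore_initial_segment)
      have "(z, covector_pullback f z \<eta>) \<in> cotangent0 \<Omega>1"
        using z1 False by (simp add: cotangent0_def)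
      moreover have "\<forall>n. ?q (n + N) \<in> \<Gamma>" using N by simp
      ultimately have "(z, covector_pullback f z \<eta>) \<in> \<Gamma>"
        using ql by (intro \<Gamma>lim[of "\<lambda>n. ?q (n + N)"])
      then show ?thesis by simp
    qed
    then show ?thesis using l z1 yz by (auto simp: push_cone_def yl)
  qed
  moreover have "?P \<subseteq> cotangent0 \<Omega>2" by (auto simp: push_cone_def)
  ultimately have "closedin (top_of_set (cotangent0 \<Omega>2)) ?P"
    unfolding closedin_sequential_limits by metis
  with conic show ?thesis by (simp add: closed_cone_def)
qed

end

theory Submission
  imports Defs
begin

text \<open>By properness of \<open>f\<close> on \<open>C\<close>, on test functions with support in a fixed compact set the push-forward
  is \<open>\<phi> \<mapsto> \<langle>u, \<theta> (\<phi> \<circ> f)\<rangle>\<close> with one cutoff \<open>\<theta>\<close>. This handles the seminorms \<open>p\<^sub>B\<close>, since pull-back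
  maps bounded sets of test functions to bounded sets. For the Fourier seminorms one localises near
  a point \<open>x \<in> C\<close>: there a closed cone \<open>W\<close> that avoids \<open>\<Gamma>\<close> contains a neighbourhood of the
  covectors \<open>k \<circ> df\<^sub>x\<close>, \<open>k \<in> V\<close>. Expanding \<open>g e\<^sup>-\<^sup>i\<^sup>k\<^sup>f\<close> in a Fourier series on a cube, the frequencies
  \<open>\<xi> \<in> W\<close> with \<open>|\<xi>| \<ge> \<delta> |k|\<close> meet the decay of \<open>u\<close> in \<open>W\<close>. For all others the phase
  \<open>k\<cdot>f(x) - \<xi>\<cdot>x\<close> is non-stationary, so the coefficients decay rapidly in \<open>|k| + |\<xi>|\<close> and turn the
  waves into a bounded set of test functions, on which \<open>u\<close> is controlled by some \<open>p\<^sub>B\<close>. The same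
  bounds put the wave front set of the push-forward into the push-forward cone.\<close>

section \<open>Families with uniformly bounded derivatives\<close>

text \<open>A single estimate, \<open>local_estimate\<close>, serves both halves of the theorem. Its
  constants do not depend on the distribution, and its values may be infinite, so it holds for every
  distribution whatever its wave front set. For the given map it yields continuity. For the identity
  map it carries rapid decay from one cutoff to every cutoff with smaller support. That transfer is
  the hidden obstacle: the wave front set provides only some cutoff and some cone at each covector,
  while the normal topology tests all admissible cutoffs and cones. It makes the Fourier seminorms
  finite on the source space, and this finiteness, inserted into the domination of the target
  seminorms, bounds the wave front set of the push-forward. A series over a lattice is preferred to
  an integral because a distribution commutes with finite sums, and passing to the limit only takes
  uniform convergence of finitely many derivatives. All bounds must be uniform in the two
  frequencies, which range over unbounded sets; hence the calculus of parametrised families that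
  starts here, with the frequencies normalised before it is applied.\<close>

abbreviation pderiv_at :: "'a::euclidean_space \<Rightarrow> ('a \<Rightarrow> 'b::real_normed_vector) \<Rightarrow> 'a \<Rightarrow> 'b" where
  "pderiv_at b f \<equiv> (\<lambda>x. frechet_derivative f (at x) b)"

lemma partials_append: "partials (vs @ ws) f = partials vs (partials ws f)"
  by (induction vs) auto

lemma frechet_derivative_cong_open:
  assumes "open S" "x \<in> S" "\<And>y. y \<in> S \<Longrightarrow> f y = g y"
  shows "frechet_derivative f (at x) = frechet_derivative g (at x)"
proof -
  have "(f has_derivative D) (at x) \<longleftrightarrow> (g has_derivative D) (at x)" for D
    using assms has_derivative_transform_within_open[of _ D x UNIV S] by metis
  then show ?thesis by (simp add: frechet_derivative_def)
qed

lemma differentiable_cong_open: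
  assumes "open S" "x \<in> S" "\<And>y. y \<in> S \<Longrightarrow> f y = g y"
  shows "f differentiable (at x) \<longleftrightarrow> g differentiable (at x)"
proof -
  have "(f has_derivative D) (at x) \<longleftrightarrow> (g has_derivative D) (at x)" for D
    using assms has_derivative_transform_within_open[of _ D x UNIV S] by metis
  then show ?thesis by (simp add: differentiable_def)
qed

lemma partials_cong_open:
  assumes "open S" "x \<in> S" "\<And>y. y \<in> S \<Longrightarrow> f y = g y"
  shows "partials vs f x = partials vs g x"
  using assms(2)
proof (induction vs arbitrary: x)
  case (Cons v vs)
  then show ?case
    using frechet_derivative_cong_open[OF assms(1) Cons.prems Cons.IH] by simp
qed (simp add: assms(3))

lemma partials_differentiable_cong_open:
  assumes "open S" "x \<in> S" "\<And>y. y \<in> S \<Longrightarrow> f y = g y"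
  shows "partials vs f differentiable (at x) \<longleftrightarrow> partials vs g differentiable (at x)"
  by (rule differentiable_cong_open[OF assms(1,2)]) (rule partials_cong_open[OF assms(1) _ assms(3)])

text \<open>One bound has to serve all parameters and all points for each multi-index.
  Differentiability belongs to the predicate because \<open>frechet_derivative\<close> is an
  arbitrary value where the derivative does not exist, so that a bound alone would carry no
  information.\<close>

definition Cm_bounded ::
  "nat \<Rightarrow> 'p set \<Rightarrow> 'a::euclidean_space set \<Rightarrow> ('p \<Rightarrow> 'a \<Rightarrow> 'b::real_normed_vector) \<Rightarrow> bool" where
  "Cm_bounded m P S G \<longleftrightarrow> (\<forall>vs. set vs \<subseteq> Basis \<and> length vs \<le> m \<longrightarrow>
     (\<exists>B. \<forall>p\<in>P. \<forall>x\<in>S. partials vs (G p) differentiable (at x) \<and> norm (partials vs (G p) x) \<le> B))"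

lemma Cm_bounded_0_iff:
  "Cm_bounded 0 P S G \<longleftrightarrow> (\<exists>B. \<forall>p\<in>P. \<forall>x\<in>S. G p differentiable (at x) \<and> norm (G p x) \<le> B)"
  by (simp add: Cm_bounded_def)

text \<open>The last entry of the list is the derivative taken first, so splitting lists at their
  end moves one derivative onto the family. The closure properties below are inductions along this
  equivalence, and each of them uses only a first-order differentiation rule.\<close>

lemma Cm_bounded_Suc_iff:
  "Cm_bounded (Suc m) P S G \<longleftrightarrow>
     Cm_bounded 0 P S G \<and> (\<forall>b\<in>Basis. Cm_bounded m P S (\<lambda>p. pderiv_at b (G p)))"
proof
  assume L: "Cm_bounded (Suc m) P S G"
  have "Cm_bounded m P S (\<lambda>p. pderiv_at b (G p))" if b: "b \<in> Basis" for b
    unfolding Cm_bounded_def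
  proof (intro allI impI)
    fix vs :: "'b list" assume vs: "set vs \<subseteq> Basis \<and> length vs \<le> m"
    with b have "set (vs @ [b]) \<subseteq> Basis \<and> length (vs @ [b]) \<le> Suc m" by simp
    with L have "\<exists>B. \<forall>p\<in>P. \<forall>x\<in>S. partials (vs @ [b]) (G p) differentiable at x \<and>
        norm (partials (vs @ [b]) (G p) x) \<le> B"
      unfolding Cm_bounded_def by blast
    then show "\<exists>B. \<forall>p\<in>P. \<forall>x\<in>S. partials vs (pderiv_at b (G p)) differentiable at x \<and>
        norm (partials vs (pderiv_at b (G p)) x) \<le> B"
      by (simp add: partials_append)
  qed
  moreover have "Cm_bounded 0 P S G"
    using L[unfolded Cm_bounded_def, THEN spec, of "[]"] by (simp add: Cm_bounded_0_iff)
  ultimately show "Cm_bounded 0 P S G \<and> (\<forall>b\<in>Basis. Cm_bounded m P S (\<lambda>p. pderiv_at b (G p)))"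
    by blast
next
  assume R: "Cm_bounded 0 P S G \<and> (\<forall>b\<in>Basis. Cm_bounded m P S (\<lambda>p. pderiv_at b (G p)))"
  show "Cm_bounded (Suc m) P S G"
    unfolding Cm_bounded_def
  proof (intro allI impI)
    fix vs :: "'b list" assume vs: "set vs \<subseteq> Basis \<and> length vs \<le> Suc m"
    show "\<exists>B. \<forall>p\<in>P. \<forall>x\<in>S. partials vs (G p) differentiable at x \<and> norm (partials vs (G p) x) \<le> B"
    proof (cases vs rule: rev_exhaust)
      case Nil
      with R show ?thesis by (simp add: Cm_bounded_0_iff)
    next
      case (snoc ws b)
      then have "Cm_bounded m P S (\<lambda>p. pderiv_at b (G p))" "set ws \<subseteq> Basis \<and> length ws \<le> m"
        using R vs by auto
      then show ?thesis unfolding Cm_bounded_def snoc by (auto simp: partials_append)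
    qed
  qed
qed

lemma Cm_bounded_mono:
  assumes "Cm_bounded m P S G" "m' \<le> m" "P' \<subseteq> P" "S' \<subseteq> S"
  shows "Cm_bounded m' P' S' G"
  unfolding Cm_bounded_def
proof (intro allI impI)
  fix vs :: "'b list" assume "set vs \<subseteq> Basis \<and> length vs \<le> m'"
  then obtain B where "\<forall>p\<in>P. \<forall>x\<in>S. partials vs (G p) differentiable (at x) \<and> norm (partials vs (G p) x) \<le> B"
    using assms(1,2) unfolding Cm_bounded_def by fastforce
  then show "\<exists>B. \<forall>p\<in>P'. \<forall>x\<in>S'. partials vs (G p) differentiable (at x) \<and> norm (partials vs (G p) x) \<le> B"
    using assms(3,4) by blast
qed

lemma Cm_bounded_0I:
  assumes "\<And>p x. p \<in> P \<Longrightarrow> x \<in> S \<Longrightarrow> G p differentiable (at x)"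
    and "\<And>p x. p \<in> P \<Longrightarrow> x \<in> S \<Longrightarrow> norm (G p x) \<le> B"
  shows "Cm_bounded 0 P S G"
  unfolding Cm_bounded_0_iff using assms by (intro exI[of _ B]) simp

lemma Cm_bounded_0: "Cm_bounded m P S G \<Longrightarrow> Cm_bounded 0 P S G"
  by (rule Cm_bounded_mono) auto

lemma Cm_bounded_differentiable:
  "Cm_bounded m P S G \<Longrightarrow> p \<in> P \<Longrightarrow> x \<in> S \<Longrightarrow> G p differentiable (at x)"
  using Cm_bounded_0[of m P S G] by (auto simp: Cm_bounded_0_iff)

lemma Cm_bounded_norm_le:
  assumes "Cm_bounded m P S G"
  shows "\<exists>B\<ge>0. \<forall>p\<in>P. \<forall>x\<in>S. norm (G p x) \<le> B"
proof -
  obtain B where "\<forall>p\<in>P. \<forall>x\<in>S. norm (G p x) \<le> B"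
    using Cm_bounded_0[OF assms] by (auto simp: Cm_bounded_0_iff)
  then show ?thesis by (intro exI[of _ "max B 0"]) (auto simp: le_max_iff_disj)
qed

lemma Cm_bounded_pderiv: "Cm_bounded (Suc m) P S G \<Longrightarrow> b \<in> Basis \<Longrightarrow> Cm_bounded m P S (\<lambda>p. pderiv_at b (G p))"
  by (simp add: Cm_bounded_Suc_iff)

lemma Cm_bounded_cong:
  assumes "open S" "\<And>p x. p \<in> P \<Longrightarrow> x \<in> S \<Longrightarrow> G p x = H p x"
  shows "Cm_bounded m P S G \<longleftrightarrow> Cm_bounded m P S H"
proof -
  have "partials vs (G p) differentiable (at x) \<longleftrightarrow> partials vs (H p) differentiable (at x)"
       "partials vs (G p) x = partials vs (H p) x" if "p \<in> P" "x \<in> S" for vs p x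
    using partials_differentiable_cong_open[OF assms(1) that(2)] partials_cong_open[OF assms(1) that(2)]
      assms(2)[OF that(1)] by blast+
  then show ?thesis unfolding Cm_bounded_def by simp
qed

lemma Cm_bounded_congI:
  assumes "open S" "\<And>p x. p \<in> P \<Longrightarrow> x \<in> S \<Longrightarrow> G p x = H p x" "Cm_bounded m P S H"
  shows "Cm_bounded m P S G"
  using Cm_bounded_cong[of S P G H m, OF assms(1,2)] assms(3) by simp

lemma Cm_bounded_reindex: "Cm_bounded m Q S G \<Longrightarrow> h ` P \<subseteq> Q \<Longrightarrow> Cm_bounded m P S (\<lambda>p. G (h p))"
  unfolding Cm_bounded_def by (metis image_subset_iff)

lemma Cm_bounded_const:
  assumes "\<And>p. p \<in> P \<Longrightarrow> norm (a p) \<le> B"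
  shows "Cm_bounded m P S (\<lambda>p x. a p)"
  using assms
proof (induction m arbitrary: a B)
  case 0
  then show ?case unfolding Cm_bounded_0_iff by auto
next
  case (Suc m)
  have "Cm_bounded m P S (\<lambda>p x. 0::'b)" by (rule Suc.IH[of _ 0]) simp
  then show ?case unfolding Cm_bounded_Suc_iff using Suc.prems by (auto simp: Cm_bounded_0_iff)
qed

lemma Cm_bounded_linear:
  assumes "open S" "bounded_linear L" "Cm_bounded m P S G"
  shows "Cm_bounded m P S (\<lambda>p x. L (G p x))"
  using assms(3)
proof (induction m arbitrary: G)
  \<comment> \<open>The order 0 part is proved for any m, as it occurs both at 0 and inside the
    successor step.\<close>
  have base: "Cm_bounded 0 P S (\<lambda>p x. L (G p x))" if G0: "Cm_bounded m P S G" for m G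
  proof -
    obtain B where B: "B \<ge> 0" "\<And>p x. p \<in> P \<Longrightarrow> x \<in> S \<Longrightarrow> norm (G p x) \<le> B"
      using Cm_bounded_norm_le[OF G0] by blast
    obtain K where K: "K \<ge> 0" "\<And>x. norm (L x) \<le> norm x * K"
      using bounded_linear.nonneg_bounded[OF assms(2)] by blast
    show ?thesis
    proof (rule Cm_bounded_0I)
      fix p x assume px: "p \<in> P" "x \<in> S"
      show "(\<lambda>x. L (G p x)) differentiable (at x)"
        by (rule differentiable_compose[OF bounded_linear_imp_differentiable[OF assms(2)] Cm_bounded_differentiable[OF G0 px]])
      show "norm (L (G p x)) \<le> B * K"
        using K(2)[of "G p x"] mult_right_mono[OF B(2)[OF px] K(1)] by linarith
    qed
  qed
  {
    case (0 G)
    then show ?case by (rule base)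
  next
    case (Suc m G)
    have "Cm_bounded m P S (\<lambda>p. pderiv_at b (\<lambda>x. L (G p x)))" if b: "b \<in> Basis" for b
    proof (rule Cm_bounded_congI[OF assms(1)])
      fix p x assume px: "p \<in> P" "x \<in> S"
      have "(G p has_derivative frechet_derivative (G p) (at x)) (at x)"
        using Cm_bounded_differentiable[OF Suc.prems px] by (simp add: frechet_derivative_works)
      from frechet_derivative_at[OF bounded_linear.has_derivative[OF assms(2) this], symmetric]
      show "pderiv_at b (\<lambda>x. L (G p x)) x = L (pderiv_at b (G p) x)" by simp
    next
      show "Cm_bounded m P S (\<lambda>p x. L (pderiv_at b (G p) x))"
        by (rule Suc.IH[OF Cm_bounded_pderiv[OF Suc.prems b]])
    qed
    then show ?case using base[OF Suc.prems] by (simp add: Cm_bounded_Suc_iff)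
  }
qed

lemma Cm_bounded_add:
  fixes F G :: "'p \<Rightarrow> 'a::euclidean_space \<Rightarrow> 'c::real_normed_vector"
  assumes "open S" "Cm_bounded m P S F" "Cm_bounded m P S G"
  shows "Cm_bounded m P S (\<lambda>p x. F p x + G p x)"
  using assms(2,3)
proof (induction m arbitrary: F G)
  have base: "Cm_bounded 0 P S (\<lambda>p x. F p x + G p x)"
    if F0: "Cm_bounded m P S F" and G0: "Cm_bounded m P S G" for F G :: "'p \<Rightarrow> 'a \<Rightarrow> 'c" and m
  proof -
    obtain B where B: "B \<ge> 0" "\<And>p x. p \<in> P \<Longrightarrow> x \<in> S \<Longrightarrow> norm (F p x) \<le> B"
      using Cm_bounded_norm_le[OF F0] by blast
    obtain B' where B': "B' \<ge> 0" "\<And>p x. p \<in> P \<Longrightarrow> x \<in> S \<Longrightarrow> norm (G p x) \<le> B'" 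
      using Cm_bounded_norm_le[OF G0] by blast
    show ?thesis
      by (rule Cm_bounded_0I)
         (intro differentiable_add Cm_bounded_differentiable[OF F0] Cm_bounded_differentiable[OF G0],
          assumption+, rule norm_triangle_mono[OF B(2) B'(2)])
  qed
  {
    case (0 F G)
    then show ?case by (rule base)
  next
    case (Suc m F G)
    have "Cm_bounded m P S (\<lambda>p. pderiv_at b (\<lambda>x. F p x + G p x))" if b: "b \<in> Basis" for b
    proof (rule Cm_bounded_congI[OF assms(1)])
      fix p x assume px: "p \<in> P" "x \<in> S"
      have "(F p has_derivative frechet_derivative (F p) (at x)) (at x)"
           "(G p has_derivative frechet_derivative (G p) (at x)) (at x)"
        using Cm_bounded_differentiable[OF Suc.prems(1) px] Cm_bounded_differentiable[OF Suc.prems(2) px] 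
        by (simp_all add: frechet_derivative_works)
      from frechet_derivative_at[OF has_derivative_add[OF this], symmetric]
      show "pderiv_at b (\<lambda>x. F p x + G p x) x = pderiv_at b (F p) x + pderiv_at b (G p) x" by simp
    next
      show "Cm_bounded m P S (\<lambda>p x. pderiv_at b (F p) x + pderiv_at b (G p) x)"
        by (rule Suc.IH[OF Cm_bounded_pderiv[OF Suc.prems(1) b] Cm_bounded_pderiv[OF Suc.prems(2) b]])
    qed
    then show ?case using base[OF Suc.prems] by (simp add: Cm_bounded_Suc_iff)
  }
qed

lemma Cm_bounded_sum:
  assumes "open S" "finite J" "\<And>j. j \<in> J \<Longrightarrow> Cm_bounded m P S (F j)"
  shows "Cm_bounded m P S (\<lambda>p x. \<Sum>j\<in>J. F j p x)"
  using assms(2,3)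
proof (induction J rule: finite_induct)
  case empty
  show ?case using Cm_bounded_const[of P "\<lambda>_. 0" 0] by simp
next
  case (insert j J)
  then show ?case using Cm_bounded_add[OF assms(1), of m P "F j"] by simp
qed

lemma Cm_bounded_bilinear:
  fixes prod :: "'b::real_normed_vector \<Rightarrow> 'c::real_normed_vector \<Rightarrow> 'd::real_normed_vector"
  assumes S: "open S" and bil: "bounded_bilinear prod"
    and "Cm_bounded m P S F" "Cm_bounded m P S G"
  shows "Cm_bounded m P S (\<lambda>p x. prod (F p x) (G p x))"
  using assms(3,4)
proof (induction m arbitrary: F G)
  have base: "Cm_bounded 0 P S (\<lambda>p x. prod (F p x) (G p x))"
    if F0: "Cm_bounded m P S F" and G0: "Cm_bounded m P S G" for F G and m
  proof -
    obtain B where B: "B \<ge> 0" "\<And>p x. p \<in> P \<Longrightarrow> x \<in> S \<Longrightarrow> norm (F p x) \<le> B"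
      using Cm_bounded_norm_le[OF F0] by blast
    obtain B' where B': "B' \<ge> 0" "\<And>p x. p \<in> P \<Longrightarrow> x \<in> S \<Longrightarrow> norm (G p x) \<le> B'" 
      using Cm_bounded_norm_le[OF G0] by blast
    obtain K where K: "K \<ge> 0" "\<And>a b. norm (prod a b) \<le> norm a * norm b * K"
      using bounded_bilinear.nonneg_bounded[OF bil] by blast
    show ?thesis
    proof (rule Cm_bounded_0I)
      fix p x assume px: "p \<in> P" "x \<in> S"
      have "norm (F p x) * norm (G p x) * K \<le> B * B' * K"
        using B(1) B'(1) B(2)[OF px] B'(2)[OF px] K(1) by (intro mult_right_mono mult_mono) auto
      then show "norm (prod (F p x) (G p x)) \<le> B * B' * K"
        using K(2)[of "F p x" "G p x"] by linarith
      obtain F' G' where "(F p has_derivative F') (at x)" "(G p has_derivative G') (at x)"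
        using Cm_bounded_differentiable[OF F0 px] Cm_bounded_differentiable[OF G0 px]
        unfolding differentiable_def by blast
      from bounded_bilinear.FDERIV[OF bil this]
      show "(\<lambda>x. prod (F p x) (G p x)) differentiable (at x)"
        by (rule differentiableI)
    qed
  qed
  {
    case (0 F G)
    then show ?case by (rule base)
  next
    case (Suc m F G)
    have "Cm_bounded m P S (\<lambda>p. pderiv_at b (\<lambda>x. prod (F p x) (G p x)))" if b: "b \<in> Basis" for b
    proof (rule Cm_bounded_congI[OF S])
      fix p x assume px: "p \<in> P" "x \<in> S"
      have "(F p has_derivative frechet_derivative (F p) (at x)) (at x)"
           "(G p has_derivative frechet_derivative (G p) (at x)) (at x)"
        using Cm_bounded_differentiable[OF Suc.prems(1) px] Cm_bounded_differentiable[OF Suc.prems(2) px] 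
        by (simp_all add: frechet_derivative_works)
      from frechet_derivative_at[OF bounded_bilinear.FDERIV[OF bil this], symmetric]
      show "pderiv_at b (\<lambda>x. prod (F p x) (G p x)) x =
          prod (F p x) (pderiv_at b (G p) x) + prod (pderiv_at b (F p) x) (G p x)" by simp
    next
      show "Cm_bounded m P S (\<lambda>p x. prod (F p x) (pderiv_at b (G p) x) + prod (pderiv_at b (F p) x) (G p x))"
      proof (intro Cm_bounded_add[OF S])
        show "Cm_bounded m P S (\<lambda>p x. prod (F p x) (pderiv_at b (G p) x))"
          using Suc.prems b Cm_bounded_mono[OF Suc.prems(1), of m P S] 
          by (intro Suc.IH Cm_bounded_pderiv) auto
        show "Cm_bounded m P S (\<lambda>p x. prod (pderiv_at b (F p) x) (G p x))"
          using Suc.prems b Cm_bounded_mono[OF Suc.prems(2), of m P S] 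
          by (intro Suc.IH Cm_bounded_pderiv) auto
      qed
    qed
    then show ?case using base[OF Suc.prems] by (simp add: Cm_bounded_Suc_iff)
  }
qed

lemmas Cm_bounded_mult = Cm_bounded_bilinear[OF _ bounded_bilinear_mult]
lemmas Cm_bounded_scaleR = Cm_bounded_bilinear[OF _ bounded_bilinear_scaleR]
lemmas Cm_bounded_inner_left = Cm_bounded_linear[OF _ bounded_linear_inner_left]

text \<open>The derivative of 1/G is -(1/G) G' (1/G), so the induction hypothesis is applied to the
  same function and only multiplied; the lower bound c enters the size estimate at order 0.\<close>

lemma Cm_bounded_inverse:
  fixes G :: "'p \<Rightarrow> 'a::euclidean_space \<Rightarrow> 'b::real_normed_field"
  assumes S: "open S" and "c > 0" and "Cm_bounded m P S G"
    and c: "\<And>p x. p \<in> P \<Longrightarrow> x \<in> S \<Longrightarrow> c \<le> norm (G p x)"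
  shows "Cm_bounded m P S (\<lambda>p x. inverse (G p x))"
  using assms(3)
proof (induction m)
  have nz: "G p x \<noteq> 0" if "p \<in> P" "x \<in> S" for p x
    using c[OF that] \<open>c > 0\<close> by auto
  have base: "Cm_bounded 0 P S (\<lambda>p x. inverse (G p x))" if G0: "Cm_bounded m P S G" for m
  proof -
    show ?thesis
    proof (rule Cm_bounded_0I)
      fix p x assume px: "p \<in> P" "x \<in> S"
      show "norm (inverse (G p x)) \<le> inverse c"
        using c[OF px] \<open>c > 0\<close> nz[OF px] by (simp add: norm_inverse le_imp_inverse_le)
      show "(\<lambda>x. inverse (G p x)) differentiable (at x)"
        using Cm_bounded_differentiable[OF G0 px] nz[OF px]
        by (intro differentiable_inverse) auto
    qed
  qed
  {
    case 0
    then show ?case by (rule base)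
  next
    case (Suc m)
    have IH: "Cm_bounded m P S (\<lambda>p x. inverse (G p x))"
      using Suc.IH Cm_bounded_mono[OF Suc.prems, of m P S] by auto
    have "Cm_bounded m P S (\<lambda>p. pderiv_at b (\<lambda>x. inverse (G p x)))" if b: "b \<in> Basis" for b
    proof (rule Cm_bounded_congI[OF S])
      fix p x assume px: "p \<in> P" "x \<in> S"
      have "(G p has_derivative frechet_derivative (G p) (at x)) (at x)"
        using Cm_bounded_differentiable[OF Suc.prems px] by (simp add: frechet_derivative_works)
      from frechet_derivative_at[OF Deriv.has_derivative_inverse[OF nz[OF px] this], symmetric]
      show "pderiv_at b (\<lambda>x. inverse (G p x)) x = - (inverse (G p x) * pderiv_at b (G p) x * inverse (G p x))"
        by simp
    next
      show "Cm_bounded m P S (\<lambda>p x. - (inverse (G p x) * pderiv_at b (G p) x * inverse (G p x)))"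
        using IH b Suc.prems
        by (intro Cm_bounded_linear[OF S bounded_linear_minus[OF bounded_linear_ident]] 
            Cm_bounded_mult[OF S] Cm_bounded_pderiv) auto
    qed
    then show ?case using base[OF Suc.prems] by (simp add: Cm_bounded_Suc_iff)
  }
qed

text \<open>The chain rule writes a first derivative as a finite sum of components of F' times first
  partials of G taken along F. The induction runs over G with F fixed, which avoids a formula for
  higher derivatives of a composition.\<close>

lemma Cm_bounded_compose:
  fixes F :: "'p \<Rightarrow> 'a::euclidean_space \<Rightarrow> 'b::euclidean_space"
    and G :: "'p \<Rightarrow> 'b \<Rightarrow> 'c::real_normed_vector"
  assumes S: "open S" and F: "Cm_bounded m P S F" and G: "Cm_bounded m P T G"
    and FT: "\<And>p x. p \<in> P \<Longrightarrow> x \<in> S \<Longrightarrow> F p x \<in> T"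
  shows "Cm_bounded m P S (\<lambda>p x. G p (F p x))"
  using F G
proof (induction m arbitrary: G)
  have base: "Cm_bounded 0 P S (\<lambda>p x. G p (F p x))"
    if F0: "Cm_bounded m P S F" and G0: "Cm_bounded m P T G" for m and G :: "'p \<Rightarrow> 'b \<Rightarrow> 'c"
  proof -
    obtain B where B: "B \<ge> 0" "\<And>p x. p \<in> P \<Longrightarrow> x \<in> T \<Longrightarrow> norm (G p x) \<le> B"
      using Cm_bounded_norm_le[OF G0] by blast
    show ?thesis
      by (rule Cm_bounded_0I)
         (rule differentiable_compose[OF Cm_bounded_differentiable[OF G0 _ FT] Cm_bounded_differentiable[OF F0]],
          assumption+, rule B(2), assumption, rule FT, assumption+)
  qed
  {
    case (0 G)
    then show ?case by (rule base)
  next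
    case (Suc m G)
    have "Cm_bounded m P S (\<lambda>p. pderiv_at b (\<lambda>x. G p (F p x)))" if b: "b \<in> Basis" for b
    proof (rule Cm_bounded_congI[OF S])
      show "pderiv_at b (\<lambda>x. G p (F p x)) x = 
          (\<Sum>j\<in>Basis. (pderiv_at b (F p) x \<bullet> j) *\<^sub>R pderiv_at j (G p) (F p x))"
        if px: "p \<in> P" "x \<in> S" for p x
      proof -
        have 1: "(F p has_derivative frechet_derivative (F p) (at x)) (at x)"
          using Cm_bounded_differentiable[OF Suc.prems(1) px] by (simp add: frechet_derivative_works)
        have 2: "(G p has_derivative frechet_derivative (G p) (at (F p x))) (at (F p x))"
          using Cm_bounded_differentiable[OF Suc.prems(2) px(1) FT[OF px]] by (simp add: frechet_derivative_works)
        have lin: "linear (frechet_derivative (G p) (at (F p x)))"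
          using 2 has_derivative_linear by blast
        have "pderiv_at b (\<lambda>x. G p (F p x)) x = 
            frechet_derivative (G p) (at (F p x)) (frechet_derivative (F p) (at x) b)"
          using frechet_derivative_at[OF has_derivative_compose[OF 1 2], symmetric] by simp
        also have "\<dots> = frechet_derivative (G p) (at (F p x)) (\<Sum>j\<in>Basis. (pderiv_at b (F p) x \<bullet> j) *\<^sub>R j)"
          by (simp add: euclidean_representation)
        also have "\<dots> = (\<Sum>j\<in>Basis. (pderiv_at b (F p) x \<bullet> j) *\<^sub>R pderiv_at j (G p) (F p x))"
          by (simp add: linear_sum[OF lin] linear_cmul[OF lin])
        finally show ?thesis .
      qed
      show "Cm_bounded m P S (\<lambda>p x. \<Sum>j\<in>Basis. (pderiv_at b (F p) x \<bullet> j) *\<^sub>R pderiv_at j (G p) (F p x))"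
      proof (intro Cm_bounded_sum[OF S] Cm_bounded_scaleR[OF S] Cm_bounded_inner_left[OF S] finite_Basis)
        show "Cm_bounded m P S (\<lambda>p. pderiv_at b (F p))" using Suc.prems(1) b by (rule Cm_bounded_pderiv)
        show "Cm_bounded m P S (\<lambda>p x. pderiv_at j (G p) (F p x))" if "j \<in> Basis" for j
          using Suc.prems that Cm_bounded_mono[OF Suc.prems(1), of m P S]
          by (intro Suc.IH Cm_bounded_pderiv) auto
      qed
    qed
    then show ?case using base[OF Suc.prems] by (simp add: Cm_bounded_Suc_iff)
  }
qed

text \<open>A point outside S lies in the open complement of K, where the functions vanish
  identically and so do all their partials; hence \<open>max B 0\<close> is a bound
  everywhere.\<close>

lemma Cm_bounded_extend:
  assumes "Cm_bounded m P S G" "closed K" "K \<subseteq> S" "\<And>p x. p \<in> P \<Longrightarrow> x \<notin> K \<Longrightarrow> G p x = 0"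
  shows "Cm_bounded m P UNIV G"
  unfolding Cm_bounded_def
proof (intro allI impI)
  fix vs :: "'b list" assume vs: "set vs \<subseteq> Basis \<and> length vs \<le> m"
  then obtain B where B: "\<forall>p\<in>P. \<forall>x\<in>S. partials vs (G p) differentiable (at x) \<and> norm (partials vs (G p) x) \<le> B"
    using assms(1)[unfolded Cm_bounded_def, THEN spec, of vs] vs by auto
  have zero: "partials vs (\<lambda>_::'b. 0::'c) = (\<lambda>_. 0)"
    by (induction vs) auto
  have "partials vs (G p) differentiable (at x) \<and> norm (partials vs (G p) x) \<le> max B 0" if p: "p \<in> P" for p x
  proof (cases "x \<in> S")
    case True
    with B p show ?thesis by (simp add: le_max_iff_disj)
  next
    case False
    then have x: "x \<in> - K" "open (-K)" using assms by auto
    have G0: "\<And>y. y \<in> -K \<Longrightarrow> G p y = 0" using assms(4)[OF p] by simp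
    have "partials vs (G p) x = 0"
      using partials_cong_open[OF x(2,1) G0, where vs = vs] by (simp add: zero)
    moreover have "partials vs (G p) differentiable (at x)"
      using partials_differentiable_cong_open[OF x(2,1) G0, where vs = vs] by (simp add: zero)
    ultimately show ?thesis by simp
  qed
  then show "\<exists>B. \<forall>p\<in>P. \<forall>x\<in>UNIV. partials vs (G p) differentiable (at x) \<and> norm (partials vs (G p) x) \<le> B"
    by (intro exI[of _ "max B 0"]) simp
qed

section \<open>Smooth functions\<close>

lemma smooth_on_mono: "smooth_on \<Omega> f \<Longrightarrow> \<Omega>' \<subseteq> \<Omega> \<Longrightarrow> smooth_on \<Omega>' f"
  by (auto simp: smooth_on_def)

lemma smooth_on_differentiable: "smooth_on \<Omega> f \<Longrightarrow> x \<in> \<Omega> \<Longrightarrow> f differentiable (at x)"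
  unfolding smooth_on_def by (drule spec[of _ "[]"]) auto

lemma smooth_on_pderiv: "smooth_on \<Omega> f \<Longrightarrow> b \<in> Basis \<Longrightarrow> smooth_on \<Omega> (pderiv_at b f)"
  unfolding smooth_on_def
proof (intro allI impI)
  fix vs :: "'a list"
  assume "\<forall>vs. set vs \<subseteq> Basis \<longrightarrow> (\<forall>x\<in>\<Omega>. partials vs f differentiable at x)" "b \<in> Basis" "set vs \<subseteq> Basis"
  then have "\<forall>x\<in>\<Omega>. partials (vs @ [b]) f differentiable at x" by auto
  then show "\<forall>x\<in>\<Omega>. partials vs (pderiv_at b f) differentiable at x" by (simp add: partials_append)
qed

lemma smooth_on_partials: "smooth_on \<Omega> f \<Longrightarrow> set vs \<subseteq> Basis \<Longrightarrow> smooth_on \<Omega> (partials vs f)"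
  by (auto simp: smooth_on_def partials_append[symmetric])

lemma smooth_on_continuous: "smooth_on \<Omega> f \<Longrightarrow> continuous_on \<Omega> f"
  by (meson continuous_at_imp_continuous_on differentiable_imp_continuous_within smooth_on_differentiable)

text \<open>Compactness of K gives the bounds, while the differential calculus works on open sets;
  hence an S between, typically an open neighbourhood inside K.\<close>

lemma smooth_on_imp_Cm_bounded:
  assumes "smooth_on \<Omega> f" "compact K" "S \<subseteq> K" "K \<subseteq> \<Omega>"
  shows "Cm_bounded m P S (\<lambda>_. f)"
  unfolding Cm_bounded_def
proof (intro allI impI)
  fix vs :: "'a list" assume vs: "set vs \<subseteq> Basis \<and> length vs \<le> m"
  have "smooth_on \<Omega> (partials vs f)" using smooth_on_partials[OF assms(1)] vs by blast
  then have "continuous_on K (partials vs f)"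
    using smooth_on_continuous smooth_on_mono assms(4) by blast
  then have "bounded (partials vs f ` K)" using assms(2) compact_continuous_image compact_imp_bounded by blast
  then obtain B where "\<And>x. x \<in> K \<Longrightarrow> norm (partials vs f x) \<le> B"
    unfolding bounded_iff by blast
  moreover have "partials vs f differentiable (at x)" if "x \<in> K" for x
    using assms vs that unfolding smooth_on_def by blast
  ultimately show "\<exists>B. \<forall>p\<in>P. \<forall>x\<in>S. partials vs f differentiable at x \<and> norm (partials vs f x) \<le> B"
    using assms(3) by blast
qed

text \<open>Bridges the two notions: each closure property of \<open>smooth_on\<close> below follows
  from the one of \<open>Cm_bounded\<close> on a small ball, with the one-point type as parameter
  set.\<close>

lemma smooth_onI_local:
  assumes "\<And>x m. x \<in> \<Omega> \<Longrightarrow> \<exists>S. x \<in> S \<and> Cm_bounded m (UNIV::unit set) S (\<lambda>_. f)"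
  shows "smooth_on \<Omega> f"
  unfolding smooth_on_def
proof (intro allI impI ballI)
  fix vs :: "'a list" and x assume vs: "set vs \<subseteq> Basis" and x: "x \<in> \<Omega>"
  obtain S where "x \<in> S" "Cm_bounded (length vs) (UNIV::unit set) S (\<lambda>_. f)"
    using assms[OF x] by blast
  then show "partials vs f differentiable (at x)" using vs unfolding Cm_bounded_def by blast
qed

lemma Cm_bounded_imp_smooth_on:
  assumes "\<And>m. Cm_bounded m P S G" "p \<in> P"
  shows "smooth_on S (G p)"
proof (rule smooth_onI_local)
  fix x m assume "x \<in> S"
  have "Cm_bounded m (UNIV::unit set) S (\<lambda>_. G p)"
    using Cm_bounded_reindex[OF assms(1), of "\<lambda>_. p" "UNIV::unit set"] assms(2) by auto
  then show "\<exists>S. x \<in> S \<and> Cm_bounded m (UNIV::unit set) S (\<lambda>_. G p)" using \<open>x \<in> S\<close> by blast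
qed

lemma smooth_on_ball_Cm_bounded:
  "smooth_on \<Omega> f \<Longrightarrow> cball x e \<subseteq> \<Omega> \<Longrightarrow> Cm_bounded m P (ball x e) (\<lambda>_. f)"
  by (rule smooth_on_imp_Cm_bounded[OF _ compact_cball ball_subset_cball])

lemma smooth_on_const [simp]: "smooth_on \<Omega> (\<lambda>_. c)"
proof (rule smooth_onI_local)
  fix x :: 'a and m
  show "\<exists>S. x \<in> S \<and> Cm_bounded m (UNIV::unit set) S (\<lambda>_ _. c)"
    by (rule exI[of _ UNIV]) (simp add: Cm_bounded_const[of _ _ "norm c"])
qed

lemma smooth_on_bilinear:
  fixes prod :: "'b::real_normed_vector \<Rightarrow> 'c::real_normed_vector \<Rightarrow> 'd::real_normed_vector"
  assumes "open \<Omega>" "bounded_bilinear prod" "smooth_on \<Omega> f" "smooth_on \<Omega> g"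
  shows "smooth_on \<Omega> (\<lambda>x. prod (f x) (g x))"
proof (rule smooth_onI_local)
  fix x m assume "x \<in> \<Omega>"
  then obtain e where e0: "e > 0" "cball x e \<subseteq> \<Omega>" using assms(1) open_contains_cball by blast
  note e = e0(1) smooth_on_ball_Cm_bounded[OF assms(3) e0(2), of m] smooth_on_ball_Cm_bounded[OF assms(4) e0(2), of m]
  show "\<exists>S. x \<in> S \<and> Cm_bounded m (UNIV::unit set) S (\<lambda>_ x. prod (f x) (g x))"
    using Cm_bounded_bilinear[OF open_ball assms(2) e(2,3)] e(1) by (intro exI[of _ "ball x e"]) auto
qed

lemmas smooth_on_mult = smooth_on_bilinear[OF _ bounded_bilinear_mult]
lemma smooth_on_linear:
  assumes "open \<Omega>" "bounded_linear L" "smooth_on \<Omega> f"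
  shows "smooth_on \<Omega> (\<lambda>x. L (f x))"
proof (rule smooth_onI_local)
  fix x m assume "x \<in> \<Omega>"
  then obtain e where e0: "e > 0" "cball x e \<subseteq> \<Omega>" using assms(1) open_contains_cball by blast
  note e = e0(1) smooth_on_ball_Cm_bounded[OF assms(3) e0(2), of m]
  show "\<exists>S. x \<in> S \<and> Cm_bounded m (UNIV::unit set) S (\<lambda>_ x. L (f x))"
    using Cm_bounded_linear[OF open_ball assms(2) e(2)] e(1) by (intro exI[of _ "ball x e"]) auto
qed

lemma smooth_on_add:
  assumes "open \<Omega>" "smooth_on \<Omega> f" "smooth_on \<Omega> g"
  shows "smooth_on \<Omega> (\<lambda>x. f x + g x)"
proof (rule smooth_onI_local)
  fix x m assume "x \<in> \<Omega>"
  then obtain e where e0: "e > 0" "cball x e \<subseteq> \<Omega>" using assms(1) open_contains_cball by blast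
  note e = e0(1) smooth_on_ball_Cm_bounded[OF assms(2) e0(2), of m] smooth_on_ball_Cm_bounded[OF assms(3) e0(2), of m]
  show "\<exists>S. x \<in> S \<and> Cm_bounded m (UNIV::unit set) S (\<lambda>_ x. f x + g x)"
    using Cm_bounded_add[OF open_ball e(2,3)] e(1) by (intro exI[of _ "ball x e"]) auto
qed

lemma smooth_on_minus: "open \<Omega> \<Longrightarrow> smooth_on \<Omega> f \<Longrightarrow> smooth_on \<Omega> (\<lambda>x. - f x)"
  by (rule smooth_on_linear[OF _ bounded_linear_minus[OF bounded_linear_ident]])

lemma smooth_on_diff:
  "open \<Omega> \<Longrightarrow> smooth_on \<Omega> f \<Longrightarrow> smooth_on \<Omega> g \<Longrightarrow> smooth_on \<Omega> (\<lambda>x. f x - g x)"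
  using smooth_on_add[of \<Omega> f "\<lambda>x. - g x"] smooth_on_minus[of \<Omega> g] by simp

lemma smooth_on_sum:
  assumes "open \<Omega>" "finite J" "\<And>j. j \<in> J \<Longrightarrow> smooth_on \<Omega> (f j)"
  shows "smooth_on \<Omega> (\<lambda>x. \<Sum>j\<in>J. f j x)"
  using assms(2,3)
  by (induction J rule: finite_induct) (auto intro: smooth_on_add[OF assms(1)])

lemma smooth_on_inverse:
  fixes f :: "'a::euclidean_space \<Rightarrow> 'b::real_normed_field"
  assumes "open \<Omega>" "smooth_on \<Omega> f" and nz: "\<And>x. x \<in> \<Omega> \<Longrightarrow> f x \<noteq> 0"
  shows "smooth_on \<Omega> (\<lambda>x. inverse (f x))"
proof (rule smooth_onI_local)
  fix x m assume x: "x \<in> \<Omega>"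
  then obtain e where e0: "e > 0" "cball x e \<subseteq> \<Omega>" using assms(1) open_contains_cball by blast
  note e = e0 smooth_on_ball_Cm_bounded[OF assms(2) e0(2), of m]
  have "continuous_on (cball x e) (\<lambda>x. norm (f x))"
    by (intro continuous_on_norm continuous_on_subset[OF smooth_on_continuous[OF assms(2)] e(2)])
  then obtain y where y: "y \<in> cball x e" "\<And>z. z \<in> cball x e \<Longrightarrow> norm (f y) \<le> norm (f z)"
    using continuous_attains_inf[of "cball x e" "\<lambda>x. norm (f x)"] e(1) by auto
  then have "norm (f y) > 0" using nz e(2) by auto
  then have "Cm_bounded m (UNIV::unit set) (ball x e) (\<lambda>_ x. inverse (f x))"
    using y by (intro Cm_bounded_inverse[OF open_ball, of "norm (f y)"] e(3)) auto
  then show "\<exists>S. x \<in> S \<and> Cm_bounded m (UNIV::unit set) S (\<lambda>_ x. inverse (f x))"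
    using e(1) by (intro exI[of _ "ball x e"]) auto
qed

lemma smooth_on_compose:
  assumes "open \<Omega>" "open \<Omega>'" "smooth_on \<Omega> f" "smooth_on \<Omega>' g" "\<And>x. x \<in> \<Omega> \<Longrightarrow> f x \<in> \<Omega>'"
  shows "smooth_on \<Omega> (\<lambda>x. g (f x))"
proof (rule smooth_onI_local)
  fix x m assume x: "x \<in> \<Omega>"
  then have "f x \<in> \<Omega>'" using assms(5) by blast
  then obtain e' where e0': "e' > 0" "cball (f x) e' \<subseteq> \<Omega>'" using assms(2) open_contains_cball by blast
  note e' = e0'(1) smooth_on_ball_Cm_bounded[OF assms(4) e0'(2), of m]
  define U where "U = \<Omega> \<inter> f -` ball (f x) e'"
  have U: "open U" "x \<in> U" "U \<subseteq> \<Omega>"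
    unfolding U_def using continuous_open_preimage[OF smooth_on_continuous[OF assms(3)] assms(1) open_ball] x e' by auto
  obtain e where e0: "e > 0" "cball x e \<subseteq> U" using U open_contains_cball by blast
  note e = e0 smooth_on_ball_Cm_bounded[OF smooth_on_mono[OF assms(3) U(3)] e0(2), of m]
  have "Cm_bounded m (UNIV::unit set) (ball x e) (\<lambda>_ x. g (f x))"
    using e(2) ball_subset_cball[of x e]
    by (intro Cm_bounded_compose[OF open_ball e(3) e'(2)]) (auto simp: U_def subset_iff)
  then show "\<exists>S. x \<in> S \<and> Cm_bounded m (UNIV::unit set) S (\<lambda>_ x. g (f x))"
    using e(1) by (intro exI[of _ "ball x e"]) auto
qed

lemma smooth_on_ident: "smooth_on UNIV (\<lambda>x. x)"
  unfolding smooth_on_def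
proof (intro allI impI ballI)
  fix vs :: "'a list" and x :: 'a assume vs: "set vs \<subseteq> Basis"
  show "partials vs (\<lambda>x. x) differentiable (at x)"
  proof (cases vs rule: rev_exhaust)
    case (snoc ws b)
    then have "partials vs (\<lambda>x. x) = partials ws (\<lambda>x. b)" by (simp add: partials_append)
    moreover have "set ws \<subseteq> Basis" using vs snoc by auto
    ultimately show ?thesis using smooth_on_const[of UNIV b, unfolded smooth_on_def, rule_format, of ws x] by simp
  qed auto
qed

text \<open>Invariance under basis derivatives keeps every iterated derivative in X. It is made for
  the flat functions below, whose derivatives remain in one explicit span.\<close>

lemma smooth_onI_coinduct:
  fixes X :: "('a::euclidean_space \<Rightarrow> 'b::real_normed_vector) set"
  assumes "f \<in> X" "\<And>g x. g \<in> X \<Longrightarrow> g differentiable (at x)"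
    "\<And>g b. g \<in> X \<Longrightarrow> b \<in> Basis \<Longrightarrow> pderiv_at b g \<in> X"
  shows "smooth_on UNIV f"
proof -
  have "partials vs f \<in> X" if "set vs \<subseteq> Basis" for vs
    using that by (induction vs) (auto intro: assms)
  then show ?thesis using assms(2) by (auto simp: smooth_on_def)
qed

lemma smooth_on_extend:
  assumes "smooth_on S f" "closed K" "K \<subseteq> S" "\<And>x. x \<notin> K \<Longrightarrow> f x = 0"
  shows "smooth_on UNIV f"
  unfolding smooth_on_def
proof (intro allI impI ballI)
  fix vs :: "'a list" and x :: 'a assume vs: "set vs \<subseteq> Basis"
  show "partials vs f differentiable (at x)"
  proof (cases "x \<in> S")
    case True
    with assms(1) vs show ?thesis by (auto simp: smooth_on_def)
  next
    case False
    have "partials vs (\<lambda>_. 0::'b) differentiable (at x)"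
      using smooth_on_const[of UNIV "0::'b"] vs by (auto simp: smooth_on_def simp del: smooth_on_const)
    then show ?thesis
      using partials_differentiable_cong_open[of "-K" x f "\<lambda>_. 0"] assms False by auto
  qed
qed

lemma partials_linear:
  assumes "bounded_linear L" "smooth_on UNIV f" "set vs \<subseteq> Basis"
  shows "partials vs (\<lambda>x. L (f x)) = (\<lambda>x. L (partials vs f x))"
  using assms(3)
proof (induction vs)
  case (Cons v vs)
  have "frechet_derivative (\<lambda>x. L (partials vs f x)) (at x) = (\<lambda>h. L (frechet_derivative (partials vs f) (at x) h))" for x
  proof -
    have "partials vs f differentiable (at x)" using assms(2) Cons.prems by (auto simp: smooth_on_def)
    then show ?thesis
      using frechet_derivative_at[OF bounded_linear.has_derivative[OF assms(1)], symmetric] 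
      by (simp add: frechet_derivative_works)
  qed
  with Cons show ?case by simp
qed auto

lemma partials_add:
  assumes "smooth_on UNIV f" "smooth_on UNIV g" "set vs \<subseteq> Basis"
  shows "partials vs (\<lambda>x. f x + g x) = (\<lambda>x. partials vs f x + partials vs g x)"
  using assms(3)
proof (induction vs)
  case (Cons v vs)
  have "frechet_derivative (\<lambda>x. partials vs f x + partials vs g x) (at x) =
     (\<lambda>h. frechet_derivative (partials vs f) (at x) h + frechet_derivative (partials vs g) (at x) h)" for x
  proof -
    have "partials vs f differentiable (at x)" "partials vs g differentiable (at x)"
      using assms Cons.prems by (auto simp: smooth_on_def)
    then show ?thesis
      using frechet_derivative_at[OF has_derivative_add, symmetric] 
      by (simp add: frechet_derivative_works)
  qed
  with Cons show ?case by simp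
qed auto

section \<open>Test functions\<close>

lemma fun_supp_outside: "x \<notin> fun_supp \<phi> \<Longrightarrow> \<phi> x = 0"
  using closure_subset[of "{x. \<phi> x \<noteq> 0}"] unfolding fun_supp_def subset_iff mem_Collect_eq by metis

lemma closed_fun_supp [simp]: "closed (fun_supp \<phi>)"
  by (simp add: fun_supp_def)

lemma fun_supp_subset:
  assumes "closed K" "\<And>x. x \<notin> K \<Longrightarrow> \<phi> x = 0"
  shows "fun_supp \<phi> \<subseteq> K"
proof -
  have "{x. \<phi> x \<noteq> 0} \<subseteq> K" using assms(2) by blast
  then show ?thesis unfolding fun_supp_def by (rule closure_minimal[OF _ assms(1)])
qed

lemma fun_supp_mono:
  assumes "\<And>x. \<phi> x = 0 \<Longrightarrow> \<psi> x = 0"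
  shows "fun_supp \<psi> \<subseteq> fun_supp \<phi>"
proof -
  have "{x. \<psi> x \<noteq> 0} \<subseteq> {x. \<phi> x \<noteq> 0}" using assms by blast
  then show ?thesis unfolding fun_supp_def by (rule closure_mono)
qed

lemma test_funD:
  assumes "\<phi> \<in> test_fun \<Omega>"
  shows "smooth_on UNIV \<phi>" "compact (fun_supp \<phi>)" "fun_supp \<phi> \<subseteq> \<Omega>"
  using assms by (simp_all add: test_fun_def)

lemma test_funI:
  assumes "smooth_on UNIV \<phi>" "compact K" "K \<subseteq> \<Omega>" "\<And>x. x \<notin> K \<Longrightarrow> \<phi> x = 0"
  shows "\<phi> \<in> test_fun \<Omega>"
proof -
  have K: "fun_supp \<phi> \<subseteq> K" by (rule fun_supp_subset[OF compact_imp_closed[OF assms(2)] assms(4)])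
  have "compact (fun_supp \<phi>)"
    using compact_Int_closed[OF assms(2) closed_fun_supp, of \<phi>] K by (simp add: Int_absorb1)
  then show ?thesis using assms(1,3) K by (simp add: test_fun_def)
qed

lemma test_fun_subset: "\<phi> \<in> test_fun \<Omega> \<Longrightarrow> fun_supp \<phi> \<subseteq> U \<Longrightarrow> \<phi> \<in> test_fun U"
  by (auto simp: test_fun_def)

lemma test_fun_mono: "\<phi> \<in> test_fun \<Omega> \<Longrightarrow> \<Omega> \<subseteq> \<Omega>' \<Longrightarrow> \<phi> \<in> test_fun \<Omega>'"
  by (auto simp: test_fun_def)

lemma fun_supp_mult: "fun_supp (\<lambda>x. \<theta> x * g x) \<subseteq> fun_supp \<theta>" "fun_supp (\<lambda>x. \<theta> x * g x) \<subseteq> fun_supp g"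
  by (rule fun_supp_mono, simp)+

lemma test_fun_mult:
  assumes "\<theta> \<in> test_fun \<Omega>" "open \<Omega>" "smooth_on \<Omega> g"
  shows "(\<lambda>x. \<theta> x * g x) \<in> test_fun \<Omega>"
proof (rule test_funI)
  note \<theta> = test_funD[OF assms(1)]
  show "smooth_on UNIV (\<lambda>x. \<theta> x * g x)"
  proof (rule smooth_on_extend)
    show "smooth_on \<Omega> (\<lambda>x. \<theta> x * g x)"
      by (rule smooth_on_mult[OF assms(2) smooth_on_mono[OF \<theta>(1)] assms(3)]) simp
    show "closed (fun_supp \<theta>)" by simp
    show "fun_supp \<theta> \<subseteq> \<Omega>" by (rule \<theta>)
    show "\<theta> x * g x = 0" if "x \<notin> fun_supp \<theta>" for x
      using fun_supp_outside[OF that] by simp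
  qed
  show "compact (fun_supp \<theta>)" "fun_supp \<theta> \<subseteq> \<Omega>" by (rule \<theta>)+
  show "\<theta> x * g x = 0" if "x \<notin> fun_supp \<theta>" for x
    using fun_supp_outside[OF that] by simp
qed

lemma test_fun_zero [simp]: "(\<lambda>_. 0) \<in> test_fun \<Omega>"
  by (rule test_funI[of _ "{}"]) auto

lemma test_fun_add:
  assumes "\<phi> \<in> test_fun \<Omega>" "\<psi> \<in> test_fun \<Omega>"
  shows "(\<lambda>x. \<phi> x + \<psi> x) \<in> test_fun \<Omega>"
proof (rule test_funI)
  show "smooth_on UNIV (\<lambda>x. \<phi> x + \<psi> x)"
    using test_funD(1)[OF assms(1)] test_funD(1)[OF assms(2)] by (intro smooth_on_add) auto
  show "compact (fun_supp \<phi> \<union> fun_supp \<psi>)" "fun_supp \<phi> \<union> fun_supp \<psi> \<subseteq> \<Omega>"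
    using test_funD(2,3)[OF assms(1)] test_funD(2,3)[OF assms(2)] by auto
  show "\<phi> x + \<psi> x = 0" if "x \<notin> fun_supp \<phi> \<union> fun_supp \<psi>" for x
    using that fun_supp_outside[of x \<phi>] fun_supp_outside[of x \<psi>] by simp
qed

lemma test_fun_scale:
  assumes "\<phi> \<in> test_fun \<Omega>"
  shows "(\<lambda>x. a * \<phi> x) \<in> test_fun \<Omega>"
proof (rule test_funI)
  show "smooth_on UNIV (\<lambda>x. a * \<phi> x)"
    by (rule smooth_on_mult[OF open_UNIV smooth_on_const test_funD(1)[OF assms]])
  show "compact (fun_supp \<phi>)" "fun_supp \<phi> \<subseteq> \<Omega>" by (rule test_funD[OF assms])+
  show "a * \<phi> x = 0" if "x \<notin> fun_supp \<phi>" for x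
    using fun_supp_outside[OF that] by simp
qed

lemma test_fun_diff:
  assumes "\<phi> \<in> test_fun \<Omega>" "\<psi> \<in> test_fun \<Omega>"
  shows "(\<lambda>x. \<phi> x - \<psi> x) \<in> test_fun \<Omega>"
  using test_fun_add[OF assms(1) test_fun_scale[OF assms(2), of "-1"]] by simp

lemma test_fun_sum:
  assumes "finite J" "\<And>j. j \<in> J \<Longrightarrow> \<phi> j \<in> test_fun \<Omega>"
  shows "(\<lambda>x. \<Sum>j\<in>J. \<phi> j x) \<in> test_fun \<Omega>"
  using assms by (induction J rule: finite_induct) (auto intro: test_fun_add)

section \<open>Flat functions, bumps and cutoffs\<close>

definition flat_exp :: "nat \<Rightarrow> real \<Rightarrow> real" where
  "flat_exp j t = (if t \<le> 0 then 0 else exp (- inverse t) * inverse t ^ j)"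

lemma flat_exp_tendsto_0: "(flat_exp j \<longlongrightarrow> 0) (at 0)"
proof -
  have "((\<lambda>t. inverse t ^ j / exp (inverse t)) \<longlongrightarrow> (0::real)) (at_right 0)"
    by (rule filterlim_compose[OF tendsto_power_div_exp_0 filterlim_inverse_at_top_right])
  moreover have "inverse t ^ j / exp (inverse t) = flat_exp j t" if "t > 0" for t :: real
    using that by (simp add: flat_exp_def exp_minus divide_inverse)
  then have "\<forall>\<^sub>F t in at_right (0::real). inverse t ^ j / exp (inverse t) = flat_exp j t"
    by (simp add: eventually_at_filter)
  ultimately have R: "(flat_exp j \<longlongrightarrow> 0) (at_right 0)"
    by (rule Lim_transform_eventually)
  have "\<forall>\<^sub>F t in at_left (0::real). 0 = flat_exp j t"
    by (simp add: eventually_at_filter flat_exp_def)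
  then have "(flat_exp j \<longlongrightarrow> 0) (at_left 0)"
    by (rule Lim_transform_eventually[OF tendsto_const])
  with R show ?thesis by (simp add: filterlim_split_at)
qed

text \<open>The functions exp(-1/t) (1/t)^j are closed under differentiation up to linear
  combinations, which is why the power j is carried along; j = 0 is the classical flat
  function.\<close>

lemma flat_exp_has_derivative:
  "(flat_exp j has_real_derivative (flat_exp (j + 2) t - of_nat j * flat_exp (j + 1) t)) (at t)"
proof -
  consider "t < 0" | "t = 0" | "t > 0" by linarith
  then show ?thesis
  proof cases
    case 1
    have "(flat_exp j has_real_derivative 0) (at t)"
      by (rule has_field_derivative_transform_within_open[OF DERIV_const[where k = "0::real"] open_lessThan[of 0]])
         (use 1 in \<open>auto simp: flat_exp_def\<close>)
    then show ?thesis using 1 by (simp add: flat_exp_def)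
  next
    case 2
    \<comment> \<open>At 0 the difference quotient is the next flat function, so its limit 0 is the
      limit already proved.\<close>
    have "(flat_exp j h - flat_exp j 0) / (h - 0) = flat_exp (Suc j) h" if "h \<noteq> 0" for h
    proof (cases "h \<le> 0")
      case False
      then show ?thesis
        by (simp only: flat_exp_def if_False order_refl if_True diff_0_right power_Suc divide_inverse mult_ac)
    qed (simp add: flat_exp_def)
    then have "\<forall>\<^sub>F h in at 0. flat_exp (Suc j) h = (flat_exp j h - flat_exp j 0) / (h - 0)"
      by (simp add: eventually_at_filter)
    from Lim_transform_eventually[OF flat_exp_tendsto_0 this]
    have "((\<lambda>h. (flat_exp j h - flat_exp j 0) / (h - 0)) \<longlongrightarrow> 0) (at 0)" .
    then have "(flat_exp j has_real_derivative 0) (at 0)"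
      by (simp add: has_field_derivative_iff)
    then show ?thesis using 2 by (simp add: flat_exp_def)
  next
    case 3
    have inv: "(inverse has_real_derivative - (inverse t * inverse t)) (at t)"
      using DERIV_inverse'[OF DERIV_ident, of t UNIV] 3 by simp
    have e: "((\<lambda>t. exp (- inverse t)) has_real_derivative exp (- inverse t) * (inverse t * inverse t)) (at t)"
      using DERIV_fun_exp[OF DERIV_minus[OF inv]] by simp
    have p: "((\<lambda>t. inverse t ^ j) has_real_derivative of_nat j * (- (inverse t * inverse t) * inverse t ^ (j - Suc 0))) (at t)"
      by (rule DERIV_power[OF inv])
    have eq: "exp (- i) * (i * i) * i ^ j + of_nat j * (- (i * i) * i ^ (j - Suc 0)) * exp (- i) =
        exp (- i) * i ^ (j + 2) - of_nat j * (exp (- i) * i ^ (j + 1))" for i :: real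
      by (cases j) (simp_all add: algebra_simps)
    have d: "((\<lambda>t. exp (- inverse t) * inverse t ^ j) has_real_derivative
        (flat_exp (j + 2) t - of_nat j * flat_exp (j + 1) t)) (at t)"
      by (rule DERIV_cong[OF DERIV_mult[OF e p]], subst eq) (use 3 in \<open>simp add: flat_exp_def\<close>)
    show ?thesis
      by (rule has_field_derivative_transform_within_open[OF d open_greaterThan[of 0]])
         (use 3 in \<open>auto simp: flat_exp_def\<close>)
  qed
qed

inductive_set flat_span :: "(real \<Rightarrow> real) set" where
  base: "flat_exp j \<in> flat_span"
| comb: "g \<in> flat_span \<Longrightarrow> h \<in> flat_span \<Longrightarrow> (\<lambda>t. a * g t + b * h t) \<in> flat_span"

lemma flat_span_derivative:
  "g \<in> flat_span \<Longrightarrow> \<exists>g'\<in>flat_span. \<forall>t. (g has_real_derivative g' t) (at t)"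
proof (induction rule: flat_span.induct)
  case (base j)
  have "(\<lambda>t. 1 * flat_exp (j + 2) t + (- of_nat j) * flat_exp (j + 1) t) \<in> flat_span"
    by (intro flat_span.intros)
  then show ?case using flat_exp_has_derivative[of j] 
    by (intro bexI[of _ "\<lambda>t. 1 * flat_exp (j + 2) t + (- of_nat j) * flat_exp (j + 1) t"]) auto
next
  case (comb g h a b)
  then obtain g' h' where "g' \<in> flat_span" "h' \<in> flat_span" 
    and d: "\<forall>t. (g has_real_derivative g' t) (at t)" "\<forall>t. (h has_real_derivative h' t) (at t)"
    by blast
  then have "(\<lambda>t. a * g' t + b * h' t) \<in> flat_span" by (intro flat_span.intros)
  moreover have "\<forall>t. ((\<lambda>t. a * g t + b * h t) has_real_derivative a * g' t + b * h' t) (at t)"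
    using d by (auto intro!: derivative_eq_intros)
  ultimately show ?case by (intro bexI[of _ "\<lambda>t. a * g' t + b * h' t"])
qed

lemma smooth_flat_exp: "smooth_on UNIV (flat_exp j)"
proof (rule smooth_onI_coinduct[of _ flat_span])
  show "flat_exp j \<in> flat_span" by (rule flat_span.base)
  fix g assume g: "g \<in> flat_span"
  obtain g' where g': "g' \<in> flat_span" "\<And>t. (g has_real_derivative g' t) (at t)"
    using flat_span_derivative[OF g] by blast
  show "g differentiable (at x)" for x
    using g'(2)[of x] unfolding has_field_derivative_def by (rule differentiableI)
  fix b :: real assume "b \<in> Basis"
  have "frechet_derivative g (at x) b = g' x" for x
    using frechet_derivative_at[OF g'(2)[of x, unfolded has_field_derivative_def], symmetric] \<open>b \<in> Basis\<close> by simp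
  then show "pderiv_at b g \<in> flat_span" using g'(1) by simp
qed

text \<open>The denominator is positive everywhere, because t and 1 - t are never both
  nonpositive.\<close>

definition smooth_step :: "real \<Rightarrow> real" where
  "smooth_step t = flat_exp 0 t * inverse (flat_exp 0 t + flat_exp 0 (1 - t))"

lemma smooth_smooth_step: "smooth_on UNIV smooth_step"
proof -
  have "flat_exp 0 t + flat_exp 0 (1 - t) \<noteq> 0" for t
    by (cases "t \<le> 0"; cases "1 - t \<le> 0")
       (simp_all add: flat_exp_def add_pos_pos[THEN less_imp_neq, symmetric])
  moreover have "smooth_on UNIV (\<lambda>t. flat_exp 0 (1 - t))"
    by (rule smooth_on_compose[of UNIV UNIV "\<lambda>t. 1 - t"])
       (auto intro: smooth_flat_exp smooth_on_diff smooth_on_ident)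
  ultimately show ?thesis
    unfolding smooth_step_def[abs_def]
    by (intro smooth_on_mult smooth_on_inverse smooth_on_add smooth_flat_exp) auto
qed

lemma smooth_step_0: "t \<le> 0 \<Longrightarrow> smooth_step t = 0"
  by (simp add: smooth_step_def flat_exp_def)

lemma smooth_step_1: "t \<ge> 1 \<Longrightarrow> smooth_step t = 1"
  by (simp add: smooth_step_def flat_exp_def)

lemma exists_bump:
  fixes a :: "'a::euclidean_space"
  assumes "r > 0" "cball a (2 * r) \<subseteq> \<Omega>"
  shows "\<exists>\<beta>\<in>test_fun \<Omega>. fun_supp \<beta> \<subseteq> cball a (2 * r) \<and> (\<forall>x\<in>cball a r. \<beta> x = 1)"
proof -
  \<comment> \<open>A polynomial, hence smooth where the norm is not: it is 1 at distance r from a,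
    0 at distance 2r, and decreases with the distance.\<close>
  define q where "q = (\<lambda>x::'a. (4 * r\<^sup>2 - (x - a) \<bullet> (x - a)) / (3 * r\<^sup>2))"
  define \<beta> where "\<beta> = (\<lambda>x. complex_of_real (smooth_step (q x)))"
  have lin: "smooth_on UNIV (\<lambda>x. x - a)" by (intro smooth_on_diff smooth_on_ident) auto
  have "smooth_on UNIV q" unfolding q_def
    by (rule smooth_on_linear[OF _ bounded_linear_divide])
       (auto intro!: smooth_on_diff smooth_on_bilinear[OF _ bounded_bilinear_inner] lin)
  then have sm: "smooth_on UNIV \<beta>" unfolding \<beta>_def
    by (intro smooth_on_linear[OF _ bounded_linear_of_real] smooth_on_compose[OF _ _ _ smooth_smooth_step]) auto
  have n: "(x - a) \<bullet> (x - a) = (dist a x)\<^sup>2" for x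
    by (simp add: dist_norm power2_norm_eq_inner[symmetric] norm_minus_commute)
  have out: "\<beta> x = 0" if "x \<notin> cball a (2 * r)" for x
  proof -
    have "(2 * r)\<^sup>2 \<le> (dist a x)\<^sup>2" using that assms(1) by (intro power_mono) auto
    then have "q x \<le> 0" unfolding q_def n by (simp add: divide_le_0_iff power_mult_distrib)
    then show ?thesis by (simp add: \<beta>_def smooth_step_0)
  qed
  have "\<beta> x = 1" if "x \<in> cball a r" for x
  proof -
    have "(dist a x)\<^sup>2 \<le> r\<^sup>2" using that assms(1) by (intro power_mono) auto
    then have "q x \<ge> 1" unfolding q_def n using assms(1) by (simp add: field_simps)
    then show ?thesis by (simp add: \<beta>_def smooth_step_1)
  qed
  moreover have "\<beta> \<in> test_fun \<Omega>" using sm out assms(2) by (intro test_funI[of _ "cball a (2 * r)"]) auto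
  moreover have "fun_supp \<beta> \<subseteq> cball a (2 * r)" using out by (intro fun_supp_subset) auto
  ultimately show ?thesis by blast
qed

lemma open_contains_cball2:
  assumes "open U" "x \<in> U"
  shows "\<exists>r>0. cball x (2 * r) \<subseteq> U"
proof -
  obtain e where "e > 0" "cball x e \<subseteq> U" using assms open_contains_cball by blast
  then show ?thesis by (intro exI[of _ "e / 2"]) auto
qed

lemma exists_cutoff:
  fixes K \<Omega> :: "'a::euclidean_space set"
  assumes "compact K" "open \<Omega>" "K \<subseteq> \<Omega>"
  shows "\<exists>\<theta>\<in>test_fun \<Omega>. \<exists>W. open W \<and> K \<subseteq> W \<and> (\<forall>x\<in>W. \<theta> x = 1)"
proof -
  have "\<forall>x\<in>K. \<exists>r>0. cball x (2 * r) \<subseteq> \<Omega>" using open_contains_cball2 assms by blast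
  then obtain r where r: "\<And>x. x \<in> K \<Longrightarrow> r x > 0 \<and> cball x (2 * r x) \<subseteq> \<Omega>" by metis
  have "K \<subseteq> (\<Union>x\<in>K. ball x (r x))" using r by fastforce
  then obtain F where F: "F \<subseteq> K" "finite F" "K \<subseteq> (\<Union>x\<in>F. ball x (r x))"
    using compactE_image[OF assms(1), of K "\<lambda>x. ball x (r x)"] by auto
  have "\<exists>\<theta>\<in>test_fun \<Omega>. \<forall>x\<in>(\<Union>x\<in>F. ball x (r x)). \<theta> x = 1"
    using F(2,1)
  proof (induction F rule: finite_induct)
    case empty
    then show ?case using test_fun_zero by blast
  next
    case (insert y F)
    then obtain \<theta> where \<theta>: "\<theta> \<in> test_fun \<Omega>" "\<forall>x\<in>(\<Union>x\<in>F. ball x (r x)). \<theta> x = 1" by auto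
    obtain \<beta> where \<beta>: "\<beta> \<in> test_fun \<Omega>" "\<And>x. x \<in> cball y (r y) \<Longrightarrow> \<beta> x = 1"
      using exists_bump[of "r y" y \<Omega>] r[of y] insert.prems by blast
    \<comment> \<open>This is 1 - (1 - \<theta>)(1 - \<beta>), which equals 1 wherever one of the
      two factors does.\<close>
    have "(\<lambda>x. \<theta> x + \<beta> x - \<theta> x * \<beta> x) \<in> test_fun \<Omega>"
      by (intro test_fun_diff test_fun_add test_fun_mult \<theta> \<beta> assms smooth_on_mono[OF test_funD(1)[OF \<beta>(1)]]) simp
    moreover have "\<forall>x\<in>(\<Union>x\<in>insert y F. ball x (r x)). \<theta> x + \<beta> x - \<theta> x * \<beta> x = 1"
      using \<theta>(2) \<beta>(2) by (auto simp: algebra_simps)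
    ultimately show ?case by (intro bexI)
  qed
  then obtain \<theta> where "\<theta> \<in> test_fun \<Omega>" "\<forall>x\<in>(\<Union>x\<in>F. ball x (r x)). \<theta> x = 1" by blast
  then show ?thesis using F(3) by (intro bexI[of _ \<theta>] exI[of _ "\<Union>x\<in>F. ball x (r x)"]) auto
qed

text \<open>Takes the place of a partition of unity. The compact support is covered by finitely many
  balls; a bump splits off the part of \<phi> near one ball, and since it is 1 there, the remainder
  loses that ball from its support. It serves for seminorm finiteness, for supports and for the
  estimate of the push-forward.\<close>

lemma test_fun_localize:
  fixes \<Omega> :: "'a::euclidean_space set"
  assumes "open \<Omega>" and zero: "P (\<lambda>_. 0)"
    and add: "\<And>\<phi> \<psi>. \<phi> \<in> test_fun \<Omega> \<Longrightarrow> \<psi> \<in> test_fun \<Omega> \<Longrightarrow> P \<phi> \<Longrightarrow> P \<psi> \<Longrightarrow> P (\<lambda>x. \<phi> x + \<psi> x)"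
    and loc: "\<And>x. x \<in> \<Omega> \<Longrightarrow> \<exists>U. open U \<and> x \<in> U \<and> (\<forall>\<phi>\<in>test_fun \<Omega>. fun_supp \<phi> \<subseteq> U \<longrightarrow> P \<phi>)"
    and \<phi>: "\<phi> \<in> test_fun \<Omega>"
  shows "P \<phi>"
proof -
  \<comment> \<open>The property is required on the ball of radius 2r because a bump that is 1 on
    radius r has its support there.\<close>
  define Q where "Q x r \<longleftrightarrow> r > 0 \<and> cball x (2 * r) \<subseteq> \<Omega> \<and>
      (\<forall>\<phi>\<in>test_fun \<Omega>. fun_supp \<phi> \<subseteq> cball x (2 * r) \<longrightarrow> P \<phi>)" for x r
  have "\<exists>r. Q x r" if x: "x \<in> \<Omega>" for x
  proof -
    obtain U where U: "open U" "x \<in> U" "\<forall>\<phi>\<in>test_fun \<Omega>. fun_supp \<phi> \<subseteq> U \<longrightarrow> P \<phi>"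
      using loc[OF x] by blast
    obtain r where "r > 0" "cball x (2 * r) \<subseteq> U \<inter> \<Omega>"
      using open_contains_cball2[of "U \<inter> \<Omega>" x] U(1,2) assms(1) x by blast
    then show ?thesis unfolding Q_def using U(3) by (intro exI[of _ r]) blast
  qed
  then obtain r where rQ: "\<forall>x\<in>\<Omega>. Q x (r x)" using bchoice[of \<Omega> Q] by blast
  then have r: "r x > 0" "cball x (2 * r x) \<subseteq> \<Omega>" if "x \<in> \<Omega>" for x
    using that by (auto simp: Q_def)
  have rP: "P \<phi>" if "x \<in> \<Omega>" "\<phi> \<in> test_fun \<Omega>" "fun_supp \<phi> \<subseteq> cball x (2 * r x)" for x \<phi>
    using rQ that unfolding Q_def by blast
  note supp = test_funD[OF \<phi>]
  have "fun_supp \<phi> \<subseteq> (\<Union>x\<in>fun_supp \<phi>. ball x (r x))"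
  proof
    fix x assume x: "x \<in> fun_supp \<phi>"
    then have "x \<in> ball x (r x)" using r(1) supp(3) by auto
    with x show "x \<in> (\<Union>x\<in>fun_supp \<phi>. ball x (r x))" by blast
  qed
  then obtain F where F: "F \<subseteq> fun_supp \<phi>" "finite F" "fun_supp \<phi> \<subseteq> (\<Union>x\<in>F. ball x (r x))"
    by (rule compactE_image[OF supp(2), of "fun_supp \<phi>" "\<lambda>x. ball x (r x)", OF open_ball])
  have "F \<subseteq> \<Omega>" using F(1) supp(3) by blast
  with F(2) have "\<forall>\<phi>\<in>test_fun \<Omega>. fun_supp \<phi> \<subseteq> (\<Union>x\<in>F. ball x (r x)) \<longrightarrow> P \<phi>"
  proof (induction F rule: finite_induct)
    case empty
    have "P \<phi>" if "fun_supp \<phi> \<subseteq> {}" for \<phi> :: "'a \<Rightarrow> complex"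
    proof -
      have "\<phi> = (\<lambda>_. 0)" using fun_supp_outside[of _ \<phi>] that by auto
      then show ?thesis using zero by simp
    qed
    then show ?case by simp
  next
    case (insert y F)
    then have y: "y \<in> \<Omega>" by simp
    obtain \<beta> where \<beta>: "\<beta> \<in> test_fun \<Omega>" "fun_supp \<beta> \<subseteq> cball y (2 * r y)" "\<And>x. x \<in> cball y (r y) \<Longrightarrow> \<beta> x = 1"
      using exists_bump[OF r(1)[OF y] r(2)[OF y]] by blast
    show ?case
    proof (intro ballI impI)
      fix \<phi> assume \<phi>: "\<phi> \<in> test_fun \<Omega>" and s: "fun_supp \<phi> \<subseteq> (\<Union>x\<in>insert y F. ball x (r x))"
      have 1: "(\<lambda>x. \<beta> x * \<phi> x) \<in> test_fun \<Omega>"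
        by (rule test_fun_mult[OF \<beta>(1) assms(1) smooth_on_mono[OF test_funD(1)[OF \<phi>] subset_UNIV]])
      have P1: "P (\<lambda>x. \<beta> x * \<phi> x)"
        using rP[OF y 1] fun_supp_mult(1)[of \<beta> \<phi>] \<beta>(2) by blast
      have 2: "(\<lambda>x. \<phi> x - \<beta> x * \<phi> x) \<in> test_fun \<Omega>" by (rule test_fun_diff[OF \<phi> 1])
      have "fun_supp (\<lambda>x. \<phi> x - \<beta> x * \<phi> x) \<subseteq> fun_supp \<phi> - ball y (r y)"
      proof (rule fun_supp_subset)
        show "closed (fun_supp \<phi> - ball y (r y))" by (intro closed_Diff) auto
        fix x assume "x \<notin> fun_supp \<phi> - ball y (r y)"
        then show "\<phi> x - \<beta> x * \<phi> x = 0" using \<beta>(3)[of x] fun_supp_outside[of x \<phi>] by auto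
      qed
      with s have "fun_supp (\<lambda>x. \<phi> x - \<beta> x * \<phi> x) \<subseteq> (\<Union>x\<in>F. ball x (r x))" by blast
      then have P2: "P (\<lambda>x. \<phi> x - \<beta> x * \<phi> x)" using insert.IH insert.prems 2 by blast
      show "P \<phi>" using add[OF 1 2 P1 P2] by simp
    qed
  qed
  then show ?thesis using \<phi> F(3) by blast
qed

text \<open>Provides the pair asked for by the bounds on families: an open S for the derivatives,
  inside a compact K' for the bounds.\<close>

lemma compact_open_between:
  fixes K :: "'a::euclidean_space set"
  assumes "compact K" "open \<Omega>" "K \<subseteq> \<Omega>"
  shows "\<exists>S K'. open S \<and> compact K' \<and> K \<subseteq> S \<and> S \<subseteq> K' \<and> K' \<subseteq> \<Omega>"
proof -
  have "\<forall>x\<in>K. \<exists>r>0. cball x r \<subseteq> \<Omega>" using open_contains_cball assms by blast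
  then obtain r where r: "\<And>x. x \<in> K \<Longrightarrow> r x > 0 \<and> cball x (r x) \<subseteq> \<Omega>" by metis
  have "K \<subseteq> (\<Union>x\<in>K. ball x (r x))" using r by fastforce
  then obtain F where F: "F \<subseteq> K" "finite F" "K \<subseteq> (\<Union>x\<in>F. ball x (r x))"
    using compactE_image[OF assms(1), of K "\<lambda>x. ball x (r x)"] by auto
  show ?thesis
  proof (intro exI conjI)
    show "open (\<Union>x\<in>F. ball x (r x))" by auto
    show "compact (\<Union>x\<in>F. cball x (r x))" using F(2) by auto
    show "(\<Union>x\<in>F. ball x (r x)) \<subseteq> (\<Union>x\<in>F. cball x (r x))" by force
    show "(\<Union>x\<in>F. cball x (r x)) \<subseteq> \<Omega>" using r F(1) by blast
  qed (rule F(3))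
qed

section \<open>The norms on test functions\<close>

text \<open>There are finitely many lists of basis vectors of length at most m, so the sum of the
  absolute values of their bounds is a common one.\<close>

lemma Cm_bounded_uniform:
  assumes "Cm_bounded m P S G"
  shows "\<exists>B\<ge>0. \<forall>vs. set vs \<subseteq> Basis \<and> length vs \<le> m \<longrightarrow> (\<forall>p\<in>P. \<forall>x\<in>S. norm (partials vs (G p) x) \<le> B)"
proof -
  let ?L = "{vs :: 'b list. set vs \<subseteq> Basis \<and> length vs \<le> m}"
  have fin: "finite ?L" by (rule finite_lists_length_le) simp
  have "\<exists>B. \<forall>p\<in>P. \<forall>x\<in>S. norm (partials vs (G p) x) \<le> B" if "vs \<in> ?L" for vs
    using assms[unfolded Cm_bounded_def, THEN spec, of vs] that by auto
  then obtain B where B: "\<And>vs. vs \<in> ?L \<Longrightarrow> \<forall>p\<in>P. \<forall>x\<in>S. norm (partials vs (G p) x) \<le> B vs" by metis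
  have "B vs \<le> (\<Sum>vs\<in>?L. \<bar>B vs\<bar>)" if "vs \<in> ?L" for vs
    using member_le_sum[OF that, of "\<lambda>vs. \<bar>B vs\<bar>"] fin by auto
  then have "norm (partials vs (G p) x) \<le> (\<Sum>vs\<in>?L. \<bar>B vs\<bar>)" if "vs \<in> ?L" "p \<in> P" "x \<in> S" for vs p x
    using B that by fastforce
  then show ?thesis by (intro exI[of _ "\<Sum>vs\<in>?L. \<bar>B vs\<bar>"]) (auto intro: sum_nonneg)
qed

lemma test_fun_Cm_bounded:
  assumes "\<phi> \<in> test_fun \<Omega>"
  shows "Cm_bounded m P UNIV (\<lambda>_. \<phi>)"
proof -
  note \<phi> = test_funD[OF assms]
  obtain S K' where S: "open S" "compact K'" "fun_supp \<phi> \<subseteq> S" "S \<subseteq> K'" "K' \<subseteq> UNIV"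
    using compact_open_between[OF \<phi>(2) open_UNIV] by blast
  show ?thesis
    by (rule Cm_bounded_extend[OF smooth_on_imp_Cm_bounded[OF \<phi>(1) S(2,4,5)] _ S(3)])
       (auto simp: fun_supp_outside)
qed

lemma Cm_norm_least:
  assumes "\<And>vs x. set vs \<subseteq> Basis \<Longrightarrow> length vs \<le> m \<Longrightarrow> cmod (partials vs \<phi> x) \<le> B"
  shows "Cm_norm m \<phi> \<le> B"
proof -
  have "([], 0) \<in> {vs. set vs \<subseteq> Basis \<and> length vs \<le> m} \<times> UNIV" by simp
  then have "{vs. set vs \<subseteq> Basis \<and> length vs \<le> m} \<times> (UNIV :: 'a set) \<noteq> {}" by blast
  then show ?thesis unfolding Cm_norm_def by (rule cSUP_least) (use assms in auto)
qed

lemma Cm_norm_upper: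
  assumes "\<phi> \<in> test_fun \<Omega>" "set vs \<subseteq> Basis" "length vs \<le> m"
  shows "cmod (partials vs \<phi> x) \<le> Cm_norm m \<phi>"
proof -
  obtain B where "\<forall>vs. set vs \<subseteq> Basis \<and> length vs \<le> m \<longrightarrow> (\<forall>p\<in>(UNIV::unit set). \<forall>x\<in>UNIV. norm (partials vs \<phi> x) \<le> B)"
    using Cm_bounded_uniform[OF test_fun_Cm_bounded[OF assms(1)], of m "UNIV :: unit set"] by blast
  then have "bdd_above ((\<lambda>(vs, x). cmod (partials vs \<phi> x)) ` ({vs. set vs \<subseteq> Basis \<and> length vs \<le> m} \<times> UNIV))"
    by (intro bdd_aboveI[of _ B]) auto
  from cSUP_upper[OF _ this, of "(vs, x)"] assms(2,3) show ?thesis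
    unfolding Cm_norm_def by auto
qed

lemma Cm_norm_nonneg: "\<phi> \<in> test_fun \<Omega> \<Longrightarrow> 0 \<le> Cm_norm m \<phi>"
  using Cm_norm_upper[of \<phi> \<Omega> "[]" m undefined] by (auto intro: order_trans[OF norm_ge_zero])

lemma Cm_bounded_Cm_norm:
  assumes "Cm_bounded m P UNIV G"
  shows "\<exists>B\<ge>0. \<forall>p\<in>P. Cm_norm m (G p) \<le> B"
proof -
  obtain B where "B \<ge> 0" and B: "\<forall>vs. set vs \<subseteq> Basis \<and> length vs \<le> m \<longrightarrow> (\<forall>p\<in>P. \<forall>x\<in>UNIV. norm (partials vs (G p) x) \<le> B)"
    using Cm_bounded_uniform[OF assms] by blast
  have "\<forall>p\<in>P. Cm_norm m (G p) \<le> B" using B by (auto intro!: Cm_norm_least)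
  then show ?thesis using \<open>B \<ge> 0\<close> by blast
qed

lemma Cm_norm_scaleR_le:
  assumes "\<phi> \<in> test_fun \<Omega>"
  shows "Cm_norm m (\<lambda>x. a *\<^sub>R \<phi> x) \<le> \<bar>a\<bar> * Cm_norm m \<phi>"
proof (rule Cm_norm_least)
  fix vs :: "'a list" and x assume vs: "set vs \<subseteq> Basis" "length vs \<le> m"
  have "partials vs (\<lambda>x. a *\<^sub>R \<phi> x) x = a *\<^sub>R partials vs \<phi> x"
    using partials_linear[OF bounded_linear_scaleR_right test_funD(1)[OF assms] vs(1)] by metis
  then show "cmod (partials vs (\<lambda>x. a *\<^sub>R \<phi> x) x) \<le> \<bar>a\<bar> * Cm_norm m \<phi>"
    using Cm_norm_upper[OF assms vs, of x] by (simp add: mult_left_mono)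
qed

text \<open>Divided by their own norms, all test functions form one family bounded by 1. Composition
  with f and multiplication by \<theta> keep it bounded, and homogeneity undoes the
  normalisation.\<close>

lemma Cm_norm_pullback:
  fixes f :: "'a::euclidean_space \<Rightarrow> 'b::euclidean_space"
  assumes "open \<Omega>" "smooth_on \<Omega> f" "\<theta> \<in> test_fun \<Omega>"
  shows "\<exists>c\<ge>0. \<forall>\<phi>\<in>test_fun UNIV. Cm_norm m (\<lambda>x. \<theta> x * \<phi> (f x)) \<le> c * Cm_norm m \<phi>"
proof -
  note \<theta> = test_funD[OF assms(3)]
  obtain S K' where S: "open S" "compact K'" "fun_supp \<theta> \<subseteq> S" "S \<subseteq> K'" "K' \<subseteq> \<Omega>"
    using compact_open_between[OF \<theta>(2) assms(1) \<theta>(3)] by blast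
  define P where "P = (test_fun UNIV :: ('b \<Rightarrow> complex) set)"
  define N where "N = (\<lambda>\<phi>::'b \<Rightarrow> complex. Cm_norm m \<phi>)"
  define \<Phi> where "\<Phi> = (\<lambda>\<phi>::'b \<Rightarrow> complex. \<lambda>y. (1 / N \<phi>) *\<^sub>R \<phi> y)"
  have "Cm_bounded m P UNIV \<Phi>"
    unfolding Cm_bounded_def
  proof (intro allI impI exI[of _ 1] ballI conjI)
    fix vs :: "'b list" and \<phi> y assume vs: "set vs \<subseteq> Basis \<and> length vs \<le> m" and \<phi>: "\<phi> \<in> P"
    have e: "partials vs (\<Phi> \<phi>) = (\<lambda>y. (1 / N \<phi>) *\<^sub>R partials vs \<phi> y)"
      unfolding \<Phi>_def using \<phi> vs test_funD(1)[of \<phi> UNIV]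
      by (intro partials_linear[OF bounded_linear_scaleR_right, of \<phi> vs "1 / N \<phi>"]) (auto simp: P_def)
    have "smooth_on UNIV (\<Phi> \<phi>)" unfolding \<Phi>_def using \<phi>
      test_funD(1)[of \<phi> UNIV] by (intro smooth_on_linear[OF _ bounded_linear_scaleR_right]) (auto simp: P_def)
    then show "partials vs (\<Phi> \<phi>) differentiable (at y)" using vs by (auto simp: smooth_on_def)
    have "cmod (partials vs \<phi> y) \<le> N \<phi>" unfolding N_def using \<phi> vs by (intro Cm_norm_upper[of _ UNIV]) (auto simp: P_def)
    moreover have "N \<phi> \<ge> 0" using \<phi> Cm_norm_nonneg[of \<phi> UNIV m] by (simp add: N_def P_def)
    ultimately show "norm (partials vs (\<Phi> \<phi>) y) \<le> 1" unfolding e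
      by (cases "N \<phi> = 0") (auto simp: divide_le_eq)
  qed
  moreover have "Cm_bounded m P S (\<lambda>_. f)" by (rule smooth_on_imp_Cm_bounded[OF assms(2) S(2,4,5)])
  ultimately have "Cm_bounded m P S (\<lambda>\<phi> x. \<Phi> \<phi> (f x))"
    by (intro Cm_bounded_compose[OF S(1), of m P "\<lambda>_. f" UNIV \<Phi>]) simp_all
  moreover have "Cm_bounded m P S (\<lambda>_. \<theta>)"
    by (rule Cm_bounded_mono[OF test_fun_Cm_bounded[OF assms(3)]]) auto
  ultimately have "Cm_bounded m P S (\<lambda>\<phi> x. \<theta> x * \<Phi> \<phi> (f x))" 
    by (intro Cm_bounded_mult[OF S(1), of m P "\<lambda>_. \<theta>" "\<lambda>\<phi> x. \<Phi> \<phi> (f x)"])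
  then have BB: "Cm_bounded m P UNIV (\<lambda>\<phi> x. \<theta> x * \<Phi> \<phi> (f x))"
    by (rule Cm_bounded_extend[OF _ closed_fun_supp S(3)]) (simp add: fun_supp_outside)
  then obtain B where B: "B \<ge> 0" "\<forall>\<phi>\<in>P. Cm_norm m (\<lambda>x. \<theta> x * \<Phi> \<phi> (f x)) \<le> B"
    using Cm_bounded_Cm_norm[OF BB] by blast
  have "Cm_norm m (\<lambda>x. \<theta> x * \<phi> (f x)) \<le> B * Cm_norm m \<phi>" if \<phi>: "\<phi> \<in> P" for \<phi>
  proof -
    have Nn: "N \<phi> \<ge> 0" using \<phi> Cm_norm_nonneg[of \<phi> UNIV m] by (simp add: N_def P_def)
    \<comment> \<open>A vanishing norm forces \<phi> = 0, so the value 1 / 0 = 0 used in the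
      normalisation is harmless.\<close>
    have z: "\<phi> y = 0" if "N \<phi> = 0" for y
      using Cm_norm_upper[of \<phi> UNIV "[]" m y] \<phi> that by (simp add: N_def P_def)
    have "(\<lambda>x. \<theta> x * \<phi> (f x)) = (\<lambda>x. N \<phi> *\<^sub>R (\<theta> x * \<Phi> \<phi> (f x)))"
      using z by (cases "N \<phi> = 0") (auto simp: \<Phi>_def)
    moreover have "(\<lambda>x. \<theta> x * \<Phi> \<phi> (f x)) \<in> test_fun \<Omega>"
    proof -
      have "smooth_on UNIV \<phi>" using \<phi> by (simp add: P_def test_funD(1))
      then have "smooth_on \<Omega> (\<lambda>x. \<phi> (f x))"
        by (rule smooth_on_compose[OF assms(1) open_UNIV assms(2)]) simp
      then show ?thesis unfolding \<Phi>_def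
        by (intro test_fun_mult[OF assms(3,1)] smooth_on_linear[OF assms(1) bounded_linear_scaleR_right])
    qed
    ultimately have "Cm_norm m (\<lambda>x. \<theta> x * \<phi> (f x)) \<le> N \<phi> * Cm_norm m (\<lambda>x. \<theta> x * \<Phi> \<phi> (f x))"
      using Cm_norm_scaleR_le[of "\<lambda>x. \<theta> x * \<Phi> \<phi> (f x)" \<Omega> m "N \<phi>"] Nn by simp
    also have "\<dots> \<le> N \<phi> * B" using B(2) \<phi> Nn by (intro mult_left_mono) auto
    finally show ?thesis by (simp add: N_def mult.commute)
  qed
  then show ?thesis using B(1) unfolding P_def by blast
qed

lemma bounded_test_setI:
  assumes "B \<subseteq> test_fun \<Omega>" "compact K" "K \<subseteq> \<Omega>" "\<And>\<phi>. \<phi> \<in> B \<Longrightarrow> fun_supp \<phi> \<subseteq> K"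
    and "\<And>m. \<exists>c. \<forall>\<phi>\<in>B. Cm_norm m \<phi> \<le> c"
  shows "bounded_test_set \<Omega> B"
  unfolding bounded_test_set_def
proof (intro conjI allI impI assms(1))
  fix p assume "test_seminorm \<Omega> p \<and> continuous_on_DK \<Omega> p"
  then obtain m c where p: "\<forall>\<phi>\<in>test_fun \<Omega>. fun_supp \<phi> \<subseteq> K \<longrightarrow> p \<phi> \<le> c * Cm_norm m \<phi>"
    using assms(2,3) unfolding continuous_on_DK_def by blast
  obtain d where d: "\<forall>\<phi>\<in>B. Cm_norm m \<phi> \<le> d" using assms(5) by blast
  have "p \<phi> \<le> \<bar>c\<bar> * d" if "\<phi> \<in> B" for \<phi>
  proof -
    have \<phi>: "\<phi> \<in> test_fun \<Omega>" using that assms(1) by blast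
    have "p \<phi> \<le> c * Cm_norm m \<phi>" using p \<phi> assms(4)[OF that] by blast
    also have "\<dots> \<le> \<bar>c\<bar> * Cm_norm m \<phi>" using Cm_norm_nonneg[OF \<phi>] by (intro mult_right_mono) auto
    also have "\<dots> \<le> \<bar>c\<bar> * d" using d that by (intro mult_left_mono) auto
    finally show ?thesis .
  qed
  then show "bdd_above (p ` B)" by (intro bdd_aboveI[of _ "\<bar>c\<bar> * d"]) auto
qed

section \<open>Plane waves, with the sign convention of \<open>fourier_loc\<close>\<close>

definition plane_wave :: "'a::euclidean_space \<Rightarrow> 'a \<Rightarrow> complex" where
  "plane_wave k x = exp (- \<i> * complex_of_real (k \<bullet> x))"

lemma plane_wave_0 [simp]: "plane_wave 0 x = 1"
  by (simp add: plane_wave_def)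

lemma norm_plane_wave [simp]: "cmod (plane_wave k x) = 1"
  by (simp add: plane_wave_def)

lemma plane_wave_has_derivative:
  "((\<lambda>x. c * plane_wave k x) has_derivative (\<lambda>h. c * (plane_wave k x * (- \<i> * complex_of_real (k \<bullet> h))))) (at x)"
proof -
  have "bounded_linear (\<lambda>x. - \<i> * complex_of_real (k \<bullet> x))"
    by (intro bounded_linear_compose[OF bounded_linear_mult_right]
        bounded_linear_compose[OF bounded_linear_of_real] bounded_linear_inner_right)
  then have "((\<lambda>x. - \<i> * complex_of_real (k \<bullet> x)) has_derivative (\<lambda>h. - \<i> * complex_of_real (k \<bullet> h))) (at x)"
    by (rule bounded_linear_imp_has_derivative)
  from has_derivative_compose[OF this DERIV_exp[THEN has_field_derivative_imp_has_derivative]]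
  show ?thesis unfolding plane_wave_def by (rule has_derivative_mult_right)
qed

lemma partials_plane_wave:
  "partials vs (\<lambda>x. c * plane_wave k x) = (\<lambda>x. c * (\<Prod>v\<leftarrow>vs. - \<i> * complex_of_real (k \<bullet> v)) * plane_wave k x)"
proof (induction vs)
  case (Cons v vs)
  have d: "frechet_derivative (\<lambda>x. d * plane_wave k x) (at x) v = d * (plane_wave k x * (- \<i> * complex_of_real (k \<bullet> v)))" for d x
    using frechet_derivative_at[OF plane_wave_has_derivative[of d k x], symmetric] by simp
  show ?case unfolding partials.simps Cons by (rule ext, simp only: d list.map prod_list.Cons, simp only: mult_ac)
qed simp

lemma smooth_plane_wave: "smooth_on \<Omega> (plane_wave k)"
proof -
  have "partials vs (plane_wave k) differentiable (at x)" for vs x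
    using partials_plane_wave[of vs 1 k] plane_wave_has_derivative differentiable_def by fastforce
  then show ?thesis by (simp add: smooth_on_def)
qed

text \<open>Each derivative falling on the wave costs at most a factor 1 + |k|. Waves divided by the
  m-th power of that factor are a bounded family, and the product rule does the rest.\<close>

lemma Cm_norm_mult_plane_wave:
  assumes "\<psi> \<in> test_fun \<Omega>"
  shows "\<exists>c\<ge>0. \<forall>k. Cm_norm m (\<lambda>x. \<psi> x * plane_wave k x) \<le> c * (1 + norm k) ^ m"
proof -
  define w where "w = (\<lambda>k::'a. (1 + norm k) ^ m)"
  have w: "w k > 0" for k unfolding w_def by (intro zero_less_power add_pos_nonneg) auto
  define G where "G = (\<lambda>k (x::'a). complex_of_real (1 / w k) * plane_wave k x)"
  have "Cm_bounded m UNIV UNIV G"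
    unfolding Cm_bounded_def
  proof (intro allI impI exI[of _ 1] ballI conjI)
    fix vs :: "'a list" and k x assume vs: "set vs \<subseteq> Basis \<and> length vs \<le> m"
    show "partials vs (G k) differentiable (at x)"
      unfolding G_def partials_plane_wave using plane_wave_has_derivative differentiable_def by blast
    have "cmod (\<Prod>v\<leftarrow>vs. - \<i> * complex_of_real (k \<bullet> v)) \<le> (1 + norm k) ^ length vs"
      using vs[THEN conjunct1]
    proof (induction vs)
      case (Cons v vs)
      have "\<bar>k \<bullet> v\<bar> \<le> 1 + norm k" using Cauchy_Schwarz_ineq2[of k v] Cons.prems by (auto)
      then show ?case using Cons by (auto simp: norm_mult intro!: mult_mono)
    qed simp
    also have "\<dots> \<le> w k" unfolding w_def using vs by (intro power_increasing) auto
    finally show "norm (partials vs (G k) x) \<le> 1"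
      unfolding G_def partials_plane_wave using w[of k] by (simp add: norm_mult divide_le_eq norm_divide)
  qed
  then have "Cm_bounded m UNIV UNIV (\<lambda>k x. \<psi> x * G k x)"
    by (intro Cm_bounded_mult[OF open_UNIV] test_fun_Cm_bounded[OF assms])
  then obtain B where B: "B \<ge> 0" "\<And>k. Cm_norm m (\<lambda>x. \<psi> x * G k x) \<le> B"
    using Cm_bounded_Cm_norm by blast
  have "Cm_norm m (\<lambda>x. \<psi> x * plane_wave k x) \<le> B * w k" for k
  proof -
    have "(\<lambda>x. \<psi> x * plane_wave k x) = (\<lambda>x. w k *\<^sub>R (\<psi> x * G k x))"
      using w[of k] by (auto simp: G_def scaleR_conv_of_real field_simps)
    moreover have "(\<lambda>x. \<psi> x * G k x) \<in> test_fun UNIV"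
      unfolding G_def using smooth_plane_wave
      by (intro test_fun_mult test_fun_mono[OF assms] smooth_on_mult) auto
    ultimately have "Cm_norm m (\<lambda>x. \<psi> x * plane_wave k x) \<le> w k * Cm_norm m (\<lambda>x. \<psi> x * G k x)"
      using Cm_norm_scaleR_le[of "\<lambda>x. \<psi> x * G k x" UNIV m "w k"] w[of k] by simp
    also have "\<dots> \<le> w k * B" using B w[of k] by (intro mult_left_mono) auto
    finally show ?thesis by (simp add: mult.commute)
  qed
  then show ?thesis using B(1) unfolding w_def by blast
qed

section \<open>Fourier series on a cube\<close>

definition cube :: "real \<Rightarrow> 'a::euclidean_space set" where
  "cube R = cbox (- (R *\<^sub>R One)) (R *\<^sub>R One)"

lemma mem_cube: "x \<in> cube R \<longleftrightarrow> (\<forall>b\<in>Basis. \<bar>x \<bullet> b\<bar> \<le> R)"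
  by (auto simp: cube_def mem_box abs_le_iff)

lemma compact_cube [simp]: "compact (cube R)"
  by (simp add: cube_def)

lemma content_cube: "R > 0 \<Longrightarrow> measure lborel (cube R :: 'a::euclidean_space set) = (2 * R) ^ DIM('a)"
  by (simp add: cube_def content_cbox inner_add_left mult_2[symmetric])

lemma cube_integrable:
  fixes f :: "'a::euclidean_space \<Rightarrow> 'b::banach"
  shows "continuous_on (cube R) f \<Longrightarrow> f integrable_on cube R"
  unfolding cube_def by (rule integrable_continuous)

text \<open>A translation argument: the integral of h(x + s b) over the cube does not depend on s
  while the support stays inside, and differentiating it under the integral at s = 0 gives the
  integral of the derivative.\<close>

lemma integral_pderiv_eq_0:
  fixes h :: "'a::euclidean_space \<Rightarrow> complex"
  assumes h: "smooth_on UNIV h" and out: "\<And>x. x \<notin> cube r \<Longrightarrow> h x = 0" and r: "r < R" and b: "b \<in> Basis"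
  shows "integral (cube R) (pderiv_at b h) = 0"
proof -
  \<comment> \<open>Translates by less than this margin keep the support within the cube of size
    R.\<close>
  define \<delta> where "\<delta> = R - r"
  have \<delta>: "\<delta> > 0" using r by (simp add: \<delta>_def)
  define J where "J s = integral (cube R) (\<lambda>x. h (x + s *\<^sub>R b))" for s
  have J0: "J s = J 0" if s: "\<bar>s\<bar> < \<delta>" for s
  proof -
    have bb: "b \<bullet> c = (if b = c then 1 else 0)" if "c \<in> Basis" for c
      using inner_Basis[OF b that] .
    have sub: "cube r \<subseteq> cbox (- (R *\<^sub>R One) + s *\<^sub>R b) (R *\<^sub>R One + s *\<^sub>R b)"
    proof
      fix x :: 'a assume "x \<in> cube r"
      then have x: "\<bar>x \<bullet> c\<bar> \<le> r" if "c \<in> Basis" for c using that by (simp add: mem_cube)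
      show "x \<in> cbox (- (R *\<^sub>R One) + s *\<^sub>R b) (R *\<^sub>R One + s *\<^sub>R b)"
        unfolding mem_box
      proof
        fix c :: 'a assume c: "c \<in> Basis"
        show "(- (R *\<^sub>R One) + s *\<^sub>R b) \<bullet> c \<le> x \<bullet> c \<and> x \<bullet> c \<le> (R *\<^sub>R One + s *\<^sub>R b) \<bullet> c"
          using x[OF c] s c bb[OF c] by (auto simp: inner_add_left inner_diff_left \<delta>_def)
      qed
    qed
    have eq: "integral T h = integral UNIV h" if "cube r \<subseteq> T" for T
    proof -
      have "(\<lambda>x. if x \<in> T then h x else 0) = h" using out that by (auto simp: fun_eq_iff)
      then show ?thesis using Henstock_Kurzweil_Integration.integral_restrict_UNIV[of T h] by simp
    qed
    have "J s = integral (cube R) (h \<circ> ((+) (s *\<^sub>R b)))"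
      by (simp add: J_def comp_def add.commute)
    also have "\<dots> = integral (cbox (- (R *\<^sub>R One) + s *\<^sub>R b) (R *\<^sub>R One + s *\<^sub>R b)) h"
      unfolding cube_def by (rule integral_shift_cbox_plus)
    also have "\<dots> = integral UNIV h" by (rule eq[OF sub])
    finally have 1: "J s = integral UNIV h" .
    have "cube r \<subseteq> (cube R :: 'a set)"
    proof
      fix x :: 'a assume x: "x \<in> cube r"
      have "\<bar>x \<bullet> c\<bar> \<le> R" if "c \<in> Basis" for c
      proof -
        have "\<bar>x \<bullet> c\<bar> \<le> r" using x that unfolding mem_cube by blast
        then show ?thesis using r by linarith
      qed
      then show "x \<in> cube R" unfolding mem_cube by blast
    qed
    from eq[OF this] have "J 0 = integral UNIV h" by (simp add: J_def)
    with 1 show ?thesis by simp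
  qed
  have contd: "continuous_on UNIV (pderiv_at b h)"
    by (rule smooth_on_continuous[OF smooth_on_pderiv[OF h b]])
  have conth: "continuous_on UNIV h" by (rule smooth_on_continuous[OF h])
  have "(J has_vector_derivative integral (cbox (- (R *\<^sub>R One)) (R *\<^sub>R One)) (\<lambda>x. pderiv_at b h (x + 0 *\<^sub>R b))) (at 0 within {-\<delta><..<\<delta>})"
    unfolding J_def cube_def
  proof (rule leibniz_rule_vector_derivative)
    fix s :: real and x :: 'a
    have "h differentiable (at (x + s *\<^sub>R b))" by (rule smooth_on_differentiable[OF h]) simp
    then have d: "(h has_derivative frechet_derivative h (at (x + s *\<^sub>R b))) (at (x + s *\<^sub>R b))"
      by (simp add: frechet_derivative_works)
    have "((\<lambda>s. s *\<^sub>R b) has_derivative (\<lambda>t. t *\<^sub>R b)) (at s within {-\<delta><..<\<delta>})"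
      by (rule bounded_linear_imp_has_derivative[OF bounded_linear_scaleR_left])
    from has_derivative_add[OF has_derivative_const this]
    have g: "((\<lambda>s. x + s *\<^sub>R b) has_derivative (\<lambda>t. t *\<^sub>R b)) (at s within {-\<delta><..<\<delta>})"
      by simp
    from has_derivative_compose[OF g d]
    show "((\<lambda>s. h (x + s *\<^sub>R b)) has_vector_derivative pderiv_at b h (x + s *\<^sub>R b)) (at s within {-\<delta><..<\<delta>})"
      unfolding has_vector_derivative_def
      using linear_cmul[OF has_derivative_linear[OF d]] by simp
  next
    fix s :: real
    show "(\<lambda>x. h (x + s *\<^sub>R b)) integrable_on cbox (- (R *\<^sub>R One)) (R *\<^sub>R One)"
      by (rule integrable_continuous, rule continuous_on_compose2[OF conth])
         (intro continuous_on_add continuous_on_id continuous_on_const, simp)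
  next
    show "continuous_on ({-\<delta><..<\<delta>} \<times> cbox (- (R *\<^sub>R One)) (R *\<^sub>R One)) (\<lambda>(s, x). pderiv_at b h (x + s *\<^sub>R b))"
      unfolding case_prod_beta
      by (rule continuous_on_compose2[OF contd])
         (intro continuous_on_add continuous_on_snd continuous_on_scaleR continuous_on_fst continuous_on_id continuous_on_const, simp)
  qed (use \<delta> in auto)
  then have "(J has_vector_derivative integral (cube R) (pderiv_at b h)) (at 0)"
    using at_within_open[OF _ open_greaterThanLessThan, of 0 "- \<delta>" \<delta>] \<delta> by (simp add: cube_def)
  moreover have "(J has_vector_derivative 0) (at 0)"
  proof (rule has_vector_derivative_transform_within_open[OF has_vector_derivative_const[of "J 0"] open_greaterThanLessThan[of "-\<delta>" \<delta>]])
    show "0 \<in> {-\<delta><..<\<delta>}" using \<delta> by simp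
    show "J 0 = J s" if "s \<in> {-\<delta><..<\<delta>}" for s
      by (rule J0[symmetric]) (use that in auto)
  qed
  ultimately show ?thesis by (rule vector_derivative_unique_at)
qed

section \<open>The lattice of frequencies of period 2R in each coordinate, and orthogonality of its
  waves\<close>

definition freqs :: "real \<Rightarrow> 'a::euclidean_space set" where
  "freqs R = {\<xi>. \<forall>b\<in>Basis. \<exists>m::int. \<xi> \<bullet> b = pi * of_int m / R}"

lemma freqs_add: "\<xi> \<in> freqs R \<Longrightarrow> \<eta> \<in> freqs R \<Longrightarrow> \<xi> + \<eta> \<in> freqs R"
  unfolding freqs_def
proof (intro CollectI ballI)
  fix b :: 'a assume a: "\<xi> \<in> {\<xi>. \<forall>b\<in>Basis. \<exists>m::int. \<xi> \<bullet> b = pi * of_int m / R}"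
    "\<eta> \<in> {\<xi>. \<forall>b\<in>Basis. \<exists>m::int. \<xi> \<bullet> b = pi * of_int m / R}" and b: "b \<in> Basis"
  then obtain m n where "\<xi> \<bullet> b = pi * of_int m / R" "\<eta> \<bullet> b = pi * of_int n / R" by blast
  then show "\<exists>m::int. (\<xi> + \<eta>) \<bullet> b = pi * of_int m / R"
    by (intro exI[of _ "m + n"]) (simp add: inner_add_left algebra_simps add_divide_distrib)
qed

lemma freqs_minus: "\<xi> \<in> freqs R \<Longrightarrow> - \<xi> \<in> freqs R"
  unfolding freqs_def
proof (intro CollectI ballI)
  fix b :: 'a assume a: "\<xi> \<in> {\<xi>. \<forall>b\<in>Basis. \<exists>m::int. \<xi> \<bullet> b = pi * of_int m / R}" and b: "b \<in> Basis"
  then obtain m where "\<xi> \<bullet> b = pi * of_int m / R" by blast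
  then show "\<exists>m::int. (- \<xi>) \<bullet> b = pi * of_int m / R"
    by (intro exI[of _ "- m"]) simp
qed

lemma freqs_0: "0 \<in> freqs R"
  unfolding freqs_def by (auto intro: exI[of _ 0])

lemma freqs_Basis:
  assumes "b \<in> Basis"
  shows "(pi / R) *\<^sub>R b \<in> freqs R"
  unfolding freqs_def
proof (intro CollectI ballI)
  fix c :: 'a assume c: "c \<in> Basis"
  show "\<exists>m::int. ((pi / R) *\<^sub>R b) \<bullet> c = pi * of_int m / R"
    using inner_Basis[OF assms c] by (intro exI[of _ "if b = c then 1 else 0"]) simp
qed

lemma plane_wave_add: "plane_wave (k + l) x = plane_wave k x * plane_wave l x"
  by (simp add: plane_wave_def inner_add_left distrib_left exp_add[symmetric])

lemma continuous_plane_wave: "continuous_on S (plane_wave k)"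
  by (rule smooth_on_continuous[OF smooth_plane_wave])

lemma integral_wave_real:
  fixes m :: int and c :: real
  assumes "R > 0" and c: "c = pi * of_int m / R" and "c \<noteq> 0"
  shows "integral {-R..R} (\<lambda>t. exp (- \<i> * complex_of_real (c * t))) = 0"
proof -
  define F where "F t = (\<i> / complex_of_real c) * exp (- \<i> * complex_of_real (c * t))" for t
  have "(F has_vector_derivative exp (- \<i> * complex_of_real (c * t))) (at t within {-R..R})" for t
  proof -
    have "((\<lambda>z. (\<i> / complex_of_real c) * exp (- \<i> * (complex_of_real c * z))) has_field_derivative
        (\<i> / complex_of_real c) * (exp (- \<i> * (complex_of_real c * of_real t)) * (- \<i> * (complex_of_real c * 1)))) (at (of_real t))"
      by (intro DERIV_cmult DERIV_fun_exp DERIV_ident)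
    then have "((\<lambda>z. (\<i> / complex_of_real c) * exp (- \<i> * (complex_of_real c * z))) has_field_derivative
        exp (- \<i> * (complex_of_real c * of_real t))) (at (of_real t))"
      using \<open>c \<noteq> 0\<close> by (simp add: mult_ac)
    from has_vector_derivative_real_field[OF this, of "{-R..R}"]
    show ?thesis by (simp add: F_def[abs_def])
  qed
  then have "((\<lambda>t. exp (- \<i> * complex_of_real (c * t))) has_integral (F R - F (- R))) {-R..R}"
    using assms(1) by (intro fundamental_theorem_of_calculus) auto
  moreover have "F R = F (- R)"
  proof -
    \<comment> \<open>As c R = \<pi> m, the two exponents differ by -m times 2 \<pi> \<i>.\<close>
    have "exp (- \<i> * complex_of_real (c * R)) = exp (- \<i> * complex_of_real (c * (- R)))"
      unfolding exp_eq using assms(1) by (intro exI[of _ "- m"]) (simp add: c)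
    then show ?thesis by (simp add: F_def)
  qed
  ultimately show ?thesis by (simp add: integral_unique)
qed

text \<open>Lebesgue measure is the image of the product of its coordinate measures under
  reassembling a vector, which reduces the claim to the product rule for integrals.\<close>

lemma lborel_integral_prod:
  fixes g :: "'a::euclidean_space \<Rightarrow> real \<Rightarrow> complex"
  assumes "\<And>b. b \<in> Basis \<Longrightarrow> integrable lborel (g b)"
  shows "(\<integral>x. (\<Prod>b\<in>Basis. g b (x \<bullet> b)) \<partial>(lborel :: 'a measure)) = (\<Prod>b\<in>Basis. integral\<^sup>L lborel (g b))"
proof -
  interpret product_sigma_finite "\<lambda>_::'a. lborel :: real measure" ..
  have [measurable]: "g b \<in> borel_measurable borel" if "b \<in> Basis" for b
    using borel_measurable_integrable[OF assms[OF that]] by simp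
  have "(\<integral>x. (\<Prod>b\<in>Basis. g b (x \<bullet> b)) \<partial>(lborel :: 'a measure)) =
     (\<integral>y. (\<Prod>b\<in>Basis. g b ((\<Sum>c\<in>Basis. y c *\<^sub>R c) \<bullet> b)) \<partial>(\<Pi>\<^sub>M b\<in>(Basis::'a set). lborel))"
    by (subst lborel_eq, rule integral_distr) measurable
  also have "\<dots> = (\<integral>y. (\<Prod>b\<in>Basis. g b (y b)) \<partial>(\<Pi>\<^sub>M b\<in>(Basis::'a set). lborel))"
    by (intro Bochner_Integration.integral_cong prod.cong refl) simp
  also have "\<dots> = (\<Prod>b\<in>Basis. integral\<^sup>L lborel (g b))"
    by (rule product_integral_prod) (use assms in auto)
  finally show ?thesis .
qed

text \<open>The wave factors into waves in one coordinate each; where \<xi> has a nonzero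
  coordinate, that factor is integrated over whole periods.\<close>

lemma integral_plane_wave_eq_0:
  fixes \<xi> :: "'a::euclidean_space"
  assumes "R > 0" "\<xi> \<in> freqs R" "\<xi> \<noteq> 0"
  shows "integral (cube R) (plane_wave \<xi>) = 0"
proof -
  define w where "w b t = exp (- \<i> * complex_of_real ((\<xi> \<bullet> b) * t))" for b t
  define g where "g b t = indicat_real {-R..R} t *\<^sub>R w b t" for b t
  have contw: "continuous_on S (w b)" for S b unfolding w_def by (intro continuous_intros)
  have int_g: "integrable lborel (g b)" for b
    unfolding g_def by (rule borel_integrable_compact[OF compact_Icc contw])
  have 1: "integral\<^sup>L lborel (g b) = integral {-R..R} (w b)" for b
    using set_borel_integral_eq_integral(2)[of "{-R..R}" "w b"] int_g[of b]
    by (simp add: set_integrable_def set_lebesgue_integral_def g_def[abs_def])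
  have 2: "indicat_real (cube R) x *\<^sub>R plane_wave \<xi> x = (\<Prod>b\<in>Basis. g b (x \<bullet> b))" for x :: 'a
  proof -
    have "\<xi> \<bullet> x = (\<Sum>b\<in>Basis. (\<xi> \<bullet> b) * (x \<bullet> b))" by (rule euclidean_inner)
    then have "plane_wave \<xi> x = exp (\<Sum>b\<in>Basis. - \<i> * complex_of_real ((\<xi> \<bullet> b) * (x \<bullet> b)))"
      by (simp add: plane_wave_def sum_distrib_left sum_negf)
    also have "\<dots> = (\<Prod>b\<in>Basis. w b (x \<bullet> b))" unfolding w_def by (rule exp_sum) simp
    finally have pw: "plane_wave \<xi> x = (\<Prod>b\<in>Basis. w b (x \<bullet> b))" .
    show ?thesis
    proof (cases "x \<in> cube R")
      case True
      then have "g b (x \<bullet> b) = w b (x \<bullet> b)" if "b \<in> Basis" for b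
        using that by (auto simp: g_def mem_cube abs_le_iff)
      then show ?thesis using True pw by simp
    next
      case False
      then obtain b where b: "b \<in> Basis" "\<not> \<bar>x \<bullet> b\<bar> \<le> R" by (auto simp: mem_cube)
      then have "g b (x \<bullet> b) = 0" by (auto simp: g_def indicator_def)
      then have "(\<Prod>b\<in>Basis. g b (x \<bullet> b)) = 0" using b(1) by (intro prod_zero) auto
      then show ?thesis using False by simp
    qed
  qed
  have "set_integrable lborel (cube R) (plane_wave \<xi>)"
    unfolding set_integrable_def by (rule borel_integrable_compact[OF compact_cube continuous_plane_wave])
  from set_borel_integral_eq_integral(2)[OF this]
  have "integral (cube R) (plane_wave \<xi>) = (\<integral>x. (\<Prod>b\<in>Basis. g b (x \<bullet> b)) \<partial>(lborel :: 'a measure))"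
    by (simp add: set_lebesgue_integral_def 2)
  also have "\<dots> = (\<Prod>b\<in>Basis. integral {-R..R} (w b))"
    using lborel_integral_prod[of g] int_g by (simp add: 1)
  also have "\<dots> = 0"
  proof -
    obtain b where b: "b \<in> Basis" "\<xi> \<bullet> b \<noteq> 0" using assms(3) euclidean_all_zero_iff by blast
    obtain m :: int where "\<xi> \<bullet> b = pi * of_int m / R" using assms(2) b(1) unfolding freqs_def by blast
    from integral_wave_real[OF assms(1) this b(2)] have "integral {-R..R} (w b) = 0"
      by (simp add: w_def[abs_def])
    then show ?thesis using b(1) by (intro prod_zero) auto
  qed
  finally show ?thesis .
qed

lemma cos_factor_less_1:
  assumes "0 < \<bar>t\<bar>" "\<bar>t\<bar> < 2 * pi"
  shows "cos t < 1"
proof -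
  have "cos t \<noteq> 1"
  proof
    assume "cos t = 1"
    then obtain n :: int where n: "t = of_int n * 2 * pi" using cos_one_2pi_int by blast
    then have "\<bar>of_int n\<bar> < (1::real)" "n \<noteq> 0" using assms by (auto simp: abs_mult)
    then show False by linarith
  qed
  then show ?thesis using cos_le_one[of t] by linarith
qed

text \<open>Powers of the trigonometric polynomial \<open>\<Prod>\<^sub>b (1 + cos (\<pi>/R (x - x\<^sub>0)\<cdot>b)) / 2\<close> concentrate at \<open>x\<^sub>0\<close>.\<close>

lemma fourier_uniqueness:
  fixes F :: "'a::euclidean_space \<Rightarrow> complex"
  assumes R: "R > 0" and F: "continuous_on (cube R) F"
    and coef: "\<And>\<eta>. \<eta> \<in> freqs R \<Longrightarrow> integral (cube R) (\<lambda>x. F x * plane_wave \<eta> x) = 0"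
    and x0: "\<And>b. b \<in> Basis \<Longrightarrow> \<bar>x0 \<bullet> b\<bar> < R"
  shows "F x0 = 0"
proof (rule ccontr)
  assume Fx0: "F x0 \<noteq> 0"
  define \<kappa>b where "\<kappa>b b x = (1 + cos ((pi / R) * ((x - x0) \<bullet> b))) / 2" for b x
  define \<kappa> where "\<kappa> x = (\<Prod>b\<in>Basis. \<kappa>b b x)" for x
  \<comment> \<open>Multipliers t for which all coefficients of F t vanish. Each factor of the
    kernel is a combination of waves with frequencies 0, \<beta> and -\<beta>, so multiplying by it
    shifts the coefficients within the lattice; hence T contains all powers of the kernel.\<close>
  define T where "T = {t::'a \<Rightarrow> complex. continuous_on (cube R) t \<and> 
      (\<forall>\<eta>\<in>freqs R. integral (cube R) (\<lambda>x. F x * t x * plane_wave \<eta> x) = 0)}"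
  have T1: "(\<lambda>_. 1) \<in> T" using coef by (simp add: T_def)
  have Tb: "(\<lambda>x. t x * of_real (\<kappa>b b x)) \<in> T" if t: "t \<in> T" and b: "b \<in> Basis" for t b
  proof -
    define \<beta> where "\<beta> = (pi / R) *\<^sub>R b"
    have \<beta>: "\<beta> \<in> freqs R" unfolding \<beta>_def by (rule freqs_Basis[OF b])
    have kap: "of_real (\<kappa>b b x) = 1 / 2 + plane_wave (- \<beta>) x * (plane_wave \<beta> x0 / 4) + plane_wave \<beta> x * (plane_wave (- \<beta>) x0 / 4)" for x
    proof -
      have c: "complex_of_real (cos r) = (exp (- \<i> * complex_of_real r) + exp (- \<i> * complex_of_real (- r))) / 2" for r
        by (simp add: cos_of_real[symmetric] cos_exp_eq add.commute)
      have sh: "plane_wave k (x - x0) = plane_wave k x * plane_wave (-k) x0" for k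
        by (simp add: plane_wave_def inner_diff_right exp_add[symmetric] algebra_simps)
      define D where "D = complex_of_real (cos ((pi / R) * ((x - x0) \<bullet> b)))"
      have "D = (plane_wave \<beta> (x - x0) + plane_wave (- \<beta>) (x - x0)) / 2"
        unfolding plane_wave_def \<beta>_def D_def c by (simp add: inner_commute[of b])
      then have D: "D = (plane_wave \<beta> x * plane_wave (- \<beta>) x0 + plane_wave (- \<beta>) x * plane_wave \<beta> x0) / 2"
        unfolding sh by simp
      have "complex_of_real (\<kappa>b b x) = (1 + D) / 2"
        unfolding \<kappa>b_def D_def by simp
      then show ?thesis unfolding D by (simp add: field_simps)
    qed
    have ct: "continuous_on (cube R) t" and it: "\<And>\<eta>. \<eta> \<in> freqs R \<Longrightarrow> integral (cube R) (\<lambda>x. F x * t x * plane_wave \<eta> x) = 0"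
      using t by (auto simp: T_def)
    have "integral (cube R) (\<lambda>x. F x * (t x * of_real (\<kappa>b b x)) * plane_wave \<eta> x) = 0" if \<eta>: "\<eta> \<in> freqs R" for \<eta>
    proof -
      have int: "(\<lambda>x. F x * t x * plane_wave \<mu> x) integrable_on cube R" for \<mu>
        by (intro cube_integrable continuous_on_mult F ct continuous_plane_wave)
      have hi: "((\<lambda>x. F x * t x * plane_wave \<mu> x) has_integral 0) (cube R)" if "\<mu> \<in> freqs R" for \<mu>
        using integrable_integral[OF int, of \<mu>] it[OF that] by simp
      have "((\<lambda>x. F x * t x * plane_wave \<eta> x * (1/2) + F x * t x * plane_wave (- \<beta> + \<eta>) x * (plane_wave \<beta> x0 / 4)
            + F x * t x * plane_wave (\<beta> + \<eta>) x * (plane_wave (- \<beta>) x0 / 4)) has_integral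
            0 * (1/2) + 0 * (plane_wave \<beta> x0 / 4) + 0 * (plane_wave (- \<beta>) x0 / 4)) (cube R)"
        by (intro has_integral_add has_integral_mult_left hi freqs_add freqs_minus \<beta> \<eta>)
      moreover have "(\<lambda>x. F x * t x * plane_wave \<eta> x * (1/2) + F x * t x * plane_wave (- \<beta> + \<eta>) x * (plane_wave \<beta> x0 / 4)
            + F x * t x * plane_wave (\<beta> + \<eta>) x * (plane_wave (- \<beta>) x0 / 4)) = 
           (\<lambda>x. F x * (t x * of_real (\<kappa>b b x)) * plane_wave \<eta> x)"
        unfolding kap plane_wave_add by (simp add: algebra_simps)
      ultimately have "((\<lambda>x. F x * (t x * of_real (\<kappa>b b x)) * plane_wave \<eta> x) has_integral 0) (cube R)"
        by simp
      then show ?thesis by (rule integral_unique)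
    qed
    moreover have "continuous_on (cube R) (\<lambda>x. t x * of_real (\<kappa>b b x))"
      unfolding \<kappa>b_def by (intro continuous_intros ct) auto
    ultimately show ?thesis by (simp add: T_def)
  qed
  have TB: "(\<lambda>x. t x * (\<Prod>b\<in>B. of_real (\<kappa>b b x))) \<in> T" if t: "t \<in> T" and "finite B" "B \<subseteq> Basis" for t B
    using that(2,3)
  proof (induction B rule: finite_induct)
    case empty
    then show ?case using t by simp
  next
    case (insert b B)
    then have "(\<lambda>x. t x * (\<Prod>b\<in>B. of_real (\<kappa>b b x))) \<in> T" by simp
    from Tb[OF this, of b] insert show ?case by (simp add: mult_ac)
  qed
  have TN: "(\<lambda>x. of_real (\<kappa> x ^ N)) \<in> T" for N
  proof (induction N)
    case 0
    then show ?case using T1 by simp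
  next
    case (Suc N)
    from TB[OF Suc, of Basis] show ?case by (simp add: \<kappa>_def mult_ac)
  qed
  \<comment> \<open>Dividing by F x0 and taking the real part gives a real function with value 1 at
    x0 that is still orthogonal to the powers of the kernel.\<close>
  define G where "G x = Re (F x / F x0)" for x
  have contG: "continuous_on (cube R) G" unfolding G_def using Fx0 by (intro continuous_intros F) auto
  have contk: "continuous_on S \<kappa>" for S unfolding \<kappa>_def \<kappa>b_def by (intro continuous_intros) auto
  have int0: "((\<lambda>x. G x * \<kappa> x ^ N) has_integral 0) (cube R)" for N
  proof -
    have "(\<lambda>x. F x * of_real (\<kappa> x ^ N) * plane_wave 0 x) integrable_on cube R"
      by (intro cube_integrable continuous_on_mult F continuous_plane_wave continuous_on_of_real continuous_on_power contk)
    then have "((\<lambda>x. F x * of_real (\<kappa> x ^ N) * plane_wave 0 x) has_integral 0) (cube R)"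
      using TN[of N] freqs_0[of R] integrable_integral unfolding T_def by fastforce
    from has_integral_linear[OF has_integral_mult_left[OF this, of "1 / F x0"] bounded_linear_Re]
    have "((\<lambda>x. Re (F x * of_real (\<kappa> x ^ N) * (1 / F x0))) has_integral 0) (cube R)"
      by (simp add: comp_def)
    moreover have "Re (F x * of_real (\<kappa> x ^ N) * (1 / F x0)) = G x * \<kappa> x ^ N" for x
    proof -
      have "F x * of_real (\<kappa> x ^ N) * (1 / F x0) = (\<kappa> x ^ N) *\<^sub>R (F x / F x0)"
        by (simp add: scaleR_conv_of_real)
      then show ?thesis unfolding G_def by (simp only: scaleR_complex.sel mult.commute)
    qed
    ultimately show ?thesis by simp
  qed
  have kb: "0 \<le> \<kappa>b b x" "\<kappa>b b x \<le> 1" for b x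
  proof -
    have "0 \<le> (1 + cos t) / 2" for t :: real using add_left_mono[OF cos_ge_minus_one[of t], of 1] by simp
    moreover have "(1 + cos t) / 2 \<le> 1" for t :: real using add_left_mono[OF cos_le_one[of t], of 1] by simp
    ultimately show "0 \<le> \<kappa>b b x" "\<kappa>b b x \<le> 1" unfolding \<kappa>b_def by blast+
  qed
  have k01: "0 \<le> \<kappa> x" "\<kappa> x \<le> 1" for x unfolding \<kappa>_def using kb by (auto intro: prod_nonneg prod_le_1)
  have kx0: "\<kappa> x0 = 1" by (simp add: \<kappa>_def \<kappa>b_def)
  \<comment> \<open>Here x0 must be interior: then every coordinate of x - x0 is strictly less than
    a period 2R in size, and the kernel reaches 1 at x0 only.\<close>
  have klt: "\<kappa> x < 1" if x: "x \<in> cube R" "x \<noteq> x0" for x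
  proof -
    obtain b where b: "b \<in> Basis" "(x - x0) \<bullet> b \<noteq> 0" using x(2) euclidean_all_zero_iff[of "x - x0"] by auto
    have "\<bar>x \<bullet> b\<bar> \<le> R" using x(1) b(1) by (simp add: mem_cube)
    then have "\<bar>(x - x0) \<bullet> b\<bar> < 2 * R" using x0[OF b(1)] by (simp add: inner_diff_left abs_le_iff abs_less_iff)
    then have "(pi / R) * \<bar>(x - x0) \<bullet> b\<bar> < (pi / R) * (2 * R)" using R by (intro mult_strict_left_mono) auto
    then have "\<bar>(pi / R) * ((x - x0) \<bullet> b)\<bar> < 2 * pi" using R by (simp add: abs_mult)
    moreover have "0 < \<bar>(pi / R) * ((x - x0) \<bullet> b)\<bar>" using b(2) R by simp
    ultimately have "cos ((pi / R) * ((x - x0) \<bullet> b)) < 1" by (rule cos_factor_less_1[rotated])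
    then have "\<kappa>b b x < 1" unfolding \<kappa>b_def by (simp only: field_simps)
    moreover have "\<kappa> x = \<kappa>b b x * (\<Prod>b\<in>Basis - {b}. \<kappa>b b x)"
      unfolding \<kappa>_def using b(1) by (simp add: prod.remove)
    moreover have "(\<Prod>b\<in>Basis - {b}. \<kappa>b b x) \<le> 1" "0 \<le> (\<Prod>b\<in>Basis - {b}. \<kappa>b b x)"
      using kb by (auto intro: prod_nonneg prod_le_1)
    ultimately show ?thesis using kb[of b x]
      by (metis mult_left_le order_le_less_trans)
  qed
  have x0b: "x0 \<in> box (- (R *\<^sub>R One)) (R *\<^sub>R One)" using x0 by (fastforce simp: mem_box abs_less_iff)
  have "continuous_on (box (- (R *\<^sub>R One)) (R *\<^sub>R One)) G"
    using contG box_subset_cbox unfolding cube_def by (rule continuous_on_subset)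
  then have "open (box (- (R *\<^sub>R One)) (R *\<^sub>R One) \<inter> G -` {1/2<..})"
    by (intro continuous_open_preimage) auto
  moreover have "x0 \<in> box (- (R *\<^sub>R One)) (R *\<^sub>R One) \<inter> G -` {1/2<..}" using x0b Fx0 by (simp add: G_def)
  ultimately obtain \<delta> where \<delta>: "\<delta> > 0" "ball x0 \<delta> \<subseteq> box (- (R *\<^sub>R One)) (R *\<^sub>R One) \<inter> G -` {1/2<..}"
    using open_contains_ball by blast
  obtain q where q: "0 \<le> q" "q < 1" "\<And>x. x \<in> cube R - ball x0 \<delta> \<Longrightarrow> \<kappa> x \<le> q"
  proof (cases "cube R - ball x0 \<delta> = {}")
    case True
    show ?thesis by (rule that[of 0]) (use True in auto)
  next
    case False
    have "compact (cube R - ball x0 \<delta>)" by (intro compact_diff) auto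
    then obtain y where y: "y \<in> cube R - ball x0 \<delta>" "\<And>x. x \<in> cube R - ball x0 \<delta> \<Longrightarrow> \<kappa> x \<le> \<kappa> y"
      using continuous_attains_sup[OF _ False contk] by blast
    have "y \<noteq> x0" using y(1) \<delta>(1) by auto
    then have "\<kappa> y < 1" using klt y(1) by blast
    then show ?thesis using that[of "\<kappa> y"] y(2) k01 by blast
  qed
  \<comment> \<open>Between the bound q of the kernel off the ball and its peak 1, so that (q /
    q')^N tends to 0.\<close>
  define q' where "q' = (1 + q) / 2"
  have q': "q < q'" "q' < 1" "0 < q'" using q by (auto simp: q'_def)
  have "open (ball x0 \<delta> \<inter> \<kappa> -` {q'<..})" by (intro continuous_open_preimage contk) auto
  moreover have "x0 \<in> ball x0 \<delta> \<inter> \<kappa> -` {q'<..}" using \<delta>(1) kx0 q' by simp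
  ultimately obtain a b where ab: "cbox a b \<subseteq> ball x0 \<delta> \<inter> \<kappa> -` {q'<..}" "\<forall>i\<in>Basis. a \<bullet> i < b \<bullet> i"
    by (rule open_contains_cbox)
  have cpos: "measure lborel (cbox a b) > 0" using ab(2) by (rule content_pos_lt)
  have absub: "cbox a b \<subseteq> cube R" using ab(1) \<delta>(2) box_subset_cbox unfolding cube_def by blast
  have "compact (G ` cube R)" by (intro compact_continuous_image contG) auto
  then have "bounded (G ` cube R)" by (rule compact_imp_bounded)
  then obtain M where M: "\<And>x. x \<in> cube R \<Longrightarrow> \<bar>G x\<bar> \<le> M" unfolding bounded_iff by (metis imageI real_norm_def)
  have M0: "M \<ge> 0" using M[of x0] x0b box_subset_cbox unfolding cube_def by fastforce
  \<comment> \<open>Comparison with the vanishing integral: the integrand is at least q'^N / 2 on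
    the small box, nonnegative on the rest of the ball, and at least -M q^N off the ball.\<close>
  have ineq: "(1/2) * q' ^ N * measure lborel (cbox a b) \<le> M * q ^ N * measure lborel (cube R :: 'a set)" for N
  proof -
    have i1: "((\<lambda>x. if x \<in> cbox a b then (1/2) * q' ^ N else 0) has_integral measure lborel (cbox a b) *\<^sub>R ((1/2) * q' ^ N)) (cube R)"
      by (rule has_integral_restrict[OF absub, THEN iffD2, OF has_integral_const])
    have i2: "((\<lambda>x::'a. M * q ^ N) has_integral measure lborel (cube R :: 'a set) *\<^sub>R (M * q ^ N)) (cube R)"
      unfolding cube_def by (rule has_integral_const)
    have "measure lborel (cbox a b) *\<^sub>R ((1/2) * q' ^ N) - measure lborel (cube R :: 'a set) *\<^sub>R (M * q ^ N) \<le> 0"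
    proof (rule has_integral_le[OF has_integral_diff[OF i1 i2] int0[of N]])
      fix x :: 'a assume x: "x \<in> cube R"
      have nn: "0 \<le> M * q ^ N" using M0 q(1) by simp
      show "(if x \<in> cbox a b then (1/2) * q' ^ N else 0) - M * q ^ N \<le> G x * \<kappa> x ^ N"
      proof (cases "x \<in> ball x0 \<delta>")
        case True
        then have G: "G x > 1/2" using \<delta>(2) by blast
        show ?thesis
        proof (cases "x \<in> cbox a b")
          case True
          then have "q' \<le> \<kappa> x" using ab(1) by auto
          then have "q' ^ N \<le> \<kappa> x ^ N" using q' by (intro power_mono) auto
          then have "(1/2) * q' ^ N \<le> G x * \<kappa> x ^ N" using G q' k01 by (intro mult_mono) auto
          then show ?thesis using nn True by simp
        next
          case False
          have "0 \<le> G x * \<kappa> x ^ N" using G k01(1)[of x] by simp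
          then show ?thesis using nn False by simp
        qed
      next
        case False
        then have "x \<notin> cbox a b" using ab(1) by blast
        moreover have "\<kappa> x ^ N \<le> q ^ N" using q(3)[of x] x False k01 by (intro power_mono) auto
        then have "\<bar>G x\<bar> * \<kappa> x ^ N \<le> M * q ^ N" using M[OF x] M0 k01(1)[of x] by (intro mult_mono) auto
        then have "- (M * q ^ N) \<le> G x * \<kappa> x ^ N"
          using abs_ge_minus_self[of "G x * \<kappa> x ^ N"] k01(1)[of x] by (simp add: abs_mult)
        ultimately show ?thesis by simp
      qed
    qed
    then show ?thesis by (simp add: mult_ac)
  qed
  have "(\<lambda>N. (q / q') ^ N) \<longlonglongrightarrow> 0" using q q' by (intro LIMSEQ_power_zero) auto
  then have "(\<lambda>N. M * measure lborel (cube R :: 'a set) * (q / q') ^ N) \<longlonglongrightarrow> M * measure lborel (cube R :: 'a set) * 0"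
    by (rule tendsto_mult_left)
  moreover have "(1/2) * measure lborel (cbox a b) \<le> M * measure lborel (cube R :: 'a set) * (q / q') ^ N" for N
    using ineq[of N] q'(3) by (simp add: power_divide field_simps)
  ultimately have "(1/2) * measure lborel (cbox a b) \<le> M * measure lborel (cube R :: 'a set) * 0"
    by (intro LIMSEQ_le_const) auto
  then show False using cpos by simp
qed

section \<open>Fourier coefficients\<close>

text \<open>Indexed so that \<open>h\<close> is the sum of \<open>fourier_coef R h \<xi> * plane_wave \<xi>\<close> over \<open>freqs R\<close>.\<close>

definition fourier_coef :: "real \<Rightarrow> ('a::euclidean_space \<Rightarrow> complex) \<Rightarrow> 'a \<Rightarrow> complex" where
  "fourier_coef R h \<xi> = integral (cube R) (\<lambda>x. h x * plane_wave (- \<xi>) x) / complex_of_real ((2 * R) ^ DIM('a))"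

lemma pderiv_mult_plane_wave:
  assumes "h differentiable (at x)"
  shows "pderiv_at b (\<lambda>x. h x * plane_wave k x) x =
    pderiv_at b h x * plane_wave k x + (- \<i> * complex_of_real (k \<bullet> b)) * (h x * plane_wave k x)"
proof -
  have h: "(h has_derivative frechet_derivative h (at x)) (at x)"
    using assms by (simp add: frechet_derivative_works)
  have p: "(plane_wave k has_derivative (\<lambda>h. plane_wave k x * (- \<i> * complex_of_real (k \<bullet> h)))) (at x)"
    using plane_wave_has_derivative[of 1 k x] by simp
  show ?thesis
    using frechet_derivative_at[OF has_derivative_mult[OF h p], symmetric] by (simp add: algebra_simps)
qed

text \<open>Integration by parts; as the support of h lies strictly inside the cube, no boundary
  term appears.\<close>

lemma fourier_coef_pderiv:
  assumes h: "smooth_on UNIV h" and out: "\<And>x. x \<notin> cube r \<Longrightarrow> h x = 0" and r: "r < R" and b: "b \<in> Basis"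
  shows "fourier_coef R (pderiv_at b h) \<xi> = (- \<i> * complex_of_real (\<xi> \<bullet> b)) * fourier_coef R h \<xi>"
proof -
  let ?g = "\<lambda>x. h x * plane_wave (- \<xi>) x"
  have g: "smooth_on UNIV ?g" by (rule smooth_on_mult[OF open_UNIV h smooth_plane_wave])
  have int1: "(\<lambda>x. pderiv_at b h x * plane_wave (- \<xi>) x) integrable_on cube R"
    by (intro cube_integrable continuous_on_mult continuous_plane_wave
        continuous_on_subset[OF smooth_on_continuous[OF smooth_on_pderiv[OF h b]]]) simp
  have int2: "(\<lambda>x. (\<i> * complex_of_real (\<xi> \<bullet> b)) * ?g x) integrable_on cube R"
    by (intro cube_integrable continuous_on_mult continuous_plane_wave continuous_on_const
        continuous_on_subset[OF smooth_on_continuous[OF h]]) simp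
  have "0 = integral (cube R) (pderiv_at b ?g)"
    by (rule integral_pderiv_eq_0[OF g _ r b, symmetric]) (simp add: out)
  also have "pderiv_at b ?g = (\<lambda>x. pderiv_at b h x * plane_wave (- \<xi>) x + (\<i> * complex_of_real (\<xi> \<bullet> b)) * ?g x)"
  proof
    fix x
    have "h differentiable (at x)" by (rule smooth_on_differentiable[OF h]) simp
    from pderiv_mult_plane_wave[OF this, where b = b and k = "- \<xi>"]
    show "pderiv_at b ?g x = pderiv_at b h x * plane_wave (- \<xi>) x + (\<i> * complex_of_real (\<xi> \<bullet> b)) * ?g x"
      by simp
  qed
  also have "integral (cube R) \<dots> = integral (cube R) (\<lambda>x. pderiv_at b h x * plane_wave (- \<xi>) x) + (\<i> * complex_of_real (\<xi> \<bullet> b)) * integral (cube R) ?g"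
    by (subst Henstock_Kurzweil_Integration.integral_add[OF int1 int2]) (simp only: Henstock_Kurzweil_Integration.integral_mult_right)
  finally have "integral (cube R) (\<lambda>x. pderiv_at b h x * plane_wave (- \<xi>) x) = (- \<i> * complex_of_real (\<xi> \<bullet> b)) * integral (cube R) ?g"
    by (simp add: eq_neg_iff_add_eq_0)
  then show ?thesis unfolding fourier_coef_def by simp
qed

lemma partials_outside:
  assumes "closed K" "\<And>x. x \<notin> K \<Longrightarrow> f x = 0" "x \<notin> K"
  shows "partials vs f x = 0"
proof -
  have zero: "partials vs (\<lambda>_::'a. 0::'b) = (\<lambda>_. 0)" for vs
    by (induction vs) auto
  have "open (- K)" "x \<in> - K" "\<And>y. y \<in> - K \<Longrightarrow> f y = 0" using assms by auto
  from partials_cong_open[OF this, where vs = vs] show ?thesis by (simp add: zero)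
qed

lemma fourier_coef_partials:
  assumes h: "smooth_on UNIV h" and out: "\<And>x. x \<notin> cube r \<Longrightarrow> h x = 0" and r: "r < R" and vs: "set vs \<subseteq> Basis"
  shows "fourier_coef R (partials vs h) \<xi> = (\<Prod>v\<leftarrow>vs. - \<i> * complex_of_real (\<xi> \<bullet> v)) * fourier_coef R h \<xi>"
  using vs
proof (induction vs)
  case (Cons v vs)
  have "fourier_coef R (pderiv_at v (partials vs h)) \<xi> = (- \<i> * complex_of_real (\<xi> \<bullet> v)) * fourier_coef R (partials vs h) \<xi>"
  proof (rule fourier_coef_pderiv[OF _ _ r])
    show "smooth_on UNIV (partials vs h)" using Cons.prems by (intro smooth_on_partials[OF h]) simp
    show "partials vs h x = 0" if "x \<notin> cube r" for x
      by (rule partials_outside[OF compact_imp_closed[OF compact_cube] out that])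
  qed (use Cons.prems in simp)
  with Cons show ?case by (simp add: mult.assoc)
qed simp

lemma norm_fourier_coef_le:
  fixes h :: "'a::euclidean_space \<Rightarrow> complex"
  assumes R: "R > 0" and h: "continuous_on (cube R) h" and B: "\<And>x. x \<in> cube R \<Longrightarrow> cmod (h x) \<le> B"
  shows "cmod (fourier_coef R h \<xi>) \<le> B"
proof -
  have c: "measure lborel (cube R :: 'a set) = (2 * R) ^ DIM('a)" by (rule content_cube[OF R])
  have B0: "B \<ge> 0" using B[of 0] R norm_ge_zero[of "h 0"] by (simp add: mem_cube del: norm_ge_zero)
  have "((\<lambda>x. h x * plane_wave (- \<xi>) x) has_integral integral (cube R) (\<lambda>x. h x * plane_wave (- \<xi>) x)) (cube R)"
    by (intro integrable_integral cube_integrable continuous_on_mult h continuous_plane_wave)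
  then have "cmod (integral (cube R) (\<lambda>x. h x * plane_wave (- \<xi>) x)) \<le> B * measure lborel (cube R :: 'a set)"
    unfolding cube_def by (rule has_integral_bound[OF B0]) (use B in \<open>simp add: norm_mult cube_def\<close>)
  then show ?thesis
    unfolding fourier_coef_def c using R by (simp add: norm_divide norm_power divide_le_eq norm_mult)
qed

text \<open>Via the largest coordinate. Derivatives in basis directions control the coefficients
  times powers of single coordinates, and this turns them into powers of the norm.\<close>

lemma norm_le_powers:
  fixes \<xi> :: "'a::euclidean_space"
  shows "norm \<xi> ^ M \<le> real DIM('a) ^ M * (\<Sum>b\<in>Basis. \<bar>\<xi> \<bullet> b\<bar> ^ M)"
proof -
  have "Max ((\<lambda>b. \<bar>\<xi> \<bullet> b\<bar>) ` Basis) \<in> (\<lambda>b. \<bar>\<xi> \<bullet> b\<bar>) ` Basis" by (rule Max_in) auto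
  then obtain c where "c \<in> Basis" and cM: "Max ((\<lambda>b. \<bar>\<xi> \<bullet> b\<bar>) ` Basis) = \<bar>\<xi> \<bullet> c\<bar>" by blast
  then have c: "c \<in> Basis" "\<And>b. b \<in> Basis \<Longrightarrow> \<bar>\<xi> \<bullet> b\<bar> \<le> \<bar>\<xi> \<bullet> c\<bar>"
    using Max_ge[of "(\<lambda>b. \<bar>\<xi> \<bullet> b\<bar>) ` Basis"] by auto
  have "norm \<xi> \<le> (\<Sum>b\<in>Basis. \<bar>\<xi> \<bullet> b\<bar>)" by (rule norm_le_l1)
  also have "\<dots> \<le> (\<Sum>b\<in>(Basis::'a set). \<bar>\<xi> \<bullet> c\<bar>)" by (intro sum_mono c)
  also have "\<dots> = real DIM('a) * \<bar>\<xi> \<bullet> c\<bar>" by simp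
  finally have "norm \<xi> ^ M \<le> (real DIM('a) * \<bar>\<xi> \<bullet> c\<bar>) ^ M" by (intro power_mono) auto
  also have "\<dots> = real DIM('a) ^ M * \<bar>\<xi> \<bullet> c\<bar> ^ M" by (rule power_mult_distrib)
  also have "\<dots> \<le> real DIM('a) ^ M * (\<Sum>b\<in>Basis. \<bar>\<xi> \<bullet> b\<bar> ^ M)"
    using member_le_sum[OF c(1), of "\<lambda>b. \<bar>\<xi> \<bullet> b\<bar> ^ M"] by (intro mult_left_mono) auto
  finally show ?thesis .
qed

lemma one_plus_power_le:
  fixes t :: real
  assumes "t \<ge> 0"
  shows "(1 + t) ^ M \<le> 2 ^ M * (1 + t ^ M)"
proof (cases "t \<le> 1")
  case True
  then have "(1 + t) ^ M \<le> 2 ^ M" using assms by (intro power_mono) auto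
  also have "\<dots> \<le> 2 ^ M * (1 + t ^ M)" using assms by simp
  finally show ?thesis .
next
  case False
  then have "(1 + t) ^ M \<le> (2 * t) ^ M" using assms by (intro power_mono) auto
  also have "\<dots> \<le> 2 ^ M * (1 + t ^ M)" by (simp add: power_mult_distrib)
  finally show ?thesis .
qed

text \<open>M derivatives in one direction b multiply the coefficient by a number of modulus
  \<open>\<bar>\<xi> \<bullet> b\<bar> ^ M\<close>, while the coefficients of that derivative are
  bounded by its supremum on the cube.\<close>

lemma fourier_coef_decay:
  fixes h :: "'a::euclidean_space \<Rightarrow> complex"
  assumes h: "smooth_on UNIV h" and out: "\<And>x. x \<notin> cube r \<Longrightarrow> h x = 0" and r: "0 < R" "r < R"
  shows "\<exists>c\<ge>0. \<forall>\<xi>. (1 + norm \<xi>) ^ M * cmod (fourier_coef R h \<xi>) \<le> c"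
proof -
  have bd: "\<exists>B\<ge>0. \<forall>x\<in>cube R. cmod (partials vs h x) \<le> B" if "set vs \<subseteq> Basis" for vs
  proof -
    have "continuous_on (cube R) (partials vs h)"
      by (rule continuous_on_subset[OF smooth_on_continuous[OF smooth_on_partials[OF h that]]]) simp
    then have "bounded (partials vs h ` cube R)"
      by (intro compact_imp_bounded compact_continuous_image) auto
    then obtain B where "\<forall>x\<in>cube R. cmod (partials vs h x) \<le> B" unfolding bounded_iff by blast
    then show ?thesis by (intro exI[of _ "max B 0"]) (auto simp: le_max_iff_disj)
  qed
  have est: "\<exists>B\<ge>0. \<forall>\<xi>. cmod (\<Prod>v\<leftarrow>vs. - \<i> * complex_of_real (\<xi> \<bullet> v)) * cmod (fourier_coef R h \<xi>) \<le> B"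
    if vs: "set vs \<subseteq> Basis" for vs
  proof -
    obtain B where B: "B \<ge> 0" "\<forall>x\<in>cube R. cmod (partials vs h x) \<le> B" using bd[OF vs] by blast
    have "continuous_on (cube R) (partials vs h)"
      by (rule continuous_on_subset[OF smooth_on_continuous[OF smooth_on_partials[OF h vs]]]) simp
    then have le: "cmod (fourier_coef R (partials vs h) \<xi>) \<le> B" for \<xi>
      by (rule norm_fourier_coef_le[OF r(1)]) (use B(2) in blast)
    have "\<forall>\<xi>. cmod (\<Prod>v\<leftarrow>vs. - \<i> * complex_of_real (\<xi> \<bullet> v)) * cmod (fourier_coef R h \<xi>) \<le> B"
    proof
      fix \<xi> :: 'a
      have "fourier_coef R (partials vs h) \<xi> = (\<Prod>v\<leftarrow>vs. - \<i> * complex_of_real (\<xi> \<bullet> v)) * fourier_coef R h \<xi>"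
        by (rule fourier_coef_partials[OF h out r(2) vs])
      then show "cmod (\<Prod>v\<leftarrow>vs. - \<i> * complex_of_real (\<xi> \<bullet> v)) * cmod (fourier_coef R h \<xi>) \<le> B"
        using le[of \<xi>] by (metis norm_mult)
    qed
    then show ?thesis using B(1) by blast
  qed
  have pr: "cmod (\<Prod>v\<leftarrow>replicate M b. - \<i> * complex_of_real (\<xi> \<bullet> v)) = \<bar>\<xi> \<bullet> b\<bar> ^ M" for b \<xi> :: 'a
    by (simp add: norm_power norm_mult prod_list_replicate)
  have "\<forall>b\<in>Basis. \<exists>B. B \<ge> 0 \<and> (\<forall>\<xi>. \<bar>\<xi> \<bullet> b\<bar> ^ M * cmod (fourier_coef R h \<xi>) \<le> B)"
  proof
    fix b :: 'a assume b: "b \<in> Basis"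
    have "set (replicate M b) \<subseteq> Basis" using b by (simp add: set_replicate_conv_if)
    from est[OF this] show "\<exists>B. B \<ge> 0 \<and> (\<forall>\<xi>. \<bar>\<xi> \<bullet> b\<bar> ^ M * cmod (fourier_coef R h \<xi>) \<le> B)"
      unfolding pr by blast
  qed
  from bchoice[OF this] obtain B where
    B: "\<forall>b\<in>Basis. B b \<ge> 0 \<and> (\<forall>\<xi>. \<bar>\<xi> \<bullet> b\<bar> ^ M * cmod (fourier_coef R h \<xi>) \<le> B b)" ..
  obtain B0 where B0: "B0 \<ge> 0" "\<And>\<xi>. cmod (fourier_coef R h \<xi>) \<le> B0" using est[of "[]"] by (auto simp: )
  define c where "c = 2 ^ M * (B0 + real DIM('a) ^ M * (\<Sum>b\<in>Basis. B b))"
  have "(1 + norm \<xi>) ^ M * cmod (fourier_coef R h \<xi>) \<le> c" for \<xi>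
  proof -
    let ?f = "cmod (fourier_coef R h \<xi>)"
    have "norm \<xi> ^ M * ?f \<le> (real DIM('a) ^ M * (\<Sum>b\<in>Basis. \<bar>\<xi> \<bullet> b\<bar> ^ M)) * ?f"
      by (intro mult_right_mono norm_le_powers) simp
    also have "\<dots> = real DIM('a) ^ M * (\<Sum>b\<in>Basis. \<bar>\<xi> \<bullet> b\<bar> ^ M * ?f)"
      by (simp add: sum_distrib_right mult.assoc)
    also have "\<dots> \<le> real DIM('a) ^ M * (\<Sum>b\<in>Basis. B b)"
      using B by (intro mult_left_mono sum_mono) simp_all
    finally have n: "norm \<xi> ^ M * ?f \<le> real DIM('a) ^ M * (\<Sum>b\<in>Basis. B b)" .
    have "(1 + norm \<xi>) ^ M * ?f \<le> 2 ^ M * (1 + norm \<xi> ^ M) * ?f"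
      by (intro mult_right_mono one_plus_power_le) auto
    also have "\<dots> = 2 ^ M * (?f + norm \<xi> ^ M * ?f)" by (simp add: algebra_simps)
    also have "\<dots> \<le> c" unfolding c_def using n B0(2)[of \<xi>] by (intro mult_left_mono add_mono) auto
    finally show ?thesis .
  qed
  moreover have "(\<Sum>b\<in>Basis. B b) \<ge> 0" using B by (intro sum_nonneg) simp
  then have "c \<ge> 0" unfolding c_def using B0(1) by simp
  ultimately show ?thesis by blast
qed

text \<open>Comparison with the series of 1/n^2. On the nonnegative and on the negative multiples
  the absolute value is injective, so each half is bounded by the sum over the naturals, whence the
  factor 2.\<close>

lemma sum_int_multiples_le:
  fixes a :: real
  assumes "a > 0"
  shows "\<exists>c\<ge>0. \<forall>A. finite A \<and> A \<subseteq> {a * of_int m |m. True} \<longrightarrow> (\<Sum>t\<in>A. 1 / (1 + t\<^sup>2)) \<le> c"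
proof -
  define g where "g n = 1 / (1 + (a * real n)\<^sup>2)" for n :: nat
  have "summable (\<lambda>n. (1 / a\<^sup>2) * (1 / (real n) ^ 2))"
    by (intro summable_mult) (use inverse_power_summable[of 2, where 'a = real] in \<open>simp add: inverse_eq_divide\<close>)
  moreover have "norm (g n) \<le> (1 / a\<^sup>2) * (1 / (real n) ^ 2)" if "n \<ge> 1" for n
  proof -
    have "norm (g n) = 1 / (1 + (a * real n)\<^sup>2)" by (simp add: g_def)
    also have "\<dots> \<le> 1 / (a * real n)\<^sup>2" using assms that by (intro frac_le) auto
    finally show ?thesis by (simp add: power_mult_distrib)
  qed
  ultimately have sg: "summable g" by (rule summable_comparison_test'[where N = 1])
  have g0: "g n \<ge> 0" for n by (simp add: g_def)
  have part: "(\<Sum>t\<in>A. 1 / (1 + t\<^sup>2)) \<le> suminf g"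
    if fin: "finite A" and A: "\<And>t. t \<in> A \<Longrightarrow> \<exists>n::nat. \<bar>t\<bar> = a * real n" and inj: "inj_on abs A" for A
  proof -
    define \<nu> where "\<nu> t = (SOME n::nat. \<bar>t\<bar> = a * real n)" for t
    have \<nu>: "\<bar>t\<bar> = a * real (\<nu> t)" if "t \<in> A" for t
      unfolding \<nu>_def by (rule someI_ex[OF A[OF that]])
    have inj\<nu>: "inj_on \<nu> A" by (rule inj_onI) (metis \<nu> inj inj_onD)
    have "(\<Sum>t\<in>A. 1 / (1 + t\<^sup>2)) = (\<Sum>t\<in>A. g (\<nu> t))"
    proof (rule sum.cong[OF refl])
      fix t assume "t \<in> A"
      from \<nu>[OF this] have "t\<^sup>2 = (a * real (\<nu> t))\<^sup>2" by (metis power2_abs)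
      then show "1 / (1 + t\<^sup>2) = g (\<nu> t)" by (simp add: g_def)
    qed
    also have "\<dots> = sum g (\<nu> ` A)" by (simp add: sum.reindex[OF inj\<nu>])
    also have "\<dots> \<le> suminf g" using fin g0 by (intro sum_le_suminf[OF sg]) auto
    finally show ?thesis .
  qed
  have "(\<Sum>t\<in>A. 1 / (1 + t\<^sup>2)) \<le> 2 * suminf g" if fin: "finite A" and A: "A \<subseteq> {a * of_int m |m. True}" for A
  proof -
    have ex: "\<exists>n::nat. \<bar>t\<bar> = a * real n" if tA: "t \<in> A" for t
    proof -
      obtain m :: int where "t = a * of_int m" using A tA by auto
      then show ?thesis using assms by (intro exI[of _ "nat \<bar>m\<bar>"]) (simp add: abs_mult)
    qed
    have "(\<Sum>t\<in>A. 1 / (1 + t\<^sup>2)) = (\<Sum>t\<in>A \<inter> {0..}. 1 / (1 + t\<^sup>2)) + (\<Sum>t\<in>A - {0..}. 1 / (1 + t\<^sup>2))"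
      by (rule sum.Int_Diff[OF fin])
    also have "(\<Sum>t\<in>A \<inter> {0..}. 1 / (1 + t\<^sup>2)) \<le> suminf g"
      by (rule part) (use fin in simp, use ex in blast, auto simp: inj_on_def)
    also have "(\<Sum>t\<in>A - {0..}. 1 / (1 + t\<^sup>2)) \<le> suminf g"
      by (rule part) (use fin in simp, use ex in blast, auto simp: inj_on_def)
    finally show ?thesis by simp
  qed
  moreover have "2 * suminf g \<ge> 0" using suminf_nonneg[OF sg g0] by simp
  ultimately show ?thesis by (intro exI[of _ "2 * suminf g"]) blast
qed

text \<open>The exponent is twice the dimension because (1 + |\<xi>|)^2 dominates 1 +
  \<open>(\<xi> \<bullet> b)\<^sup>2\<close> for each b; the product of these bounds separates the
  coordinates and reduces the sum to one dimension.\<close>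

lemma freqs_summable:
  assumes R: "R > 0"
  shows "(\<lambda>\<xi>::'a::euclidean_space. 1 / (1 + norm \<xi>) ^ (2 * DIM('a))) summable_on freqs R"
proof (rule nonneg_bdd_above_summable_on)
  obtain c where c: "c \<ge> 0" "\<And>A. finite A \<Longrightarrow> A \<subseteq> {(pi / R) * of_int m |m. True} \<Longrightarrow> (\<Sum>t\<in>A. 1 / (1 + t\<^sup>2)) \<le> c"
    using sum_int_multiples_le[of "pi / R"] R by auto
  have "(\<Sum>\<xi>\<in>F. 1 / (1 + norm \<xi>) ^ (2 * DIM('a))) \<le> c ^ DIM('a)" if F: "F \<subseteq> freqs R" "finite F" for F :: "'a set"
  proof -
    define A where "A b = (\<lambda>\<xi>. \<xi> \<bullet> b) ` F" for b
    define \<rho> where "\<rho> \<xi> = restrict (\<lambda>b. \<xi> \<bullet> b) Basis" for \<xi> :: 'a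
    have A: "finite (A b)" for b using F(2) by (simp add: A_def)
    have "A b \<subseteq> {(pi / R) * of_int m |m. True}" if b: "b \<in> Basis" for b
    proof
      fix t assume "t \<in> A b"
      then obtain \<xi> where \<xi>: "\<xi> \<in> F" "t = \<xi> \<bullet> b" by (auto simp: A_def)
      then obtain m :: int where "\<xi> \<bullet> b = pi * of_int m / R" using F(1) b unfolding freqs_def by blast
      then have "t = (pi / R) * of_int m" using \<xi>(2) by simp
      then show "t \<in> {(pi / R) * of_int m |m. True}" by blast
    qed
    then have Ac: "(\<Sum>t\<in>A b. 1 / (1 + t\<^sup>2)) \<le> c" if "b \<in> Basis" for b using c(2)[OF A] that by blast
    have inj: "inj_on \<rho> F"
    proof (rule inj_onI)
      fix \<xi> \<eta> assume e: "\<rho> \<xi> = \<rho> \<eta>"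
      have "\<xi> \<bullet> b = \<eta> \<bullet> b" if "b \<in> Basis" for b
        using fun_cong[OF e, of b] that by (simp add: \<rho>_def)
      then show "\<xi> = \<eta>" by (rule euclidean_eqI)
    qed
    have le: "1 / (1 + norm \<xi>) ^ (2 * DIM('a)) \<le> (\<Prod>b\<in>Basis. 1 / (1 + (\<rho> \<xi> b)\<^sup>2))" for \<xi> :: 'a
    proof -
      have "(\<Prod>b\<in>Basis. 1 + (\<xi> \<bullet> b)\<^sup>2) \<le> (\<Prod>b\<in>(Basis::'a set). (1 + norm \<xi>)\<^sup>2)"
      proof (rule prod_mono)
        fix b :: 'a assume "b \<in> Basis"
        then have "\<bar>\<xi> \<bullet> b\<bar> \<le> norm \<xi>" by (rule Basis_le_norm)
        then have "\<bar>\<xi> \<bullet> b\<bar>\<^sup>2 \<le> (norm \<xi>)\<^sup>2" by (intro power_mono) simp_all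
        moreover have "(1 + norm \<xi>)\<^sup>2 = 1 + 2 * norm \<xi> + (norm \<xi>)\<^sup>2" by (simp add: power2_sum)
        ultimately show "0 \<le> 1 + (\<xi> \<bullet> b)\<^sup>2 \<and> 1 + (\<xi> \<bullet> b)\<^sup>2 \<le> (1 + norm \<xi>)\<^sup>2"
          using norm_ge_zero[of \<xi>] zero_le_power2[of "\<xi> \<bullet> b"] unfolding power2_abs by linarith
      qed
      also have "\<dots> = (1 + norm \<xi>) ^ (2 * DIM('a))" by (simp add: power_mult)
      finally have "1 / (1 + norm \<xi>) ^ (2 * DIM('a)) \<le> 1 / (\<Prod>b\<in>Basis. 1 + (\<xi> \<bullet> b)\<^sup>2)"
        by (intro frac_le prod_pos) (simp_all add: add_pos_nonneg)
      also have "\<dots> = (\<Prod>b\<in>Basis. 1 / (1 + (\<rho> \<xi> b)\<^sup>2))"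
        by (simp add: \<rho>_def prod_dividef)
      finally show ?thesis .
    qed
    have "(\<Sum>\<xi>\<in>F. 1 / (1 + norm \<xi>) ^ (2 * DIM('a))) \<le> (\<Sum>\<xi>\<in>F. \<Prod>b\<in>Basis. 1 / (1 + (\<rho> \<xi> b)\<^sup>2))"
      by (intro sum_mono le)
    also have "\<dots> = (\<Sum>y\<in>\<rho> ` F. \<Prod>b\<in>Basis. 1 / (1 + (y b)\<^sup>2))"
      by (simp add: sum.reindex[OF inj])
    \<comment> \<open>The finite set is enlarged to the box of its coordinate projections, over
      which the sum of products is a product of sums.\<close>
    also have "\<dots> \<le> (\<Sum>y\<in>PiE Basis A. \<Prod>b\<in>Basis. 1 / (1 + (y b)\<^sup>2))"
    proof (rule sum_mono2)
      show "finite (PiE Basis A)" using A by (intro finite_PiE) auto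
      show "\<rho> ` F \<subseteq> PiE Basis A" by (auto simp: \<rho>_def A_def)
    qed (simp add: prod_nonneg)
    also have "\<dots> = (\<Prod>b\<in>Basis. \<Sum>t\<in>A b. 1 / (1 + t\<^sup>2))"
      by (rule prod_sum_PiE[symmetric]) (auto simp: A)
    also have "\<dots> \<le> (\<Prod>b\<in>(Basis::'a set). c)"
      using Ac by (intro prod_mono) (simp add: sum_nonneg)
    finally show ?thesis by simp
  qed
  then show "bdd_above (sum (\<lambda>\<xi>::'a. 1 / (1 + norm \<xi>) ^ (2 * DIM('a))) ` {F. F \<subseteq> freqs R \<and> finite F})"
    by (intro bdd_aboveI[of _ "c ^ DIM('a)"]) auto
qed auto

lemma freqs_summable_decay:
  fixes c :: "'a::euclidean_space \<Rightarrow> complex"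
  assumes "R > 0" "\<And>\<xi>. (1 + norm \<xi>) ^ (2 * DIM('a)) * cmod (c \<xi>) \<le> B"
  shows "(\<lambda>\<xi>. cmod (c \<xi>)) summable_on freqs R"
proof (rule summable_on_comparison_test)
  show "(\<lambda>\<xi>. B * (1 / (1 + norm \<xi>) ^ (2 * DIM('a)))) summable_on (freqs R :: 'a set)"
    by (intro summable_on_cmult_right freqs_summable assms)
  show "cmod (c \<xi>) \<le> B * (1 / (1 + norm \<xi>) ^ (2 * DIM('a)))" for \<xi>
  proof -
    have "(1 + norm \<xi>) ^ (2 * DIM('a)) > 0" by (intro zero_less_power add_pos_nonneg) auto
    with assms(2)[of \<xi>] show ?thesis by (simp add: pos_le_divide_eq mult.commute)
  qed
qed auto

text \<open>The decay makes the series converge uniformly to a continuous S. The difference h - S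
  has only vanishing coefficients, so uniqueness identifies the two in the open cube. Limits are
  taken over finite sets of frequencies, which fixes no enumeration of the lattice.\<close>

lemma fourier_series:
  fixes h :: "'a::euclidean_space \<Rightarrow> complex"
  assumes h: "smooth_on UNIV h" and out: "\<And>x. x \<notin> cube r \<Longrightarrow> h x = 0" and r: "0 < R" "r < R"
  shows "\<And>x. (\<And>b. b \<in> Basis \<Longrightarrow> \<bar>x \<bullet> b\<bar> < R) \<Longrightarrow> (\<Sum>\<^sub>\<infinity>\<xi>\<in>freqs R. fourier_coef R h \<xi> * plane_wave \<xi> x) = h x"
    and "uniform_limit UNIV (\<lambda>F x. \<Sum>\<xi>\<in>F. fourier_coef R h \<xi> * plane_wave \<xi> x)
      (\<lambda>x. \<Sum>\<^sub>\<infinity>\<xi>\<in>freqs R. fourier_coef R h \<xi> * plane_wave \<xi> x) (finite_subsets_at_top (freqs R))"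
proof -
  let ?c = "fourier_coef R h"
  define S where "S x = (\<Sum>\<^sub>\<infinity>\<xi>\<in>freqs R. ?c \<xi> * plane_wave \<xi> x)" for x
  obtain B where "\<And>\<xi>. (1 + norm \<xi>) ^ (2 * DIM('a)) * cmod (?c \<xi>) \<le> B"
    using fourier_coef_decay[OF h out r] by blast
  then have summ: "(\<lambda>\<xi>. cmod (?c \<xi>)) summable_on freqs R" by (rule freqs_summable_decay[OF r(1)])
  have U: "uniform_limit UNIV (\<lambda>F x. \<Sum>\<xi>\<in>F. ?c \<xi> * plane_wave \<xi> x) S (finite_subsets_at_top (freqs R))"
    unfolding S_def by (rule Weierstrass_m_test_general[OF _ summ]) (simp add: norm_mult)
  then show "uniform_limit UNIV (\<lambda>F x. \<Sum>\<xi>\<in>F. ?c \<xi> * plane_wave \<xi> x)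
      (\<lambda>x. \<Sum>\<^sub>\<infinity>\<xi>\<in>freqs R. ?c \<xi> * plane_wave \<xi> x) (finite_subsets_at_top (freqs R))"
    by (simp add: S_def[abs_def])
  have contS: "continuous_on UNIV S"
    by (rule uniform_limit_theorem[OF _ U])
       (auto intro!: always_eventually continuous_on_sum continuous_on_mult continuous_plane_wave)
  have conth: "continuous_on (cube R) h" by (rule continuous_on_subset[OF smooth_on_continuous[OF h]]) simp
  have coef: "integral (cube R) (\<lambda>x. (h x - S x) * plane_wave \<eta> x) = 0" if \<eta>: "\<eta> \<in> freqs R" for \<eta>
  proof -
    let ?V = "complex_of_real ((2 * R) ^ DIM('a))"
    define f where "f F x = (\<Sum>\<xi>\<in>F. ?c \<xi> * plane_wave \<xi> x) * plane_wave \<eta> x" for F and x :: 'a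
    have Uf: "uniform_limit (cube R) f (\<lambda>x. S x * plane_wave \<eta> x) (finite_subsets_at_top (freqs R))"
      unfolding uniform_limit_iff
    proof (intro allI impI)
      fix e :: real assume "e > 0"
      with U have "\<forall>\<^sub>F F in finite_subsets_at_top (freqs R). \<forall>x\<in>UNIV. dist (\<Sum>\<xi>\<in>F. ?c \<xi> * plane_wave \<xi> x) (S x) < e"
        unfolding uniform_limit_iff by blast
      then show "\<forall>\<^sub>F F in finite_subsets_at_top (freqs R). \<forall>x\<in>cube R. dist (f F x) (S x * plane_wave \<eta> x) < e"
        by (rule eventually_mono) (simp add: f_def dist_norm left_diff_distrib[symmetric] norm_mult)
    qed
    have contf: "continuous_on (cube R) (f F)" for F
      unfolding f_def by (intro continuous_on_mult continuous_on_sum continuous_plane_wave continuous_on_const)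
    have "\<exists>I J. (\<forall>F. (f F has_integral I F) (cube R)) \<and> ((\<lambda>x. S x * plane_wave \<eta> x) has_integral J) (cube R) \<and>
      (I \<longlongrightarrow> J) (finite_subsets_at_top (freqs R))"
      unfolding cube_def
      by (rule uniform_limit_integral_cbox[OF Uf[unfolded cube_def] contf[unfolded cube_def] finite_subsets_at_top_neq_bot]) blast
    then obtain I J where IJ: "\<forall>F. (f F has_integral I F) (cube R)" "((\<lambda>x. S x * plane_wave \<eta> x) has_integral J) (cube R)"
      "(I \<longlongrightarrow> J) (finite_subsets_at_top (freqs R))" by blast
    \<comment> \<open>Once the finite set contains -\<eta>, orthogonality leaves just this term, so
      the integrals are eventually constant.\<close>
    have IF: "I F = ?c (- \<eta>) * ?V" if F: "finite F" "F \<subseteq> freqs R" "- \<eta> \<in> F" for F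
    proof -
      have pw: "(plane_wave (\<xi> + \<eta>) has_integral (if \<xi> = - \<eta> then ?V else 0)) (cube R)" if "\<xi> \<in> F" for \<xi>
      proof (cases "\<xi> = - \<eta>")
        case True
        have "((\<lambda>x::'a. 1::complex) has_integral measure lborel (cube R :: 'a set) *\<^sub>R 1) (cube R)"
          unfolding cube_def by (rule has_integral_const)
        moreover have "plane_wave (\<xi> + \<eta>) = (\<lambda>_. 1)" using True by (simp add: fun_eq_iff)
        ultimately show ?thesis using True content_cube[OF r(1), where 'a = 'a] by (simp add: scaleR_conv_of_real)
      next
        case False
        have "\<xi> + \<eta> \<in> freqs R" using that F(2) \<eta> by (intro freqs_add) auto
        moreover have "\<xi> + \<eta> \<noteq> 0" using False by (simp add: add_eq_0_iff2)
        ultimately have "integral (cube R) (plane_wave (\<xi> + \<eta>)) = 0" by (rule integral_plane_wave_eq_0[OF r(1)])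
        moreover have "plane_wave (\<xi> + \<eta>) integrable_on cube R" by (intro cube_integrable continuous_plane_wave)
        ultimately have "(plane_wave (\<xi> + \<eta>) has_integral 0) (cube R)" using integrable_integral[of "plane_wave (\<xi> + \<eta>)" "cube R"] by simp
        then show ?thesis using False by simp
      qed
      have "((\<lambda>x. \<Sum>\<xi>\<in>F. ?c \<xi> * plane_wave (\<xi> + \<eta>) x) has_integral (\<Sum>\<xi>\<in>F. ?c \<xi> * (if \<xi> = - \<eta> then ?V else 0))) (cube R)"
        by (intro has_integral_sum F(1) has_integral_mult_right pw)
      moreover have "(\<lambda>x. \<Sum>\<xi>\<in>F. ?c \<xi> * plane_wave (\<xi> + \<eta>) x) = f F"
        unfolding f_def plane_wave_add sum_distrib_right mult.assoc ..
      ultimately have "(f F has_integral (\<Sum>\<xi>\<in>F. ?c \<xi> * (if \<xi> = - \<eta> then ?V else 0))) (cube R)" by simp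
      from has_integral_unique[OF IJ(1)[rule_format] this]
      have "I F = (\<Sum>\<xi>\<in>F. ?c \<xi> * (if \<xi> = - \<eta> then ?V else 0))" .
      also have "\<dots> = (\<Sum>\<xi>\<in>F. if \<xi> = - \<eta> then ?c \<xi> * ?V else 0)" by (intro sum.cong) auto
      also have "\<dots> = ?c (- \<eta>) * ?V" using F(1,3) by (simp add: sum.delta)
      finally show ?thesis .
    qed
    have "\<forall>\<^sub>F F in finite_subsets_at_top (freqs R). finite F \<and> F \<subseteq> freqs R \<and> - \<eta> \<in> F"
      unfolding eventually_finite_subsets_at_top
      using freqs_minus[OF \<eta>] by (intro exI[of _ "{- \<eta>}"]) auto
    then have "\<forall>\<^sub>F F in finite_subsets_at_top (freqs R). ?c (- \<eta>) * ?V = I F"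
      by (rule eventually_mono) (simp only: IF)
    then have "(I \<longlongrightarrow> ?c (- \<eta>) * ?V) (finite_subsets_at_top (freqs R))"
      by (rule Lim_transform_eventually[OF tendsto_const])
    from IJ(3) this have J: "J = ?c (- \<eta>) * ?V"
      by (rule tendsto_unique[OF finite_subsets_at_top_neq_bot])
    have "?V \<noteq> 0" using r(1) by simp
    then have "integral (cube R) (\<lambda>x. h x * plane_wave \<eta> x) = J"
      unfolding J fourier_coef_def by simp
    moreover have "(\<lambda>x. h x * plane_wave \<eta> x) integrable_on cube R"
      by (intro cube_integrable continuous_on_mult conth continuous_plane_wave)
    ultimately have "((\<lambda>x. h x * plane_wave \<eta> x) has_integral J) (cube R)"
      using integrable_integral[of "\<lambda>x. h x * plane_wave \<eta> x" "cube R"] by simp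
    from has_integral_diff[OF this IJ(2)] show ?thesis
      by (simp add: left_diff_distrib integral_unique)
  qed
  fix x :: 'a assume x: "\<And>b. b \<in> Basis \<Longrightarrow> \<bar>x \<bullet> b\<bar> < R"
  have "h x - S x = 0"
    by (rule fourier_uniqueness[OF r(1) continuous_on_diff[OF conth continuous_on_subset[OF contS subset_UNIV]] coef x])
  then show "(\<Sum>\<^sub>\<infinity>\<xi>\<in>freqs R. ?c \<xi> * plane_wave \<xi> x) = h x" by (simp add: S_def)
qed

section \<open>Non-stationary phase\<close>

text \<open>The pull-back is the transpose of the derivative; in this form it appears in the
  gradient of the phase.\<close>

lemma covector_pullback_inner:
  assumes b: "b \<in> Basis"
  shows "covector_pullback f x k \<bullet> b = k \<bullet> frechet_derivative f (at x) b"
proof -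
  let ?s = "\<lambda>i. \<Sum>j\<in>Basis. (k \<bullet> j) * (frechet_derivative f (at x) i \<bullet> j)"
  have "covector_pullback f x k \<bullet> b = (\<Sum>i\<in>Basis. ?s i * (i \<bullet> b))"
    by (simp add: covector_pullback_def inner_sum_left)
  also have "\<dots> = (\<Sum>i\<in>Basis. if i = b then ?s i else 0)"
    by (rule sum.cong[OF refl]) (use b in \<open>simp only: inner_Basis if_distrib, simp\<close>)
  also have "\<dots> = ?s b" using b by (simp only: sum.delta finite_Basis if_True)
  also have "\<dots> = k \<bullet> frechet_derivative f (at x) b" by (rule euclidean_inner[symmetric])
  finally show ?thesis .
qed

lemma norm_integral_cube_le:
  fixes F :: "'a::euclidean_space \<Rightarrow> complex"
  assumes R: "R > 0" and F: "continuous_on (cube R) F" and B0: "B \<ge> 0" and B: "\<And>x. x \<in> cube R \<Longrightarrow> cmod (F x) \<le> B"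
  shows "cmod (integral (cube R) F) \<le> B * (2 * R) ^ DIM('a)"
proof -
  have "(F has_integral integral (cube R) F) (cube R)"
    by (intro integrable_integral cube_integrable F)
  then have "cmod (integral (cube R) F) \<le> B * measure lborel (cube R :: 'a set)"
    unfolding cube_def by (rule has_integral_bound[OF B0]) (use B in \<open>simp add: cube_def\<close>)
  then show ?thesis by (simp only: content_cube[OF R])
qed

text \<open>The exponential with phase k \<bullet> f(x) - \<xi> \<bullet> x. The frequencies form a
  pair p so that the amplitudes can be treated as families over p.\<close>

definition phase :: "('a::euclidean_space \<Rightarrow> 'b::euclidean_space) \<Rightarrow> 'b \<times> 'a \<Rightarrow> 'a \<Rightarrow> complex" where
  "phase f p x = plane_wave (fst p) (f x) * plane_wave (- snd p) x"

lemma norm_phase [simp]: "cmod (phase f p x) = 1"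
  by (simp add: phase_def norm_mult)

lemma smooth_phase: "open S \<Longrightarrow> smooth_on S f \<Longrightarrow> smooth_on S (phase f p)"
  unfolding phase_def
  by (rule smooth_on_mult[OF _ smooth_on_compose[OF _ open_UNIV _ smooth_plane_wave] smooth_plane_wave]) auto

lemma pderiv_mult_phase:
  fixes f :: "'a::euclidean_space \<Rightarrow> 'b::euclidean_space"
  assumes f: "f differentiable (at x)" and H: "H differentiable (at x)"
  shows "pderiv_at b (\<lambda>y. H y * phase f p y) x =
    pderiv_at b H x * phase f p x
    + (- \<i> * complex_of_real (fst p \<bullet> frechet_derivative f (at x) b - snd p \<bullet> b)) * (H x * phase f p x)"
proof -
  have h: "(H has_derivative frechet_derivative H (at x)) (at x)"
    using H by (simp add: frechet_derivative_works)
  have g: "(f has_derivative frechet_derivative f (at x)) (at x)"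
    using f by (simp add: frechet_derivative_works)
  have p: "(plane_wave k has_derivative (\<lambda>h. plane_wave k y * (- \<i> * complex_of_real (k \<bullet> h)))) (at y)" for k y
    using plane_wave_has_derivative[of 1 k y] by simp
  have "(phase f p has_derivative (\<lambda>h. plane_wave (fst p) (f x) * (plane_wave (- snd p) x * (- \<i> * complex_of_real (- snd p \<bullet> h)))
      + plane_wave (fst p) (f x) * (- \<i> * complex_of_real (fst p \<bullet> frechet_derivative f (at x) h)) * plane_wave (- snd p) x)) (at x)"
    unfolding phase_def by (rule has_derivative_mult[OF has_derivative_compose[OF g p] p])
  from frechet_derivative_at[OF has_derivative_mult[OF h this], symmetric]
  have D: "frechet_derivative (\<lambda>y. H y * phase f p y) (at x) = (\<lambda>h. H x * (plane_wave (fst p) (f x) * (plane_wave (- snd p) x * (- \<i> * complex_of_real (- snd p \<bullet> h)))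
      + plane_wave (fst p) (f x) * (- \<i> * complex_of_real (fst p \<bullet> frechet_derivative f (at x) h)) * plane_wave (- snd p) x) + frechet_derivative H (at x) h * phase f p x)" .
  have "h * (A * (B * (- \<i> * complex_of_real (- s))) + A * (- \<i> * complex_of_real r) * B) + h' * (A * B) =
      h' * (A * B) + (- \<i> * complex_of_real (r - s)) * (h * (A * B))" for h h' A B :: complex and r s :: real
    by (simp add: algebra_simps)
  then show ?thesis unfolding D unfolding phase_def inner_minus_left .
qed

text \<open>Integrating by parts along the gradient of the phase, with the covectors normalised to \<open>|k| + |\<xi>| = 1\<close>:
  every step gains a factor \<open>|k| + |\<xi>|\<close>, and the new amplitudes stay bounded in all \<open>C\<^sup>m\<close> norms.\<close>

lemma nonstationary_phase:
  fixes f :: "'a::euclidean_space \<Rightarrow> 'b::euclidean_space"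
  assumes U: "open U" and f: "smooth_on U f" and g: "g \<in> test_fun U" and c: "c > 0"
    and cube: "fun_supp g \<subseteq> cube r" and r: "r < R" "0 < R"
  shows "\<exists>C\<ge>0. \<forall>k \<xi>. (\<forall>x\<in>U. c * (norm k + norm \<xi>) \<le> norm (covector_pullback f x k - \<xi>)) \<longrightarrow>
    (1 + norm k + norm \<xi>) ^ M * cmod (integral (cube R) (\<lambda>x. g x * phase f (k, \<xi>) x)) \<le> C"
proof -
  let ?K = "fun_supp g"
  define L where "L p = norm (fst p) + norm (snd p)" for p :: "'b \<times> 'a"
  \<comment> \<open>The restriction \<open>L p \<ge> 1\<close> makes division by \<open>L p\<close>
    safe; smaller frequencies are left to a trivial bound at the end.\<close>
  define P where "P = {p. L p \<ge> 1 \<and> (\<forall>x\<in>U. c * L p \<le> norm (covector_pullback f x (fst p) - snd p))}"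
  obtain S K' where S: "open S" "compact K'" "?K \<subseteq> S" "S \<subseteq> K'" "K' \<subseteq> U"
    using compact_open_between[OF test_funD(2)[OF g] U test_funD(3)[OF g]] by blast
  have SU: "S \<subseteq> U" using S by blast
  have fS: "smooth_on S f" by (rule smooth_on_mono[OF f SU])
  \<comment> \<open>The gradient of the phase divided by \<open>L p\<close>. The frequencies enter
    only through coefficients of modulus at most 1, so these functions have uniform bounds although
    P is unbounded.\<close>
  define a where "a b p x = complex_of_real ((fst p \<bullet> frechet_derivative f (at x) b - snd p \<bullet> b) / L p)"
    for b :: 'a and p and x :: 'a
  have Lpos: "L p > 0" if "p \<in> P" for p using that by (auto simp: P_def)
  have a_bdd: "Cm_bounded m P S (a b)" if b: "b \<in> Basis" for m b
  proof -
    have eq: "a b p x = (\<Sum>j\<in>Basis. complex_of_real ((fst p \<bullet> j) / L p) * complex_of_real (frechet_derivative f (at x) b \<bullet> j))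
        + complex_of_real (- (snd p \<bullet> b) / L p)" for p x
      unfolding a_def by (subst euclidean_inner[of "fst p"])
        (simp add: diff_divide_distrib sum_divide_distrib)
    have small1: "\<bar>(fst p \<bullet> j) / L p\<bar> \<le> 1" if "p \<in> P" "j \<in> Basis" for p j
    proof -
      have "\<bar>fst p \<bullet> j\<bar> \<le> L p" using Basis_le_norm[OF that(2), of "fst p"] norm_ge_zero[of "snd p"] unfolding L_def by linarith
      then show ?thesis using Lpos[OF that(1)] by simp
    qed
    have small2: "\<bar>- (snd p \<bullet> b) / L p\<bar> \<le> 1" if "p \<in> P" for p
    proof -
      have "\<bar>snd p \<bullet> b\<bar> \<le> L p" using Basis_le_norm[OF b, of "snd p"] norm_ge_zero[of "fst p"] unfolding L_def by linarith
      then show ?thesis using Lpos[OF that] by simp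
    qed
    have d: "Cm_bounded m P S (\<lambda>_ x. complex_of_real (frechet_derivative f (at x) b \<bullet> j))" for j
      by (rule Cm_bounded_linear[OF S(1) bounded_linear_of_real Cm_bounded_inner_left[OF S(1)
            smooth_on_imp_Cm_bounded[OF smooth_on_pderiv[OF f b] S(2,4,5)]]])
    have k: "Cm_bounded m P S (\<lambda>p x. complex_of_real ((fst p \<bullet> j) / L p))" if "j \<in> Basis" for j
      by (rule Cm_bounded_const[where B = 1]) (simp only: norm_of_real small1[OF _ that])
    have l: "Cm_bounded m P S (\<lambda>p x. complex_of_real (- (snd p \<bullet> b) / L p))"
      by (rule Cm_bounded_const[where B = 1]) (simp only: norm_of_real small2)
    show ?thesis
      by (rule Cm_bounded_congI[OF S(1) eq Cm_bounded_add[OF S(1) Cm_bounded_sum[OF S(1) finite_Basis Cm_bounded_mult[OF S(1) k d]] l]])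
  qed
  \<comment> \<open>The squared length of the normalised gradient, complex-valued so that it can be
    inverted among the amplitudes; on P it is at least \<open>c\<^sup>2\<close>.\<close>
  define Dn where "Dn p x = (\<Sum>b\<in>Basis. a b p x * a b p x)" for p x
  have D_bdd: "Cm_bounded m P S Dn" for m
    unfolding Dn_def[abs_def] by (rule Cm_bounded_sum[OF S(1) finite_Basis Cm_bounded_mult[OF S(1) a_bdd a_bdd]])
  have D_low: "c\<^sup>2 \<le> cmod (Dn p x)" if "p \<in> P" "x \<in> S" for p x
  proof -
    let ?v = "covector_pullback f x (fst p) - snd p"
    have "(norm ?v)\<^sup>2 = (\<Sum>b\<in>Basis. (?v \<bullet> b)\<^sup>2)"
      unfolding power2_norm_eq_inner by (subst euclidean_inner) (simp add: power2_eq_square)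
    also have "\<dots> = (\<Sum>b\<in>Basis. (fst p \<bullet> frechet_derivative f (at x) b - snd p \<bullet> b)\<^sup>2)"
      by (intro sum.cong refl) (simp add: inner_diff_left covector_pullback_inner)
    finally have n: "(norm ?v / L p)\<^sup>2 = (\<Sum>b\<in>Basis. ((fst p \<bullet> frechet_derivative f (at x) b - snd p \<bullet> b) / L p)\<^sup>2)"
      by (simp add: power_divide sum_divide_distrib)
    have "Dn p x = complex_of_real ((norm ?v / L p)\<^sup>2)"
      unfolding Dn_def a_def n by (simp add: power2_eq_square)
    then have "cmod (Dn p x) = (norm ?v / L p)\<^sup>2" by (simp only: norm_of_real abs_power2)
    moreover have "c \<le> norm ?v / L p"
      using that SU Lpos[OF that(1)] by (auto simp: P_def pos_le_divide_eq)
    ultimately show ?thesis using c by (simp add: power_mono)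
  qed
  define q where "q p x = inverse (Dn p x)" for p x
  have q_bdd: "Cm_bounded m P S q" for m
    unfolding q_def[abs_def] using c by (intro Cm_bounded_inverse[OF S(1), of "c\<^sup>2"] D_bdd D_low) auto
  have Dq: "Dn p x * q p x = 1" if "p \<in> P" "x \<in> S" for p x
  proof -
    have "Dn p x \<noteq> 0" using D_low[OF that] c by auto
    then show ?thesis by (simp add: q_def)
  qed
  have ext: "smooth_on UNIV F" if "smooth_on S F" "\<And>x. x \<notin> ?K \<Longrightarrow> F x = 0" for F :: "'a \<Rightarrow> complex"
    by (rule smooth_on_extend[OF that(1) closed_fun_supp S(3) that(2)])
  \<comment> \<open>The transposed operator of the integration by parts. For \<open>G b\<close> = w
    a_b q the sum of a_b \<open>G b\<close> is w, so the divergence of the fields \<open>G b\<close>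
    times the exponential is (T w) times the exponential minus \<i> \<open>L p\<close> w times it;
    its integral is 0, which gains 1 / \<open>L p\<close>.\<close>
  define T where "T w p x = (\<Sum>b\<in>Basis. pderiv_at b (\<lambda>y. w p y * (a b p y * q p y)) x)"
    for w :: "'b \<times> 'a \<Rightarrow> 'a \<Rightarrow> complex" and p x
  have T_bdd: "Cm_bounded m P S (T w)" if w: "\<And>m. Cm_bounded m P S w" for w m
    unfolding T_def[abs_def]
    by (rule Cm_bounded_sum[OF S(1) finite_Basis Cm_bounded_pderiv[OF Cm_bounded_mult[OF S(1) w Cm_bounded_mult[OF S(1) a_bdd q_bdd]]]])
  have T_out: "T w p x = 0" if w: "\<And>x. x \<notin> ?K \<Longrightarrow> w p x = 0" and x: "x \<notin> ?K" for w p x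
  proof -
    have "pderiv_at b (\<lambda>y. w p y * (a b p y * q p y)) x = 0" for b
      using partials_outside[OF closed_fun_supp[of g] _ x, of "\<lambda>y. w p y * (a b p y * q p y)" "[b]"] w by simp
    then show ?thesis by (simp add: T_def)
  qed
  have T_int: "integral (cube R) (\<lambda>x. w p x * phase f p x) =
      (- \<i> / complex_of_real (L p)) * integral (cube R) (\<lambda>x. T w p x * phase f p x)"
    if w: "\<And>m. Cm_bounded m P S w" and out: "\<And>x. x \<notin> ?K \<Longrightarrow> w p x = 0" and p: "p \<in> P" for w p
  proof -
    define G where "G b y = w p y * (a b p y * q p y)" for b y
    have G_sm: "smooth_on S (G b)" if b: "b \<in> Basis" for b
      unfolding G_def[abs_def]
      by (rule Cm_bounded_imp_smooth_on[OF Cm_bounded_mult[OF S(1) w Cm_bounded_mult[OF S(1) a_bdd[OF b] q_bdd]] p])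
    have w_sm: "smooth_on S (w p)" by (rule Cm_bounded_imp_smooth_on[OF w p])
    have Tw_sm: "smooth_on S (T w p)" by (rule Cm_bounded_imp_smooth_on[OF T_bdd[OF w] p])
    have ph: "smooth_on S (phase f p)" by (rule smooth_phase[OF S(1) fS])
    have Gout: "G b x * phase f p x = 0" if "x \<notin> ?K" for b x using out[OF that] by (simp add: G_def)
    have Ge: "smooth_on UNIV (\<lambda>x. G b x * phase f p x)" if b: "b \<in> Basis" for b
      by (rule ext[OF smooth_on_mult[OF S(1) G_sm[OF b] ph] Gout])
    have we: "smooth_on UNIV (\<lambda>x. w p x * phase f p x)"
      by (rule ext[OF smooth_on_mult[OF S(1) w_sm ph]]) (simp add: out)
    have Te: "smooth_on UNIV (\<lambda>x. T w p x * phase f p x)"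
      by (rule ext[OF smooth_on_mult[OF S(1) Tw_sm ph]]) (simp add: T_out out)
    have int: "F integrable_on cube R" if "smooth_on UNIV F" for F :: "'a \<Rightarrow> complex"
      by (rule cube_integrable[OF continuous_on_subset[OF smooth_on_continuous[OF that] subset_UNIV]])
    have pt: "(\<Sum>b\<in>Basis. pderiv_at b (\<lambda>x. G b x * phase f p x) x) =
        T w p x * phase f p x - (\<i> * complex_of_real (L p)) * (w p x * phase f p x)" for x
    proof (cases "x \<in> ?K")
      case True
      then have xS: "x \<in> S" using S(3) by blast
      have fd: "f differentiable (at x)" by (rule smooth_on_differentiable[OF fS xS])
      have pG: "pderiv_at b (\<lambda>x. G b x * phase f p x) x = pderiv_at b (G b) x * phase f p x
          + (- \<i> * complex_of_real (L p)) * (a b p x * G b x * phase f p x)" if b: "b \<in> Basis" for b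
      proof -
        have "complex_of_real (fst p \<bullet> frechet_derivative f (at x) b - snd p \<bullet> b) = complex_of_real (L p) * a b p x"
          using Lpos[OF p] by (simp add: a_def)
        then show ?thesis
          using pderiv_mult_phase[OF fd smooth_on_differentiable[OF G_sm[OF b] xS], where b = b and p = p] by (simp only: mult_ac)
      qed
      have "(\<Sum>b\<in>Basis. pderiv_at b (\<lambda>x. G b x * phase f p x) x) =
        (\<Sum>b\<in>Basis. pderiv_at b (G b) x * phase f p x + (- \<i> * complex_of_real (L p)) * (a b p x * G b x * phase f p x))"
        by (rule sum.cong[OF refl pG])
      also have "\<dots> = (\<Sum>b\<in>Basis. pderiv_at b (G b) x) * phase f p x
          + (- \<i> * complex_of_real (L p)) * ((\<Sum>b\<in>Basis. a b p x * G b x) * phase f p x)"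
        by (simp only: sum.distrib sum_distrib_left sum_distrib_right)
      also have "(\<Sum>b\<in>Basis. pderiv_at b (G b) x) = T w p x" by (simp add: T_def G_def[abs_def])
      also have "(\<Sum>b\<in>Basis. a b p x * G b x) = w p x * (Dn p x * q p x)"
        by (simp add: G_def Dn_def sum_distrib_left sum_distrib_right mult_ac)
      finally show ?thesis unfolding Dq[OF p xS] by simp
    next
      case False
      have "pderiv_at b (\<lambda>x. G b x * phase f p x) x = 0" for b
        using partials_outside[OF closed_fun_supp[of g] _ False, of "\<lambda>x. G b x * phase f p x" "[b]"] Gout by simp
      moreover have "T w p x = 0" by (rule T_out[where w = w and p = p]) (use out False in auto)
      ultimately show ?thesis using out[OF False] by simp
    qed
    have "integral (cube R) (pderiv_at b (\<lambda>x. G b x * phase f p x)) = 0" if b: "b \<in> Basis" for b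
      by (rule integral_pderiv_eq_0[OF Ge[OF b] _ r(1) b]) (use cube Gout in blast)
    then have "0 = (\<Sum>b\<in>Basis. integral (cube R) (pderiv_at b (\<lambda>x. G b x * phase f p x)))" by simp
    also have "\<dots> = integral (cube R) (\<lambda>x. \<Sum>b\<in>Basis. pderiv_at b (\<lambda>x. G b x * phase f p x) x)"
      by (rule Henstock_Kurzweil_Integration.integral_sum[OF finite_Basis int[OF smooth_on_pderiv[OF Ge]], symmetric])
    also have "\<dots> = integral (cube R) (\<lambda>x. T w p x * phase f p x - (\<i> * complex_of_real (L p)) * (w p x * phase f p x))"
      by (simp only: pt)
    also have "\<dots> = integral (cube R) (\<lambda>x. T w p x * phase f p x) - (\<i> * complex_of_real (L p)) * integral (cube R) (\<lambda>x. w p x * phase f p x)"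
      by (subst Henstock_Kurzweil_Integration.integral_diff[OF int[OF Te] integrable_on_mult_right[OF int[OF we]]])
         (simp only: Henstock_Kurzweil_Integration.integral_mult_right)
    finally have "integral (cube R) (\<lambda>x. T w p x * phase f p x) = (\<i> * complex_of_real (L p)) * integral (cube R) (\<lambda>x. w p x * phase f p x)"
      by simp
    then show ?thesis using Lpos[OF p] by (simp add: field_simps)
  qed
  have "\<exists>w. (\<forall>m. Cm_bounded m P S w) \<and> (\<forall>p. \<forall>x. x \<notin> ?K \<longrightarrow> w p x = 0) \<and>
      (\<forall>p\<in>P. integral (cube R) (\<lambda>x. g x * phase f p x) = (- \<i> / complex_of_real (L p)) ^ M * integral (cube R) (\<lambda>x. w p x * phase f p x))"
  proof (induction M)
    case 0
    have "\<forall>m. Cm_bounded m P S (\<lambda>_. g)"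
      using Cm_bounded_mono[OF test_fun_Cm_bounded[OF g] order_refl subset_refl subset_UNIV] by blast
    then show ?case by (intro exI[of _ "\<lambda>_. g"]) (simp add: fun_supp_outside)
  next
    case (Suc M)
    then obtain w where w: "\<forall>m. Cm_bounded m P S w" "\<forall>p. \<forall>x. x \<notin> ?K \<longrightarrow> w p x = 0"
      "\<forall>p\<in>P. integral (cube R) (\<lambda>x. g x * phase f p x) = (- \<i> / complex_of_real (L p)) ^ M * integral (cube R) (\<lambda>x. w p x * phase f p x)"
      by blast
    have "\<forall>p\<in>P. integral (cube R) (\<lambda>x. g x * phase f p x) = (- \<i> / complex_of_real (L p)) ^ Suc M * integral (cube R) (\<lambda>x. T w p x * phase f p x)"
    proof
      fix p assume p: "p \<in> P"
      have "integral (cube R) (\<lambda>x. w p x * phase f p x) =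
          (- \<i> / complex_of_real (L p)) * integral (cube R) (\<lambda>x. T w p x * phase f p x)"
        by (rule T_int[OF _ _ p]) (use w(1,2) in blast)+
      with w(3) p show "integral (cube R) (\<lambda>x. g x * phase f p x) = (- \<i> / complex_of_real (L p)) ^ Suc M * integral (cube R) (\<lambda>x. T w p x * phase f p x)"
        by simp
    qed
    moreover have "\<forall>m. Cm_bounded m P S (T w)" using T_bdd w(1) by blast
    moreover have "\<forall>p. \<forall>x. x \<notin> ?K \<longrightarrow> T w p x = 0"
    proof (intro allI impI)
      fix p x assume "x \<notin> ?K"
      then show "T w p x = 0" by (rule T_out[rotated]) (use w(2) in blast)
    qed
    ultimately show ?case by (intro exI[of _ "T w"]) blast
  qed
  then obtain w where w: "\<forall>m. Cm_bounded m P S w" "\<forall>p. \<forall>x. x \<notin> ?K \<longrightarrow> w p x = 0"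
      "\<forall>p\<in>P. integral (cube R) (\<lambda>x. g x * phase f p x) = (- \<i> / complex_of_real (L p)) ^ M * integral (cube R) (\<lambda>x. w p x * phase f p x)"
    by blast
  obtain B where B: "B \<ge> 0" "\<forall>p\<in>P. \<forall>x\<in>S. cmod (w p x) \<le> B" using Cm_bounded_norm_le w(1) by blast
  obtain B' where B': "B' \<ge> 0" "\<forall>p\<in>(UNIV::unit set). \<forall>x\<in>UNIV. cmod (g x) \<le> B'"
    using Cm_bounded_norm_le[OF test_fun_Cm_bounded[OF g, of 0 "UNIV :: unit set"]] by blast
  let ?V = "(2 * R) ^ DIM('a)"
  have V: "?V \<ge> 0" using r by simp
  \<comment> \<open>The bounds of the two cases are added. The factor 2^M comes from 1 + L \<le> 2 L
    if L \<ge> 1, and from 1 + L \<le> 2 otherwise, for L = |k| + |\<xi>|.\<close>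
  define C where "C = 2 ^ M * (B * ?V) + 2 ^ M * (B' * ?V)"
  have cont: "continuous_on (cube R) (\<lambda>x. F x * phase f p x)" if "smooth_on S F" "\<And>x. x \<notin> ?K \<Longrightarrow> F x = 0" for F p
  proof -
    have "smooth_on UNIV (\<lambda>x. F x * phase f p x)"
      by (rule ext[OF smooth_on_mult[OF S(1) that(1) smooth_phase[OF S(1) fS]]]) (simp add: that(2))
    then show ?thesis by (rule continuous_on_subset[OF smooth_on_continuous subset_UNIV])
  qed
  have "(1 + norm k + norm \<xi>) ^ M * cmod (integral (cube R) (\<lambda>x. g x * phase f (k, \<xi>) x)) \<le> C"
    if H: "\<forall>x\<in>U. c * (norm k + norm \<xi>) \<le> norm (covector_pullback f x k - \<xi>)" for k \<xi>
  proof (cases "norm k + norm \<xi> \<ge> 1")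
    case True
    define p where "p = (k, \<xi>)"
    have Lp: "L p = norm k + norm \<xi>" by (simp add: L_def p_def)
    have p: "p \<in> P" using True H by (simp add: P_def p_def L_def)
    have wS: "smooth_on S (w p)" by (rule Cm_bounded_imp_smooth_on[OF _ p]) (use w(1) in blast)
    have wo: "w p x = 0" if "x \<notin> ?K" for x using w(2) that by blast
    have "cmod (w p x) \<le> B" for x
    proof (cases "x \<in> ?K")
      case True
      then show ?thesis using B(2) p S(3) by blast
    next
      case False
      then show ?thesis using wo B(1) by simp
    qed
    then have wi: "cmod (integral (cube R) (\<lambda>x. w p x * phase f p x)) \<le> B * ?V"
      by (intro norm_integral_cube_le[OF r(2) cont[OF wS wo] B(1)]) (simp_all add: norm_mult)
    have "cmod (integral (cube R) (\<lambda>x. g x * phase f p x)) = (1 / L p) ^ M * cmod (integral (cube R) (\<lambda>x. w p x * phase f p x))"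
      using w(3) p Lpos[OF p] by (simp add: norm_mult norm_power norm_divide)
    also have "\<dots> \<le> (1 / L p) ^ M * (B * ?V)" using wi Lpos[OF p] by (intro mult_left_mono) auto
    finally have i: "cmod (integral (cube R) (\<lambda>x. g x * phase f p x)) \<le> (1 / L p) ^ M * (B * ?V)" .
    have "(1 + norm k + norm \<xi>) ^ M \<le> (2 * L p) ^ M" using True by (intro power_mono) (auto simp: Lp)
    then have "(1 + norm k + norm \<xi>) ^ M * cmod (integral (cube R) (\<lambda>x. g x * phase f p x)) \<le> (2 * L p) ^ M * ((1 / L p) ^ M * (B * ?V))"
      using i Lpos[OF p] by (intro mult_mono) auto
    also have "\<dots> = 2 ^ M * (B * ?V)" using Lpos[OF p] by (simp add: power_mult_distrib power_divide)
    also have "\<dots> \<le> C" using B' V by (simp add: C_def)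
    finally show ?thesis by (simp only: p_def)
  next
    case False
    have "cmod (integral (cube R) (\<lambda>x. g x * phase f (k, \<xi>) x)) \<le> B' * ?V"
      by (rule norm_integral_cube_le[OF r(2) cont[OF smooth_on_mono[OF test_funD(1)[OF g] subset_UNIV]] B'(1)])
         (use B'(2) in \<open>simp_all add: norm_mult fun_supp_outside\<close>)
    moreover have "(1 + norm k + norm \<xi>) ^ M \<le> 2 ^ M" using False by (intro power_mono) auto
    ultimately have "(1 + norm k + norm \<xi>) ^ M * cmod (integral (cube R) (\<lambda>x. g x * phase f (k, \<xi>) x)) \<le> 2 ^ M * (B' * ?V)"
      by (intro mult_mono) auto
    also have "\<dots> \<le> C" using B V by (simp add: C_def)
    finally show ?thesis .
  qed
  moreover have "C \<ge> 0" unfolding C_def using B(1) B'(1) V by simp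
  ultimately show ?thesis by blast
qed

section \<open>Localised Fourier expansion of distributions\<close>

lemma distributionsD:
  assumes "u \<in> distributions \<Omega>"
  shows "\<phi> \<notin> test_fun \<Omega> \<Longrightarrow> u \<phi> = 0"
    and "\<phi> \<in> test_fun \<Omega> \<Longrightarrow> \<psi> \<in> test_fun \<Omega> \<Longrightarrow> u (\<lambda>x. \<phi> x + \<psi> x) = u \<phi> + u \<psi>"
    and "\<phi> \<in> test_fun \<Omega> \<Longrightarrow> u (\<lambda>x. a * \<phi> x) = a * u \<phi>"
    and "continuous_on_DK \<Omega> (\<lambda>\<phi>. cmod (u \<phi>))"
  using assms by (simp_all add: distributions_def)

lemma distribution_zero: "u \<in> distributions \<Omega> \<Longrightarrow> u (\<lambda>_. 0) = 0"
  using distributionsD(3)[of u \<Omega> "\<lambda>_. 0" 0] by simp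

lemma distribution_diff:
  assumes "u \<in> distributions \<Omega>" "\<phi> \<in> test_fun \<Omega>" "\<psi> \<in> test_fun \<Omega>"
  shows "u (\<lambda>x. \<phi> x - \<psi> x) = u \<phi> - u \<psi>"
  using distributionsD(2)[OF assms(1,2) test_fun_scale[OF assms(3), of "-1"]]
    distributionsD(3)[OF assms(1,3), of "-1"] by simp

lemma distribution_sum:
  assumes u: "u \<in> distributions \<Omega>" and "finite J" "\<And>j. j \<in> J \<Longrightarrow> \<phi> j \<in> test_fun \<Omega>"
  shows "u (\<lambda>x. \<Sum>j\<in>J. c j * \<phi> j x) = (\<Sum>j\<in>J. c j * u (\<phi> j))"
  using assms(2,3)
proof (induction J rule: finite_induct)
  case empty
  then show ?case using distribution_zero[OF u] by simp
next
  case (insert j J)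
  have "u (\<lambda>x. c j * \<phi> j x + (\<Sum>j\<in>J. c j * \<phi> j x)) = u (\<lambda>x. c j * \<phi> j x) + u (\<lambda>x. \<Sum>j\<in>J. c j * \<phi> j x)"
    using insert by (intro distributionsD(2)[OF u] test_fun_sum test_fun_scale) auto
  with insert show ?case by (simp add: distributionsD(3)[OF u])
qed

lemma partials_sum:
  assumes "finite J" "\<And>j. j \<in> J \<Longrightarrow> smooth_on UNIV (f j)" "set vs \<subseteq> Basis"
  shows "partials vs (\<lambda>x. \<Sum>j\<in>J. f j x) = (\<lambda>x. \<Sum>j\<in>J. partials vs (f j) x)"
  using assms(1,2)
proof (induction J rule: finite_induct)
  case empty
  have "partials vs (\<lambda>_. 0) = (\<lambda>_. 0)" by (induction vs) auto
  then show ?case by simp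
next
  case (insert j J)
  have "partials vs (\<lambda>x. f j x + (\<Sum>j\<in>J. f j x)) = (\<lambda>x. partials vs (f j) x + partials vs (\<lambda>x. \<Sum>j\<in>J. f j x) x)"
    using insert by (intro partials_add smooth_on_sum assms(3)) auto
  with insert show ?case by simp
qed

lemma partials_diff:
  assumes "smooth_on UNIV f" "smooth_on UNIV g" "set vs \<subseteq> Basis"
  shows "partials vs (\<lambda>x. f x - g x) = (\<lambda>x. partials vs f x - partials vs g x)"
  using partials_add[OF assms(1) smooth_on_minus[OF open_UNIV assms(2)] assms(3)]
    partials_linear[OF bounded_linear_minus[OF bounded_linear_ident] assms(2,3)] by simp

text \<open>Functions u / e form a family bounded by 1 on S, and \<psi> carries this to the whole
  space. Smallness is assumed on S alone because a Fourier series is known to represent the function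
  only inside the cube.\<close>

lemma Cm_norm_mult_le:
  fixes \<psi> :: "'a::euclidean_space \<Rightarrow> complex"
  assumes \<psi>: "\<psi> \<in> test_fun S" and S: "open S"
  shows "\<exists>c\<ge>0. \<forall>u e. smooth_on UNIV u \<longrightarrow> e > 0 \<longrightarrow>
    (\<forall>vs. set vs \<subseteq> Basis \<and> length vs \<le> m \<longrightarrow> (\<forall>x\<in>S. cmod (partials vs u x) \<le> e)) \<longrightarrow> Cm_norm m (\<lambda>x. \<psi> x * u x) \<le> c * e"
proof -
  define P where "P = {u :: 'a \<Rightarrow> complex. smooth_on UNIV u \<and> 
    (\<forall>vs. set vs \<subseteq> Basis \<and> length vs \<le> m \<longrightarrow> (\<forall>x\<in>S. cmod (partials vs u x) \<le> 1))}"
  have "Cm_bounded m P S (\<lambda>u. u)"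
    unfolding Cm_bounded_def
  proof (intro allI impI exI[of _ 1] ballI conjI)
    fix vs :: "'a list" and u x assume vs: "set vs \<subseteq> Basis \<and> length vs \<le> m" and u: "u \<in> P" and x: "x \<in> S"
    have "smooth_on UNIV u" using u by (simp add: P_def)
    then show "partials vs u differentiable (at x)" using vs by (simp add: smooth_on_def)
    show "cmod (partials vs u x) \<le> 1" using u vs x by (simp add: P_def)
  qed
  then have "Cm_bounded m P S (\<lambda>u x. \<psi> x * u x)"
    by (rule Cm_bounded_mult[OF S Cm_bounded_mono[OF test_fun_Cm_bounded[OF \<psi>] order_refl subset_refl subset_UNIV]])
  then have b: "Cm_bounded m P UNIV (\<lambda>u x. \<psi> x * u x)"
    by (rule Cm_bounded_extend[OF _ closed_fun_supp test_funD(3)[OF \<psi>]]) (simp add: fun_supp_outside)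
  obtain c where c: "c \<ge> 0" "\<forall>u\<in>P. Cm_norm m (\<lambda>x. \<psi> x * u x) \<le> c" using Cm_bounded_Cm_norm[OF b] by blast
  have "Cm_norm m (\<lambda>x. \<psi> x * u x) \<le> c * e"
    if u: "smooth_on UNIV u" and e: "e > 0"
      and le: "\<forall>vs. set vs \<subseteq> Basis \<and> length vs \<le> m \<longrightarrow> (\<forall>x\<in>S. cmod (partials vs u x) \<le> e)" for u e
  proof -
    let ?v = "\<lambda>x. (1 / e) *\<^sub>R u x"
    have v: "smooth_on UNIV ?v" by (rule smooth_on_linear[OF open_UNIV bounded_linear_scaleR_right u])
    have "cmod (partials vs ?v x) \<le> 1" if "set vs \<subseteq> Basis \<and> length vs \<le> m" "x \<in> S" for vs x
    proof -
      have "partials vs ?v x = (1 / e) *\<^sub>R partials vs u x"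
        using partials_linear[OF bounded_linear_scaleR_right u, of vs "1 / e"] that(1) by simp
      moreover have "cmod (partials vs u x) \<le> e" using le that by blast
      ultimately show ?thesis using e by (simp add: divide_le_eq)
    qed
    then have "?v \<in> P" using v by (simp add: P_def)
    from bspec[OF c(2) this] have 1: "Cm_norm m (\<lambda>x. \<psi> x * ?v x) \<le> c" .
    have "(\<lambda>x. \<psi> x * ?v x) \<in> test_fun S" by (rule test_fun_mult[OF \<psi> S smooth_on_mono[OF v subset_UNIV]])
    from Cm_norm_scaleR_le[OF this, of m e]
    have "Cm_norm m (\<lambda>x. e *\<^sub>R (\<psi> x * ?v x)) \<le> e * Cm_norm m (\<lambda>x. \<psi> x * ?v x)" using e by simp
    also have "\<dots> \<le> e * c" using 1 e by simp
    also have "(\<lambda>x. e *\<^sub>R (\<psi> x * ?v x)) = (\<lambda>x. \<psi> x * u x)" using e by (simp add: fun_eq_iff)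
    finally show ?thesis by (simp add: mult.commute)
  qed
  then show ?thesis using c(1) by blast
qed

text \<open>The coefficients of a derivative of h are those of the series differentiated term by
  term, so finitely many derivatives of the partial sums converge uniformly on the open cube.
  Multiplied by \<psi>, the error tends to 0 in the norm that controls w on the support of
  \<psi>.\<close>

lemma distribution_fourier_series:
  fixes h \<psi> :: "'a::euclidean_space \<Rightarrow> complex"
  assumes w: "w \<in> distributions \<Omega>" and \<Omega>: "open \<Omega>" and \<psi>: "\<psi> \<in> test_fun \<Omega>" "fun_supp \<psi> \<subseteq> cube r"
    and h: "smooth_on UNIV h" "\<And>x. x \<notin> cube r \<Longrightarrow> h x = 0" and r: "0 < R" "r < R"
  shows "((\<lambda>\<xi>. fourier_coef R h \<xi> * w (\<lambda>x. \<psi> x * plane_wave \<xi> x)) has_sum w (\<lambda>x. \<psi> x * h x)) (freqs R)"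
proof -
  define S where "S = {x::'a. \<forall>b\<in>Basis. \<bar>x \<bullet> b\<bar> < R}"
  have "open (\<Inter>b\<in>Basis. {x::'a. \<bar>x \<bullet> b\<bar> < R})"
    by (intro open_INT finite_Basis ballI open_Collect_less continuous_intros)
  moreover have "S = (\<Inter>b\<in>Basis. {x::'a. \<bar>x \<bullet> b\<bar> < R})" unfolding S_def by blast
  ultimately have S: "open S" by simp
  have "fun_supp \<psi> \<subseteq> S"
  proof
    fix x assume "x \<in> fun_supp \<psi>"
    then have "x \<in> cube r" using \<psi>(2) by blast
    then have "\<bar>x \<bullet> b\<bar> < R" if "b \<in> Basis" for b
      using that r(2) order_le_less_trans unfolding mem_cube by blast
    then show "x \<in> S" unfolding S_def by blast
  qed
  then have \<psi>S: "\<psi> \<in> test_fun S" by (rule test_fun_subset[OF \<psi>(1)])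
  let ?c = "fourier_coef R h"
  let ?FS = "finite_subsets_at_top (freqs R :: 'a set)"
  obtain m C where "\<forall>\<phi>\<in>test_fun \<Omega>. fun_supp \<phi> \<subseteq> fun_supp \<psi> \<longrightarrow> cmod (w \<phi>) \<le> C * Cm_norm m \<phi>"
    using distributionsD(4)[OF w] test_funD(2,3)[OF \<psi>(1)] unfolding continuous_on_DK_def by blast
  note C = this
  obtain c where c: "c \<ge> 0" "\<forall>u e. smooth_on UNIV u \<longrightarrow> e > 0 \<longrightarrow>
    (\<forall>vs. set vs \<subseteq> Basis \<and> length vs \<le> m \<longrightarrow> (\<forall>x\<in>S. cmod (partials vs u x) \<le> e)) \<longrightarrow> Cm_norm m (\<lambda>x. \<psi> x * u x) \<le> c * e"
    using Cm_norm_mult_le[OF \<psi>S S] by blast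
  define u where "u F x = h x - (\<Sum>\<xi>\<in>F. ?c \<xi> * plane_wave \<xi> x)" for F x
  have smF: "smooth_on UNIV (\<lambda>x. \<Sum>\<xi>\<in>F. ?c \<xi> * plane_wave \<xi> x)" if "finite F" for F
    by (intro smooth_on_sum[OF open_UNIV that] smooth_on_mult[OF open_UNIV smooth_on_const smooth_plane_wave])
  have usm: "smooth_on UNIV (u F)" if "finite F" for F
    unfolding u_def[abs_def] by (rule smooth_on_diff[OF open_UNIV h(1) smF[OF that]])
  have pu: "partials vs (u F) x = partials vs h x - (\<Sum>\<xi>\<in>F. fourier_coef R (partials vs h) \<xi> * plane_wave \<xi> x)"
    if F: "finite F" and vs: "set vs \<subseteq> Basis" for F vs x
  proof -
    have "partials vs (\<lambda>x. \<Sum>\<xi>\<in>F. ?c \<xi> * plane_wave \<xi> x) = (\<lambda>x. \<Sum>\<xi>\<in>F. partials vs (\<lambda>x. ?c \<xi> * plane_wave \<xi> x) x)"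
      by (rule partials_sum[OF F smooth_on_mult[OF open_UNIV smooth_on_const smooth_plane_wave] vs])
    moreover have "fourier_coef R (partials vs h) \<xi> = (\<Prod>v\<leftarrow>vs. - \<i> * complex_of_real (\<xi> \<bullet> v)) * ?c \<xi>" for \<xi>
      by (rule fourier_coef_partials[OF h(1) h(2) r(2) vs])
    ultimately show ?thesis
      unfolding u_def[abs_def] partials_diff[OF h(1) smF[OF F] vs] by (simp only: partials_plane_wave) (simp only: mult_ac)
  qed
  have fin: "\<forall>\<^sub>F F in ?FS. finite F \<and> F \<subseteq> freqs R"
    by (simp add: eventually_finite_subsets_at_top) (intro exI[of _ "{}"], simp)
  have small: "\<forall>\<^sub>F F in ?FS. \<forall>x\<in>S. cmod (partials vs (u F) x) \<le> e"
    if vs: "set vs \<subseteq> Basis" and e: "e > 0" for vs and e :: real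
  proof -
    have sm: "smooth_on UNIV (partials vs h)" by (rule smooth_on_partials[OF h(1) vs])
    have out: "partials vs h x = 0" if "x \<notin> cube r" for x
      by (rule partials_outside[OF compact_imp_closed[OF compact_cube] h(2) that])
    have val: "(\<Sum>\<^sub>\<infinity>\<xi>\<in>freqs R. fourier_coef R (partials vs h) \<xi> * plane_wave \<xi> x) = partials vs h x" if "x \<in> S" for x
      by (rule fourier_series(1)[OF sm out r]) (use that in \<open>simp_all add: S_def\<close>)
    have "uniform_limit UNIV (\<lambda>F x. \<Sum>\<xi>\<in>F. fourier_coef R (partials vs h) \<xi> * plane_wave \<xi> x)
      (\<lambda>x. \<Sum>\<^sub>\<infinity>\<xi>\<in>freqs R. fourier_coef R (partials vs h) \<xi> * plane_wave \<xi> x) ?FS"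
      by (rule fourier_series(2)[OF sm out r])
    then have "\<forall>\<^sub>F F in ?FS. \<forall>x\<in>UNIV. dist (\<Sum>\<xi>\<in>F. fourier_coef R (partials vs h) \<xi> * plane_wave \<xi> x)
        (\<Sum>\<^sub>\<infinity>\<xi>\<in>freqs R. fourier_coef R (partials vs h) \<xi> * plane_wave \<xi> x) < e"
      using e unfolding uniform_limit_iff by blast
    with fin show ?thesis
    proof eventually_elim
      case (elim F)
      then have F: "finite F" and d: "\<forall>x\<in>UNIV. dist (\<Sum>\<xi>\<in>F. fourier_coef R (partials vs h) \<xi> * plane_wave \<xi> x)
        (\<Sum>\<^sub>\<infinity>\<xi>\<in>freqs R. fourier_coef R (partials vs h) \<xi> * plane_wave \<xi> x) < e" by blast+
      show ?case
      proof
        fix x assume x: "x \<in> S"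
        from bspec[OF d UNIV_I, of x] show "cmod (partials vs (u F) x) \<le> e"
          unfolding pu[OF F vs] val[OF x] dist_norm by (simp add: norm_minus_commute)
      qed
    qed
  qed
  have "((\<lambda>F. \<Sum>\<xi>\<in>F. ?c \<xi> * w (\<lambda>x. \<psi> x * plane_wave \<xi> x)) \<longlongrightarrow> w (\<lambda>x. \<psi> x * h x)) ?FS"
  proof (rule tendstoI)
    fix e :: real assume e: "e > 0"
    \<comment> \<open>The summand 1 keeps Z positive, so that dividing by it is legitimate.\<close>
    define Z where "Z = \<bar>C\<bar> * c + 1"
    define e' where "e' = e / (2 * Z)"
    have pos: "Z > 0" unfolding Z_def using c(1) by (intro add_nonneg_pos) auto
    have e': "e' > 0" using e pos by (simp add: e'_def)
    let ?L = "{vs :: 'a list. set vs \<subseteq> Basis \<and> length vs \<le> m}"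
    have "finite ?L" by (rule finite_lists_length_le) simp
    then have "\<forall>\<^sub>F F in ?FS. \<forall>vs\<in>?L. \<forall>x\<in>S. cmod (partials vs (u F) x) \<le> e'"
      by (rule eventually_ball_finite) (use small e' in blast)
    with fin show "\<forall>\<^sub>F F in ?FS. dist (\<Sum>\<xi>\<in>F. ?c \<xi> * w (\<lambda>x. \<psi> x * plane_wave \<xi> x)) (w (\<lambda>x. \<psi> x * h x)) < e"
    proof eventually_elim
      case (elim F)
      then have F: "finite F" and le: "\<forall>vs. set vs \<subseteq> Basis \<and> length vs \<le> m \<longrightarrow> (\<forall>x\<in>S. cmod (partials vs (u F) x) \<le> e')" by auto
      have t1: "(\<lambda>x. \<psi> x * h x) \<in> test_fun \<Omega>" by (rule test_fun_mult[OF \<psi>(1) \<Omega> smooth_on_mono[OF h(1) subset_UNIV]])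
      have t2: "(\<lambda>x. \<psi> x * plane_wave \<xi> x) \<in> test_fun \<Omega>" for \<xi> by (rule test_fun_mult[OF \<psi>(1) \<Omega> smooth_plane_wave])
      have "(\<lambda>x. \<psi> x * u F x) = (\<lambda>x. \<psi> x * h x - (\<Sum>\<xi>\<in>F. ?c \<xi> * (\<psi> x * plane_wave \<xi> x)))"
        by (simp add: u_def fun_eq_iff right_diff_distrib sum_distrib_left mult_ac)
      then have "w (\<lambda>x. \<psi> x * u F x) = w (\<lambda>x. \<psi> x * h x) - (\<Sum>\<xi>\<in>F. ?c \<xi> * w (\<lambda>x. \<psi> x * plane_wave \<xi> x))"
        using distribution_diff[OF w t1 test_fun_sum[OF F test_fun_scale[OF t2]]] distribution_sum[OF w F t2] by simp
      moreover have "cmod (w (\<lambda>x. \<psi> x * u F x)) < e"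
      proof -
        have tu: "(\<lambda>x. \<psi> x * u F x) \<in> test_fun \<Omega>"
          by (rule test_fun_mult[OF \<psi>(1) \<Omega> smooth_on_mono[OF usm[OF F] subset_UNIV]])
        have "Cm_norm m (\<lambda>x. \<psi> x * u F x) \<le> c * e'" using c(2) usm[OF F] e' le by blast
        have "cmod (w (\<lambda>x. \<psi> x * u F x)) \<le> C * Cm_norm m (\<lambda>x. \<psi> x * u F x)" using C tu fun_supp_mult(1) by blast
        also have "\<dots> \<le> \<bar>C\<bar> * Cm_norm m (\<lambda>x. \<psi> x * u F x)" using Cm_norm_nonneg[OF tu, of m] by (intro mult_right_mono) auto
        also have "\<dots> \<le> \<bar>C\<bar> * (c * e')" using \<open>Cm_norm m (\<lambda>x. \<psi> x * u F x) \<le> c * e'\<close> by (intro mult_left_mono) auto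
        also have "\<dots> \<le> Z * e'" using e' by (simp add: Z_def algebra_simps)
        also have "\<dots> = e / 2" using pos by (simp add: e'_def)
        also have "\<dots> < e" using e by simp
        finally show ?thesis .
      qed
      ultimately show ?case by (simp add: dist_norm norm_minus_commute)
    qed
  qed
  then show ?thesis by (simp add: has_sum_def)
qed

section \<open>The local estimate\<close>

lemma Cm_norm_cmult_le:
  assumes "\<phi> \<in> test_fun \<Omega>"
  shows "Cm_norm m (\<lambda>x. a * \<phi> x) \<le> cmod a * Cm_norm m \<phi>"
proof (rule Cm_norm_least)
  fix vs :: "'a list" and x assume vs: "set vs \<subseteq> Basis" "length vs \<le> m"
  have "partials vs (\<lambda>x. a * \<phi> x) = (\<lambda>x. a * partials vs \<phi> x)"
    by (rule partials_linear[OF bounded_linear_mult_right test_funD(1)[OF assms] vs(1)])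
  then show "cmod (partials vs (\<lambda>x. a * \<phi> x) x) \<le> cmod a * Cm_norm m \<phi>"
    using Cm_norm_upper[OF assms vs, of x] by (simp add: mult_left_mono norm_mult)
qed

lemma compact_subset_cube:
  fixes K :: "'a::euclidean_space set"
  assumes "compact K"
  shows "\<exists>r>0. K \<subseteq> cube r"
proof -
  obtain B where B: "\<forall>x\<in>K. norm x \<le> B" using compact_imp_bounded[OF assms] unfolding bounded_iff by blast
  have "K \<subseteq> cube (max B 1)"
  proof
    fix x assume "x \<in> K"
    then have x: "norm x \<le> B" using B by blast
    have "\<bar>x \<bullet> b\<bar> \<le> max B 1" if "b \<in> Basis" for b
      using Basis_le_norm[OF that, of x] x by linarith
    then show "x \<in> cube (max B 1)" by (simp add: mem_cube)
  qed
  then show ?thesis by (intro exI[of _ "max B 1"]) simp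
qed

lemma fourier_loc_plane_wave: "fourier_loc u \<theta> k = u (\<lambda>x. \<theta> x * plane_wave k x)"
  by (simp add: fourier_loc_def plane_wave_def)

lemma sup_seminorm_upper: "\<phi> \<in> B \<Longrightarrow> ennreal (cmod (u \<phi>)) \<le> sup_seminorm B u"
  unfolding sup_seminorm_def by (rule SUP_upper)

lemma fourier_seminorm_upper:
  "k \<in> V \<Longrightarrow> ennreal ((1 + norm k) ^ N * cmod (fourier_loc u \<theta> k)) \<le> fourier_seminorm N V \<theta> u"
  unfolding fourier_seminorm_def by (rule SUP_upper)

text \<open>Two cutoffs share the work: \<psi> stays with w and produces the seminorms, while g is
  expanded together with the wave in f. Assumption H1 keeps the phase non-stationary for \<xi>
  outside W, and H2 does so for \<xi> small against k. The triple B, C, M is chosen before w and k,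
  as continuity requires.\<close>

lemma local_estimate:
  fixes f :: "'a::euclidean_space \<Rightarrow> 'b::euclidean_space"
  assumes \<Omega>: "open \<Omega>" and U: "open U" "U \<subseteq> \<Omega>" and f: "smooth_on U f"
    and \<psi>: "\<psi> \<in> test_fun \<Omega>" and g: "g \<in> test_fun U" and c: "c > 0"
    and H1: "\<And>x k \<xi>. x \<in> U \<Longrightarrow> k \<in> V \<Longrightarrow> \<xi> \<notin> W \<Longrightarrow> c * (norm k + norm \<xi>) \<le> norm (covector_pullback f x k - \<xi>)"
    and H2: "\<And>x k. x \<in> U \<Longrightarrow> k \<in> V \<Longrightarrow> c * norm k \<le> norm (covector_pullback f x k)"
  shows "\<exists>B C M. bounded_test_set \<Omega> B \<and> C > 0 \<and> (\<forall>w\<in>distributions \<Omega>. \<forall>k\<in>V.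
    ennreal ((1 + norm k) ^ N * cmod (w (\<lambda>x. \<psi> x * (g x * plane_wave k (f x)))))
      \<le> ennreal C * (sup_seminorm B w + fourier_seminorm M W \<psi> w))"
proof -
  obtain r where r0: "r > 0" and rK: "fun_supp \<psi> \<union> fun_supp g \<subseteq> cube r"
    using compact_subset_cube[OF compact_Un[OF test_funD(2)[OF \<psi>] test_funD(2)[OF g]]] by blast
  define R where "R = r + 1"
  have R: "0 < R" "r < R" using r0 by (auto simp: R_def)
  have r\<psi>: "fun_supp \<psi> \<subseteq> cube r" and rg: "fun_supp g \<subseteq> cube r" using rK by auto
  define h where "h k x = g x * plane_wave k (f x)" for k x
  have hU: "h k \<in> test_fun U" for k
    unfolding h_def by (rule test_fun_mult[OF g U(1) smooth_on_compose[OF U(1) open_UNIV f smooth_plane_wave]]) simp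
  have hout: "h k x = 0" if "x \<notin> cube r" for k x
  proof -
    have "x \<notin> fun_supp g" using that rg by blast
    then show ?thesis by (simp add: h_def fun_supp_outside)
  qed
  define Vd where "Vd = (2 * R) ^ DIM('a)"
  have Vd: "Vd > 0" using R by (simp add: Vd_def)
  have coef: "fourier_coef R (h k) \<xi> = integral (cube R) (\<lambda>x. g x * phase f (k, \<xi>) x) / complex_of_real Vd" for k \<xi>
    by (simp add: fourier_coef_def h_def phase_def Vd_def mult.assoc)
  \<comment> \<open>The constant c / 4 is what H2 leaves: if |\<xi>| is at most (c/2) |k| and at
    most |k|, then c |k| - |\<xi>| \<ge> (c/2) |k| \<ge> (c/4)(|k| + |\<xi>|). The two demands on
    \<xi> are the two entries of the minimum \<delta>.\<close>
  define nonstat where "nonstat k \<xi> \<longleftrightarrow> (\<forall>x\<in>U. (c / 4) * (norm k + norm \<xi>) \<le> norm (covector_pullback f x k - \<xi>))" for k \<xi>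
  define \<delta> where "\<delta> = min (c / 2) 1"
  have \<delta>: "0 < \<delta>" "\<delta> \<le> 1" "\<delta> \<le> c / 2" using c by (auto simp: \<delta>_def)
  have nonstat1: "nonstat k \<xi>" if "k \<in> V" "\<xi> \<notin> W" for k \<xi>
    unfolding nonstat_def
  proof
    fix x assume "x \<in> U"
    have "(c / 4) * (norm k + norm \<xi>) \<le> c * (norm k + norm \<xi>)" using c by (intro mult_right_mono) auto
    then show "(c / 4) * (norm k + norm \<xi>) \<le> norm (covector_pullback f x k - \<xi>)"
      using H1[OF \<open>x \<in> U\<close> that] by linarith
  qed
  have nonstat2: "nonstat k \<xi>" if "k \<in> V" "norm \<xi> \<le> \<delta> * norm k" for k \<xi>
    unfolding nonstat_def
  proof
    fix x assume "x \<in> U"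
    have 1: "norm \<xi> \<le> c / 2 * norm k" using that(2) mult_right_mono[OF \<delta>(3) norm_ge_zero[of k]] by linarith
    have 2: "norm \<xi> \<le> 1 * norm k" using that(2) mult_right_mono[OF \<delta>(2) norm_ge_zero[of k]] by linarith
    have "(c / 4) * (norm k + norm \<xi>) \<le> (c / 4) * (norm k + norm k)" using 2 c by (intro mult_left_mono) auto
    also have "\<dots> = c * norm k - c / 2 * norm k" by simp
    also have "\<dots> \<le> norm (covector_pullback f x k) - norm \<xi>" using H2[OF \<open>x \<in> U\<close> that(1)] 1 by linarith
    also have "\<dots> \<le> norm (covector_pullback f x k - \<xi>)" by (rule norm_triangle_ineq2)
    finally show "(c / 4) * (norm k + norm \<xi>) \<le> norm (covector_pullback f x k - \<xi>)" .
  qed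
  have c4: "c / 4 > 0" using c by simp
  have nsp: "\<exists>C\<ge>0. \<forall>k \<xi>. nonstat k \<xi> \<longrightarrow> (1 + norm k + norm \<xi>) ^ M * cmod (fourier_coef R (h k) \<xi>) \<le> C" for M
  proof -
    obtain C where C: "C \<ge> 0" "\<forall>k \<xi>. nonstat k \<xi> \<longrightarrow>
       (1 + norm k + norm \<xi>) ^ M * cmod (integral (cube R) (\<lambda>x. g x * phase f (k, \<xi>) x)) \<le> C"
      using nonstationary_phase[OF U(1) f g c4 rg R(2,1), of M] unfolding nonstat_def by blast
    have "(1 + norm k + norm \<xi>) ^ M * cmod (fourier_coef R (h k) \<xi>) \<le> C / Vd" if "nonstat k \<xi>" for k \<xi>
    proof -
      have "(1 + norm k + norm \<xi>) ^ M * cmod (integral (cube R) (\<lambda>x. g x * phase f (k, \<xi>) x)) \<le> C"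
        using C(2) that by blast
      then show ?thesis unfolding coef using Vd by (simp add: norm_divide divide_right_mono)
    qed
    moreover have "C / Vd \<ge> 0" using C(1) Vd by simp
    ultimately show ?thesis by blast
  qed
  \<comment> \<open>The power of 1 + |\<xi>| that is spent on summability over the lattice.\<close>
  define d2 where "d2 = 2 * DIM('a)"
  \<comment> \<open>The coefficient goes into the test function with both weights: the decay in k
    that is claimed, and the decay in \<xi> that makes the series summable.\<close>
  define a where "a k \<xi> = complex_of_real ((1 + norm k) ^ N * (1 + norm \<xi>) ^ d2) * fourier_coef R (h k) \<xi>" for k \<xi>
  define B where "B = {(\<lambda>x. a k \<xi> * (\<psi> x * plane_wave \<xi> x)) |k \<xi>. nonstat k \<xi>}"
  have \<psi>pw: "(\<lambda>x. \<psi> x * plane_wave \<xi> x) \<in> test_fun \<Omega>" for \<xi> by (rule test_fun_mult[OF \<psi> \<Omega> smooth_plane_wave])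
  have one: "1 + norm v \<ge> 1" for v :: "'c::real_normed_vector" by simp
  have na: "cmod (a k \<xi>) = (1 + norm k) ^ N * (1 + norm \<xi>) ^ d2 * cmod (fourier_coef R (h k) \<xi>)" for k \<xi>
  proof -
    have "(1 + norm k) ^ N * (1 + norm \<xi>) ^ d2 \<ge> 0" by simp
    then show ?thesis unfolding a_def norm_mult norm_of_real by simp
  qed
  have Bb: "bounded_test_set \<Omega> B"
  proof (rule bounded_test_setI[OF _ test_funD(2,3)[OF \<psi>]])
    show "B \<subseteq> test_fun \<Omega>"
    proof
      fix \<phi> assume "\<phi> \<in> B"
      then obtain k \<xi> where "\<phi> = (\<lambda>x. a k \<xi> * (\<psi> x * plane_wave \<xi> x))" unfolding B_def by blast
      then show "\<phi> \<in> test_fun \<Omega>" using test_fun_scale[OF \<psi>pw] by simp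
    qed
    show "fun_supp \<phi> \<subseteq> fun_supp \<psi>" if \<phi>: "\<phi> \<in> B" for \<phi>
    proof -
      obtain k \<xi> where "\<phi> = (\<lambda>x. a k \<xi> * (\<psi> x * plane_wave \<xi> x))" using \<phi> unfolding B_def by blast
      then show ?thesis by (intro fun_supp_mono) simp
    qed
    show "\<exists>C. \<forall>\<phi>\<in>B. Cm_norm m \<phi> \<le> C" for m
    proof -
      obtain c1 where c1: "c1 \<ge> 0" "\<forall>\<xi>. Cm_norm m (\<lambda>x. \<psi> x * plane_wave \<xi> x) \<le> c1 * (1 + norm \<xi>) ^ m"
        using Cm_norm_mult_plane_wave[OF \<psi>] by blast
      \<comment> \<open>N and d2 pay for the two weights, and m for the derivatives that fall on the
        wave of frequency \<xi>.\<close>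
      obtain C where C: "C \<ge> 0" "\<forall>k \<xi>. nonstat k \<xi> \<longrightarrow> (1 + norm k + norm \<xi>) ^ (N + d2 + m) * cmod (fourier_coef R (h k) \<xi>) \<le> C"
        using nsp by blast
      have "Cm_norm m \<phi> \<le> c1 * C" if \<phi>: "\<phi> \<in> B" for \<phi>
      proof -
        obtain k \<xi> where e: "\<phi> = (\<lambda>x. a k \<xi> * (\<psi> x * plane_wave \<xi> x))" and n: "nonstat k \<xi>" using \<phi> unfolding B_def by blast
        let ?s = "1 + norm k + norm \<xi>" and ?f = "cmod (fourier_coef R (h k) \<xi>)"
        have p: "(1 + norm k) ^ N \<le> ?s ^ N" "(1 + norm \<xi>) ^ d2 \<le> ?s ^ d2" "(1 + norm \<xi>) ^ m \<le> ?s ^ m"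
          by (intro power_mono; simp)+
        have "Cm_norm m \<phi> \<le> cmod (a k \<xi>) * Cm_norm m (\<lambda>x. \<psi> x * plane_wave \<xi> x)"
          unfolding e by (rule Cm_norm_cmult_le[OF \<psi>pw])
        also have "\<dots> \<le> cmod (a k \<xi>) * (c1 * (1 + norm \<xi>) ^ m)" using c1(2) by (intro mult_left_mono) auto
        also have "\<dots> = c1 * (((1 + norm k) ^ N * (1 + norm \<xi>) ^ d2 * (1 + norm \<xi>) ^ m) * ?f)"
          unfolding na by (simp only: mult_ac)
        also have "\<dots> \<le> c1 * ((?s ^ N * ?s ^ d2 * ?s ^ m) * ?f)"
          using p c1(1) by (intro mult_left_mono mult_right_mono mult_mono) auto
        also have "\<dots> = c1 * (?s ^ (N + d2 + m) * ?f)" by (simp only: power_add)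
        also have "\<dots> \<le> c1 * C" using C(2) n c1(1) by (intro mult_left_mono) auto
        finally show ?thesis .
      qed
      then show ?thesis by blast
    qed
  qed
  obtain G where G: "G \<ge> 0" "\<forall>p\<in>(UNIV::unit set). \<forall>x\<in>UNIV. cmod (g x) \<le> G"
    using Cm_bounded_norm_le[OF test_fun_Cm_bounded[OF g, of 0 "UNIV :: unit set"]] by blast
  have coefG: "cmod (fourier_coef R (h k) \<xi>) \<le> G" for k \<xi>
    by (rule norm_fourier_coef_le[OF R(1) continuous_on_subset[OF smooth_on_continuous[OF test_funD(1)[OF hU]] subset_UNIV]])
       (use G(2) in \<open>simp add: h_def norm_mult\<close>)
  define Z where "Z = (\<Sum>\<^sub>\<infinity>\<xi>\<in>(freqs R :: 'a set). 1 / (1 + norm \<xi>) ^ d2)"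
  have Zs: "((\<lambda>\<xi>. 1 / (1 + norm \<xi>) ^ d2) has_sum Z) (freqs R :: 'a set)"
    unfolding Z_def d2_def by (rule has_sum_infsum[OF freqs_summable[OF R(1)]])
  have Z0: "Z \<ge> 0" unfolding Z_def by (rule infsum_nonneg) simp
  \<comment> \<open>Large enough for both kinds of terms: 1 for those controlled by the bounded set,
    the rest for those controlled by decay in W.\<close>
  define D where "D = 1 + G * (1 / \<delta>) ^ N"
  have D: "D \<ge> 1" "D \<ge> G * (1 / \<delta>) ^ N" using G(1) \<delta>(1) by (auto simp: D_def)
  define C where "C = D * (Z + 1)"
  have C0: "C > 0" unfolding C_def using D(1) Z0 by (intro mult_pos_pos) auto
  have main: "ennreal ((1 + norm k) ^ N * cmod (w (\<lambda>x. \<psi> x * h k x)))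
      \<le> ennreal C * (sup_seminorm B w + fourier_seminorm (N + d2) W \<psi> w)"
    if w: "w \<in> distributions \<Omega>" and k: "k \<in> V" for w k
  proof (cases "sup_seminorm B w = top \<or> fourier_seminorm (N + d2) W \<psi> w = top")
    case True
    then have "ennreal C * (sup_seminorm B w + fourier_seminorm (N + d2) W \<psi> w) = top"
      using C0 by (auto simp: ennreal_mult_eq_top_iff)
    then show ?thesis by simp
  next
    case False
    then obtain s t where s: "s \<ge> 0" "sup_seminorm B w = ennreal s" and t: "t \<ge> 0" "fourier_seminorm (N + d2) W \<psi> w = ennreal t"
      by (metis ennreal_cases)
    let ?w = "\<lambda>\<xi>. w (\<lambda>x. \<psi> x * plane_wave \<xi> x)"
    have ts: "(1 + norm k) ^ N * (cmod (fourier_coef R (h k) \<xi>) * cmod (?w \<xi>)) * (1 + norm \<xi>) ^ d2 \<le> s" if n: "nonstat k \<xi>" for \<xi>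
    proof -
      have "(\<lambda>x. a k \<xi> * (\<psi> x * plane_wave \<xi> x)) \<in> B" unfolding B_def using n by blast
      from sup_seminorm_upper[OF this, of w] have "cmod (w (\<lambda>x. a k \<xi> * (\<psi> x * plane_wave \<xi> x))) \<le> s"
        unfolding s(2) using s(1) by simp
      then show ?thesis unfolding distributionsD(3)[OF w \<psi>pw] norm_mult na by (simp only: mult_ac)
    qed
    \<comment> \<open>As |k| \<le> |\<xi>| / \<delta>, the weight in k is converted into a weight in
      \<xi>; this asks N more orders of decay from w, hence the order N + d2 in the
      seminorm.\<close>
    have tt: "(1 + norm k) ^ N * (cmod (fourier_coef R (h k) \<xi>) * cmod (?w \<xi>)) * (1 + norm \<xi>) ^ d2 \<le> G * (1 / \<delta>) ^ N * t"
      if \<xi>W: "\<xi> \<in> W" and \<xi>k: "\<delta> * norm k \<le> norm \<xi>" for \<xi>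
    proof -
      have tw: "(1 + norm \<xi>) ^ (N + d2) * cmod (?w \<xi>) \<le> t"
        using fourier_seminorm_upper[OF \<xi>W, of "N + d2" w \<psi>] t unfolding fourier_loc_plane_wave by simp
      have "1 + norm k \<le> (1 / \<delta>) * (1 + norm \<xi>)"
        using \<xi>k \<delta>(1,2) by (simp add: field_simps)
      then have "(1 + norm k) ^ N \<le> ((1 / \<delta>) * (1 + norm \<xi>)) ^ N" by (intro power_mono) auto
      then have "(1 + norm k) ^ N \<le> (1 / \<delta>) ^ N * (1 + norm \<xi>) ^ N" by (simp only: power_mult_distrib)
      then have "(1 + norm k) ^ N * (cmod (fourier_coef R (h k) \<xi>) * cmod (?w \<xi>)) * (1 + norm \<xi>) ^ d2
          \<le> ((1 / \<delta>) ^ N * (1 + norm \<xi>) ^ N) * (G * cmod (?w \<xi>)) * (1 + norm \<xi>) ^ d2"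
        using coefG \<delta>(1) by (intro mult_right_mono mult_mono) auto
      also have "\<dots> = G * (1 / \<delta>) ^ N * ((1 + norm \<xi>) ^ (N + d2) * cmod (?w \<xi>))"
        by (simp only: power_add mult_ac)
      also have "\<dots> \<le> G * (1 / \<delta>) ^ N * t"
        by (rule mult_left_mono[OF tw]) (use G(1) \<delta>(1) in simp)
      finally show ?thesis .
    qed
    define E where "E = s + G * (1 / \<delta>) ^ N * t"
    have GN: "G * (1 / \<delta>) ^ N * t \<ge> 0" using G(1) \<delta>(1) t(1) by simp
    have tle: "(1 + norm k) ^ N * (cmod (fourier_coef R (h k) \<xi>) * cmod (?w \<xi>)) \<le> E * (1 / (1 + norm \<xi>) ^ d2)" for \<xi>
    proof -
      have "(1 + norm k) ^ N * (cmod (fourier_coef R (h k) \<xi>) * cmod (?w \<xi>)) * (1 + norm \<xi>) ^ d2 \<le> E"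
      proof (cases "\<xi> \<in> W \<and> \<delta> * norm k \<le> norm \<xi>")
        case True
        then show ?thesis using tt[of \<xi>] s(1) unfolding E_def by linarith
      next
        case False
        then have "nonstat k \<xi>" using nonstat1[OF k, of \<xi>] nonstat2[OF k, of \<xi>] by linarith
        then show ?thesis using ts[of \<xi>] GN unfolding E_def by linarith
      qed
      moreover have "(1 + norm \<xi>) ^ d2 > 0" by (intro zero_less_power add_pos_nonneg) auto
      ultimately show ?thesis by (simp add: pos_le_divide_eq)
    qed
    have "((\<lambda>\<xi>. complex_of_real ((1 + norm k) ^ N) * (fourier_coef R (h k) \<xi> * ?w \<xi>)) has_sum
        complex_of_real ((1 + norm k) ^ N) * w (\<lambda>x. \<psi> x * h k x)) (freqs R)"
      by (intro has_sum_cmult_right distribution_fourier_series[OF w \<Omega> \<psi> r\<psi> test_funD(1)[OF hU] hout R])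
    moreover have "((\<lambda>\<xi>. E * (1 / (1 + norm \<xi>) ^ d2)) has_sum E * Z) (freqs R :: 'a set)"
      by (rule has_sum_cmult_right[OF Zs])
    ultimately have "norm (complex_of_real ((1 + norm k) ^ N) * w (\<lambda>x. \<psi> x * h k x)) \<le> E * Z"
    proof (rule norm_infsum_le)
      fix \<xi> :: 'a
      have "(1 + norm k) ^ N \<ge> 0" by simp
      then show "norm (complex_of_real ((1 + norm k) ^ N) * (fourier_coef R (h k) \<xi> * ?w \<xi>)) \<le> E * (1 / (1 + norm \<xi>) ^ d2)"
        using tle[of \<xi>] unfolding norm_mult norm_of_real by simp
    qed
    then have "(1 + norm k) ^ N * cmod (w (\<lambda>x. \<psi> x * h k x)) \<le> E * Z"
      unfolding norm_mult norm_of_real by simp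
    also have "\<dots> \<le> (D * (s + t)) * (Z + 1)"
    proof (intro mult_mono)
      have "G * (1 / \<delta>) ^ N * t \<le> D * t" using D(2) t(1) by (rule mult_right_mono)
      moreover have "s \<le> D * s" using D(1) s(1) mult_right_mono[of 1 D s] by simp
      ultimately show "E \<le> D * (s + t)" unfolding E_def by (simp add: distrib_left)
      show "0 \<le> D * (s + t)" using D(1) s(1) t(1) by simp
    qed (use Z0 in auto)
    also have "\<dots> = C * (s + t)" by (simp add: C_def mult_ac)
    finally have "ennreal ((1 + norm k) ^ N * cmod (w (\<lambda>x. \<psi> x * h k x))) \<le> ennreal (C * (s + t))" by (rule ennreal_leI)
    also have "\<dots> = ennreal C * (ennreal s + ennreal t)"
      using C0 s(1) t(1) by (simp add: ennreal_mult ennreal_plus)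
    finally show ?thesis by (simp only: s(2) t(2))
  qed
  show ?thesis
    by (rule exI[of _ B], rule exI[of _ C], rule exI[of _ "N + d2"], intro conjI ballI Bb C0, unfold h_def[symmetric], rule main)
qed

section \<open>Finiteness of the Fourier seminorms\<close>

text \<open>The modulus of a distribution is itself one of the continuous seminorms that bounded
  sets are tested with.\<close>

lemma sup_seminorm_finite:
  assumes u: "u \<in> distributions \<Omega>" and B: "bounded_test_set \<Omega> B"
  shows "sup_seminorm B u < top"
proof -
  have "test_seminorm \<Omega> (\<lambda>\<phi>. cmod (u \<phi>))"
    unfolding test_seminorm_def
    by (simp add: distributionsD(2,3)[OF u] norm_triangle_ineq norm_mult)
  then have "bdd_above ((\<lambda>\<phi>. cmod (u \<phi>)) ` B)"
    using B[unfolded bounded_test_set_def, THEN conjunct2, THEN spec, of "\<lambda>\<phi>. cmod (u \<phi>)"] distributionsD(4)[OF u] by simp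
  then obtain M where "\<And>\<phi>. \<phi> \<in> B \<Longrightarrow> cmod (u \<phi>) \<le> M" unfolding bdd_above_def by auto
  then have "sup_seminorm B u \<le> ennreal M"
    unfolding sup_seminorm_def by (intro SUP_least ennreal_leI)
  then show ?thesis by (rule order_le_less_trans) simp
qed

text \<open>For a unit vector \<eta>, a cone around its ray. The comparison with
  \<open>norm k *\<^sub>R \<eta>\<close> contains no division, which makes closedness and
  homogeneity immediate; k = 0 belongs to it.\<close>

definition sector :: "'a::euclidean_space \<Rightarrow> real \<Rightarrow> 'a set" where
  "sector \<eta> \<epsilon> = {k. norm (k - norm k *\<^sub>R \<eta>) \<le> \<epsilon> * norm k}"

lemma closed_sector: "closed (sector \<eta> \<epsilon>)"
  unfolding sector_def by (intro closed_Collect_le continuous_intros)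

lemma sector_scale:
  assumes "t > 0"
  shows "t *\<^sub>R k \<in> sector \<eta> \<epsilon> \<longleftrightarrow> k \<in> sector \<eta> \<epsilon>"
proof -
  have "t *\<^sub>R k - norm (t *\<^sub>R k) *\<^sub>R \<eta> = t *\<^sub>R (k - norm k *\<^sub>R \<eta>)"
    using assms by (simp add: scaleR_diff_right)
  then have "norm (t *\<^sub>R k - norm (t *\<^sub>R k) *\<^sub>R \<eta>) = t * norm (k - norm k *\<^sub>R \<eta>)"
    using assms by simp
  moreover have "\<epsilon> * norm (t *\<^sub>R k) = t * (\<epsilon> * norm k)" using assms by simp
  ultimately show ?thesis using assms unfolding sector_def by simp
qed

lemma conic_sector: "conic (sector \<eta> \<epsilon>)"
  unfolding conic_def using sector_scale by blast

lemma covector_pullback_ident: "covector_pullback (\<lambda>x. x) x k = k"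
proof (rule euclidean_eqI)
  fix b :: 'a assume "b \<in> Basis"
  from covector_pullback_inner[OF this, of "\<lambda>x. x" x k]
  show "covector_pullback (\<lambda>x. x) x k \<bullet> b = k \<bullet> b" by simp
qed

text \<open>After division by |k| the point k is within \<epsilon> of \<eta>, whereas \<xi> stays
  outside the ball of radius 2 \<epsilon>; hence |k| \<le> |k - \<xi>| / \<epsilon>. The constant
  comes from adding |\<xi>| \<le> |k| + |k - \<xi>|.\<close>

lemma sector_far:
  assumes W: "conic W" "cball \<eta> (2 * \<epsilon>) \<subseteq> W" and \<epsilon>: "\<epsilon> > 0" and k: "k \<in> sector \<eta> \<epsilon>" and \<xi>: "\<xi> \<notin> W"
  shows "1 / (1 + 2 / \<epsilon>) * (norm k + norm \<xi>) \<le> norm (k - \<xi>)"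
proof -
  let ?t = "norm k"
  have far: "\<epsilon> * ?t \<le> norm (k - \<xi>)"
  proof (cases "k = 0")
    case False
    then have t: "?t > 0" by simp
    have "(1 / ?t) *\<^sub>R \<xi> \<notin> W"
    proof
      assume "(1 / ?t) *\<^sub>R \<xi> \<in> W"
      then have "?t *\<^sub>R ((1 / ?t) *\<^sub>R \<xi>) \<in> W" using W(1) t unfolding conic_def by blast
      then show False using \<xi> t by simp
    qed
    then have "(1 / ?t) *\<^sub>R \<xi> \<notin> cball \<eta> (2 * \<epsilon>)" using W(2) by blast
    then have "2 * \<epsilon> \<le> norm (\<eta> - (1 / ?t) *\<^sub>R \<xi>)" by (simp add: dist_norm)
    then have "?t * (2 * \<epsilon>) \<le> ?t * norm (\<eta> - (1 / ?t) *\<^sub>R \<xi>)" using t by (intro mult_left_mono) auto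
    also have "\<dots> = norm (?t *\<^sub>R (\<eta> - (1 / ?t) *\<^sub>R \<xi>))" by simp
    also have "?t *\<^sub>R (\<eta> - (1 / ?t) *\<^sub>R \<xi>) = ?t *\<^sub>R \<eta> - \<xi>" using t by (simp add: scaleR_diff_right)
    finally have "2 * (\<epsilon> * ?t) \<le> norm (?t *\<^sub>R \<eta> - \<xi>)" by (simp add: mult_ac)
    also have "\<dots> = norm ((k - \<xi>) - (k - ?t *\<^sub>R \<eta>))" by (simp add: algebra_simps)
    also have "\<dots> \<le> norm (k - \<xi>) + norm (k - ?t *\<^sub>R \<eta>)" by (rule norm_triangle_ineq4)
    also have "norm (k - ?t *\<^sub>R \<eta>) \<le> \<epsilon> * ?t" using k by (simp add: sector_def)
    finally show ?thesis by simp
  qed simp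
  have "norm \<xi> \<le> norm k + norm (k - \<xi>)" using norm_triangle_ineq2[of \<xi> k] by (simp add: norm_minus_commute)
  moreover define A where "A = norm (k - \<xi>) / \<epsilon>"
  then have "?t \<le> A" using far \<epsilon> by (simp add: pos_le_divide_eq mult.commute)
  ultimately have "norm k + norm \<xi> \<le> 2 * A + norm (k - \<xi>)" by linarith
  also have "\<dots> = (1 + 2 / \<epsilon>) * norm (k - \<xi>)" using \<epsilon> by (simp add: A_def field_simps)
  finally have "norm k + norm \<xi> \<le> (1 + 2 / \<epsilon>) * norm (k - \<xi>)" .
  moreover have "1 + 2 / \<epsilon> > 0" using \<epsilon> by (simp add: add_pos_pos)
  ultimately show ?thesis by (simp add: pos_divide_le_eq mult.commute)
qed

text \<open>The local estimate for the identity map with g = \<rho> / \<psi>, which is smooth where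
  \<psi> does not vanish, so that \<psi> g = \<rho>. The decay drawn from \<psi> may be of higher
  order than N, hence the assumption for all orders.\<close>

lemma microlocal_cutoff:
  fixes u :: "'a::euclidean_space functional"
  assumes u: "u \<in> distributions \<Omega>" and \<Omega>: "open \<Omega>" and \<psi>: "\<psi> \<in> test_fun \<Omega>" "\<psi> x \<noteq> 0"
    and W: "open W" "conic W" "\<eta> \<in> W" and fin: "\<And>N. fourier_seminorm N W \<psi> u < \<infinity>"
  shows "\<exists>U \<epsilon>. open U \<and> x \<in> U \<and> \<epsilon> > 0 \<and> (\<forall>\<rho>\<in>test_fun \<Omega>. fun_supp \<rho> \<subseteq> U \<longrightarrow>
    fourier_seminorm N (sector \<eta> \<epsilon>) \<rho> u < top)"
proof -
  define U where "U = {y. \<psi> y \<noteq> 0}"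
  have U: "open U" unfolding U_def
    by (rule open_Collect_neq[OF smooth_on_continuous[OF test_funD(1)[OF \<psi>(1)]] continuous_on_const])
  have U\<Omega>: "U \<subseteq> \<Omega>" using fun_supp_outside[of _ \<psi>] test_funD(3)[OF \<psi>(1)] unfolding U_def by blast
  obtain \<epsilon> where \<epsilon>: "\<epsilon> > 0" "cball \<eta> (2 * \<epsilon>) \<subseteq> W" using open_contains_cball2[OF W(1,3)] by blast
  define c where "c = 1 / (1 + 2 / \<epsilon>)"
  have c: "c > 0" "c \<le> 1" using \<epsilon>(1) by (auto simp: c_def add_pos_pos)
  have "fourier_seminorm N (sector \<eta> \<epsilon>) \<rho> u < top" if \<rho>: "\<rho> \<in> test_fun \<Omega>" "fun_supp \<rho> \<subseteq> U" for \<rho>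
  proof -
    define g where "g y = \<rho> y * inverse (\<psi> y)" for y
    have \<rho>U: "\<rho> \<in> test_fun U" by (rule test_fun_subset[OF \<rho>])
    have g: "g \<in> test_fun U" unfolding g_def
      by (rule test_fun_mult[OF \<rho>U U smooth_on_inverse[OF U smooth_on_mono[OF test_funD(1)[OF \<psi>(1)] subset_UNIV]]])
         (simp add: U_def)
    have id: "smooth_on U (\<lambda>x::'a. x)" by (rule smooth_on_mono[OF smooth_on_ident subset_UNIV])
    have H1: "c * (norm k + norm \<xi>) \<le> norm (covector_pullback (\<lambda>x. x) y k - \<xi>)" if "k \<in> sector \<eta> \<epsilon>" "\<xi> \<notin> W" for y k \<xi>
      unfolding covector_pullback_ident c_def by (rule sector_far[OF W(2) \<epsilon>(2,1) that])
    have H2: "c * norm k \<le> norm (covector_pullback (\<lambda>x. x) y k)" if "k \<in> sector \<eta> \<epsilon>" for y k :: 'a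
      unfolding covector_pullback_ident using mult_right_mono[OF c(2) norm_ge_zero[of k]] by simp
    have "\<exists>B C M. bounded_test_set \<Omega> B \<and> C > 0 \<and> (\<forall>w\<in>distributions \<Omega>. \<forall>k\<in>sector \<eta> \<epsilon>.
        ennreal ((1 + norm k) ^ N * cmod (w (\<lambda>x. \<psi> x * (g x * plane_wave k x))))
          \<le> ennreal C * (sup_seminorm B w + fourier_seminorm M W \<psi> w))"
      by (rule local_estimate[OF \<Omega> U U\<Omega> id \<psi>(1) g c(1)]) (rule H1 H2, assumption+)+
    then obtain B C M where B: "bounded_test_set \<Omega> B" and est: "\<forall>w\<in>distributions \<Omega>. \<forall>k\<in>sector \<eta> \<epsilon>.
        ennreal ((1 + norm k) ^ N * cmod (w (\<lambda>x. \<psi> x * (g x * plane_wave k x))))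
          \<le> ennreal C * (sup_seminorm B w + fourier_seminorm M W \<psi> w)" by blast
    have eq: "(\<lambda>x. \<psi> x * (g x * plane_wave k x)) = (\<lambda>x. \<rho> x * plane_wave k x)" for k
    proof
      fix y
      show "\<psi> y * (g y * plane_wave k y) = \<rho> y * plane_wave k y"
      proof (cases "\<psi> y = 0")
        case True
        then have "y \<notin> fun_supp \<rho>" using \<rho>(2) by (auto simp: U_def)
        then show ?thesis using True by (simp add: fun_supp_outside)
      qed (simp add: g_def)
    qed
    have "fourier_seminorm N (sector \<eta> \<epsilon>) \<rho> u \<le> ennreal C * (sup_seminorm B u + fourier_seminorm M W \<psi> u)"
      unfolding fourier_seminorm_def[of N] fourier_loc_plane_wave
      by (rule SUP_least) (use est u in \<open>simp only: eq\<close>)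
    also have "\<dots> < top"
      using sup_seminorm_finite[OF u B] fin[of M] by (simp add: ennreal_mult_less_top)
    finally show ?thesis .
  qed
  then show ?thesis using U \<psi>(2) \<epsilon>(1) by (intro exI[of _ U] exI[of _ \<epsilon>]) (simp add: U_def)
qed

lemma fourier_seminorm_mono: "V \<subseteq> V' \<Longrightarrow> fourier_seminorm N V \<theta> u \<le> fourier_seminorm N V' \<theta> u"
  unfolding fourier_seminorm_def by (rule SUP_subset_mono) auto

lemma fourier_seminorm_add:
  assumes u: "u \<in> distributions \<Omega>" and \<Omega>: "open \<Omega>" and \<phi>: "\<phi> \<in> test_fun \<Omega>" and \<psi>: "\<psi> \<in> test_fun \<Omega>"
  shows "fourier_seminorm N V (\<lambda>x. \<phi> x + \<psi> x) u \<le> fourier_seminorm N V \<phi> u + fourier_seminorm N V \<psi> u"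
  unfolding fourier_seminorm_def[of N V "\<lambda>x. \<phi> x + \<psi> x"]
proof (rule SUP_least)
  fix k assume k: "k \<in> V"
  have "fourier_loc u (\<lambda>x. \<phi> x + \<psi> x) k = fourier_loc u \<phi> k + fourier_loc u \<psi> k"
    unfolding fourier_loc_plane_wave distrib_right
    by (rule distributionsD(2)[OF u test_fun_mult[OF \<phi> \<Omega> smooth_plane_wave] test_fun_mult[OF \<psi> \<Omega> smooth_plane_wave]])
  then have "(1 + norm k) ^ N * cmod (fourier_loc u (\<lambda>x. \<phi> x + \<psi> x) k)
      \<le> (1 + norm k) ^ N * cmod (fourier_loc u \<phi> k) + (1 + norm k) ^ N * cmod (fourier_loc u \<psi> k)"
    unfolding distrib_left[symmetric] by (intro mult_left_mono) (simp_all add: norm_triangle_ineq)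
  then have "ennreal ((1 + norm k) ^ N * cmod (fourier_loc u (\<lambda>x. \<phi> x + \<psi> x) k))
      \<le> ennreal ((1 + norm k) ^ N * cmod (fourier_loc u \<phi> k) + (1 + norm k) ^ N * cmod (fourier_loc u \<psi> k))"
    by (rule ennreal_leI)
  also have "\<dots> = ennreal ((1 + norm k) ^ N * cmod (fourier_loc u \<phi> k)) + ennreal ((1 + norm k) ^ N * cmod (fourier_loc u \<psi> k))"
    by (rule ennreal_plus) auto
  also have "\<dots> \<le> fourier_seminorm N V \<phi> u + fourier_seminorm N V \<psi> u"
    by (intro add_mono fourier_seminorm_upper k)
  finally show "ennreal ((1 + norm k) ^ N * cmod (fourier_loc u (\<lambda>x. \<phi> x + \<psi> x) k))
      \<le> fourier_seminorm N V \<phi> u + fourier_seminorm N V \<psi> u" .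
qed

lemma sector_normalised:
  assumes "k \<noteq> 0" "norm ((1 / norm k) *\<^sub>R k - \<eta>) \<le> \<epsilon>"
  shows "k \<in> sector \<eta> \<epsilon>"
proof -
  have "norm k * norm ((1 / norm k) *\<^sub>R k - \<eta>) = norm (norm k *\<^sub>R ((1 / norm k) *\<^sub>R k - \<eta>))" by simp
  also have "norm k *\<^sub>R ((1 / norm k) *\<^sub>R k - \<eta>) = k - norm k *\<^sub>R \<eta>"
    using assms(1) by (simp add: scaleR_diff_right)
  finally have "norm (k - norm k *\<^sub>R \<eta>) = norm k * norm ((1 / norm k) *\<^sub>R k - \<eta>)" by simp
  also have "\<dots> \<le> norm k * \<epsilon>" using assms(2) by (intro mult_left_mono) auto
  finally show ?thesis by (simp add: sector_def mult.commute)
qed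

lemma sector_normalised_dist:
  assumes "k \<noteq> 0" "k \<in> sector \<eta> \<epsilon>"
  shows "norm ((1 / norm k) *\<^sub>R k - \<eta>) \<le> \<epsilon>"
proof -
  have t: "norm k > 0" using assms(1) by simp
  have "norm k * norm ((1 / norm k) *\<^sub>R k - \<eta>) = norm (norm k *\<^sub>R ((1 / norm k) *\<^sub>R k - \<eta>))" by simp
  also have "norm k *\<^sub>R ((1 / norm k) *\<^sub>R k - \<eta>) = k - norm k *\<^sub>R \<eta>"
    using assms(1) by (simp add: scaleR_diff_right)
  finally have "norm k * norm ((1 / norm k) *\<^sub>R k - \<eta>) \<le> norm k * \<epsilon>"
    using assms(2) by (simp add: sector_def mult.commute)
  then show ?thesis using t by simp
qed

lemma ennreal_sum_finite:
  fixes f :: "'i \<Rightarrow> ennreal"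
  assumes "finite J" "\<And>j. j \<in> J \<Longrightarrow> f j < top"
  shows "sum f J < top"
  using assms by (induction J rule: finite_induct) simp_all

text \<open>Two compactness arguments join the data that the wave front set supplies covector by
  covector: over the unit directions in V at a fixed base point, and, through localisation, over the
  base points.\<close>

lemma fourier_seminorm_finite:
  fixes u :: "'a::euclidean_space functional"
  assumes \<Omega>: "open \<Omega>" and u: "u \<in> dist_WF \<Omega> \<Gamma>" and \<theta>: "\<theta> \<in> test_fun \<Omega>" and V: "closed V" "conic V"
    and disj: "(fun_supp \<theta> \<times> V) \<inter> \<Gamma> = {}"
  shows "fourier_seminorm N V \<theta> u < top"
proof -
  have ud: "u \<in> distributions \<Omega>" and uWF: "wave_front \<Omega> u \<subseteq> \<Gamma>" using u by (auto simp: dist_WF_def)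
  have \<rho>\<theta>: "(\<lambda>x. \<rho> x * \<theta> x) \<in> test_fun \<Omega>" if "\<rho> \<in> test_fun \<Omega>" for \<rho>
    by (rule test_fun_mult[OF that \<Omega> smooth_on_mono[OF test_funD(1)[OF \<theta>] subset_UNIV]])
  have zero: "fourier_seminorm N V (\<lambda>x. 0) u < top"
    unfolding fourier_seminorm_def fourier_loc_plane_wave
    by (rule order_le_less_trans[OF SUP_least[where u = 0]]) (simp_all add: distribution_zero[OF ud])
  \<comment> \<open>Only the factor \<rho> is localised. Keeping \<theta> makes the pieces off its
    support vanish, and at the points of the support the covectors in V avoid \<Gamma>. In the end
    \<rho> is 1 near the support of \<theta>.\<close>
  have P: "fourier_seminorm N V (\<lambda>x. \<rho> x * \<theta> x) u < top" if "\<rho> \<in> test_fun \<Omega>" for \<rho>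
  proof (rule test_fun_localize[OF \<Omega> _ _ _ that, of "\<lambda>\<rho>. fourier_seminorm N V (\<lambda>x. \<rho> x * \<theta> x) u < top"])
    show "fourier_seminorm N V (\<lambda>x. 0 * \<theta> x) u < top" using zero by simp
  next
    fix \<phi> \<psi> assume a: "\<phi> \<in> test_fun \<Omega>" "\<psi> \<in> test_fun \<Omega>"
      "fourier_seminorm N V (\<lambda>x. \<phi> x * \<theta> x) u < top" "fourier_seminorm N V (\<lambda>x. \<psi> x * \<theta> x) u < top"
    have "fourier_seminorm N V (\<lambda>x. \<phi> x * \<theta> x + \<psi> x * \<theta> x) u
        \<le> fourier_seminorm N V (\<lambda>x. \<phi> x * \<theta> x) u + fourier_seminorm N V (\<lambda>x. \<psi> x * \<theta> x) u"
      by (rule fourier_seminorm_add[OF ud \<Omega> \<rho>\<theta>[OF a(1)] \<rho>\<theta>[OF a(2)]])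
    also have "\<dots> < top" using a(3,4) by simp
    finally show "fourier_seminorm N V (\<lambda>x. (\<phi> x + \<psi> x) * \<theta> x) u < top" by (simp only: distrib_right)
  next
    fix x assume x: "x \<in> \<Omega>"
    show "\<exists>U. open U \<and> x \<in> U \<and> (\<forall>\<rho>\<in>test_fun \<Omega>. fun_supp \<rho> \<subseteq> U \<longrightarrow> fourier_seminorm N V (\<lambda>x. \<rho> x * \<theta> x) u < top)"
    proof (cases "x \<in> fun_supp \<theta>")
      case False
      have "fourier_seminorm N V (\<lambda>x. \<rho> x * \<theta> x) u < top" if "fun_supp \<rho> \<subseteq> - fun_supp \<theta>" for \<rho>
      proof -
        have "\<rho> y * \<theta> y = 0" for y using that fun_supp_outside[of y \<rho>] fun_supp_outside[of y \<theta>] by auto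
        then have "(\<lambda>y. \<rho> y * \<theta> y) = (\<lambda>_. 0)" by (rule ext)
        then show ?thesis using zero by simp
      qed
      then show ?thesis using False by (intro exI[of _ "- fun_supp \<theta>"]) (simp add: open_Compl)
    next
      case True
      define S where "S = V \<inter> sphere 0 1"
      have S: "compact S" unfolding S_def by (intro closed_Int_compact V) auto
      define Q where "Q \<eta> U \<epsilon> \<longleftrightarrow> open U \<and> x \<in> U \<and> \<epsilon> > (0::real) \<and> (\<forall>\<rho>\<in>test_fun \<Omega>. fun_supp \<rho> \<subseteq> U \<longrightarrow>
          fourier_seminorm N (sector \<eta> \<epsilon>) \<rho> u < top)" for \<eta> U \<epsilon>
      have "\<exists>p. Q \<eta> (fst p) (snd p)" if \<eta>: "\<eta> \<in> S" for \<eta>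
      proof -
        have "\<eta> \<in> V" "\<eta> \<noteq> 0" using \<eta> by (auto simp: S_def)
        then have "(x, \<eta>) \<notin> \<Gamma>" "(x, \<eta>) \<in> cotangent0 \<Omega>" using disj True x by (auto simp: cotangent0_def)
        then have "\<exists>\<psi>\<in>test_fun \<Omega>. \<psi> x \<noteq> 0 \<and> (\<exists>W. open W \<and> conic W \<and> \<eta> \<in> W \<and> (\<forall>N. fourier_seminorm N W \<psi> u < \<infinity>))"
          using uWF unfolding wave_front_def by blast
        then obtain \<psi> W where \<psi>: "\<psi> \<in> test_fun \<Omega>" "\<psi> x \<noteq> 0" and W: "open W" "conic W" "\<eta> \<in> W"
          and fin: "\<forall>N. fourier_seminorm N W \<psi> u < \<infinity>" by blast
        obtain U \<epsilon> where "Q \<eta> U \<epsilon>"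
          using microlocal_cutoff[OF ud \<Omega> \<psi> W fin[THEN spec], of N] unfolding Q_def by blast
        then show ?thesis by (intro exI[of _ "(U, \<epsilon>)"]) simp
      qed
      then obtain p where p: "\<forall>\<eta>\<in>S. Q \<eta> (fst (p \<eta>)) (snd (p \<eta>))" using bchoice[of S "\<lambda>\<eta> p. Q \<eta> (fst p) (snd p)"] by blast
      define U where "U \<eta> = fst (p \<eta>)" for \<eta>
      define \<epsilon> where "\<epsilon> \<eta> = snd (p \<eta>)" for \<eta>
      have Q: "Q \<eta> (U \<eta>) (\<epsilon> \<eta>)" if "\<eta> \<in> S" for \<eta> using p that by (simp add: U_def \<epsilon>_def)
      have "S \<subseteq> (\<Union>\<eta>\<in>S. ball \<eta> (\<epsilon> \<eta>))"
      proof
        fix \<eta> assume \<eta>: "\<eta> \<in> S"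
        then have "\<eta> \<in> ball \<eta> (\<epsilon> \<eta>)" using Q[OF \<eta>] by (simp add: Q_def)
        then show "\<eta> \<in> (\<Union>\<eta>\<in>S. ball \<eta> (\<epsilon> \<eta>))" using \<eta> by blast
      qed
      then obtain F where F: "F \<subseteq> S" "finite F" "S \<subseteq> (\<Union>\<eta>\<in>F. ball \<eta> (\<epsilon> \<eta>))"
        using compactE_image[OF S, of S "\<lambda>\<eta>. ball \<eta> (\<epsilon> \<eta>)"] by blast
      define U' where "U' = (\<Inter>\<eta>\<in>F. U \<eta>)"
      have "open (U \<eta>)" "x \<in> U \<eta>" if "\<eta> \<in> F" for \<eta> using Q F(1) that by (auto simp: Q_def)
      then have O: "open U'" "x \<in> U'" unfolding U'_def using F(2) by (simp_all add: open_INT)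
      have "fourier_seminorm N V (\<lambda>x. \<rho> x * \<theta> x) u < top" if \<rho>: "\<rho> \<in> test_fun \<Omega>" "fun_supp \<rho> \<subseteq> U'" for \<rho>
      proof -
        let ?\<rho> = "\<lambda>x. \<rho> x * \<theta> x"
        let ?fs = "\<lambda>\<eta>. fourier_seminorm N (sector \<eta> (\<epsilon> \<eta>)) ?\<rho> u"
        have fin: "?fs \<eta> < top" if \<eta>: "\<eta> \<in> F" for \<eta>
        proof -
          have "fun_supp ?\<rho> \<subseteq> U \<eta>" using fun_supp_mult(1)[of \<rho> \<theta>] \<rho>(2) \<eta> unfolding U'_def by blast
          then show ?thesis using Q[of \<eta>] \<eta> F(1) \<rho>\<theta>[OF \<rho>(1)] unfolding Q_def by blast
        qed
        \<comment> \<open>The frequency 0 cannot be normalised, so its value is a separate finite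
          term; it also settles V \<subseteq> {0}, where F is empty.\<close>
        have "fourier_seminorm N V ?\<rho> u \<le> (\<Sum>\<eta>\<in>F. ?fs \<eta>) + ennreal (cmod (fourier_loc u ?\<rho> 0))"
          unfolding fourier_seminorm_def[of N V]
        proof (rule SUP_least)
          fix k assume k: "k \<in> V"
          show "ennreal ((1 + norm k) ^ N * cmod (fourier_loc u ?\<rho> k)) \<le> (\<Sum>\<eta>\<in>F. ?fs \<eta>) + ennreal (cmod (fourier_loc u ?\<rho> 0))"
          proof (cases "k = 0")
            case True
            then show ?thesis by (simp add: add_increasing)
          next
            case False
            have "(1 / norm k) *\<^sub>R k \<in> V" using V(2) k False unfolding conic_def by simp
            then have "(1 / norm k) *\<^sub>R k \<in> S" using False by (simp add: S_def)
            then obtain \<eta> where \<eta>: "\<eta> \<in> F" "(1 / norm k) *\<^sub>R k \<in> ball \<eta> (\<epsilon> \<eta>)" using F(3) by blast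
            have "norm ((1 / norm k) *\<^sub>R k - \<eta>) \<le> \<epsilon> \<eta>" using \<eta>(2) by (simp add: dist_norm norm_minus_commute)
            then have "k \<in> sector \<eta> (\<epsilon> \<eta>)" by (rule sector_normalised[OF False])
            then have "ennreal ((1 + norm k) ^ N * cmod (fourier_loc u ?\<rho> k)) \<le> ?fs \<eta>" by (rule fourier_seminorm_upper)
            also have "\<dots> \<le> (\<Sum>\<eta>\<in>F. ?fs \<eta>)" using \<eta>(1) F(2) by (intro member_le_sum) auto
            also have "\<dots> \<le> (\<Sum>\<eta>\<in>F. ?fs \<eta>) + ennreal (cmod (fourier_loc u ?\<rho> 0))" by simp
            finally show ?thesis .
          qed
        qed
        also have "\<dots> < top" using ennreal_sum_finite[OF F(2) fin] by simp
        finally show ?thesis .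
      qed
      then show ?thesis using O by blast
    qed
  qed
  obtain \<rho> W where \<rho>: "\<rho> \<in> test_fun \<Omega>" "fun_supp \<theta> \<subseteq> W" "\<forall>x\<in>W. \<rho> x = 1"
    using exists_cutoff[OF test_funD(2)[OF \<theta>] \<Omega> test_funD(3)[OF \<theta>]] by blast
  have "(\<lambda>x. \<rho> x * \<theta> x) = \<theta>"
  proof
    fix x show "\<rho> x * \<theta> x = \<theta> x"
      using \<rho>(2,3) fun_supp_outside[of x \<theta>] by (cases "x \<in> fun_supp \<theta>") auto
  qed
  then show ?thesis using P[OF \<rho>(1)] by simp
qed

section \<open>Supports\<close>

text \<open>Off its support u vanishes on test functions in each open set of a cover; localisation
  glues this to their union.\<close>

lemma distribution_vanish:
  assumes u: "u \<in> distributions \<Omega>" and \<phi>: "\<phi> \<in> test_fun \<Omega>" "fun_supp \<phi> \<inter> dist_supp \<Omega> u = {}"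
  shows "u \<phi> = 0"
proof -
  define T where "T = \<Union>{W. open W \<and> W \<subseteq> \<Omega> \<and> (\<forall>\<phi>\<in>test_fun W. u \<phi> = 0)}"
  have T: "open T" "T \<subseteq> \<Omega>" unfolding T_def by auto
  have "fun_supp \<phi> \<subseteq> T" using \<phi> test_funD(3)[OF \<phi>(1)] unfolding dist_supp_def T_def by blast
  then have \<phi>T: "\<phi> \<in> test_fun T" by (rule test_fun_subset[OF \<phi>(1)])
  show ?thesis
  proof (rule test_fun_localize[OF T(1) _ _ _ \<phi>T])
    show "u (\<lambda>_. 0) = 0" by (rule distribution_zero[OF u])
    show "u (\<lambda>x. \<phi> x + \<psi> x) = 0" if "\<phi> \<in> test_fun T" "\<psi> \<in> test_fun T" "u \<phi> = 0" "u \<psi> = 0" for \<phi> \<psi>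
      using distributionsD(2)[OF u test_fun_mono[OF that(1) T(2)] test_fun_mono[OF that(2) T(2)]] that(3,4) by simp
    show "\<exists>U. open U \<and> x \<in> U \<and> (\<forall>\<phi>\<in>test_fun T. fun_supp \<phi> \<subseteq> U \<longrightarrow> u \<phi> = 0)" if x: "x \<in> T" for x
    proof -
      obtain W where W: "open W" "x \<in> W" "\<forall>\<phi>\<in>test_fun W. u \<phi> = 0" using x unfolding T_def by blast
      have "u \<phi> = 0" if "\<phi> \<in> test_fun T" "fun_supp \<phi> \<subseteq> W" for \<phi>
        using W(3) test_fun_subset[OF that] by blast
      then show ?thesis using W(1,2) by blast
    qed
  qed
qed

lemma Cm_norm_mono:
  assumes "\<phi> \<in> test_fun \<Omega>" "m \<le> n"
  shows "Cm_norm m \<phi> \<le> Cm_norm n \<phi>"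
  by (rule Cm_norm_least, rule Cm_norm_upper[OF assms(1)]) (use assms(2) in auto)

lemma distributions_minus:
  assumes u: "u \<in> distributions \<Omega>" and v: "v \<in> distributions \<Omega>"
  shows "(\<lambda>\<phi>. v \<phi> - u \<phi>) \<in> distributions \<Omega>"
proof -
  have "continuous_on_DK \<Omega> (\<lambda>\<phi>. cmod (v \<phi> - u \<phi>))"
    unfolding continuous_on_DK_def
  proof (intro allI impI)
    fix K assume K: "compact K \<and> K \<subseteq> \<Omega>"
    obtain m c where 1: "\<forall>\<phi>\<in>test_fun \<Omega>. fun_supp \<phi> \<subseteq> K \<longrightarrow> cmod (u \<phi>) \<le> c * Cm_norm m \<phi>"
      using distributionsD(4)[OF u] K unfolding continuous_on_DK_def by blast
    obtain n d where 2: "\<forall>\<phi>\<in>test_fun \<Omega>. fun_supp \<phi> \<subseteq> K \<longrightarrow> cmod (v \<phi>) \<le> d * Cm_norm n \<phi>"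
      using distributionsD(4)[OF v] K unfolding continuous_on_DK_def by blast
    have "cmod (v \<phi> - u \<phi>) \<le> (\<bar>c\<bar> + \<bar>d\<bar>) * Cm_norm (max m n) \<phi>" if \<phi>: "\<phi> \<in> test_fun \<Omega>" "fun_supp \<phi> \<subseteq> K" for \<phi>
    proof -
      have "cmod (u \<phi>) \<le> c * Cm_norm m \<phi>" using 1 \<phi> by blast
      also have "\<dots> \<le> \<bar>c\<bar> * Cm_norm (max m n) \<phi>"
        using Cm_norm_mono[OF \<phi>(1), of m "max m n"] Cm_norm_nonneg[OF \<phi>(1), of m] by (intro mult_mono) auto
      finally have a: "cmod (u \<phi>) \<le> \<bar>c\<bar> * Cm_norm (max m n) \<phi>" .
      have "cmod (v \<phi>) \<le> d * Cm_norm n \<phi>" using 2 \<phi> by blast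
      also have "\<dots> \<le> \<bar>d\<bar> * Cm_norm (max m n) \<phi>"
        using Cm_norm_mono[OF \<phi>(1), of n "max m n"] Cm_norm_nonneg[OF \<phi>(1), of n] by (intro mult_mono) auto
      finally show ?thesis using a norm_triangle_ineq4[of "v \<phi>" "u \<phi>"] by (simp add: distrib_right)
    qed
    then show "\<exists>m c. \<forall>\<phi>\<in>test_fun \<Omega>. fun_supp \<phi> \<subseteq> K \<longrightarrow> cmod (v \<phi> - u \<phi>) \<le> c * Cm_norm m \<phi>" by blast
  qed
  then show ?thesis using u v unfolding distributions_def by (simp add: right_diff_distrib)
qed

lemma dist_supp_minus:
  assumes u: "u \<in> distributions \<Omega>" "dist_supp \<Omega> u \<subseteq> C" and v: "v \<in> distributions \<Omega>" "dist_supp \<Omega> v \<subseteq> C"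
    and C: "closedin (top_of_set \<Omega>) C" and \<Omega>: "open \<Omega>"
  shows "dist_supp \<Omega> (\<lambda>\<phi>. v \<phi> - u \<phi>) \<subseteq> C"
proof -
  have "open (\<Omega> - C)"
    using C \<Omega> by (metis closedin_def openin_open_eq topspace_euclidean_subtopology)
  moreover have "v \<phi> - u \<phi> = 0" if \<phi>: "\<phi> \<in> test_fun (\<Omega> - C)" for \<phi>
  proof -
    have t: "\<phi> \<in> test_fun \<Omega>" by (rule test_fun_mono[OF \<phi>]) blast
    have s: "fun_supp \<phi> \<inter> C = {}" using test_funD(3)[OF \<phi>] by blast
    have "v \<phi> = 0" by (rule distribution_vanish[OF v(1) t]) (use s v(2) in blast)
    moreover have "u \<phi> = 0" by (rule distribution_vanish[OF u(1) t]) (use s u(2) in blast)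
    ultimately show ?thesis by simp
  qed
  ultimately show ?thesis unfolding dist_supp_def by blast
qed

text \<open>Otherwise there are functions \<phi>_n in B and points x_n outside the n-th set of a
  compact exhaustion with \<phi>_n(x_n) \<noteq> 0. The sum over n of n |\<psi>(x_n)| /
  |\<phi>_n(x_n)| is a seminorm of \<psi>, continuous because a compact set meets only finitely many
  x_n, yet it is at least n at \<phi>_n.\<close>

lemma bounded_test_set_supports:
  fixes B :: "('a::euclidean_space \<Rightarrow> complex) set"
  assumes B: "bounded_test_set \<Omega> B" and \<Omega>: "open \<Omega>"
  shows "\<exists>K. compact K \<and> K \<subseteq> \<Omega> \<and> (\<forall>\<phi>\<in>B. fun_supp \<phi> \<subseteq> K)"
proof (rule ccontr)
  assume neg: "\<not> ?thesis"
  have "\<exists>K. (\<forall>n::nat. compact (K n) \<and> K n \<subseteq> \<Omega>) \<and> (\<forall>L. compact L \<and> L \<subseteq> \<Omega> \<longrightarrow> (\<exists>N. \<forall>n\<ge>N. L \<subseteq> K n))"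
  proof (rule open_Union_compact_subsets[OF \<Omega>])
    fix C :: "nat \<Rightarrow> 'a set"
    assume C: "\<And>n. compact (C n)" "\<And>n. C n \<subseteq> \<Omega>" "\<And>L. compact L \<Longrightarrow> L \<subseteq> \<Omega> \<Longrightarrow> \<exists>N. \<forall>n\<ge>N. L \<subseteq> C n"
    show ?thesis by (rule exI[of _ C], intro conjI allI impI C) auto
  qed
  then obtain K where "\<forall>n::nat. compact (K n) \<and> K n \<subseteq> \<Omega>" and ex: "\<forall>L. compact L \<and> L \<subseteq> \<Omega> \<longrightarrow> (\<exists>N. \<forall>n\<ge>N. L \<subseteq> K n)"
    by (elim exE conjE)
  then have K: "compact (K n)" "K n \<subseteq> \<Omega>" for n by auto
  have BT: "B \<subseteq> test_fun \<Omega>" using B by (simp add: bounded_test_set_def)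
  have "\<exists>p. fst p \<in> B \<and> snd p \<notin> K n \<and> fst p (snd p) \<noteq> 0" for n
  proof -
    have "\<not> (\<forall>\<phi>\<in>B. fun_supp \<phi> \<subseteq> K n)"
    proof
      assume "\<forall>\<phi>\<in>B. fun_supp \<phi> \<subseteq> K n"
      then have "\<exists>K. compact K \<and> K \<subseteq> \<Omega> \<and> (\<forall>\<phi>\<in>B. fun_supp \<phi> \<subseteq> K)"
        using K[of n] by (intro exI[of _ "K n"]) simp
      with neg show False by (rule notE)
    qed
    then obtain \<phi> where \<phi>: "\<phi> \<in> B" "\<not> fun_supp \<phi> \<subseteq> K n" by blast
    have "\<exists>x. x \<notin> K n \<and> \<phi> x \<noteq> 0"
    proof (rule ccontr)
      assume "\<not> (\<exists>x. x \<notin> K n \<and> \<phi> x \<noteq> 0)"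
      then have z: "\<phi> x = 0" if "x \<notin> K n" for x using that by blast
      have "fun_supp \<phi> \<subseteq> K n" by (rule fun_supp_subset[OF compact_imp_closed[OF K(1)]]) (rule z)
      then show False using \<phi>(2) by blast
    qed
    then obtain x where "x \<notin> K n" "\<phi> x \<noteq> 0" by blast
    then show ?thesis using \<phi>(1) by (intro exI[of _ "(\<phi>, x)"]) simp
  qed
  then obtain p where p: "\<forall>n. fst (p n) \<in> B \<and> snd (p n) \<notin> K n \<and> fst (p n) (snd (p n)) \<noteq> 0"
    using choice[of "\<lambda>n p. fst p \<in> B \<and> snd p \<notin> K n \<and> fst p (snd p) \<noteq> 0"] by blast
  define \<phi> where "\<phi> n = fst (p n)" for n
  define x where "x n = snd (p n)" for n
  have \<phi>x: "\<phi> n \<in> B" "x n \<notin> K n" "\<phi> n (x n) \<noteq> 0" for n using p by (simp_all add: \<phi>_def x_def)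
  define a where "a n = real n / cmod (\<phi> n (x n))" for n
  have a0: "a n \<ge> 0" for n by (simp add: a_def)
  define P where "P \<psi> = (\<Sum>n. a n * cmod (\<psi> (x n)))" for \<psi> :: "'a \<Rightarrow> complex"
  have van: "\<exists>N. \<forall>\<psi>. fun_supp \<psi> \<subseteq> L \<longrightarrow> (\<forall>n. n \<notin> {..<N} \<longrightarrow> a n * cmod (\<psi> (x n)) = 0)" if L: "compact L" "L \<subseteq> \<Omega>" for L
  proof -
    obtain N where N: "\<forall>n\<ge>N. L \<subseteq> K n" using ex L by blast
    have "a n * cmod (\<psi> (x n)) = 0" if \<psi>: "fun_supp \<psi> \<subseteq> L" and n: "n \<notin> {..<N}" for \<psi> n
    proof -
      have "L \<subseteq> K n" using N n by simp
      then have "x n \<notin> fun_supp \<psi>" using \<psi> \<phi>x(2)[of n] by blast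
      then show ?thesis by (simp add: fun_supp_outside)
    qed
    then show ?thesis by blast
  qed
  have summ: "summable (\<lambda>n. a n * cmod (\<psi> (x n)))" if \<psi>: "\<psi> \<in> test_fun \<Omega>" for \<psi>
  proof -
    obtain N where "\<forall>\<psi>'. fun_supp \<psi>' \<subseteq> fun_supp \<psi> \<longrightarrow> (\<forall>n. n \<notin> {..<N} \<longrightarrow> a n * cmod (\<psi>' (x n)) = 0)"
      using van[OF test_funD(2,3)[OF \<psi>]] by blast
    then have "\<And>n. n \<notin> {..<N} \<Longrightarrow> a n * cmod (\<psi> (x n)) = 0" by blast
    then show ?thesis by (rule summable_finite[OF finite_lessThan])
  qed
  have "test_seminorm \<Omega> P"
    unfolding test_seminorm_def
  proof (intro conjI ballI allI)
    fix \<psi> \<tau> assume \<psi>: "\<psi> \<in> test_fun \<Omega>" and \<tau>: "\<tau> \<in> test_fun \<Omega>"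
    have "P (\<lambda>y. \<psi> y + \<tau> y) \<le> (\<Sum>n. a n * cmod (\<psi> (x n)) + a n * cmod (\<tau> (x n)))"
      unfolding P_def
    proof (rule suminf_le)
      show "a n * cmod (\<psi> (x n) + \<tau> (x n)) \<le> a n * cmod (\<psi> (x n)) + a n * cmod (\<tau> (x n))" for n
        unfolding distrib_left[symmetric] by (intro mult_left_mono norm_triangle_ineq a0)
      show "summable (\<lambda>n. a n * cmod (\<psi> (x n) + \<tau> (x n)))" by (rule summ[OF test_fun_add[OF \<psi> \<tau>]])
      show "summable (\<lambda>n. a n * cmod (\<psi> (x n)) + a n * cmod (\<tau> (x n)))"
        by (rule summable_add[OF summ[OF \<psi>] summ[OF \<tau>]])
    qed
    also have "\<dots> = P \<psi> + P \<tau>" unfolding P_def by (rule suminf_add[OF summ[OF \<psi>] summ[OF \<tau>], symmetric])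
    finally show "P (\<lambda>y. \<psi> y + \<tau> y) \<le> P \<psi> + P \<tau>" .
  next
    fix \<psi> c assume \<psi>: "\<psi> \<in> test_fun \<Omega>"
    show "P (\<lambda>y. c * \<psi> y) = cmod c * P \<psi>"
      unfolding P_def norm_mult using suminf_mult[OF summ[OF \<psi>], of "cmod c"] by (simp only: mult_ac)
  qed
  moreover have "continuous_on_DK \<Omega> P"
    unfolding continuous_on_DK_def
  proof (intro allI impI)
    fix L assume L: "compact L \<and> L \<subseteq> \<Omega>"
    obtain N where N: "\<forall>\<psi>. fun_supp \<psi> \<subseteq> L \<longrightarrow> (\<forall>n. n \<notin> {..<N} \<longrightarrow> a n * cmod (\<psi> (x n)) = 0)" using van L by blast
    have "P \<psi> \<le> (\<Sum>n<N. a n) * Cm_norm 0 \<psi>" if \<psi>: "\<psi> \<in> test_fun \<Omega>" "fun_supp \<psi> \<subseteq> L" for \<psi>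
    proof -
      have "P \<psi> = (\<Sum>n<N. a n * cmod (\<psi> (x n)))"
        unfolding P_def by (rule suminf_finite) (use N \<psi>(2) in auto)
      also have "\<dots> \<le> (\<Sum>n<N. a n * Cm_norm 0 \<psi>)"
        using Cm_norm_upper[OF \<psi>(1), of "[]" 0] a0 by (intro sum_mono mult_left_mono) auto
      finally show ?thesis by (simp add: sum_distrib_right)
    qed
    then show "\<exists>m c. \<forall>\<psi>\<in>test_fun \<Omega>. fun_supp \<psi> \<subseteq> L \<longrightarrow> P \<psi> \<le> c * Cm_norm m \<psi>" by blast
  qed
  ultimately have "bdd_above (P ` B)"
    using B[unfolded bounded_test_set_def, THEN conjunct2, THEN spec, of P] by simp
  then obtain M where M: "\<forall>\<psi>\<in>B. P \<psi> \<le> M" unfolding bdd_above_def by blast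
  obtain n where n: "real n > M" using reals_Archimedean2 by blast
  have t: "\<phi> n \<in> test_fun \<Omega>" using \<phi>x(1) BT by blast
  have "(\<Sum>i\<in>{n}. a i * cmod (\<phi> n (x i))) \<le> P (\<phi> n)"
    unfolding P_def by (rule sum_le_suminf[OF summ[OF t]]) (simp_all add: a0)
  then have "real n \<le> P (\<phi> n)" using \<phi>x(3)[of n] by (simp add: a_def)
  moreover have "P (\<phi> n) \<le> M" using M \<phi>x(1) by blast
  ultimately show False using n by linarith
qed

section \<open>Push-forward\<close>

lemma closedin_open_Diff:
  fixes \<Omega> C :: "'a::topological_space set"
  assumes "open \<Omega>" "closedin (top_of_set \<Omega>) C"
  shows "open (\<Omega> - C)"
proof -
  obtain T where "closed T" "C = \<Omega> \<inter> T" using assms(2) by (auto simp: closedin_closed)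
  then have "\<Omega> - C = \<Omega> \<inter> - T" by blast
  then show ?thesis using assms(1) \<open>closed T\<close> by (simp add: open_Int open_Compl)
qed

lemma proper_preimage_compact:
  assumes "proper_map (top_of_set C) (top_of_set \<Omega>) f" "compact K" "K \<subseteq> \<Omega>"
  shows "compact (C \<inter> f -` K)"
proof -
  have "compactin (top_of_set C) {z \<in> topspace (top_of_set C). f z \<in> K}"
    by (rule compactin_proper_map_preimage[OF assms(1)]) (simp add: compactin_subtopology assms(2,3))
  moreover have "{z \<in> topspace (top_of_set C). f z \<in> K} = C \<inter> f -` K" by auto
  ultimately show ?thesis by (simp add: compactin_subtopology)
qed

locale push_setting =
  fixes \<Omega>1 :: "'a::euclidean_space set" and \<Omega>2 :: "'b::euclidean_space set" and f :: "'a \<Rightarrow> 'b" and C :: "'a set"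
  assumes \<Omega>1: "open \<Omega>1" and \<Omega>2: "open \<Omega>2" and f: "smooth_on \<Omega>1 f" and C: "closedin (top_of_set \<Omega>1) C"
    and proper: "proper_map (top_of_set C) (top_of_set \<Omega>2) f"
begin

lemma C_sub: "C \<subseteq> \<Omega>1"
  by (rule closedin_imp_subset[OF C])

lemma smooth_comp: "\<phi> \<in> test_fun \<Omega> \<Longrightarrow> smooth_on \<Omega>1 (\<lambda>x. \<phi> (f x))"
  by (rule smooth_on_compose[OF \<Omega>1 open_UNIV f test_funD(1)]) auto

lemma test_fun_pullback: "\<theta> \<in> test_fun \<Omega>1 \<Longrightarrow> \<phi> \<in> test_fun \<Omega> \<Longrightarrow> (\<lambda>x. \<theta> x * \<phi> (f x)) \<in> test_fun \<Omega>1"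
  by (rule test_fun_mult[OF _ \<Omega>1 smooth_comp])

text \<open>By continuity of f, the closure that \<open>dist_pair\<close> refers to lies over the
  support of \<phi>, so within C it stays in the set that properness makes compact.\<close>

lemma closure_pullback:
  assumes "x \<in> \<Omega>1" "x \<in> closure {x \<in> \<Omega>1. \<phi> (f x) \<noteq> 0}"
  shows "f x \<in> fun_supp \<phi>"
proof (rule ccontr)
  assume n: "f x \<notin> fun_supp \<phi>"
  let ?O = "\<Omega>1 \<inter> f -` (- fun_supp \<phi>)"
  have O: "open ?O"
    by (rule continuous_open_preimage[OF smooth_on_continuous[OF f] \<Omega>1]) (simp add: open_Compl)
  have "?O \<inter> {x \<in> \<Omega>1. \<phi> (f x) \<noteq> 0} = {}" using fun_supp_outside[of _ \<phi>] by blast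
  then have "?O \<inter> closure {x \<in> \<Omega>1. \<phi> (f x) \<noteq> 0} = {}" using open_Int_closure_eq_empty[OF O] by blast
  then show False using assms n by blast
qed

text \<open>The difference of two cutoffs, times the pulled-back test function, vanishes near the
  support of u; hence any admissible cutoff may replace the chosen one.\<close>

lemma push_forward_eq:
  assumes u: "u \<in> distributions \<Omega>1" "dist_supp \<Omega>1 u \<subseteq> C" and \<phi>: "\<phi> \<in> test_fun \<Omega>2"
    and \<theta>: "\<theta> \<in> test_fun \<Omega>1" and W: "open W" "C \<inter> f -` fun_supp \<phi> \<subseteq> W" "\<forall>x\<in>W. \<theta> x = 1"
  shows "push_forward \<Omega>1 \<Omega>2 f u \<phi> = u (\<lambda>x. \<theta> x * \<phi> (f x))"
proof -
  define D where "D = {x \<in> \<Omega>1. \<phi> (f x) \<noteq> 0}"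
  define spec where "spec \<theta> \<longleftrightarrow> \<theta> \<in> test_fun \<Omega>1 \<and>
    (\<exists>W. open W \<and> dist_supp \<Omega>1 u \<inter> closure D \<subseteq> W \<and> (\<forall>x\<in>W. \<theta> x = 1))" for \<theta>
  have sub: "dist_supp \<Omega>1 u \<inter> closure D \<subseteq> W"
    using closure_pullback[of _ \<phi>] u(2) C_sub W(2) unfolding D_def by blast
  define \<theta>' where "\<theta>' = (SOME \<theta>. spec \<theta>)"
  \<comment> \<open>The given cutoff witnesses the specification, so the function picked by
    \<open>SOME\<close> meets it as well.\<close>
  have "spec \<theta>" unfolding spec_def using \<theta> W(1,3) sub by blast
  then have S: "spec \<theta>'" unfolding \<theta>'_def using someI[of spec \<theta>] by simp
  have pf: "push_forward \<Omega>1 \<Omega>2 f u \<phi> = u (\<lambda>x. \<theta>' x * \<phi> (f x))"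
    using \<phi> by (simp add: push_forward_def dist_pair_def \<theta>'_def spec_def[abs_def] D_def)
  obtain W' where \<theta>': "\<theta>' \<in> test_fun \<Omega>1" and W': "open W'" "dist_supp \<Omega>1 u \<inter> closure D \<subseteq> W'" "\<forall>x\<in>W'. \<theta>' x = 1"
    using S unfolding spec_def by blast
  define \<tau> where "\<tau> x = \<theta>' x * \<phi> (f x) - \<theta> x * \<phi> (f x)" for x
  have t: "(\<lambda>x. \<theta>' x * \<phi> (f x)) \<in> test_fun \<Omega>1" "(\<lambda>x. \<theta> x * \<phi> (f x)) \<in> test_fun \<Omega>1"
    by (rule test_fun_pullback[OF \<theta>' \<phi>], rule test_fun_pullback[OF \<theta> \<phi>])
  have "fun_supp \<tau> \<inter> dist_supp \<Omega>1 u = {}"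
  proof (rule ccontr)
    assume "fun_supp \<tau> \<inter> dist_supp \<Omega>1 u \<noteq> {}"
    then obtain x where x: "x \<in> fun_supp \<tau>" "x \<in> dist_supp \<Omega>1 u" by blast
    have "\<tau> y = 0" if "y \<notin> D" for y
    proof (cases "y \<in> \<Omega>1")
      case True
      then show ?thesis using that by (simp add: \<tau>_def D_def)
    next
      case False
      then have "\<theta>' y = 0" "\<theta> y = 0"
        using fun_supp_outside[of y] test_funD(3)[OF \<theta>'] test_funD(3)[OF \<theta>] by blast+
      then show ?thesis by (simp add: \<tau>_def)
    qed
    then have "{y. \<tau> y \<noteq> 0} \<subseteq> D" by blast
    then have "x \<in> closure D" using x(1) closure_mono unfolding fun_supp_def by blast
    then have "x \<in> W \<inter> W'" using x(2) sub W'(2) by blast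
    moreover have "(W \<inter> W') \<inter> {y. \<tau> y \<noteq> 0} = {}"
      using W(3) W'(3) by (auto simp: \<tau>_def)
    then have "(W \<inter> W') \<inter> fun_supp \<tau> = {}"
      unfolding fun_supp_def using open_Int_closure_eq_empty[OF open_Int[OF W(1) W'(1)]] by blast
    ultimately show False using x(1) by blast
  qed
  then have "u \<tau> = 0"
    unfolding \<tau>_def[abs_def] by (rule distribution_vanish[OF u(1) test_fun_diff[OF t]])
  then show ?thesis using distribution_diff[OF u(1) t] unfolding pf \<tau>_def[abs_def] by simp
qed

text \<open>The cutoff picked in \<open>dist_pair\<close> depends on u and \<phi>. Properness
  permits one that depends on K alone, and only then does the formula show linearity in both
  arguments.\<close>

lemma push_forward_on_compact:
  assumes "compact K" "K \<subseteq> \<Omega>2"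
  shows "\<exists>\<theta>\<in>test_fun \<Omega>1. \<forall>u\<in>distributions \<Omega>1. dist_supp \<Omega>1 u \<subseteq> C \<longrightarrow>
    (\<forall>\<phi>\<in>test_fun \<Omega>2. fun_supp \<phi> \<subseteq> K \<longrightarrow> push_forward \<Omega>1 \<Omega>2 f u \<phi> = u (\<lambda>x. \<theta> x * \<phi> (f x)))"
proof -
  have "compact (C \<inter> f -` K)" by (rule proper_preimage_compact[OF proper assms])
  moreover have "C \<inter> f -` K \<subseteq> \<Omega>1" using C_sub by blast
  ultimately have "\<exists>\<theta>\<in>test_fun \<Omega>1. \<exists>W. open W \<and> C \<inter> f -` K \<subseteq> W \<and> (\<forall>x\<in>W. \<theta> x = 1)"
    by (rule exists_cutoff[OF _ \<Omega>1])
  then obtain \<theta> W where \<theta>: "\<theta> \<in> test_fun \<Omega>1" and W: "open W" "C \<inter> f -` K \<subseteq> W" "\<forall>x\<in>W. \<theta> x = 1"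
    by (elim bexE exE conjE)
  show ?thesis
  proof (intro bexI[of _ \<theta>] \<theta> ballI impI)
    fix u and \<phi> assume h: "u \<in> distributions \<Omega>1" "dist_supp \<Omega>1 u \<subseteq> C" "\<phi> \<in> test_fun \<Omega>2" "fun_supp \<phi> \<subseteq> K"
    have "C \<inter> f -` fun_supp \<phi> \<subseteq> W" using h(4) W(2) by (auto simp: subset_iff)
    then show "push_forward \<Omega>1 \<Omega>2 f u \<phi> = u (\<lambda>x. \<theta> x * \<phi> (f x))"
      by (rule push_forward_eq[OF h(1-3) \<theta> W(1) _ W(3)])
  qed
qed

text \<open>Each of the three push-forwards may use its own cutoff; a common one for the support of
  \<phi> makes the identity an evaluation at a single test function.\<close>

lemma push_forward_minus:
  assumes u: "u \<in> distributions \<Omega>1" "dist_supp \<Omega>1 u \<subseteq> C" and v: "v \<in> distributions \<Omega>1" "dist_supp \<Omega>1 v \<subseteq> C"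
  shows "push_forward \<Omega>1 \<Omega>2 f (\<lambda>\<phi>. v \<phi> - u \<phi>) = (\<lambda>\<phi>. push_forward \<Omega>1 \<Omega>2 f v \<phi> - push_forward \<Omega>1 \<Omega>2 f u \<phi>)"
proof
  fix \<phi>
  show "push_forward \<Omega>1 \<Omega>2 f (\<lambda>\<phi>. v \<phi> - u \<phi>) \<phi> = push_forward \<Omega>1 \<Omega>2 f v \<phi> - push_forward \<Omega>1 \<Omega>2 f u \<phi>"
  proof (cases "\<phi> \<in> test_fun \<Omega>2")
    case True
    obtain \<theta> where "\<forall>u\<in>distributions \<Omega>1. dist_supp \<Omega>1 u \<subseteq> C \<longrightarrow> 
      (\<forall>\<phi>'\<in>test_fun \<Omega>2. fun_supp \<phi>' \<subseteq> fun_supp \<phi> \<longrightarrow> push_forward \<Omega>1 \<Omega>2 f u \<phi>' = u (\<lambda>x. \<theta> x * \<phi>' (f x)))"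
      using push_forward_on_compact[OF test_funD(2,3)[OF True]] by blast
    then have e: "push_forward \<Omega>1 \<Omega>2 f u \<phi> = u (\<lambda>x. \<theta> x * \<phi> (f x))" if "u \<in> distributions \<Omega>1" "dist_supp \<Omega>1 u \<subseteq> C" for u
      using that True by blast
    show ?thesis
      unfolding e[OF u] e[OF v] e[OF distributions_minus[OF u(1) v(1)] dist_supp_minus[OF u v C \<Omega>1]] ..
  qed (simp add: push_forward_def)
qed

lemma push_forward_distribution:
  assumes u: "u \<in> distributions \<Omega>1" "dist_supp \<Omega>1 u \<subseteq> C"
  shows "push_forward \<Omega>1 \<Omega>2 f u \<in> distributions \<Omega>2"
proof -
  let ?F = "push_forward \<Omega>1 \<Omega>2 f u"
  have ex: "\<exists>\<theta>\<in>test_fun \<Omega>1. \<forall>\<phi>\<in>test_fun \<Omega>2. fun_supp \<phi> \<subseteq> K \<longrightarrow> ?F \<phi> = u (\<lambda>x. \<theta> x * \<phi> (f x))"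
    if "compact K" "K \<subseteq> \<Omega>2" for K
    using push_forward_on_compact[OF that] u by blast
  have add: "?F (\<lambda>x. \<phi> x + \<psi> x) = ?F \<phi> + ?F \<psi>" if \<phi>: "\<phi> \<in> test_fun \<Omega>2" and \<psi>: "\<psi> \<in> test_fun \<Omega>2" for \<phi> \<psi>
  proof -
    have K: "compact (fun_supp \<phi> \<union> fun_supp \<psi>)" "fun_supp \<phi> \<union> fun_supp \<psi> \<subseteq> \<Omega>2"
      using compact_Un[OF test_funD(2)[OF \<phi>] test_funD(2)[OF \<psi>]] test_funD(3)[OF \<phi>] test_funD(3)[OF \<psi>] by auto
    obtain \<theta> where \<theta>: "\<theta> \<in> test_fun \<Omega>1"
      and e: "\<forall>\<phi>'\<in>test_fun \<Omega>2. fun_supp \<phi>' \<subseteq> fun_supp \<phi> \<union> fun_supp \<psi> \<longrightarrow> ?F \<phi>' = u (\<lambda>x. \<theta> x * \<phi>' (f x))"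
      using ex[OF K] by blast
    have s: "fun_supp (\<lambda>x. \<phi> x + \<psi> x) \<subseteq> fun_supp \<phi> \<union> fun_supp \<psi>"
      by (rule fun_supp_subset) (auto simp: fun_supp_outside)
    have "?F (\<lambda>x. \<phi> x + \<psi> x) = u (\<lambda>x. \<theta> x * (\<phi> (f x) + \<psi> (f x)))"
      by (rule e[rule_format, OF test_fun_add[OF \<phi> \<psi>] s])
    also have "\<dots> = u (\<lambda>x. \<theta> x * \<phi> (f x)) + u (\<lambda>x. \<theta> x * \<psi> (f x))"
      unfolding distrib_left by (rule distributionsD(2)[OF u(1) test_fun_pullback[OF \<theta> \<phi>] test_fun_pullback[OF \<theta> \<psi>]])
    also have "u (\<lambda>x. \<theta> x * \<phi> (f x)) = ?F \<phi>" by (rule e[rule_format, OF \<phi>, symmetric]) simp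
    also have "u (\<lambda>x. \<theta> x * \<psi> (f x)) = ?F \<psi>" by (rule e[rule_format, OF \<psi>, symmetric]) simp
    finally show ?thesis .
  qed
  have scale: "?F (\<lambda>x. a * \<phi> x) = a * ?F \<phi>" if \<phi>: "\<phi> \<in> test_fun \<Omega>2" for \<phi> a
  proof -
    obtain \<theta> where \<theta>: "\<theta> \<in> test_fun \<Omega>1"
      and e: "\<forall>\<phi>'\<in>test_fun \<Omega>2. fun_supp \<phi>' \<subseteq> fun_supp \<phi> \<longrightarrow> ?F \<phi>' = u (\<lambda>x. \<theta> x * \<phi>' (f x))"
      using ex[OF test_funD(2,3)[OF \<phi>]] by blast
    have s: "fun_supp (\<lambda>x. a * \<phi> x) \<subseteq> fun_supp \<phi>" by (rule fun_supp_mult(2))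
    have "?F (\<lambda>x. a * \<phi> x) = u (\<lambda>x. \<theta> x * (a * \<phi> (f x)))"
      by (rule e[rule_format, OF test_fun_scale[OF \<phi>] s])
    also have "\<dots> = a * u (\<lambda>x. \<theta> x * \<phi> (f x))"
      using distributionsD(3)[OF u(1) test_fun_pullback[OF \<theta> \<phi>], of a] by (simp only: mult.left_commute)
    also have "u (\<lambda>x. \<theta> x * \<phi> (f x)) = ?F \<phi>" by (rule e[rule_format, OF \<phi>, symmetric]) simp
    finally show ?thesis .
  qed
  have "continuous_on_DK \<Omega>2 (\<lambda>\<phi>. cmod (?F \<phi>))"
    unfolding continuous_on_DK_def
  proof (intro allI impI)
    fix K assume K: "compact K \<and> K \<subseteq> \<Omega>2"
    obtain \<theta> where \<theta>: "\<theta> \<in> test_fun \<Omega>1"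
      and e: "\<forall>\<phi>\<in>test_fun \<Omega>2. fun_supp \<phi> \<subseteq> K \<longrightarrow> ?F \<phi> = u (\<lambda>x. \<theta> x * \<phi> (f x))"
      using ex K by blast
    obtain m c where c: "\<forall>\<phi>\<in>test_fun \<Omega>1. fun_supp \<phi> \<subseteq> fun_supp \<theta> \<longrightarrow> cmod (u \<phi>) \<le> c * Cm_norm m \<phi>"
      using distributionsD(4)[OF u(1)] test_funD(2,3)[OF \<theta>] unfolding continuous_on_DK_def by blast
    obtain d where d: "d \<ge> 0" "\<forall>\<phi>\<in>test_fun UNIV. Cm_norm m (\<lambda>x. \<theta> x * \<phi> (f x)) \<le> d * Cm_norm m \<phi>"
      using Cm_norm_pullback[OF \<Omega>1 f \<theta>] by blast
    have "cmod (?F \<phi>) \<le> (\<bar>c\<bar> * d) * Cm_norm m \<phi>" if \<phi>: "\<phi> \<in> test_fun \<Omega>2" "fun_supp \<phi> \<subseteq> K" for \<phi>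
    proof -
      have t: "(\<lambda>x. \<theta> x * \<phi> (f x)) \<in> test_fun \<Omega>1" by (rule test_fun_pullback[OF \<theta> \<phi>(1)])
      have "cmod (?F \<phi>) = cmod (u (\<lambda>x. \<theta> x * \<phi> (f x)))" using e \<phi> by simp
      also have "\<dots> \<le> c * Cm_norm m (\<lambda>x. \<theta> x * \<phi> (f x))" using c t fun_supp_mult(1)[of \<theta> "\<lambda>x. \<phi> (f x)"] by blast
      also have "\<dots> \<le> \<bar>c\<bar> * Cm_norm m (\<lambda>x. \<theta> x * \<phi> (f x))" using Cm_norm_nonneg[OF t] by (intro mult_right_mono) auto
      also have "\<dots> \<le> \<bar>c\<bar> * (d * Cm_norm m \<phi>)"
        using d(2) test_fun_mono[OF \<phi>(1) subset_UNIV] by (intro mult_left_mono) auto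
      finally show ?thesis by (simp only: mult.assoc)
    qed
    then show "\<exists>m c. \<forall>\<phi>\<in>test_fun \<Omega>2. fun_supp \<phi> \<subseteq> K \<longrightarrow> cmod (?F \<phi>) \<le> c * Cm_norm m \<phi>" by blast
  qed
  then show ?thesis using add scale by (simp add: distributions_def push_forward_def)
qed

text \<open>The bounded set is the pull-back A of B, with one cutoff because B has its supports in a
  common compact set. It is bounded since p composed with A is a continuous seminorm for each
  continuous seminorm p on the source.\<close>

lemma push_forward_sup_seminorm:
  assumes B: "bounded_test_set \<Omega>2 B"
  shows "\<exists>B'. bounded_test_set \<Omega>1 B' \<and> (\<forall>w\<in>distributions \<Omega>1. dist_supp \<Omega>1 w \<subseteq> C \<longrightarrow>
    sup_seminorm B (push_forward \<Omega>1 \<Omega>2 f w) \<le> sup_seminorm B' w)"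
proof -
  obtain K where K: "compact K" "K \<subseteq> \<Omega>2" "\<forall>\<phi>\<in>B. fun_supp \<phi> \<subseteq> K"
    using bounded_test_set_supports[OF B \<Omega>2] by blast
  have BT: "B \<subseteq> test_fun \<Omega>2" using B by (simp add: bounded_test_set_def)
  obtain \<theta> where \<theta>: "\<theta> \<in> test_fun \<Omega>1" and e: "\<forall>u\<in>distributions \<Omega>1. dist_supp \<Omega>1 u \<subseteq> C \<longrightarrow>
    (\<forall>\<phi>\<in>test_fun \<Omega>2. fun_supp \<phi> \<subseteq> K \<longrightarrow> push_forward \<Omega>1 \<Omega>2 f u \<phi> = u (\<lambda>x. \<theta> x * \<phi> (f x)))"
    using push_forward_on_compact[OF K(1,2)] by blast
  define A where "A \<phi> x = \<theta> x * \<phi> (f x)" for \<phi> x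
  have A: "A \<phi> \<in> test_fun \<Omega>1" if "\<phi> \<in> test_fun \<Omega>2" for \<phi>
    unfolding A_def by (rule test_fun_pullback[OF \<theta> that])
  have "bounded_test_set \<Omega>1 (A ` B)"
    unfolding bounded_test_set_def
  proof (intro conjI allI impI)
    show "A ` B \<subseteq> test_fun \<Omega>1" using A BT by blast
    fix p assume p: "test_seminorm \<Omega>1 p \<and> continuous_on_DK \<Omega>1 p"
    have "test_seminorm \<Omega>2 (\<lambda>\<phi>. p (A \<phi>))"
      unfolding test_seminorm_def
    proof (intro conjI ballI allI)
      fix \<phi> \<psi> assume \<phi>: "\<phi> \<in> test_fun \<Omega>2" and \<psi>: "\<psi> \<in> test_fun \<Omega>2"
      have "A (\<lambda>x. \<phi> x + \<psi> x) = (\<lambda>x. A \<phi> x + A \<psi> x)" by (simp add: A_def[abs_def] distrib_left)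
      then show "p (A (\<lambda>x. \<phi> x + \<psi> x)) \<le> p (A \<phi>) + p (A \<psi>)"
        using p A[OF \<phi>] A[OF \<psi>] unfolding test_seminorm_def by simp
    next
      fix \<phi> a assume \<phi>: "\<phi> \<in> test_fun \<Omega>2"
      have "A (\<lambda>x. a * \<phi> x) = (\<lambda>x. a * A \<phi> x)" by (simp add: A_def[abs_def] mult.left_commute)
      then show "p (A (\<lambda>x. a * \<phi> x)) = cmod a * p (A \<phi>)"
        using p A[OF \<phi>] unfolding test_seminorm_def by simp
    qed
    moreover have "continuous_on_DK \<Omega>2 (\<lambda>\<phi>. p (A \<phi>))"
      unfolding continuous_on_DK_def
    proof (intro allI impI)
      fix L assume "compact L \<and> L \<subseteq> \<Omega>2"
      obtain m c where c: "\<forall>\<phi>\<in>test_fun \<Omega>1. fun_supp \<phi> \<subseteq> fun_supp \<theta> \<longrightarrow> p \<phi> \<le> c * Cm_norm m \<phi>"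
        using p test_funD(2,3)[OF \<theta>] unfolding continuous_on_DK_def by blast
      obtain d where d: "d \<ge> 0" "\<forall>\<phi>\<in>test_fun UNIV. Cm_norm m (\<lambda>x. \<theta> x * \<phi> (f x)) \<le> d * Cm_norm m \<phi>"
        using Cm_norm_pullback[OF \<Omega>1 f \<theta>] by blast
      have "p (A \<phi>) \<le> (\<bar>c\<bar> * d) * Cm_norm m \<phi>" if \<phi>: "\<phi> \<in> test_fun \<Omega>2" for \<phi>
      proof -
        have "fun_supp (A \<phi>) \<subseteq> fun_supp \<theta>" unfolding A_def[abs_def] by (rule fun_supp_mult(1))
        then have "p (A \<phi>) \<le> c * Cm_norm m (A \<phi>)" using c A[OF \<phi>] by blast
        also have "\<dots> \<le> \<bar>c\<bar> * Cm_norm m (A \<phi>)" using Cm_norm_nonneg[OF A[OF \<phi>]] by (intro mult_right_mono) auto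
        also have "\<dots> \<le> \<bar>c\<bar> * (d * Cm_norm m \<phi>)"
          using d(2) test_fun_mono[OF \<phi> subset_UNIV] unfolding A_def[abs_def] by (intro mult_left_mono) auto
        finally show ?thesis by (simp only: mult.assoc)
      qed
      then show "\<exists>m c. \<forall>\<phi>\<in>test_fun \<Omega>2. fun_supp \<phi> \<subseteq> L \<longrightarrow> p (A \<phi>) \<le> c * Cm_norm m \<phi>" by blast
    qed
    ultimately have "bdd_above ((\<lambda>\<phi>. p (A \<phi>)) ` B)"
      using B[unfolded bounded_test_set_def, THEN conjunct2, THEN spec, of "\<lambda>\<phi>. p (A \<phi>)"] by simp
    then show "bdd_above (p ` A ` B)" by (simp add: image_image)
  qed
  moreover have "sup_seminorm B (push_forward \<Omega>1 \<Omega>2 f w) \<le> sup_seminorm (A ` B) w"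
    if w: "w \<in> distributions \<Omega>1" "dist_supp \<Omega>1 w \<subseteq> C" for w
    unfolding sup_seminorm_def[of B]
  proof (rule SUP_least)
    fix \<phi> assume \<phi>: "\<phi> \<in> B"
    then have "push_forward \<Omega>1 \<Omega>2 f w \<phi> = w (A \<phi>)" using e w BT K(3) unfolding A_def[abs_def] by blast
    then show "ennreal (cmod (push_forward \<Omega>1 \<Omega>2 f w \<phi>)) \<le> sup_seminorm (A ` B) w"
      using sup_seminorm_upper[of "A \<phi>" "A ` B" w] \<phi> by simp
  qed
  ultimately show ?thesis by blast
qed

end

section \<open>Bounds for pulled-back covectors\<close>

lemma covector_pullback_scale: "covector_pullback f x (c *\<^sub>R k) = c *\<^sub>R covector_pullback f x k"
  by (rule euclidean_eqI) (simp add: covector_pullback_inner)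

lemma norm_covector_pullback_le: "norm (covector_pullback f x k) \<le> (\<Sum>b\<in>Basis. norm (frechet_derivative f (at x) b)) * norm k"
proof -
  have "norm (covector_pullback f x k) \<le> (\<Sum>b\<in>Basis. \<bar>covector_pullback f x k \<bullet> b\<bar>)" by (rule norm_le_l1)
  also have "\<dots> \<le> (\<Sum>b\<in>Basis. norm (frechet_derivative f (at x) b) * norm k)"
  proof (rule sum_mono)
    fix b :: 'a assume "b \<in> Basis"
    then show "\<bar>covector_pullback f x k \<bullet> b\<bar> \<le> norm (frechet_derivative f (at x) b) * norm k"
      using Cauchy_Schwarz_ineq2[of k "frechet_derivative f (at x) b"] by (simp add: covector_pullback_inner mult.commute)
  qed
  finally show ?thesis by (simp add: sum_distrib_right)
qed

lemma norm_covector_pullback_diff_le: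
  "norm (covector_pullback f x k - covector_pullback f y k)
    \<le> (\<Sum>b\<in>Basis. norm (frechet_derivative f (at x) b - frechet_derivative f (at y) b)) * norm k"
proof -
  have "norm (covector_pullback f x k - covector_pullback f y k)
      \<le> (\<Sum>b\<in>Basis. \<bar>(covector_pullback f x k - covector_pullback f y k) \<bullet> b\<bar>)" by (rule norm_le_l1)
  also have "\<dots> \<le> (\<Sum>b\<in>Basis. norm (frechet_derivative f (at x) b - frechet_derivative f (at y) b) * norm k)"
  proof (rule sum_mono)
    fix b :: 'a assume "b \<in> Basis"
    then show "\<bar>(covector_pullback f x k - covector_pullback f y k) \<bullet> b\<bar>
        \<le> norm (frechet_derivative f (at x) b - frechet_derivative f (at y) b) * norm k"
      using Cauchy_Schwarz_ineq2[of k "frechet_derivative f (at x) b - frechet_derivative f (at y) b"]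
      by (simp add: covector_pullback_inner inner_diff_left inner_diff_right mult.commute)
  qed
  finally show ?thesis by (simp add: sum_distrib_right)
qed

lemma continuous_covector_pullback: "continuous_on S (covector_pullback f x)"
  unfolding covector_pullback_def by (intro continuous_intros)

lemma closed_cone_complement_open:
  assumes "open \<Omega>" "closed_cone \<Omega> \<Gamma>"
  shows "open (cotangent0 \<Omega> - \<Gamma>)"
proof (rule closedin_open_Diff)
  show "open (cotangent0 \<Omega>)" unfolding cotangent0_def using assms(1) by (intro open_Times) auto
  show "closedin (top_of_set (cotangent0 \<Omega>)) \<Gamma>" using assms(2) by (simp add: closed_cone_def)
qed

lemma dist_Pair_le: "dist (a, b) (c, d) \<le> dist a c + dist b d"
  unfolding dist_Pair_Pair by (rule sqrt_sum_squares_le_sum) auto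

lemma normal_seminormsE:
  assumes "p \<in> normal_seminorms \<Omega> \<Gamma>"
  obtains (sup) B where "p = sup_seminorm B" "bounded_test_set \<Omega> B"
  | (fourier) N V \<theta> where "p = fourier_seminorm N V \<theta>" "\<theta> \<in> test_fun \<Omega>" "closed V" "conic V" "(fun_supp \<theta> \<times> V) \<inter> \<Gamma> = {}"
  using assms unfolding normal_seminorms_def Un_iff mem_Collect_eq
proof (elim disjE exE conjE)
  fix B assume "p = sup_seminorm B" "bounded_test_set \<Omega> B"
  then show thesis by (rule sup)
next
  fix N V \<theta> assume "p = fourier_seminorm N V \<theta>" "\<theta> \<in> test_fun \<Omega>" "closed V" "conic V" "(fun_supp \<theta> \<times> V) \<inter> \<Gamma> = {}"
  then show thesis by (rule fourier)
qed

lemma sup_seminorm_normal: "bounded_test_set \<Omega> B \<Longrightarrow> sup_seminorm B \<in> normal_seminorms \<Omega> \<Gamma>"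
  unfolding normal_seminorms_def by (rule UnI1, rule CollectI, rule exI[of _ B]) simp

lemma fourier_seminorm_normal:
  assumes "\<theta> \<in> test_fun \<Omega>" "closed V" "conic V" "(fun_supp \<theta> \<times> V) \<inter> \<Gamma> = {}"
  shows "fourier_seminorm N V \<theta> \<in> normal_seminorms \<Omega> \<Gamma>"
  unfolding normal_seminorms_def using assms
  by (intro UnI2 CollectI exI[of _ N] exI[of _ V] exI[of _ \<theta>] conjI refl)

section \<open>Cone separation, Fourier seminorms and wave front set of the push-forward\<close>

context push_setting
begin

text \<open>Since x0 lies in C, a covector k in V outside the push cone has a pull-back that is
  neither 0 nor in \<Gamma>. Over the compact set of unit covectors this holds with a margin; W is a
  conic neighbourhood of the pull-backs within half that margin, and continuity of df extends the
  estimates to nearby points.\<close>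

lemma cone_separation:
  assumes \<Gamma>: "closed_cone \<Omega>1 \<Gamma>" and V: "closed V" "conic V" and x0: "x0 \<in> C" "f x0 \<in> \<Omega>2"
    and disj: "\<And>k. k \<in> V \<Longrightarrow> (f x0, k) \<notin> push_cone \<Omega>1 \<Omega>2 f C \<Gamma>"
  shows "\<exists>r>0. \<exists>c>0. \<exists>W. closed W \<and> conic W \<and> cball x0 (2 * r) \<subseteq> \<Omega>1 \<and> (cball x0 (2 * r) \<times> W) \<inter> \<Gamma> = {} \<and>
    (\<forall>x\<in>cball x0 (2 * r). \<forall>k\<in>V. c * norm k \<le> norm (covector_pullback f x k) \<and>
      (\<forall>\<xi>. \<xi> \<notin> W \<longrightarrow> c * (norm k + norm \<xi>) \<le> norm (covector_pullback f x k - \<xi>)))"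
proof -
  let ?A = "covector_pullback f"
  have x01: "x0 \<in> \<Omega>1" using x0(1) C_sub by blast
  define S where "S = V \<inter> sphere 0 1"
  have "compact S" unfolding S_def by (intro closed_Int_compact V) auto
  then have "compact (?A x0 ` S)" by (intro compact_continuous_image continuous_covector_pullback)
  then have K: "compact ({x0} \<times> ?A x0 ` S)" by (intro compact_Times) auto
  have Aok: "?A x0 k \<noteq> 0 \<and> (x0, ?A x0 k) \<notin> \<Gamma>" if k: "k \<in> V" "k \<noteq> 0" for k
  proof -
    have "(f x0, k) \<in> cotangent0 \<Omega>2" using x0(2) k(2) by (simp add: cotangent0_def)
    then have "(x0, ?A x0 k) \<notin> \<Gamma> \<union> (C \<times> {0})" using disj[OF k(1)] x01 unfolding push_cone_def by blast
    then show ?thesis using x0(1) by auto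
  qed
  have sub: "{x0} \<times> ?A x0 ` S \<subseteq> cotangent0 \<Omega>1 - \<Gamma>"
  proof
    fix p assume "p \<in> {x0} \<times> ?A x0 ` S"
    then obtain k where k: "k \<in> S" "p = (x0, ?A x0 k)" by blast
    then have "k \<in> V" "k \<noteq> 0" by (auto simp: S_def)
    from Aok[OF this] show "p \<in> cotangent0 \<Omega>1 - \<Gamma>" using x01 by (simp add: k(2) cotangent0_def)
  qed
  obtain \<epsilon> where \<epsilon>: "\<epsilon> > 0" "(\<Union>p\<in>{x0} \<times> ?A x0 ` S. cball p \<epsilon>) \<subseteq> cotangent0 \<Omega>1 - \<Gamma>"
    by (rule compact_subset_open_imp_cball_epsilon_subset[OF K closed_cone_complement_open[OF \<Omega>1 \<Gamma>] sub])
  have O: "(x, \<zeta>) \<in> cotangent0 \<Omega>1 - \<Gamma>" if k: "k \<in> S" and d: "dist x0 x + dist (?A x0 k) \<zeta> \<le> \<epsilon>" for x \<zeta> k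
  proof -
    have "(x, \<zeta>) \<in> cball (x0, ?A x0 k) \<epsilon>" using dist_Pair_le[of x0 "?A x0 k" x \<zeta>] d by simp
    then show ?thesis using \<epsilon>(2) k by blast
  qed
  \<comment> \<open>Half of the margin is spent on moving the base point, half on moving the
    covector.\<close>
  define e where "e = \<epsilon> / 2"
  have e: "e > 0" "2 * e = \<epsilon>" using \<epsilon>(1) by (auto simp: e_def)
  have norml: "(1 / norm k) *\<^sub>R k \<in> S" if "k \<in> V" "k \<noteq> 0" for k
    using that V(2) unfolding conic_def S_def by simp
  \<comment> \<open>The covector 0 lies outside the cotangent set, so the ball of radius \<epsilon>
    around a pull-back cannot contain it; the margin is therefore also a lower bound for the
    norm.\<close>
  have low: "2 * e * norm k \<le> norm (?A x0 k)" if k: "k \<in> V" for k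
  proof (cases "k = 0")
    case False
    let ?k = "(1 / norm k) *\<^sub>R k"
    have t: "norm k > 0" using False by simp
    have "(x0, 0) \<notin> cotangent0 \<Omega>1 - \<Gamma>" by (simp add: cotangent0_def)
    then have "\<not> dist x0 x0 + dist (?A x0 ?k) 0 \<le> \<epsilon>" using O[OF norml[OF k False], of x0 0] by blast
    then have "\<epsilon> \<le> norm (?A x0 ?k)" by simp
    also have "norm (?A x0 ?k) = norm (?A x0 k) / norm k" by (simp add: covector_pullback_scale)
    finally show ?thesis using t e(2) by (simp add: pos_le_divide_eq)
  qed simp
  define W where "W = {\<xi>. \<exists>k\<in>V. norm (?A x0 k - \<xi>) \<le> e * norm k}"
  have conicW: "conic W"
    unfolding conic_def
  proof (intro ballI allI impI)
    fix \<xi> c :: "'a" and t :: real assume "\<xi> \<in> W" "t > 0"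
    then obtain k where k: "k \<in> V" "norm (?A x0 k - \<xi>) \<le> e * norm k" unfolding W_def by blast
    have "norm (?A x0 (t *\<^sub>R k) - t *\<^sub>R \<xi>) = t * norm (?A x0 k - \<xi>)"
      using \<open>t > 0\<close> by (simp add: covector_pullback_scale scaleR_diff_right[symmetric])
    also have "\<dots> \<le> t * (e * norm k)" using k(2) \<open>t > 0\<close> by (intro mult_left_mono) auto
    also have "\<dots> = e * norm (t *\<^sub>R k)" using \<open>t > 0\<close> by simp
    finally have "norm (?A x0 (t *\<^sub>R k) - t *\<^sub>R \<xi>) \<le> e * norm (t *\<^sub>R k)" .
    moreover have "t *\<^sub>R k \<in> V" using k(1) V(2) \<open>t > 0\<close> unfolding conic_def by blast
    ultimately show "t *\<^sub>R \<xi> \<in> W" unfolding W_def by blast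
  qed
  have closedW: "closed W"
    unfolding closed_sequential_limits
  proof (intro allI impI)
    fix s l assume sl: "(\<forall>n. s n \<in> W) \<and> s \<longlonglongrightarrow> l"
    then have "\<forall>n. \<exists>k. k \<in> V \<and> norm (?A x0 k - s n) \<le> e * norm k" unfolding W_def by blast
    then obtain k where k: "\<forall>n. k n \<in> V \<and> norm (?A x0 (k n) - s n) \<le> e * norm (k n)"
      using choice[of "\<lambda>n k. k \<in> V \<and> norm (?A x0 k - s n) \<le> e * norm k"] by blast
    have "bounded (range s)" using sl convergent_imp_bounded by blast
    then obtain M where M: "\<forall>n. norm (s n) \<le> M" unfolding bounded_iff by blast
    \<comment> \<open>The lower bound 2 e |k| exceeds the tolerance e |k|, so bounded points of W
      have bounded witnesses in V; a convergent subsequence of these shows that W is closed.\<close>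
    have "norm (k n) \<le> M / e" for n
    proof -
      have "2 * e * norm (k n) \<le> norm (?A x0 (k n))" using low k by blast
      also have "\<dots> \<le> norm (?A x0 (k n) - s n) + norm (s n)" using norm_triangle_ineq[of "?A x0 (k n) - s n" "s n"] by simp
      also have "\<dots> \<le> e * norm (k n) + M" using k M by (intro add_mono) auto
      finally have "e * norm (k n) \<le> M" by simp
      then show ?thesis using e(1) by (simp add: pos_le_divide_eq mult.commute)
    qed
    then have kc: "\<forall>n. k n \<in> V \<inter> cball 0 (M / e)" using k by simp
    have "compact (V \<inter> cball 0 (M / e))" by (intro closed_Int_compact V) auto
    then have "seq_compact (V \<inter> cball 0 (M / e))" by (rule compact_imp_seq_compact)
    then obtain l' r where l': "l' \<in> V \<inter> cball 0 (M / e)" and r: "strict_mono r" "(k \<circ> r) \<longlonglongrightarrow> l'"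
      by (rule seq_compactE[OF _ kc])
    have "isCont (?A x0) l'" using continuous_covector_pullback[of UNIV f x0] by (simp add: continuous_on_eq_continuous_at)
    from isCont_tendsto_compose[OF this r(2)] have 1: "(\<lambda>n. ?A x0 (k (r n))) \<longlonglongrightarrow> ?A x0 l'" by simp
    have 2: "(\<lambda>n. s (r n)) \<longlonglongrightarrow> l" using LIMSEQ_subseq_LIMSEQ[OF _ r(1)] sl by (force simp: comp_def)
    have 3: "(\<lambda>n. e * norm (k (r n))) \<longlonglongrightarrow> e * norm l'" using r(2) by (intro tendsto_mult_left tendsto_norm) (simp add: comp_def)
    have "norm (?A x0 l' - l) \<le> e * norm l'"
      by (rule LIMSEQ_le[OF tendsto_norm[OF tendsto_diff[OF 1 2]] 3]) (use k in blast)
    then show "l \<in> W" using l' unfolding W_def by blast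
  qed
  have disjW: "(x, \<xi>) \<notin> \<Gamma>" if x: "dist x0 x \<le> e" and \<xi>: "\<xi> \<in> W" for x \<xi>
  proof
    assume \<Gamma>x: "(x, \<xi>) \<in> \<Gamma>"
    obtain k where k: "k \<in> V" "norm (?A x0 k - \<xi>) \<le> e * norm k" using \<xi> unfolding W_def by blast
    have "\<Gamma> \<subseteq> cotangent0 \<Omega>1" using \<Gamma> closedin_imp_subset unfolding closed_cone_def by blast
    then have \<xi>0: "\<xi> \<noteq> 0" using \<Gamma>x by (auto simp: cotangent0_def)
    have k0: "k \<noteq> 0"
    proof
      assume "k = 0"
      moreover have "?A x0 0 = 0" using covector_pullback_scale[of f x0 0 0] by simp
      ultimately show False using k(2) \<xi>0 by simp
    qed
    then have t: "1 / norm k > 0" by simp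
    have "norm (?A x0 ((1 / norm k) *\<^sub>R k) - (1 / norm k) *\<^sub>R \<xi>) = (1 / norm k) * norm (?A x0 k - \<xi>)"
      using t by (simp add: covector_pullback_scale scaleR_diff_right[symmetric])
    also have "\<dots> \<le> (1 / norm k) * (e * norm k)" using k(2) t by (intro mult_left_mono) auto
    also have "\<dots> = e" using k0 by simp
    finally have "dist x0 x + dist (?A x0 ((1 / norm k) *\<^sub>R k)) ((1 / norm k) *\<^sub>R \<xi>) \<le> \<epsilon>"
      using x e(2) by (simp only: dist_norm)
    from O[OF norml[OF k(1) k0] this] have "(x, (1 / norm k) *\<^sub>R \<xi>) \<notin> \<Gamma>" by blast
    then show False using \<Gamma> \<Gamma>x t unfolding closed_cone_def by blast
  qed
  define \<Lambda> where "\<Lambda> = (\<Sum>b\<in>Basis. norm (frechet_derivative f (at x0) b))"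
  have \<Lambda>: "\<Lambda> \<ge> 0" unfolding \<Lambda>_def by (intro sum_nonneg) auto
  \<comment> \<open>The oscillation of df at x0. Keeping it below e / 2 uses up half of the
    separation between pull-backs and the complement of W.\<close>
  define \<eta> where "\<eta> x = (\<Sum>b\<in>Basis. norm (frechet_derivative f (at x) b - frechet_derivative f (at x0) b))" for x
  have "continuous_on \<Omega>1 \<eta>"
    unfolding \<eta>_def[abs_def]
    by (intro continuous_on_sum continuous_on_norm continuous_on_diff continuous_on_const
        smooth_on_continuous[OF smooth_on_pderiv[OF f]])
  then have "open (\<Omega>1 \<inter> \<eta> -` {..<e / 2})" by (rule continuous_open_preimage[OF _ \<Omega>1 open_lessThan])
  then have "open (ball x0 e \<inter> (\<Omega>1 \<inter> \<eta> -` {..<e / 2}))" by (rule open_Int[OF open_ball])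
  moreover have "x0 \<in> ball x0 e \<inter> (\<Omega>1 \<inter> \<eta> -` {..<e / 2})" using x01 e(1) by (simp add: \<eta>_def)
  ultimately obtain r where r: "r > 0" "cball x0 (2 * r) \<subseteq> ball x0 e \<inter> (\<Omega>1 \<inter> \<eta> -` {..<e / 2})"
    using open_contains_cball2 by blast
  \<comment> \<open>Read off from |k| \<le> (2/e) X and |k| + |\<xi>| \<le> X + (1 + \<Lambda> +
    e/2) |k|, where X is the distance from \<xi> to the pull-back of k at x.\<close>
  define D where "D = 1 + (2 / e) * (1 + \<Lambda> + e / 2)"
  have D: "D \<ge> 1" "D > 0" using \<Lambda> e(1) by (auto simp: D_def intro: add_pos_nonneg)
  define c where "c = min (1 / D) e"
  have c: "c > 0" "c \<le> 1 / D" "c \<le> e" using D e(1) by (auto simp: c_def)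
  have est: "c * norm k \<le> norm (?A x k) \<and> (\<forall>\<xi>. \<xi> \<notin> W \<longrightarrow> c * (norm k + norm \<xi>) \<le> norm (?A x k - \<xi>))"
    if x: "x \<in> cball x0 (2 * r)" and k: "k \<in> V" for x k
  proof -
    have "\<eta> x < e / 2" using r(2) x by blast
    then have "\<eta> x * norm k \<le> (e / 2) * norm k" by (intro mult_right_mono) auto
    then have close: "norm (?A x k - ?A x0 k) \<le> (e / 2) * norm k"
      using norm_covector_pullback_diff_le[of f x k x0] unfolding \<eta>_def by linarith
    have up: "norm (?A x0 k) \<le> \<Lambda> * norm k" unfolding \<Lambda>_def by (rule norm_covector_pullback_le)
    have "2 * e * norm k \<le> norm (?A x k) + norm (?A x k - ?A x0 k)"
      using low[OF k] norm_triangle_ineq2[of "?A x0 k" "?A x k"] by (simp add: norm_minus_commute)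
    then have "2 * e * norm k \<le> norm (?A x k) + (e / 2) * norm k" using close by linarith
    moreover have "0 \<le> e * norm k" using e(1) by simp
    ultimately have "e * norm k \<le> norm (?A x k)" by (simp add: field_simps)
    moreover have "c * norm k \<le> e * norm k" using c(3) by (intro mult_right_mono) auto
    ultimately have 1: "c * norm k \<le> norm (?A x k)" by linarith
    have 2: "c * (norm k + norm \<xi>) \<le> norm (?A x k - \<xi>)" if \<xi>: "\<xi> \<notin> W" for \<xi>
    proof -
      let ?X = "norm (?A x k - \<xi>)"
      have far: "e * norm k < norm (?A x0 k - \<xi>)" using \<xi> k unfolding W_def by (simp add: not_le)
      have "norm (?A x0 k - \<xi>) \<le> norm (?A x0 k - ?A x k) + ?X"
        using norm_triangle_ineq[of "?A x0 k - ?A x k" "?A x k - \<xi>"] by simp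
      then have "e * norm k \<le> (e / 2) * norm k + ?X" using far close by (simp add: norm_minus_commute)
      then have "(e / 2) * norm k \<le> ?X" by (simp add: field_simps)
      then have kX: "norm k \<le> (2 / e) * ?X" using e(1) by (simp add: field_simps)
      have "norm \<xi> \<le> ?X + norm (?A x k)" using norm_triangle_ineq2[of \<xi> "?A x k"] by (simp add: norm_minus_commute)
      moreover have "norm (?A x k) \<le> norm (?A x0 k) + norm (?A x k - ?A x0 k)"
        using norm_triangle_ineq2[of "?A x k" "?A x0 k"] by simp
      ultimately have "norm \<xi> \<le> ?X + (\<Lambda> * norm k + (e / 2) * norm k)" using up close by linarith
      then have "norm k + norm \<xi> \<le> ?X + (1 + \<Lambda> + e / 2) * norm k" by (simp add: algebra_simps)
      also have "\<dots> \<le> ?X + (1 + \<Lambda> + e / 2) * ((2 / e) * ?X)"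
        using kX \<Lambda> e(1) by (intro add_left_mono mult_left_mono) auto
      also have "\<dots> = D * ?X"
      proof -
        have "X + L * (q * X) = (1 + q * L) * X" for X L q :: real by (simp add: algebra_simps)
        then show ?thesis unfolding D_def .
      qed
      finally have "norm k + norm \<xi> \<le> D * ?X" .
      then have "(1 / D) * (norm k + norm \<xi>) \<le> ?X" using D(2) by (simp add: pos_divide_le_eq mult.commute)
      moreover have "c * (norm k + norm \<xi>) \<le> (1 / D) * (norm k + norm \<xi>)" using c(2) by (intro mult_right_mono) auto
      ultimately show ?thesis by linarith
    qed
    show ?thesis using 1 2 by blast
  qed
  have dj: "(cball x0 (2 * r) \<times> W) \<inter> \<Gamma> = {}"
  proof -
    have "dist x0 x \<le> e" if "x \<in> cball x0 (2 * r)" for x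
    proof -
      have "x \<in> ball x0 e" using r(2) that by blast
      then show ?thesis by simp
    qed
    then show ?thesis using disjW by blast
  qed
  have "cball x0 (2 * r) \<subseteq> \<Omega>1" using r(2) by blast
  moreover have "\<forall>x\<in>cball x0 (2 * r). \<forall>k\<in>V. c * norm k \<le> norm (?A x k) \<and>
      (\<forall>\<xi>. \<xi> \<notin> W \<longrightarrow> c * (norm k + norm \<xi>) \<le> norm (?A x k - \<xi>))"
    by (intro ballI) (rule est)
  ultimately show ?thesis
    using r(1) c(1) conicW closedW dj by (intro exI[of _ r] exI[of _ c] exI[of _ W] conjI)
qed

text \<open>Points of \<Omega>1 are of three kinds: off C the distribution vanishes, off the
  preimage of the support of \<tau> the test function vanishes, and at the others cone separation
  feeds the local estimate. Compactness keeps the collection of source seminorms finite, uniformly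
  in w.\<close>

lemma push_forward_fourier_seminorm:
  assumes \<Gamma>: "closed_cone \<Omega>1 \<Gamma>" and V: "closed V" "conic V" and \<tau>: "\<tau> \<in> test_fun \<Omega>2"
    and disj: "(fun_supp \<tau> \<times> V) \<inter> push_cone \<Omega>1 \<Omega>2 f C \<Gamma> = {}"
  shows "\<exists>Q c. finite Q \<and> Q \<subseteq> normal_seminorms \<Omega>1 \<Gamma> \<and> c \<ge> 0 \<and> (\<forall>w\<in>distributions \<Omega>1. dist_supp \<Omega>1 w \<subseteq> C \<longrightarrow>
    fourier_seminorm N V \<tau> (push_forward \<Omega>1 \<Omega>2 f w) \<le> ennreal c * (\<Sum>q\<in>Q. q w))"
proof -
  obtain \<theta> where \<theta>: "\<theta> \<in> test_fun \<Omega>1" and pf: "\<forall>u\<in>distributions \<Omega>1. dist_supp \<Omega>1 u \<subseteq> C \<longrightarrow>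
    (\<forall>\<phi>\<in>test_fun \<Omega>2. fun_supp \<phi> \<subseteq> fun_supp \<tau> \<longrightarrow> push_forward \<Omega>1 \<Omega>2 f u \<phi> = u (\<lambda>x. \<theta> x * \<phi> (f x)))"
    using push_forward_on_compact[OF test_funD(2,3)[OF \<tau>]] by blast
  define G where "G x = \<theta> x * \<tau> (f x)" for x
  have G: "G \<in> test_fun \<Omega>1" unfolding G_def by (rule test_fun_pullback[OF \<theta> \<tau>])
  have pw: "smooth_on \<Omega>1 (\<lambda>x. G x * plane_wave k (f x))" for k
    by (rule smooth_on_mult[OF \<Omega>1 smooth_on_mono[OF test_funD(1)[OF G] subset_UNIV]
          smooth_on_compose[OF \<Omega>1 open_UNIV f smooth_plane_wave]]) simp
  define H where "H \<rho> k x = \<rho> x * (G x * plane_wave k (f x))" for \<rho> k x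
  have H: "H \<rho> k \<in> test_fun \<Omega>1" if "\<rho> \<in> test_fun \<Omega>1" for \<rho> k
    unfolding H_def by (rule test_fun_mult[OF that \<Omega>1 pw])
  \<comment> \<open>The localised statement for \<rho> with G fixed. The seminorms and the constant
    precede w and k, and unions of the sets Q make it additive in \<rho>.\<close>
  define P where "P \<rho> \<longleftrightarrow> (\<exists>Q c. finite Q \<and> Q \<subseteq> normal_seminorms \<Omega>1 \<Gamma> \<and> c \<ge> 0 \<and>
    (\<forall>w\<in>distributions \<Omega>1. dist_supp \<Omega>1 w \<subseteq> C \<longrightarrow>
      (\<forall>k\<in>V. ennreal ((1 + norm k) ^ N * cmod (w (H \<rho> k))) \<le> ennreal c * (\<Sum>q\<in>Q. q w))))" for \<rho>
  have trivial: "P \<rho>" if "\<And>w k. w \<in> distributions \<Omega>1 \<Longrightarrow> dist_supp \<Omega>1 w \<subseteq> C \<Longrightarrow> w (H \<rho> k) = 0" for \<rho>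
    unfolding P_def by (intro exI[of _ "{}"] exI[of _ 0]) (simp add: that)
  have zeroH: "w (H \<rho> k) = 0" if "w \<in> distributions \<Omega>1" "\<And>x. \<rho> x * G x = 0" for w \<rho> k
  proof -
    have "H \<rho> k x = 0" for x unfolding H_def mult.assoc[symmetric] that(2) by simp
    then have "H \<rho> k = (\<lambda>_. 0)" by (rule ext)
    then show ?thesis by (simp add: distribution_zero[OF that(1)])
  qed
  have P: "P \<rho>" if "\<rho> \<in> test_fun \<Omega>1" for \<rho>
  proof (rule test_fun_localize[OF \<Omega>1 _ _ _ that, of P])
    show "P (\<lambda>_. 0)" by (rule trivial, rule zeroH) auto
  next
    fix \<phi> \<psi> assume \<phi>: "\<phi> \<in> test_fun \<Omega>1" and \<psi>: "\<psi> \<in> test_fun \<Omega>1" and P1: "P \<phi>" and P2: "P \<psi>"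
    obtain Q1 c1 where 1: "finite Q1" "Q1 \<subseteq> normal_seminorms \<Omega>1 \<Gamma>" "c1 \<ge> 0" "\<forall>w\<in>distributions \<Omega>1. dist_supp \<Omega>1 w \<subseteq> C \<longrightarrow>
      (\<forall>k\<in>V. ennreal ((1 + norm k) ^ N * cmod (w (H \<phi> k))) \<le> ennreal c1 * (\<Sum>q\<in>Q1. q w))" using P1 unfolding P_def by (elim exE conjE)
    obtain Q2 c2 where 2: "finite Q2" "Q2 \<subseteq> normal_seminorms \<Omega>1 \<Gamma>" "c2 \<ge> 0" "\<forall>w\<in>distributions \<Omega>1. dist_supp \<Omega>1 w \<subseteq> C \<longrightarrow>
      (\<forall>k\<in>V. ennreal ((1 + norm k) ^ N * cmod (w (H \<psi> k))) \<le> ennreal c2 * (\<Sum>q\<in>Q2. q w))" using P2 unfolding P_def by (elim exE conjE)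
    have "ennreal ((1 + norm k) ^ N * cmod (w (H (\<lambda>x. \<phi> x + \<psi> x) k))) \<le> ennreal (c1 + c2) * (\<Sum>q\<in>Q1 \<union> Q2. q w)"
      if w: "w \<in> distributions \<Omega>1" "dist_supp \<Omega>1 w \<subseteq> C" and k: "k \<in> V" for w k
    proof -
      have "H (\<lambda>x. \<phi> x + \<psi> x) k = (\<lambda>x. H \<phi> k x + H \<psi> k x)" unfolding H_def distrib_right ..
      then have "w (H (\<lambda>x. \<phi> x + \<psi> x) k) = w (H \<phi> k) + w (H \<psi> k)"
        using distributionsD(2)[OF w(1) H[OF \<phi>] H[OF \<psi>], of k k] by simp
      then have "(1 + norm k) ^ N * cmod (w (H (\<lambda>x. \<phi> x + \<psi> x) k))
          \<le> (1 + norm k) ^ N * cmod (w (H \<phi> k)) + (1 + norm k) ^ N * cmod (w (H \<psi> k))"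
        unfolding distrib_left[symmetric] by (intro mult_left_mono) (simp_all add: norm_triangle_ineq)
      then have "ennreal ((1 + norm k) ^ N * cmod (w (H (\<lambda>x. \<phi> x + \<psi> x) k)))
          \<le> ennreal ((1 + norm k) ^ N * cmod (w (H \<phi> k)) + (1 + norm k) ^ N * cmod (w (H \<psi> k)))" by (rule ennreal_leI)
      also have "\<dots> = ennreal ((1 + norm k) ^ N * cmod (w (H \<phi> k))) + ennreal ((1 + norm k) ^ N * cmod (w (H \<psi> k)))"
        by (rule ennreal_plus) auto
      also have "\<dots> \<le> ennreal c1 * (\<Sum>q\<in>Q1. q w) + ennreal c2 * (\<Sum>q\<in>Q2. q w)"
        using 1(4) 2(4) w k by (intro add_mono) blast+
      also have "\<dots> \<le> ennreal c1 * (\<Sum>q\<in>Q1 \<union> Q2. q w) + ennreal c2 * (\<Sum>q\<in>Q1 \<union> Q2. q w)"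
        using 1(1) 2(1) by (intro add_mono mult_left_mono sum_mono2) auto
      also have "\<dots> = ennreal (c1 + c2) * (\<Sum>q\<in>Q1 \<union> Q2. q w)" using 1(3) 2(3) by (simp add: distrib_right ennreal_plus)
      finally show ?thesis .
    qed
    then show "P (\<lambda>x. \<phi> x + \<psi> x)"
      unfolding P_def using 1(1-3) 2(1-3) by (intro exI[of _ "Q1 \<union> Q2"] exI[of _ "c1 + c2"] conjI) auto
  next
    fix x assume x: "x \<in> \<Omega>1"
    show "\<exists>U. open U \<and> x \<in> U \<and> (\<forall>\<rho>\<in>test_fun \<Omega>1. fun_supp \<rho> \<subseteq> U \<longrightarrow> P \<rho>)"
    proof (cases "x \<in> C \<and> f x \<in> fun_supp \<tau>")
      case False
      then consider (a) "x \<notin> C" | (b) "f x \<notin> fun_supp \<tau>" by blast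
      then show ?thesis
      proof cases
        case a
        have "P \<rho>" if \<rho>: "\<rho> \<in> test_fun \<Omega>1" "fun_supp \<rho> \<subseteq> \<Omega>1 - C" for \<rho>
        proof (rule trivial)
          fix w k assume w: "w \<in> distributions \<Omega>1" "dist_supp \<Omega>1 w \<subseteq> C"
          have "fun_supp (H \<rho> k) \<subseteq> fun_supp \<rho>" unfolding H_def by (rule fun_supp_mult(1))
          then show "w (H \<rho> k) = 0" by (intro distribution_vanish[OF w(1) H[OF \<rho>(1)]]) (use \<rho>(2) w(2) in blast)
        qed
        then show ?thesis using closedin_open_Diff[OF \<Omega>1 C] a x by blast
      next
        case b
        let ?U = "\<Omega>1 \<inter> f -` (- fun_supp \<tau>)"
        have U: "open ?U" by (rule continuous_open_preimage[OF smooth_on_continuous[OF f] \<Omega>1]) (simp add: open_Compl)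
        have "P \<rho>" if \<rho>: "fun_supp \<rho> \<subseteq> ?U" for \<rho>
        proof (rule trivial, rule zeroH)
          fix y show "\<rho> y * G y = 0"
          proof (cases "y \<in> fun_supp \<rho>")
            case True
            then have "f y \<notin> fun_supp \<tau>" using \<rho> by blast
            then show ?thesis by (simp add: G_def fun_supp_outside)
          qed (simp add: fun_supp_outside)
        qed
        then show ?thesis using U b x by blast
      qed
    next
      case True
      have "(f x, k) \<notin> push_cone \<Omega>1 \<Omega>2 f C \<Gamma>" if "k \<in> V" for k using disj True that by blast
      moreover have "f x \<in> \<Omega>2" using True test_funD(3)[OF \<tau>] by blast
      ultimately obtain r c W where r: "r > 0" and c: "c > 0" and W: "closed W" "conic W" and r1: "cball x (2 * r) \<subseteq> \<Omega>1"
        and W\<Gamma>: "(cball x (2 * r) \<times> W) \<inter> \<Gamma> = {}"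
        and est: "\<forall>y\<in>cball x (2 * r). \<forall>k\<in>V. c * norm k \<le> norm (covector_pullback f y k) \<and>
          (\<forall>\<xi>. \<xi> \<notin> W \<longrightarrow> c * (norm k + norm \<xi>) \<le> norm (covector_pullback f y k - \<xi>))"
        using cone_separation[OF \<Gamma> V, of x] True by blast
      obtain \<psi> where \<psi>: "\<psi> \<in> test_fun \<Omega>1" "fun_supp \<psi> \<subseteq> cball x (2 * r)" "\<forall>y\<in>cball x r. \<psi> y = 1"
        using exists_bump[OF r r1] by blast
      \<comment> \<open>The support of \<psi> fills the larger ball, so W has to avoid \<Gamma> over
        all of it; g lives in the smaller ball, where \<psi> is 1 and drops out of the
        product.\<close>
      have bsub: "ball x r \<subseteq> cball x (2 * r)" using r by auto
      have b1: "ball x r \<subseteq> \<Omega>1" using bsub r1 by blast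
      have "P \<rho>" if \<rho>: "\<rho> \<in> test_fun \<Omega>1" "fun_supp \<rho> \<subseteq> ball x r" for \<rho>
      proof -
        define g where "g y = \<rho> y * G y" for y
        have g: "g \<in> test_fun (ball x r)" unfolding g_def
          by (rule test_fun_mult[OF test_fun_subset[OF \<rho>] open_ball smooth_on_mono[OF test_funD(1)[OF G] subset_UNIV]])
        have eq: "(\<lambda>y. \<psi> y * (g y * plane_wave k (f y))) = H \<rho> k" for k
        proof
          fix y
          show "\<psi> y * (g y * plane_wave k (f y)) = H \<rho> k y"
          proof (cases "y \<in> fun_supp \<rho>")
            case True
            then have "y \<in> ball x r" using \<rho>(2) by blast
            then have "y \<in> cball x r" by simp
            then have "\<psi> y = 1" using \<psi>(3) by blast
            then show ?thesis by (simp add: g_def H_def mult.assoc)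
          qed (simp add: g_def H_def fun_supp_outside)
        qed
        have "\<exists>B c M. bounded_test_set \<Omega>1 B \<and> c > 0 \<and> (\<forall>w\<in>distributions \<Omega>1. \<forall>k\<in>V.
          ennreal ((1 + norm k) ^ N * cmod (w (\<lambda>y. \<psi> y * (g y * plane_wave k (f y)))))
            \<le> ennreal c * (sup_seminorm B w + fourier_seminorm M W \<psi> w))"
          by (rule local_estimate[OF \<Omega>1 open_ball b1 smooth_on_mono[OF f b1] \<psi>(1) g c]) (use est bsub in blast)+
        then obtain B c' M where B: "bounded_test_set \<Omega>1 B" and c': "c' > 0" and le: "\<forall>w\<in>distributions \<Omega>1. \<forall>k\<in>V.
          ennreal ((1 + norm k) ^ N * cmod (w (H \<rho> k)))
            \<le> ennreal c' * (sup_seminorm B w + fourier_seminorm M W \<psi> w)" unfolding eq by (elim exE conjE)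
        \<comment> \<open>As a set, this pair would count the two seminorms once if they coincided;
          the factor 2 in the constant allows for that.\<close>
        let ?Q = "{sup_seminorm B, fourier_seminorm M W \<psi>}"
        have "sup_seminorm B w + fourier_seminorm M W \<psi> w \<le> (\<Sum>q\<in>?Q. q w) + (\<Sum>q\<in>?Q. q w)" for w
          by (intro add_mono member_le_sum) auto
        then have le2: "ennreal c' * (sup_seminorm B w + fourier_seminorm M W \<psi> w) \<le> ennreal (2 * c') * (\<Sum>q\<in>?Q. q w)" for w
        proof -
          have "ennreal c' * (sup_seminorm B w + fourier_seminorm M W \<psi> w) \<le> ennreal c' * ((\<Sum>q\<in>?Q. q w) + (\<Sum>q\<in>?Q. q w))"
            by (intro mult_left_mono add_mono member_le_sum) auto
          also have "\<dots> = (ennreal c' + ennreal c') * (\<Sum>q\<in>?Q. q w)" by (simp only: distrib_left distrib_right)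
          also have "ennreal c' + ennreal c' = ennreal (2 * c')" using c' by (simp only: mult_2 ennreal_plus less_imp_le)
          finally show ?thesis .
        qed
        have "fun_supp \<psi> \<times> W \<inter> \<Gamma> = {}" using \<psi>(2) W\<Gamma> by blast
        then have "?Q \<subseteq> normal_seminorms \<Omega>1 \<Gamma>" using sup_seminorm_normal[OF B] fourier_seminorm_normal[OF \<psi>(1) W] by simp
        then show ?thesis
          unfolding P_def using c' order_trans[OF le[rule_format] le2]
          by (intro exI[of _ ?Q] exI[of _ "2 * c'"]) simp
      qed
      then show ?thesis using r by (intro exI[of _ "ball x r"]) simp
    qed
  qed
  obtain \<rho> W where \<rho>: "\<rho> \<in> test_fun \<Omega>1" "fun_supp \<theta> \<subseteq> W" "\<forall>x\<in>W. \<rho> x = 1"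
    using exists_cutoff[OF test_funD(2)[OF \<theta>] \<Omega>1 test_funD(3)[OF \<theta>]] by blast
  obtain Q c where Q: "finite Q" "Q \<subseteq> normal_seminorms \<Omega>1 \<Gamma>" "c \<ge> 0" "\<forall>w\<in>distributions \<Omega>1. dist_supp \<Omega>1 w \<subseteq> C \<longrightarrow>
      (\<forall>k\<in>V. ennreal ((1 + norm k) ^ N * cmod (w (H \<rho> k))) \<le> ennreal c * (\<Sum>q\<in>Q. q w))"
    using P[OF \<rho>(1)] unfolding P_def by (elim exE conjE)
  have "fourier_seminorm N V \<tau> (push_forward \<Omega>1 \<Omega>2 f w) \<le> ennreal c * (\<Sum>q\<in>Q. q w)"
    if w: "w \<in> distributions \<Omega>1" "dist_supp \<Omega>1 w \<subseteq> C" for w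
    unfolding fourier_seminorm_def
  proof (rule SUP_least)
    fix k assume k: "k \<in> V"
    have t: "(\<lambda>y. \<tau> y * plane_wave k y) \<in> test_fun \<Omega>2" by (rule test_fun_mult[OF \<tau> \<Omega>2 smooth_plane_wave])
    have "fourier_loc (push_forward \<Omega>1 \<Omega>2 f w) \<tau> k = w (\<lambda>x. \<theta> x * (\<tau> (f x) * plane_wave k (f x)))"
      unfolding fourier_loc_plane_wave by (rule pf[rule_format, OF w t fun_supp_mult(1)])
    also have "(\<lambda>x. \<theta> x * (\<tau> (f x) * plane_wave k (f x))) = H \<rho> k"
    proof
      fix x show "\<theta> x * (\<tau> (f x) * plane_wave k (f x)) = H \<rho> k x"
      proof (cases "x \<in> fun_supp \<theta>")
        case True
        then have "\<rho> x = 1" using \<rho>(2,3) by blast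
        then show ?thesis by (simp add: H_def G_def mult.assoc)
      qed (simp add: H_def G_def fun_supp_outside)
    qed
    finally show "ennreal ((1 + norm k) ^ N * cmod (fourier_loc (push_forward \<Omega>1 \<Omega>2 f w) \<tau> k)) \<le> ennreal c * (\<Sum>q\<in>Q. q w)"
      using Q(4) w k by simp
  qed
  then show ?thesis using Q(1-3) by (intro exI[of _ Q] exI[of _ c]) simp
qed

text \<open>The continuity criterion for a linear map between spaces given by seminorms. It covers
  every distribution supported in C, so that it can be applied to differences.\<close>

lemma push_forward_dominated:
  assumes \<Gamma>: "closed_cone \<Omega>1 \<Gamma>" and p: "p \<in> normal_seminorms \<Omega>2 (push_cone \<Omega>1 \<Omega>2 f C \<Gamma>)"
  shows "\<exists>Q c. finite Q \<and> Q \<subseteq> normal_seminorms \<Omega>1 \<Gamma> \<and> c \<ge> 0 \<and> (\<forall>w\<in>distributions \<Omega>1. dist_supp \<Omega>1 w \<subseteq> C \<longrightarrow>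
    p (push_forward \<Omega>1 \<Omega>2 f w) \<le> ennreal c * (\<Sum>q\<in>Q. q w))"
proof -
  show ?thesis
    using p
  proof (cases rule: normal_seminormsE)
    case (sup B)
    obtain B' where B': "bounded_test_set \<Omega>1 B'" "\<forall>w\<in>distributions \<Omega>1. dist_supp \<Omega>1 w \<subseteq> C \<longrightarrow>
        sup_seminorm B (push_forward \<Omega>1 \<Omega>2 f w) \<le> sup_seminorm B' w"
      using push_forward_sup_seminorm[OF sup(2)] by (elim exE conjE)
    show ?thesis
      unfolding sup(1) using B'(2) sup_seminorm_normal[OF B'(1), of \<Gamma>]
      by (intro exI[of _ "{sup_seminorm B'}"] exI[of _ 1]) simp
  next
    case (fourier N V \<theta>)
    show ?thesis unfolding fourier(1) by (rule push_forward_fourier_seminorm[OF \<Gamma> fourier(3,4,2,5)])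
  qed
qed

text \<open>The push cone is closed, so a covector outside it has a bump and a sector around it that
  form an admissible pair. Domination bounds that Fourier seminorm by seminorms of u, and these are
  finite.\<close>

lemma wave_front_push_forward:
  assumes \<Gamma>: "closed_cone \<Omega>1 \<Gamma>" and \<Gamma>C: "fst ` \<Gamma> \<subseteq> C" and u: "u \<in> dist_WF \<Omega>1 \<Gamma>" "dist_supp \<Omega>1 u \<subseteq> C"
  shows "wave_front \<Omega>2 (push_forward \<Omega>1 \<Omega>2 f u) \<subseteq> push_cone \<Omega>1 \<Omega>2 f C \<Gamma>"
proof (rule subrelI)
  let ?P = "push_cone \<Omega>1 \<Omega>2 f C \<Gamma>"
  fix y \<eta> assume wf: "(y, \<eta>) \<in> wave_front \<Omega>2 (push_forward \<Omega>1 \<Omega>2 f u)"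
  have ct: "(y, \<eta>) \<in> cotangent0 \<Omega>2" using wf by (auto simp: wave_front_def)
  then have y: "y \<in> \<Omega>2" "\<eta> \<noteq> 0" by (auto simp: cotangent0_def)
  have ud: "u \<in> distributions \<Omega>1" using u(1) by (simp add: dist_WF_def)
  have cP: "closed_cone \<Omega>2 ?P" by (rule closed_cone_push_cone[OF \<Gamma> f C proper \<Gamma>C])
  have scale: "(z, t *\<^sub>R k) \<in> ?P" if "(z, k) \<in> ?P" "t > 0" for z k t
    using cP that unfolding closed_cone_def by blast
  show "(y, \<eta>) \<in> ?P"
  proof (rule ccontr)
    assume n: "(y, \<eta>) \<notin> ?P"
    \<comment> \<open>The unit direction, because \<eta> lies on the axis of a sector around
      it.\<close>
    define \<eta>' where "\<eta>' = (1 / norm \<eta>) *\<^sub>R \<eta>"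
    have \<eta>': "\<eta> = norm \<eta> *\<^sub>R \<eta>'" "\<eta>' \<noteq> 0" using y(2) by (auto simp: \<eta>'_def)
    have "(y, \<eta>') \<notin> ?P" using n scale[of y \<eta>' "norm \<eta>"] \<eta>'(1) y(2) by auto
    then have "(y, \<eta>') \<in> cotangent0 \<Omega>2 - ?P" using y(1) \<eta>'(2) by (simp add: cotangent0_def)
    then obtain \<epsilon> where \<epsilon>: "\<epsilon> > 0" "cball (y, \<eta>') (2 * \<epsilon>) \<subseteq> cotangent0 \<Omega>2 - ?P"
      using open_contains_cball2[OF closed_cone_complement_open[OF \<Omega>2 cP]] by blast
    have near: "(z, k) \<notin> ?P" "z \<in> \<Omega>2" if "dist y z \<le> \<epsilon>" "dist \<eta>' k \<le> \<epsilon>" for z k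
    proof -
      have "dist (y, \<eta>') (z, k) \<le> 2 * \<epsilon>" using dist_Pair_le[of y \<eta>' z k] that by linarith
      then have "(z, k) \<in> cball (y, \<eta>') (2 * \<epsilon>)" by simp
      then have "(z, k) \<in> cotangent0 \<Omega>2 - ?P" using \<epsilon>(2) by blast
      then show "(z, k) \<notin> ?P" "z \<in> \<Omega>2" by (auto simp: cotangent0_def)
    qed
    have "z \<in> \<Omega>2" if "z \<in> cball y (2 * (\<epsilon> / 2))" for z using near(2)[of z \<eta>'] that \<epsilon>(1) by simp
    then have sub: "cball y (2 * (\<epsilon> / 2)) \<subseteq> \<Omega>2" by blast
    have "\<epsilon> / 2 > 0" using \<epsilon>(1) by simp
    from exists_bump[OF this sub] obtain \<tau> where \<tau>: "\<tau> \<in> test_fun \<Omega>2" "fun_supp \<tau> \<subseteq> cball y (2 * (\<epsilon> / 2))" "\<forall>x\<in>cball y (\<epsilon> / 2). \<tau> x = 1"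
      by blast
    have \<tau>y: "\<tau> y \<noteq> 0" using \<tau>(3) \<epsilon>(1) by simp
    have disj: "(fun_supp \<tau> \<times> sector \<eta>' \<epsilon>) \<inter> ?P = {}"
    proof -
      have "(z, k) \<notin> ?P" if z: "z \<in> fun_supp \<tau>" and k: "k \<in> sector \<eta>' \<epsilon>" for z k
      proof
        assume zk: "(z, k) \<in> ?P"
        then have k0: "k \<noteq> 0" by (auto simp: push_cone_def cotangent0_def)
        have "dist y z \<le> \<epsilon>" using z \<tau>(2) by auto
        moreover have "dist \<eta>' ((1 / norm k) *\<^sub>R k) \<le> \<epsilon>"
          using sector_normalised_dist[OF k0 k] by (simp add: dist_norm norm_minus_commute)
        ultimately have "(z, (1 / norm k) *\<^sub>R k) \<notin> ?P" by (rule near(1))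
        then show False using scale[OF zk, of "1 / norm k"] k0 by simp
      qed
      then show ?thesis by blast
    qed
    \<comment> \<open>The wave front set is tested with open cones, the seminorms with closed ones;
      the strict inequality gives an open cone inside the sector.\<close>
    define W where "W = {k. norm (k - norm k *\<^sub>R \<eta>') < \<epsilon> * norm k}"
    have W: "open W" unfolding W_def by (intro open_Collect_less continuous_intros)
    have conicW: "conic W"
      unfolding conic_def
    proof (intro ballI allI impI)
      fix k and t :: real assume k: "k \<in> W" and t: "t > 0"
      have "t *\<^sub>R k - norm (t *\<^sub>R k) *\<^sub>R \<eta>' = t *\<^sub>R (k - norm k *\<^sub>R \<eta>')"
        using t by (simp add: scaleR_diff_right)
      then have "norm (t *\<^sub>R k - norm (t *\<^sub>R k) *\<^sub>R \<eta>') = t * norm (k - norm k *\<^sub>R \<eta>')" using t by simp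
      also have "\<dots> < t * (\<epsilon> * norm k)" using k t by (simp add: W_def)
      also have "\<dots> = \<epsilon> * norm (t *\<^sub>R k)" using t by simp
      finally show "t *\<^sub>R k \<in> W" by (simp add: W_def)
    qed
    have \<eta>W: "\<eta> \<in> W" using \<eta>'(1) y(2) \<epsilon>(1) by (simp add: W_def)
    have WV: "W \<subseteq> sector \<eta>' \<epsilon>" by (auto simp: W_def sector_def)
    have "fourier_seminorm N W \<tau> (push_forward \<Omega>1 \<Omega>2 f u) < \<infinity>" for N
    proof -
      obtain Q c where Q: "finite Q" "Q \<subseteq> normal_seminorms \<Omega>1 \<Gamma>"
        and le: "\<forall>w\<in>distributions \<Omega>1. dist_supp \<Omega>1 w \<subseteq> C \<longrightarrow>
          fourier_seminorm N (sector \<eta>' \<epsilon>) \<tau> (push_forward \<Omega>1 \<Omega>2 f w) \<le> ennreal c * (\<Sum>q\<in>Q. q w)"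
        using push_forward_fourier_seminorm[OF \<Gamma> closed_sector conic_sector \<tau>(1) disj, of N] by (elim exE conjE)
      have fin: "q u < top" if q: "q \<in> Q" for q
      proof -
        have "q \<in> normal_seminorms \<Omega>1 \<Gamma>" using Q(2) q by (rule subsetD)
        then show ?thesis
        proof (cases rule: normal_seminormsE)
          case (sup B)
          then show ?thesis using sup_seminorm_finite[OF ud] by simp
        next
          case (fourier N V \<theta>)
          then show ?thesis using fourier_seminorm_finite[OF \<Omega>1 u(1)] by simp
        qed
      qed
      have "fourier_seminorm N W \<tau> (push_forward \<Omega>1 \<Omega>2 f u) \<le> fourier_seminorm N (sector \<eta>' \<epsilon>) \<tau> (push_forward \<Omega>1 \<Omega>2 f u)"
        by (rule fourier_seminorm_mono[OF WV])
      also have "\<dots> \<le> ennreal c * (\<Sum>q\<in>Q. q u)" using le ud u(2) by blast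
      also have "\<dots> < top"
      proof -
        have "(\<Sum>q\<in>Q. q u) < top" by (rule ennreal_sum_finite[OF Q(1)]) (rule fin)
        then show ?thesis by (simp add: ennreal_mult_less_top)
      qed
      finally show ?thesis by simp
    qed
    then have "\<exists>\<theta>\<in>test_fun \<Omega>2. \<theta> y \<noteq> 0 \<and>
        (\<exists>V. open V \<and> conic V \<and> \<eta> \<in> V \<and> (\<forall>N. fourier_seminorm N V \<theta> (push_forward \<Omega>1 \<Omega>2 f u) < \<infinity>))"
      using \<tau>y W conicW \<eta>W by (intro bexI[OF _ \<tau>(1)] exI[of _ W] conjI allI)
    moreover have "\<not> (\<exists>\<theta>\<in>test_fun \<Omega>2. \<theta> y \<noteq> 0 \<and>
        (\<exists>V. open V \<and> conic V \<and> \<eta> \<in> V \<and> (\<forall>N. fourier_seminorm N V \<theta> (push_forward \<Omega>1 \<Omega>2 f u) < \<infinity>)))"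
      using wf unfolding wave_front_def mem_Collect_eq prod.case by (rule conjunct2)
    ultimately show False by (rule notE[rotated])
  qed
qed

end

section \<open>The normal topology\<close>

text \<open>Both kinds of seminorm are suprema of weighted moduli of values, so the inequality holds
  for arbitrary functionals and applies to differences of push-forwards directly.\<close>

lemma normal_seminorm_triangle:
  assumes "p \<in> normal_seminorms \<Omega> \<Gamma>"
  shows "p (\<lambda>\<phi>. a \<phi> + b \<phi>) \<le> p a + p b"
proof -
  have sum: "ennreal (r * cmod (s + t)) \<le> ennreal (r * cmod s) + ennreal (r * cmod t)" if "r \<ge> 0" for r s t
  proof -
    have "r * cmod (s + t) \<le> r * cmod s + r * cmod t"
      unfolding distrib_left[symmetric] by (intro mult_left_mono norm_triangle_ineq that)
    then have "ennreal (r * cmod (s + t)) \<le> ennreal (r * cmod s + r * cmod t)" by (rule ennreal_leI)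
    also have "\<dots> = ennreal (r * cmod s) + ennreal (r * cmod t)" using that by (intro ennreal_plus) auto
    finally show ?thesis .
  qed
  show ?thesis
    using assms
  proof (cases rule: normal_seminormsE)
    case (sup B)
    show ?thesis unfolding sup(1) sup_seminorm_def[of B "\<lambda>\<phi>. a \<phi> + b \<phi>"]
    proof (rule SUP_least)
      fix \<phi> assume "\<phi> \<in> B"
      then have "ennreal (1 * cmod (a \<phi>)) + ennreal (1 * cmod (b \<phi>)) \<le> sup_seminorm B a + sup_seminorm B b"
        using sup_seminorm_upper[of \<phi> B a] sup_seminorm_upper[of \<phi> B b] by (intro add_mono) simp_all
      then show "ennreal (cmod (a \<phi> + b \<phi>)) \<le> sup_seminorm B a + sup_seminorm B b"
        using order_trans[OF sum[of 1 "a \<phi>" "b \<phi>"]] by simp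
    qed
  next
    case (fourier N V \<theta>)
    show ?thesis unfolding fourier(1) fourier_seminorm_def[of N V \<theta> "\<lambda>\<phi>. a \<phi> + b \<phi>"]
    proof (rule SUP_least)
      fix k assume k: "k \<in> V"
      have "ennreal ((1 + norm k) ^ N * cmod (fourier_loc a \<theta> k)) + ennreal ((1 + norm k) ^ N * cmod (fourier_loc b \<theta> k))
          \<le> fourier_seminorm N V \<theta> a + fourier_seminorm N V \<theta> b"
        by (intro add_mono fourier_seminorm_upper k)
      moreover have "fourier_loc (\<lambda>\<phi>. a \<phi> + b \<phi>) \<theta> k = fourier_loc a \<theta> k + fourier_loc b \<theta> k"
        by (simp add: fourier_loc_def)
      ultimately show "ennreal ((1 + norm k) ^ N * cmod (fourier_loc (\<lambda>\<phi>. a \<phi> + b \<phi>) \<theta> k))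
          \<le> fourier_seminorm N V \<theta> a + fourier_seminorm N V \<theta> b"
        using order_trans[OF sum[of "(1 + norm k) ^ N" "fourier_loc a \<theta> k" "fourier_loc b \<theta> k"]] by simp
    qed
  qed
qed

lemma normal_seminorm_zero:
  assumes "p \<in> normal_seminorms \<Omega> \<Gamma>"
  shows "p (\<lambda>_. 0) = 0"
proof -
  have "p (\<lambda>_. 0) \<le> 0"
    using assms
  proof (cases rule: normal_seminormsE)
    case (sup B)
    show ?thesis unfolding sup(1) sup_seminorm_def by (rule SUP_least) simp
  next
    case (fourier N V \<theta>)
    show ?thesis unfolding fourier(1) fourier_seminorm_def by (rule SUP_least) (simp add: fourier_loc_def)
  qed
  then show ?thesis by simp
qed

lemma openin_normal_topology_ball:
  assumes Q: "finite Q" "Q \<subseteq> normal_seminorms \<Omega> \<Gamma>" and v: "v \<in> dist_WF \<Omega> \<Gamma>" and \<delta>: "\<delta> > 0"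
  shows "openin (normal_topology \<Omega> \<Gamma>) {w \<in> dist_WF \<Omega> \<Gamma>. \<forall>q\<in>Q. q (\<lambda>\<phi>. w \<phi> - v \<phi>) < ennreal \<delta>}"
proof -
  let ?X = "normal_topology \<Omega> \<Gamma>"
  have b: "openin ?X {w \<in> dist_WF \<Omega> \<Gamma>. q (\<lambda>\<phi>. w \<phi> - v \<phi>) < ennreal \<delta>}" if "q \<in> Q" for q
    unfolding normal_topology_def seminorm_topology_def
    by (rule topology_generated_by_Basis, rule CollectI, rule exI[of _ q], rule exI[of _ v], rule exI[of _ \<delta>])
       (use that Q(2) v \<delta> in auto)
  have "openin ?X (dist_WF \<Omega> \<Gamma>)" using openin_topspace[of ?X] by (simp add: topspace_normal_topology)
  then have "openin ?X ((\<Inter>q\<in>Q. {w \<in> dist_WF \<Omega> \<Gamma>. q (\<lambda>\<phi>. w \<phi> - v \<phi>) < ennreal \<delta>}) \<inter> topspace ?X)"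
    using openin_INT[OF Q(1), of ?X "\<lambda>q. {w \<in> dist_WF \<Omega> \<Gamma>. q (\<lambda>\<phi>. w \<phi> - v \<phi>) < ennreal \<delta>}"] b by simp
  moreover have "(\<Inter>q\<in>Q. {w \<in> dist_WF \<Omega> \<Gamma>. q (\<lambda>\<phi>. w \<phi> - v \<phi>) < ennreal \<delta>}) \<inter> topspace ?X
      = {w \<in> dist_WF \<Omega> \<Gamma>. \<forall>q\<in>Q. q (\<lambda>\<phi>. w \<phi> - v \<phi>) < ennreal \<delta>}"
    by (auto simp: topspace_normal_topology)
  ultimately show ?thesis by simp
qed

lemma (in push_setting) continuous_push_forward:
  assumes \<Gamma>: "closed_cone \<Omega>1 \<Gamma>" and \<Gamma>C: "fst ` \<Gamma> \<subseteq> C"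
  shows "continuous_map (subtopology (normal_topology \<Omega>1 \<Gamma>) {u. dist_supp \<Omega>1 u \<subseteq> C})
    (normal_topology \<Omega>2 (push_cone \<Omega>1 \<Omega>2 f C \<Gamma>)) (push_forward \<Omega>1 \<Omega>2 f)"
proof -
  let ?F = "push_forward \<Omega>1 \<Omega>2 f" and ?P = "push_cone \<Omega>1 \<Omega>2 f C \<Gamma>"
  let ?X = "subtopology (normal_topology \<Omega>1 \<Gamma>) {u. dist_supp \<Omega>1 u \<subseteq> C}"
  let ?E = "dist_WF \<Omega>2 ?P"
  have top: "u \<in> topspace ?X \<longleftrightarrow> u \<in> dist_WF \<Omega>1 \<Gamma> \<and> dist_supp \<Omega>1 u \<subseteq> C" for u
    by (simp add: topspace_subtopology topspace_normal_topology)
  have FE: "?F u \<in> ?E" if "u \<in> topspace ?X" for u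
  proof -
    have u: "u \<in> dist_WF \<Omega>1 \<Gamma>" "dist_supp \<Omega>1 u \<subseteq> C" using that unfolding top by simp_all
    then have "u \<in> distributions \<Omega>1" by (simp add: dist_WF_def)
    then show ?thesis
      using push_forward_distribution[OF _ u(2)] wave_front_push_forward[OF \<Gamma> \<Gamma>C u] by (simp add: dist_WF_def)
  qed
  show ?thesis
    unfolding normal_topology_def[of \<Omega>2] seminorm_topology_def
  proof (rule continuous_on_generated_topo)
    let ?S = "{{v \<in> ?E. p (\<lambda>\<phi>. v \<phi> - u \<phi>) < ennreal r} |p u r. p \<in> normal_seminorms \<Omega>2 ?P \<and> u \<in> ?E \<and> 0 < r}"
    have S: "\<Union> ?S = ?E"
      using topspace_normal_topology[of \<Omega>2 ?P]
      unfolding normal_topology_def seminorm_topology_def topology_generated_by_topspace .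
    show "?F ` topspace ?X \<subseteq> \<Union> ?S" unfolding S by (rule image_subsetI) (rule FE)
    fix U assume "U \<in> ?S"
    then obtain p u r where U: "U = {v \<in> ?E. p (\<lambda>\<phi>. v \<phi> - u \<phi>) < ennreal r}" and p: "p \<in> normal_seminorms \<Omega>2 ?P" and r: "r > 0"
      unfolding mem_Collect_eq by (elim exE conjE)
    obtain Q c where Q: "finite Q" "Q \<subseteq> normal_seminorms \<Omega>1 \<Gamma>" and c: "c \<ge> 0"
      and dom: "\<forall>w\<in>distributions \<Omega>1. dist_supp \<Omega>1 w \<subseteq> C \<longrightarrow> p (?F w) \<le> ennreal c * (\<Sum>q\<in>Q. q w)"
      using push_forward_dominated[OF \<Gamma> p] by (elim exE conjE)
    show "openin ?X (?F -` U \<inter> topspace ?X)"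
    proof (subst openin_subopen, rule ballI)
      fix v assume v: "v \<in> ?F -` U \<inter> topspace ?X"
      then have "v \<in> topspace ?X" by (rule IntD2)
      then have vX: "v \<in> dist_WF \<Omega>1 \<Gamma>" "dist_supp \<Omega>1 v \<subseteq> C" unfolding top by simp_all
      have vd: "v \<in> distributions \<Omega>1" using vX(1) by (simp add: dist_WF_def)
      have plt: "p (\<lambda>\<phi>. ?F v \<phi> - u \<phi>) < ennreal r" using v unfolding U by simp
      \<comment> \<open>A subbasic set is centred at some u, not at the image of v; the distance s
        already used leaves the room r - s.\<close>
      then obtain s where s: "s \<ge> 0" "p (\<lambda>\<phi>. ?F v \<phi> - u \<phi>) = ennreal s" by (cases "p (\<lambda>\<phi>. ?F v \<phi> - u \<phi>)") auto
      have sr: "s < r" using plt s by (simp add: ennreal_less_iff)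
      \<comment> \<open>The domination constant times the number of seminorms, raised by 1 to be
        positive; with this radius \<delta> the image moves by at most (r - s) / 2.\<close>
      define D where "D = c * real (card Q) + 1"
      have D: "D > 0" unfolding D_def using c by (intro add_nonneg_pos) auto
      define \<delta> where "\<delta> = (r - s) / (2 * D)"
      have \<delta>: "\<delta> > 0" using sr D by (simp add: \<delta>_def)
      define T where "T = {w \<in> dist_WF \<Omega>1 \<Gamma>. \<forall>q\<in>Q. q (\<lambda>\<phi>. w \<phi> - v \<phi>) < ennreal \<delta>} \<inter> {u. dist_supp \<Omega>1 u \<subseteq> C}"
      have "openin ?X T"
        unfolding T_def by (rule openin_subtopology_Int[OF openin_normal_topology_ball[OF Q vX(1) \<delta>]])
      moreover have "v \<in> T"
      proof -
        have "q (\<lambda>\<phi>. v \<phi> - v \<phi>) < ennreal \<delta>" if "q \<in> Q" for q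
          using normal_seminorm_zero[of q \<Omega>1 \<Gamma>] Q(2) that \<delta> by auto
        then show ?thesis using vX by (simp add: T_def)
      qed
      moreover have "T \<subseteq> ?F -` U \<inter> topspace ?X"
      proof
        fix w assume "w \<in> T"
        then have wX: "w \<in> dist_WF \<Omega>1 \<Gamma>" "dist_supp \<Omega>1 w \<subseteq> C" and q: "\<forall>q\<in>Q. q (\<lambda>\<phi>. w \<phi> - v \<phi>) < ennreal \<delta>"
          by (auto simp: T_def)
        have wt: "w \<in> topspace ?X" unfolding top using wX by (rule conjI)
        have wd: "w \<in> distributions \<Omega>1" using wX(1) by (simp add: dist_WF_def)
        \<comment> \<open>Linearity reduces continuity at v to the domination of the push-forward of
          w - v, a distribution supported in C.\<close>
        have "p (\<lambda>\<phi>. ?F w \<phi> - ?F v \<phi>) = p (?F (\<lambda>\<phi>. w \<phi> - v \<phi>))"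
          by (simp only: push_forward_minus[OF vd vX(2) wd wX(2)])
        also have "\<dots> \<le> ennreal c * (\<Sum>q\<in>Q. q (\<lambda>\<phi>. w \<phi> - v \<phi>))"
          by (rule dom[rule_format, OF distributions_minus[OF vd wd] dist_supp_minus[OF vd vX(2) wd wX(2) C \<Omega>1]])
        also have "\<dots> \<le> ennreal c * (\<Sum>q\<in>Q. ennreal \<delta>)"
          using q by (intro mult_left_mono sum_mono) (auto simp: less_imp_le)
        also have "(\<Sum>q\<in>Q. ennreal \<delta>) = ennreal (real (card Q) * \<delta>)"
          using \<delta> by (simp add: ennreal_mult ennreal_of_nat_eq_real_of_nat)
        also have "ennreal c * \<dots> = ennreal (c * (real (card Q) * \<delta>))"
          using c \<delta> by (simp add: ennreal_mult)
        also have "\<dots> \<le> ennreal ((r - s) / 2)"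
        proof (rule ennreal_leI)
          have "c * (real (card Q) * \<delta>) \<le> D * \<delta>" using \<delta> by (simp add: D_def algebra_simps)
          also have "\<dots> = (r - s) / 2" using D by (simp add: \<delta>_def)
          finally show "c * (real (card Q) * \<delta>) \<le> (r - s) / 2" .
        qed
        finally have 1: "p (\<lambda>\<phi>. ?F w \<phi> - ?F v \<phi>) \<le> ennreal ((r - s) / 2)" .
        have "(\<lambda>\<phi>. ?F w \<phi> - u \<phi>) = (\<lambda>\<phi>. (?F w \<phi> - ?F v \<phi>) + (?F v \<phi> - u \<phi>))" by (rule ext) simp
        then have "p (\<lambda>\<phi>. ?F w \<phi> - u \<phi>) \<le> p (\<lambda>\<phi>. ?F w \<phi> - ?F v \<phi>) + p (\<lambda>\<phi>. ?F v \<phi> - u \<phi>)"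
          using normal_seminorm_triangle[OF p, of "\<lambda>\<phi>. ?F w \<phi> - ?F v \<phi>" "\<lambda>\<phi>. ?F v \<phi> - u \<phi>"] by simp
        also have "\<dots> \<le> ennreal ((r - s) / 2) + ennreal s" unfolding s(2) by (rule add_right_mono[OF 1])
        also have "\<dots> = ennreal ((r - s) / 2 + s)" using s(1) sr by (simp add: ennreal_plus)
        also have "\<dots> < ennreal r"
          by (rule ennreal_lessI) (use s(1) sr in \<open>simp_all add: field_simps\<close>)
        finally have "p (\<lambda>\<phi>. ?F w \<phi> - u \<phi>) < ennreal r" .
        then have "?F w \<in> U" using FE[OF wt] by (simp add: U)
        then show "w \<in> ?F -` U \<inter> topspace ?X" by (intro IntI vimageI2 wt)
      qed
      ultimately show "\<exists>T. openin ?X T \<and> v \<in> T \<and> T \<subseteq> ?F -` U \<inter> topspace ?X" by (intro exI[of _ T] conjI)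
    qed
  qed
qed

theorem theorem6p3:
  fixes \<Omega>1 :: "(real ^ 'm) set" and \<Omega>2 :: "(real ^ 'n) set"
    and f :: "real ^ 'm \<Rightarrow> real ^ 'n"
    and C :: "(real ^ 'm) set"
    and \<Gamma> :: "((real ^ 'm) \<times> (real ^ 'm)) set"
  assumes "open \<Omega>1" and "open \<Omega>2"
    and "closed_cone \<Omega>1 \<Gamma>"
    and "smooth_on \<Omega>1 f" and "f \<in> \<Omega>1 \<rightarrow> \<Omega>2"
    and "closedin (top_of_set \<Omega>1) C"
    and "proper_map (top_of_set C) (top_of_set \<Omega>2) f"
    and "fst ` \<Gamma> \<subseteq> C"
  shows "continuous_map
           (subtopology (normal_topology \<Omega>1 \<Gamma>) {u. dist_supp \<Omega>1 u \<subseteq> C})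
           (normal_topology \<Omega>2 (push_cone \<Omega>1 \<Omega>2 f C \<Gamma>))
           (push_forward \<Omega>1 \<Omega>2 f)"
proof -
  interpret push_setting \<Omega>1 \<Omega>2 f C
    using assms by unfold_locales
  show ?thesis by (rule continuous_push_forward[OF assms(3,8)])
qed

end
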